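(* Let $G$ be a simply connected $2n$-dimensional nilpotent Lie group with a left-invariant complex structure $J$ and a lattice $\Gamma$. Suppose that the inclusion $\bigwedge^{*}\mathfrak{g}_{1,0}^{*}\otimes\bigwedge^{*}\mathfrak{g}_{0,1}^{*}\subset A^{*,*}(G/\Gamma)$ induces an isomorphism $H^{*,*}_{\bar\partial}(\mathfrak{g})\cong H^{*,*}_{\bar\partial}(G/\Gamma)$. Let $\mu\in\bigwedge^{2}\mathfrak{g}_{1,0}$ be a holomorphic Poisson bi-vector field. Then the inclusion $\bigwedge^{*}\mathfrak{g}_{1,0}\otimes\bigwedge^{*}\mathfrak{g}_{0,1}^{*}\subset A^{0,*}(G/\Gamma,\bigwedge^{*}T_{1,0}G/\Gamma)$ induces an isomorphism between the total cohomology of $(\bigwedge^{*}\mathfrak{g}_{1,0}\otimes\bigwedge^{*}\mathfrak{g}_{0,1}^{*},\bar\partial,[\mu\bullet])$ and the total cohomology of $(A^{0,*}(G/\Gamma,\bigwedge^{*}T_{1,0}G/\Gamma),\bar\partial,[\mu\bullet])$. Hence the total cohomology of $(\bigwedge^{*}\mathfrak{g}_{1,0}\otimes\bigwedge^{*}\mathfrak{g}_{0,1}^{*},\bar\partial,[\mu\bullet])$ is isomorphic to $H^*(G/\Gamma,\mu)$.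
   Context: $\mathfrak g$ is the Lie algebra of $G$, $\mathfrak{g}\otimes\mathbb{C}=\mathfrak{g}_{1,0}\oplus\mathfrak{g}_{0,1}$ the decomposition into $\pm\sqrt{-1}$-eigenspaces of $J$; elements of $\bigwedge\mathfrak g_{1,0}$, $\bigwedge\mathfrak g_{1,0}^*$, $\bigwedge\mathfrak g_{0,1}^*$ are viewed as left-invariant tensors, which descend to the compact quotient $G/\Gamma$ (lattice = cocompact discrete subgroup). $H^{*,*}_{\bar\partial}(\mathfrak{g})$ is the $\bar\partial$-cohomology of $\bigwedge^{*}\mathfrak{g}_{1,0}^{*}\otimes\bigwedge^{*}\mathfrak{g}_{0,1}^{*}$. For a compact complex manifold $(M,J)$, the space $\bigoplus_{p,q}A^{0,q}(M,\bigwedge^pT_{1,0}M)$ carries the wedge product, the Dolbeault operator $\bar\partial$ and the Schouten bracket $[\,\bullet\,]$ extending $[X+\bar x\bullet Y+\bar y]=[X,Y]+i_Xd\bar y-i_Yd\bar x$ (sections $X,Y$ of $T_{1,0}M$, $\bar x,\bar y$ of $T_{0,1}^*M$), $[X\bullet f]=X(f)$. A bi-vector field $\mu\in C^\infty(\bigwedge^2T_{1,0}M)$ is holomorphic Poisson if $\bar\partial\mu=0$ and $[\mu\bullet\mu]=0$; then $(A^{0,*}(M,\bigwedge^*T_{1,0}M),\bar\partial,[\mu\bullet])$ is a double complex, with $[\mu\bullet]:A^{0,q}(\bigwedge^{p}T_{1,0}M)\to A^{0,q}(\bigwedge^{p+1}T_{1,0}M)$. The holomorphic Poisson cohomology $H^*(M,\mu)$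 is its total cohomology (known to be isomorphic to the Lie algebroid cohomology of the holomorphic Lie algebroid $T^*M$ defined by $\mu$ and to that of the Lie algebroid $L_\mu$, $L_\mu=\{E+i_E\mu: E\in T_{0,1}M\oplus T^*_{1,0}M\}$). *)

theory Defs
  imports "HOL-Analysis.Analysis" "HOL-Algebra.Generated_Groups" "HOL-Library.Function_Algebras"
begin

section \<open>Smooth functions, Lie groups, lattices\<close>

primrec Ck_on :: "nat \<Rightarrow> ('a::euclidean_space \<Rightarrow> 'b::real_normed_vector) \<Rightarrow> 'a set \<Rightarrow> bool" where
  "Ck_on 0 f S = continuous_on S f"
| "Ck_on (Suc k) f S =
     (f differentiable_on S \<and> (\<forall>v. Ck_on k (\<lambda>x. frechet_derivative f (at x) v) S))"

text \<open>Only used on open sets.\<close>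
definition smooth_on :: "('a::euclidean_space \<Rightarrow> 'b::real_normed_vector) \<Rightarrow> 'a set \<Rightarrow> bool" where
  "smooth_on f S \<longleftrightarrow> (\<forall>k. Ck_on k f S)"

type_synonym ('g, 'e) chart = "'g set \<times> ('g \<Rightarrow> 'e)"

definition smooth_atlas :: "('g::topological_space, 'e::euclidean_space) chart set \<Rightarrow> bool" where
  "smooth_atlas A \<longleftrightarrow>
     (\<Union>(U, \<phi>)\<in>A. U) = UNIV \<and>
     (\<forall>(U, \<phi>)\<in>A. open U \<and> open (\<phi> ` U) \<and> homeomorphism U (\<phi> ` U) \<phi> (inv_into U \<phi>)) \<and>
     (\<forall>(U, \<phi>)\<in>A. \<forall>(V, \<psi>)\<in>A. smooth_on (\<lambda>x. \<psi> (inv_into U \<phi> x)) (\<phi> ` (U \<inter> V)))"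

definition lie_group ::
  "('g::{t2_space, second_countable_topology}, 'r) monoid_scheme \<Rightarrow> ('g, 'e::euclidean_space) chart set \<Rightarrow> bool" where
  "lie_group G A \<longleftrightarrow>
     group G \<and> carrier G = UNIV \<and> smooth_atlas A \<and>
     continuous_on UNIV (\<lambda>(x, y). x \<otimes>\<^bsub>G\<^esub> y) \<and>
     continuous_on UNIV (\<lambda>x. inv\<^bsub>G\<^esub> x) \<and>
     (\<forall>(U, \<phi>)\<in>A. \<forall>(V, \<psi>)\<in>A. \<forall>(W, \<theta>)\<in>A.
        smooth_on (\<lambda>(x, y). \<theta> (inv_into U \<phi> x \<otimes>\<^bsub>G\<^esub> inv_into V \<psi> y))
          {(x, y). x \<in> \<phi> ` U \<and> y \<in> \<psi> ` V \<and> inv_into U \<phi> x \<otimes>\<^bsub>G\<^esub> inv_into V \<psi> y \<in> W}) \<and>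
     (\<forall>(U, \<phi>)\<in>A. \<forall>(W, \<theta>)\<in>A.
        smooth_on (\<lambda>x. \<theta> (inv\<^bsub>G\<^esub> (inv_into U \<phi> x)))
          {x. x \<in> \<phi> ` U \<and> inv\<^bsub>G\<^esub> (inv_into U \<phi> x) \<in> W})"

primrec lower_central_series :: "('g, 'r) monoid_scheme \<Rightarrow> nat \<Rightarrow> 'g set" where
  "lower_central_series G 0 = carrier G"
| "lower_central_series G (Suc k) =
     generate G {x \<otimes>\<^bsub>G\<^esub> y \<otimes>\<^bsub>G\<^esub> inv\<^bsub>G\<^esub> x \<otimes>\<^bsub>G\<^esub> inv\<^bsub>G\<^esub> y | x y.
       x \<in> carrier G \<and> y \<in> lower_central_series G k}"

definition nilpotent_group :: "('g, 'r) monoid_scheme \<Rightarrow> bool" where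
  "nilpotent_group G \<longleftrightarrow> group G \<and> (\<exists>k. lower_central_series G k = {\<one>\<^bsub>G\<^esub>})"

text \<open>
  Left-invariant tensors are invariant under left translations, so the quotient to which they
  descend is the space of right cosets \<open>\<Gamma> #> x\<close>.
\<close>
definition coset_topology :: "('g::topological_space, 'r) monoid_scheme \<Rightarrow> 'g set \<Rightarrow> 'g set topology" where
  "coset_topology G \<Gamma> = topology (\<lambda>\<U>. \<U> \<subseteq> rcosets\<^bsub>G\<^esub> \<Gamma> \<and> open (\<Union>\<U>))"

definition lattice_in :: "('g::topological_space, 'r) monoid_scheme \<Rightarrow> 'g set \<Rightarrow> bool" where
  "lattice_in G \<Gamma> \<longleftrightarrow> subgroup \<Gamma> G \<and> discrete \<Gamma> \<and> compact_space (coset_topology G \<Gamma>)"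


section \<open>Vector fields and differential forms\<close>

text \<open>
  A manifold enters through its algebra \<open>C\<close> of smooth complex-valued functions. Complex vector
  fields (sections of the complexified tangent bundle) are the complex derivations of \<open>C\<close>, and
  covariant tensor fields are the \<open>C\<close>-multilinear maps on vector fields. All maps are
  normalised to be zero off their domain, so that equality of fields is equality of functions.
\<close>
type_synonym 'm fn = "'m \<Rightarrow> complex"
type_synonym 'm vf = "'m fn \<Rightarrow> 'm fn"
type_synonym 'm form = "'m vf list \<Rightarrow> 'm fn"

definition fmul :: "'m fn \<Rightarrow> ('a \<Rightarrow> 'm fn) \<Rightarrow> 'a \<Rightarrow> 'm fn" where
  "fmul f X = (\<lambda>a. f * X a)"

definition cmul :: "complex \<Rightarrow> ('a \<Rightarrow> 'm fn) \<Rightarrow> 'a \<Rightarrow> 'm fn" where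
  "cmul c X = (\<lambda>a x. c * X a x)"

definition derivations :: "'m fn set \<Rightarrow> 'm vf set" where
  "derivations C = {X.
     (\<forall>f\<in>C. X f \<in> C) \<and> (\<forall>f. f \<notin> C \<longrightarrow> X f = 0) \<and>
     (\<forall>f\<in>C. \<forall>g\<in>C. \<forall>a b. X (\<lambda>x. a * f x + b * g x) = (\<lambda>x. a * X f x + b * X g x)) \<and>
     (\<forall>f\<in>C. \<forall>g\<in>C. X (f * g) = f * X g + g * X f)}"

definition lie :: "'m vf \<Rightarrow> 'm vf \<Rightarrow> 'm vf" where
  "lie X Y = (\<lambda>f. X (Y f) - Y (X f))"

definition conj_vf :: "'m vf \<Rightarrow> 'm vf" where
  "conj_vf X = (\<lambda>f x. cnj (X (\<lambda>y. cnj (f y)) x))"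

text \<open>
  Alternating \<open>k\<close>-linear forms on a \<open>C\<close>-module \<open>V\<close> with scalar multiplication \<open>sm\<close>.
\<close>
definition alt :: "'m fn set \<Rightarrow> ('m fn \<Rightarrow> 'v \<Rightarrow> 'v) \<Rightarrow> 'v::plus set \<Rightarrow> nat \<Rightarrow> ('v list \<Rightarrow> 'm fn) set" where
  "alt C sm V k = {\<omega>.
     (\<forall>v. \<not> (length v = k \<and> set v \<subseteq> V) \<longrightarrow> \<omega> v = 0) \<and>
     (\<forall>v. length v = k \<and> set v \<subseteq> V \<longrightarrow>
        \<omega> v \<in> C \<and>
        (\<forall>i<k. \<forall>f\<in>C. \<forall>u\<in>V. \<forall>w\<in>V.
           \<omega> (v[i := sm f u + w]) = f * \<omega> (v[i := u]) + \<omega> (v[i := w])) \<and>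
        (\<forall>i<k. \<forall>j<k. i \<noteq> j \<and> v ! i = v ! j \<longrightarrow> \<omega> v = 0))}"

text \<open>Wedge product as a sum over shuffles; the exponent counts the inversions of the shuffle.\<close>
definition wedge :: "('v list \<Rightarrow> 'm fn) \<Rightarrow> ('v list \<Rightarrow> 'm fn) \<Rightarrow> 'v list \<Rightarrow> 'm fn" where
  "wedge \<omega> \<eta> v = (\<Sum>S\<in>Pow {..<length v}.
     (- 1) ^ card {(i, j). i \<in> S \<and> j \<in> {..<length v} - S \<and> j < i} *
       \<omega> (nths v S) * \<eta> (nths v (- S)))"

text \<open>
  Koszul's formula for the differential of a \<open>k\<close>-form on \<open>V\<close>, where \<open>a\<close> is the action of \<open>V\<close> on
  functions and \<open>br\<close> the bracket on \<open>V\<close>.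
\<close>
definition koszul :: "'v set \<Rightarrow> ('v \<Rightarrow> 'm vf) \<Rightarrow> ('v \<Rightarrow> 'v \<Rightarrow> 'v) \<Rightarrow> nat \<Rightarrow>
    ('v list \<Rightarrow> 'm fn) \<Rightarrow> 'v list \<Rightarrow> 'm fn" where
  "koszul V a br k \<omega> v = (if length v = Suc k \<and> set v \<subseteq> V then
     (\<Sum>i\<le>k. (- 1) ^ i * a (v ! i) (\<omega> (nths v (- {i})))) +
     (\<Sum>j\<le>k. \<Sum>i<j. (- 1) ^ (i + j) * \<omega> (br (v ! i) (v ! j) # nths v (- {i, j})))
   else 0)"

text \<open>
  For \<open>V\<close> split into two summands with projections \<open>P'\<close>, \<open>P''\<close>: the part of \<open>\<omega>\<close> of degree \<open>p\<close> in
  the first summand.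
\<close>
definition component :: "'v set \<Rightarrow> ('v \<Rightarrow> 'v) \<Rightarrow> ('v \<Rightarrow> 'v) \<Rightarrow> nat \<Rightarrow>
    ('v list \<Rightarrow> 'm fn) \<Rightarrow> 'v list \<Rightarrow> 'm fn" where
  "component V P' P'' p \<omega> v = (if set v \<subseteq> V then
     (\<Sum>S\<in>{S. S \<subseteq> {..<length v} \<and> card S = p}.
        \<omega> (map (\<lambda>i. if i \<in> S then P' (v ! i) else P'' (v ! i)) [0..<length v]))
   else 0)"

definition forms :: "'m fn set \<Rightarrow> nat \<Rightarrow> 'm form set" where
  "forms C k = alt C fmul (derivations C) k"

definition ext_d :: "'m fn set \<Rightarrow> nat \<Rightarrow> 'm form \<Rightarrow> 'm form" where
  "ext_d C k = koszul (derivations C) (\<lambda>X. X) lie k"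

definition contract :: "'m vf \<Rightarrow> 'm form \<Rightarrow> 'm form" where
  "contract X \<omega> = (\<lambda>v. \<omega> (X # v))"


section \<open>Complex manifolds\<close>

text \<open>Integrable almost complex structures, extended complex-linearly to complex vector fields.\<close>
definition complex_structure :: "'m fn set \<Rightarrow> ('m vf \<Rightarrow> 'm vf) \<Rightarrow> bool" where
  "complex_structure C J \<longleftrightarrow>
     (\<forall>X\<in>derivations C. J X \<in> derivations C \<and> J (J X) = - X \<and> J (conj_vf X) = conj_vf (J X)) \<and>
     (\<forall>f\<in>C. \<forall>X\<in>derivations C. \<forall>Y\<in>derivations C. J (fmul f X + Y) = fmul f (J X) + J Y) \<and>
     (\<forall>X\<in>derivations C. \<forall>Y\<in>derivations C.
        lie (J X) (J Y) = lie X Y + J (lie (J X) Y + lie X (J Y)))"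

record 'm complex_manifold =
  points :: "'m set"
  Cinf :: "'m fn set"
  Jop :: "'m vf \<Rightarrow> 'm vf"

definition T10 :: "('m, 'z) complex_manifold_scheme \<Rightarrow> 'm vf set" where
  "T10 M = {X \<in> derivations (Cinf M). Jop M X = cmul \<i> X}"

definition T01 :: "('m, 'z) complex_manifold_scheme \<Rightarrow> 'm vf set" where
  "T01 M = {X \<in> derivations (Cinf M). Jop M X = cmul (- \<i>) X}"

definition pr10 :: "('m, 'z) complex_manifold_scheme \<Rightarrow> 'm vf \<Rightarrow> 'm vf" where
  "pr10 M X = cmul (1 / 2) (X - cmul \<i> (Jop M X))"

definition pr01 :: "('m, 'z) complex_manifold_scheme \<Rightarrow> 'm vf \<Rightarrow> 'm vf" where
  "pr01 M X = cmul (1 / 2) (X + cmul \<i> (Jop M X))"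

definition form_component :: "('m, 'z) complex_manifold_scheme \<Rightarrow> nat \<Rightarrow> 'm form \<Rightarrow> 'm form" where
  "form_component M p = component (derivations (Cinf M)) (pr10 M) (pr01 M) p"

text \<open>\<open>A\<^sup>p\<^sup>,\<^sup>q(M)\<close>, and the Dolbeault operator as the \<open>(p, q + 1)\<close>-part of \<open>d\<close>.\<close>
definition pq_forms :: "('m, 'z) complex_manifold_scheme \<Rightarrow> nat \<Rightarrow> nat \<Rightarrow> 'm form set" where
  "pq_forms M p q = {\<omega> \<in> forms (Cinf M) (p + q). form_component M p \<omega> = \<omega>}"

definition dbar :: "('m, 'z) complex_manifold_scheme \<Rightarrow> nat \<Rightarrow> nat \<Rightarrow> 'm form \<Rightarrow> 'm form" where
  "dbar M p q \<omega> = form_component M p (ext_d (Cinf M) (p + q) \<omega>)"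


section \<open>Polyvector-valued forms\<close>

text \<open>
  Sections of \<open>T \<oplus> T\<^sup>*\<close> are pairs of a vector field and a 1-form, with the bracket
  \<open>[X + x, Y + y] = [X, Y] + i\<^sub>X dy - i\<^sub>Y dx\<close>. The bundle \<open>L = T\<^sub>1\<^sub>,\<^sub>0 \<oplus> T\<^sub>0\<^sub>,\<^sub>1\<^sup>*\<close> is dual to its conjugate
  \<open>T\<^sub>0\<^sub>,\<^sub>1 \<oplus> T\<^sub>1\<^sub>,\<^sub>0\<^sup>*\<close>, and the latter carries the conjugate of the bracket of \<open>L\<close>.
\<close>
type_synonym 'm gsec = "'m vf \<times> 'm form"
type_synonym 'm polyform = "'m gsec list \<Rightarrow> 'm fn"

definition gmul :: "'m fn \<Rightarrow> 'm gsec \<Rightarrow> 'm gsec" where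
  "gmul f v = (fmul f (fst v), fmul f (snd v))"

definition gbracket :: "'m fn set \<Rightarrow> 'm gsec \<Rightarrow> 'm gsec \<Rightarrow> 'm gsec" where
  "gbracket C v w = (lie (fst v) (fst w),
     contract (fst v) (ext_d C 1 (snd w)) - contract (fst w) (ext_d C 1 (snd v)))"

definition L_sec :: "('m, 'z) complex_manifold_scheme \<Rightarrow> 'm gsec set" where
  "L_sec M = T10 M \<times> pq_forms M 0 1"

definition Lbar_sec :: "('m, 'z) complex_manifold_scheme \<Rightarrow> 'm gsec set" where
  "Lbar_sec M = T01 M \<times> pq_forms M 1 0"

text \<open>
  Sections of \<open>\<Lambda>\<^sup>k L\<close> are represented as alternating forms on the dual of \<open>L\<close>;
  \<open>A\<^sup>0\<^sup>,\<^sup>q(M, \<Lambda>\<^sup>p T\<^sub>1\<^sub>,\<^sub>0)\<close> consists of those of degree \<open>p\<close> in the (1,0)-form arguments and degree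
  \<open>q\<close> in the (0,1)-vector arguments.
\<close>
definition L_alt :: "('m, 'z) complex_manifold_scheme \<Rightarrow> nat \<Rightarrow> 'm polyform set" where
  "L_alt M k = alt (Cinf M) gmul (Lbar_sec M) k"

definition polyvec_forms :: "('m, 'z) complex_manifold_scheme \<Rightarrow> nat \<Rightarrow> nat \<Rightarrow> 'm polyform set" where
  "polyvec_forms M p q = {\<omega> \<in> L_alt M (p + q).
     component (Lbar_sec M) (\<lambda>(Z, \<alpha>). (0, \<alpha>)) (\<lambda>(Z, \<alpha>). (Z, 0)) p \<omega> = \<omega>}"

definition embed_fn :: "'m fn \<Rightarrow> 'm polyform" where
  "embed_fn f = (\<lambda>v. if v = [] then f else 0)"

text \<open>The section \<open>X + y\<close> of \<open>L\<close>, paired with \<open>Z + \<alpha>\<close> by \<open>\<alpha>(X) + y(Z)\<close>.\<close>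
definition embed_L :: "('m, 'z) complex_manifold_scheme \<Rightarrow> 'm gsec \<Rightarrow> 'm polyform" where
  "embed_L M l = (\<lambda>v. if length v = 1 \<and> set v \<subseteq> Lbar_sec M
     then snd (v ! 0) [fst l] + snd l [fst (v ! 0)] else 0)"

text \<open>
  Dolbeault operator of \<open>\<Lambda>\<^sup>p T\<^sub>1\<^sub>,\<^sub>0\<close>-valued (0,q)-forms, in total degree \<open>k = p + q\<close>. For \<open>Z\<close> in \<open>T\<^sub>0\<^sub>,\<^sub>1\<close>
  and a (1,0)-form \<open>\<alpha>\<close>, \<open>gbracket (Z, 0) (0, \<alpha>)\<close> is \<open>i\<^sub>Z d\<alpha>\<close>, the covariant derivative of \<open>\<alpha>\<close> along \<open>Z\<close>
  for the Dolbeault operator of the holomorphic cotangent bundle. Hence for a section \<open>P\<close> of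
  \<open>\<Lambda>\<^sup>p T\<^sub>1\<^sub>,\<^sub>0\<close> the formula reads
  \<open>(dbar P)(Z; \<alpha>\<^sub>1, .., \<alpha>\<^sub>p) = Z(P(\<alpha>\<^sub>1, .., \<alpha>\<^sub>p)) - (\<Sum>j. P(\<alpha>\<^sub>1, .., i\<^sub>Z d\<alpha>\<^sub>j, .., \<alpha>\<^sub>p))\<close>;
  in particular \<open>dbar X (Z)\<close> is the (1,0)-part of \<open>[Z, X]\<close>.
\<close>
definition dbar_poly :: "('m, 'z) complex_manifold_scheme \<Rightarrow> nat \<Rightarrow> 'm polyform \<Rightarrow> 'm polyform" where
  "dbar_poly M k = koszul (Lbar_sec M) fst (gbracket (Cinf M)) k"

text \<open>
  The Schouten bracket is the unique Gerstenhaber bracket on sections of \<open>\<Lambda> L\<close> with the prescribed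
  values on generators. Degrees are shifted by one; exponents are written with \<open>k + 1\<close>, which has
  the parity of \<open>k - 1\<close>.
\<close>
definition schouten_bracket ::
  "('m, 'z) complex_manifold_scheme \<Rightarrow> ('m polyform \<Rightarrow> 'm polyform \<Rightarrow> 'm polyform) \<Rightarrow> bool" where
  "schouten_bracket M br \<longleftrightarrow>
     (\<forall>k l. \<forall>a\<in>L_alt M k. \<forall>b\<in>L_alt M l. br a b \<in> L_alt M (k + l - 1)) \<and>
     (\<forall>a\<in>L_alt M 0. \<forall>b\<in>L_alt M 0. br a b = 0) \<and>
     (\<forall>k l c. \<forall>a\<in>L_alt M k. \<forall>b\<in>L_alt M l. \<forall>b'\<in>L_alt M l.
        br a (cmul c b + b') = cmul c (br a b) + br a b') \<and>
     (\<forall>k l. \<forall>a\<in>L_alt M k. \<forall>b\<in>L_alt M l.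
        br a b = cmul (- ((- 1) ^ ((k + 1) * (l + 1)))) (br b a)) \<and>
     (\<forall>k l m. \<forall>a\<in>L_alt M k. \<forall>b\<in>L_alt M l. \<forall>c\<in>L_alt M m.
        br a (wedge b c) = wedge (br a b) c + cmul ((- 1) ^ ((k + 1) * l)) (wedge b (br a c)) \<and>
        br a (br b c) = br (br a b) c + cmul ((- 1) ^ ((k + 1) * (l + 1))) (br b (br a c))) \<and>
     (\<forall>u\<in>L_sec M. \<forall>w\<in>L_sec M.
        br (embed_L M u) (embed_L M w) = embed_L M (gbracket (Cinf M) u w)) \<and>
     (\<forall>u\<in>L_sec M. \<forall>f\<in>Cinf M. br (embed_L M u) (embed_fn f) = embed_fn (fst u f))"

definition holomorphic_poisson ::
  "('m, 'z) complex_manifold_scheme \<Rightarrow> ('m polyform \<Rightarrow> 'm polyform \<Rightarrow> 'm polyform) \<Rightarrow> 'm polyform \<Rightarrow> bool" where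
  "holomorphic_poisson M br \<mu> \<longleftrightarrow>
     \<mu> \<in> polyvec_forms M 2 0 \<and> dbar_poly M 2 \<mu> = 0 \<and> br \<mu> \<mu> = 0"


section \<open>Left-invariant tensors\<close>

text \<open>
  For a set \<open>I\<close> of vector fields forming a global frame (below: the fields induced by left-invariant
  ones), a tensor is invariant when it takes constant values on invariant arguments.
\<close>
definition constants :: "('m, 'z) complex_manifold_scheme \<Rightarrow> 'm fn set" where
  "constants M = {f \<in> Cinf M. \<exists>c. \<forall>x\<in>points M. f x = c}"

definition inv_pq_forms :: "('m, 'z) complex_manifold_scheme \<Rightarrow> 'm vf set \<Rightarrow> nat \<Rightarrow> nat \<Rightarrow> 'm form set" where
  "inv_pq_forms M I p q = {\<omega> \<in> pq_forms M p q. \<forall>v. set v \<subseteq> I \<longrightarrow> \<omega> v \<in> constants M}"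

definition inv_polyvec_forms ::
  "('m, 'z) complex_manifold_scheme \<Rightarrow> 'm vf set \<Rightarrow> nat \<Rightarrow> nat \<Rightarrow> 'm polyform set" where
  "inv_polyvec_forms M I p q = {\<omega> \<in> polyvec_forms M p q.
     \<forall>v. set v \<subseteq> (T01 M \<inter> I) \<times> inv_pq_forms M I 1 0 \<longrightarrow> \<omega> v \<in> constants M}"


section \<open>Cohomology\<close>

definition coset :: "'a::plus set \<Rightarrow> 'a \<Rightarrow> 'a set" where
  "coset B x = {x + b | b. b \<in> B}"

definition quot :: "'a::plus set \<Rightarrow> 'a set \<Rightarrow> 'a set set" where
  "quot Z B = coset B ` Z"

text \<open>
  \<open>\<Phi>\<close> is an isomorphism of complex vector spaces from \<open>Z/B\<close> onto \<open>Z'/B'\<close>.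
\<close>
definition quot_iso :: "('a \<Rightarrow> 'm fn) set \<Rightarrow> ('a \<Rightarrow> 'm fn) set \<Rightarrow> ('a \<Rightarrow> 'm fn) set \<Rightarrow> ('a \<Rightarrow> 'm fn) set \<Rightarrow>
    (('a \<Rightarrow> 'm fn) set \<Rightarrow> ('a \<Rightarrow> 'm fn) set) \<Rightarrow> bool" where
  "quot_iso Z B Z' B' \<Phi> \<longleftrightarrow>
     bij_betw \<Phi> (quot Z B) (quot Z' B') \<and>
     (\<forall>x\<in>Z. \<forall>y\<in>Z. \<forall>c. \<Phi> (coset B (cmul c x + y)) =
        {cmul c u + w | u w. u \<in> \<Phi> (coset B x) \<and> w \<in> \<Phi> (coset B y)})"

text \<open>
  The map \<open>Z/B \<rightarrow> Z'/B'\<close> induced by inclusions \<open>Z \<subseteq> Z'\<close>, \<open>B \<subseteq> B'\<close>.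
\<close>
definition induced :: "'a::plus set \<Rightarrow> 'a set \<Rightarrow> 'a set" where
  "induced B' c = {x + b | x b. x \<in> c \<and> b \<in> B'}"

text \<open>
  Cocycles and coboundaries of a bigraded subspace \<open>A\<close> of the (p,q)-forms.
\<close>
definition dbar_cocycles ::
  "('m, 'z) complex_manifold_scheme \<Rightarrow> (nat \<Rightarrow> nat \<Rightarrow> 'm form set) \<Rightarrow> nat \<Rightarrow> nat \<Rightarrow> 'm form set" where
  "dbar_cocycles M A p q = {\<omega> \<in> A p q. dbar M p q \<omega> = 0}"

definition dbar_coboundaries ::
  "('m, 'z) complex_manifold_scheme \<Rightarrow> (nat \<Rightarrow> nat \<Rightarrow> 'm form set) \<Rightarrow> nat \<Rightarrow> nat \<Rightarrow> 'm form set" where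
  "dbar_coboundaries M A p q = (if q = 0 then {0} else dbar M p (q - 1) ` A p (q - 1))"

text \<open>
  Total complex of a bigraded subspace \<open>A\<close> of the polyvector-valued forms, with \<open>A p q\<close> in total
  degree \<open>p + q\<close> and differential \<open>dbar + [\<mu>, \<bullet>]\<close>.
\<close>
definition total :: "(nat \<Rightarrow> nat \<Rightarrow> 'm polyform set) \<Rightarrow> nat \<Rightarrow> 'm polyform set" where
  "total A k = {\<Sum>p\<le>k. \<omega> p | \<omega>. \<forall>p\<le>k. \<omega> p \<in> A p (k - p)}"

definition total_d :: "('m, 'z) complex_manifold_scheme \<Rightarrow> ('m polyform \<Rightarrow> 'm polyform \<Rightarrow> 'm polyform) \<Rightarrow>
    'm polyform \<Rightarrow> nat \<Rightarrow> 'm polyform \<Rightarrow> 'm polyform" where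
  "total_d M br \<mu> k \<omega> = dbar_poly M k \<omega> + br \<mu> \<omega>"

definition total_cocycles :: "('m, 'z) complex_manifold_scheme \<Rightarrow> ('m polyform \<Rightarrow> 'm polyform \<Rightarrow> 'm polyform) \<Rightarrow>
    'm polyform \<Rightarrow> (nat \<Rightarrow> nat \<Rightarrow> 'm polyform set) \<Rightarrow> nat \<Rightarrow> 'm polyform set" where
  "total_cocycles M br \<mu> A k = {\<omega> \<in> total A k. total_d M br \<mu> k \<omega> = 0}"

definition total_coboundaries :: "('m, 'z) complex_manifold_scheme \<Rightarrow> ('m polyform \<Rightarrow> 'm polyform \<Rightarrow> 'm polyform) \<Rightarrow>
    'm polyform \<Rightarrow> (nat \<Rightarrow> nat \<Rightarrow> 'm polyform set) \<Rightarrow> nat \<Rightarrow> 'm polyform set" where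
  "total_coboundaries M br \<mu> A k =
     (if k = 0 then {0} else total_d M br \<mu> (k - 1) ` total A (k - 1))"


section \<open>Nilmanifolds\<close>

definition smooth_functions :: "('g::topological_space, 'e::euclidean_space) chart set \<Rightarrow> 'g fn set" where
  "smooth_functions A = {f. \<forall>(U, \<phi>)\<in>A. smooth_on (\<lambda>x. f (inv_into U \<phi> x)) (\<phi> ` U)}"

definition translate_fn :: "('g, 'r) monoid_scheme \<Rightarrow> 'g \<Rightarrow> 'g fn \<Rightarrow> 'g fn" where
  "translate_fn G a f = (\<lambda>x. f (a \<otimes>\<^bsub>G\<^esub> x))"

text \<open>Pushforward of a vector field under left translation by \<open>a\<close>.\<close>
definition translate_vf :: "('g, 'r) monoid_scheme \<Rightarrow> 'g \<Rightarrow> 'g vf \<Rightarrow> 'g vf" where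
  "translate_vf G a X = (\<lambda>f. translate_fn G (inv\<^bsub>G\<^esub> a) (X (translate_fn G a f)))"

text \<open>The complexification of the Lie algebra of \<open>G\<close>.\<close>
definition left_invariant_fields ::
  "('g::topological_space, 'r) monoid_scheme \<Rightarrow> ('g, 'e::euclidean_space) chart set \<Rightarrow> 'g vf set" where
  "left_invariant_fields G A =
     {X \<in> derivations (smooth_functions A). \<forall>a\<in>carrier G. translate_vf G a X = X}"

definition left_invariant_complex_structure ::
  "('g::topological_space, 'r) monoid_scheme \<Rightarrow> ('g, 'e::euclidean_space) chart set \<Rightarrow> ('g vf \<Rightarrow> 'g vf) \<Rightarrow> bool" where
  "left_invariant_complex_structure G A J \<longleftrightarrow>
     complex_structure (smooth_functions A) J \<and>
     (\<forall>a\<in>carrier G. \<forall>X\<in>derivations (smooth_functions A).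
        J (translate_vf G a X) = translate_vf G a (J X))"

text \<open>
  The projection to the quotient is a local diffeomorphism, so a function on the quotient is smooth
  if and only if its pullback to \<open>G\<close> is.
\<close>
definition quotient_functions ::
  "('g::topological_space, 'r) monoid_scheme \<Rightarrow> ('g, 'e::euclidean_space) chart set \<Rightarrow> 'g set \<Rightarrow> 'g set fn set" where
  "quotient_functions G A \<Gamma> = {f. (\<forall>c. c \<notin> rcosets\<^bsub>G\<^esub> \<Gamma> \<longrightarrow> f c = 0) \<and>
     (\<lambda>x. f (\<Gamma> #>\<^bsub>G\<^esub> x)) \<in> smooth_functions A}"

text \<open>\<open>X\<close> on \<open>G\<close> and \<open>Y\<close> on the quotient are related by the projection.\<close>
definition projects_to ::
  "('g::topological_space, 'r) monoid_scheme \<Rightarrow> ('g, 'e::euclidean_space) chart set \<Rightarrow> 'g set \<Rightarrow>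
    'g vf \<Rightarrow> 'g set vf \<Rightarrow> bool" where
  "projects_to G A \<Gamma> X Y \<longleftrightarrow>
     X \<in> derivations (smooth_functions A) \<and> Y \<in> derivations (quotient_functions G A \<Gamma>) \<and>
     (\<forall>f\<in>quotient_functions G A \<Gamma>. \<forall>x\<in>carrier G.
        X (\<lambda>y. f (\<Gamma> #>\<^bsub>G\<^esub> y)) x = Y f (\<Gamma> #>\<^bsub>G\<^esub> x))"

text \<open>Every vector field on the quotient has a unique lift to \<open>G\<close>; \<open>J\<close> is applied to the lift.\<close>
definition nilmanifold ::
  "('g::topological_space, 'r) monoid_scheme \<Rightarrow> ('g, 'e::euclidean_space) chart set \<Rightarrow> 'g set \<Rightarrow>
    ('g vf \<Rightarrow> 'g vf) \<Rightarrow> 'g set complex_manifold" where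
  "nilmanifold G A \<Gamma> J =
     \<lparr> points = rcosets\<^bsub>G\<^esub> \<Gamma>,
       Cinf = quotient_functions G A \<Gamma>,
       Jop = (\<lambda>Y. THE Y'. \<exists>X. projects_to G A \<Gamma> X Y \<and> projects_to G A \<Gamma> (J X) Y') \<rparr>"

definition induced_fields ::
  "('g::topological_space, 'r) monoid_scheme \<Rightarrow> ('g, 'e::euclidean_space) chart set \<Rightarrow> 'g set \<Rightarrow> 'g set vf set" where
  "induced_fields G A \<Gamma> = {Y. \<exists>X\<in>left_invariant_fields G A. projects_to G A \<Gamma> X Y}"

end

theory Submission
  imports Defs "HOL-Real_Asymp.Real_Asymp"
begin

text \<open>
 The polyvector-valued forms are the forms on \<open>L = T01 + T10*\<close>, a Lie algebroid with an
 invariant frame, and \<open>D = dbar + [\<mu>, _]\<close> squares to zero. By nilpotency \<open>g10\<close> has a basis that is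
 triangular for the action of \<open>g01\<close>. It gives a weight filtration, by polyvector degree and then by
 index; the bracket with \<open>\<mu>\<close> raises the weight because it raises the degree, so on the graded
 pieces \<open>D\<close> acts as \<open>dbar\<close> on the coefficient forms of type \<open>(0, q)\<close>. Working up through
 the weights, an element whose differential is invariant is seen to be invariant up to a
 coboundary; this gives both injectivity and surjectivity on cohomology.
\<close>

section \<open>Calculus of smooth functions on open sets\<close>

text \<open>A manifold is given only by its functions, and a field only as a global derivation. That
  the fields on the quotient are combinations of left-invariant ones is therefore a theorem
  (\<open>D_frame\<close>): a derivation is localised by cutoffs periodic under the lattice and
  evaluated by Hadamard's lemma. The bracket \<open>br\<close> is given only by axioms. Its values
  are recovered by induction over products of frame elements; on an invariant frame element it is a
  Lie derivative (\<open>br_LD\<close>). That the total differential squares to zero rests on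
  \<open>dbar\<close> being a derivation of \<open>br\<close>, and on frame elements this is the
  compatibility of two transversal isotropic subalgebras of a Lie algebra with invariant pairing
  (\<open>double_compat\<close>). The index part of the weight exists because the invariant frame of
  \<open>T_{1,0}\<close> need not be holomorphic, so that \<open>dbar\<close> mixes the coefficients
  of a form. Triangularity makes this mixing go upwards in weight only.\<close>

abbreviation "fd \<equiv> frechet_derivative"

lemma Ck_on_SucD: "Ck_on (Suc k) f S ==> Ck_on k f S"
proof (induction k arbitrary: f)
 case 0
 thus ?case by (simp add: differentiable_imp_continuous_on)
next
 case (Suc k)
 have "f differentiable_on S" "\<And>v. Ck_on (Suc k) (%x. fd f (at x) v) S"
  using Suc.prems unfolding Ck_on.simps(2)[of "Suc k"] by blast+
 thus ?case using Suc.IH unfolding Ck_on.simps(2)[of k f] by blast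
qed

lemma Ck_on_continuous: "Ck_on k f S ==> continuous_on S f"
 by (induction k) (auto dest: differentiable_imp_continuous_on)

lemma Ck_on_subset: "Ck_on k f S ==> T \<subseteq> S ==> Ck_on k f T"
proof (induction k arbitrary: f)
 case 0
 thus ?case by (auto intro: continuous_on_subset)
next
 case (Suc k)
 thus ?case by (auto intro: differentiable_on_subset)
qed

lemma differentiable_onD: "f differentiable_on S ==> open S ==> x \<in> S ==> f differentiable (at x)"
 by (simp add: differentiable_on_eq_differentiable_at)

lemma differentiable_on_cong_open:
 assumes "f differentiable_on S" "open S" "\<And>x. x \<in> S ==> f x = g x"
 shows "g differentiable_on S"
 unfolding differentiable_on_eq_differentiable_at[OF assms(2)]
proof
 fix x assume x: "x \<in> S"
 then obtain f' where "(f has_derivative f') (at x)"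
  using assms(1) unfolding differentiable_on_eq_differentiable_at[OF assms(2)] differentiable_def by blast
 hence "(g has_derivative f') (at x)"
  using has_derivative_transform_within_open[OF _ assms(2) x] assms(3) by blast
 thus "g differentiable (at x)" by (rule differentiableI)
qed

lemma frechet_derivative_cong_open:
 assumes "open S" "x \<in> S" "\<And>x. x \<in> S ==> f x = g x"
 shows "fd f (at x) = fd g (at x)"
proof -
 have "(f has_derivative h) (at x) \<longleftrightarrow> (g has_derivative h) (at x)" for h
  using has_derivative_transform_within_open[of f h x UNIV S g, OF _ assms(1,2)]
   has_derivative_transform_within_open[of g h x UNIV S f, OF _ assms(1,2)] assms(3) by metis
 thus ?thesis by (simp add: frechet_derivative_def)
qed

lemma Ck_on_cong:
 assumes "Ck_on k f S" "open S" "\<And>x. x \<in> S ==> f x = g x"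
 shows "Ck_on k g S"
 using assms(1,3)
proof (induction k arbitrary: f g)
 case 0
 thus ?case using continuous_on_eq by auto
next
 case (Suc k)
 have "Ck_on k (%x. fd g (at x) v) S" for v
 proof (rule Suc.IH)
  show "Ck_on k (%x. fd f (at x) v) S" using Suc.prems by simp
  show "\<And>x. x \<in> S ==> fd f (at x) v = fd g (at x) v"
   using frechet_derivative_cong_open[OF assms(2) _ Suc.prems(2)] by simp
 qed
 moreover have "g differentiable_on S"
  by (rule differentiable_on_cong_open[where f = f, OF _ assms(2)]) (use Suc.prems in auto)
 ultimately show ?case by simp
qed

lemma Ck_on_const [simp]: "Ck_on k (%x. c) S"
 by (induction k arbitrary: c) (auto simp: frechet_derivative_const)

lemma frechet_derivative_eqI: "(f has_derivative f') (at x) ==> fd f (at x) v = f' v"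
 using frechet_derivative_at by metis

lemma Ck_on_SucI:
 assumes "open S" "\<And>x. x \<in> S ==> (f has_derivative f' x) (at x)" "\<And>v. Ck_on k (%x. f' x v) S"
 shows "Ck_on (Suc k) f S"
proof -
 have "f differentiable_on S"
  using assms(1,2) by (auto simp: differentiable_on_eq_differentiable_at differentiable_def)
 moreover have "Ck_on k (%x. fd f (at x) v) S" for v
  by (rule Ck_on_cong[OF assms(3)[of v] assms(1)]) (metis assms(2) frechet_derivative_at)
 ultimately show ?thesis by simp
qed

lemma Ck_on_SucE:
 assumes "Ck_on (Suc k) f S" "open S"
 shows "\<And>x. x \<in> S ==> (f has_derivative fd f (at x)) (at x)"
  "\<And>v. Ck_on k (%x. fd f (at x) v) S"
 using assms by (auto dest: differentiable_onD simp: frechet_derivative_works[symmetric])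

lemma Ck_on_linear: "bounded_linear f ==> open S ==> Ck_on k f S"
proof (cases k)
 case (Suc j)
 assume "bounded_linear f" "open S"
 thus ?thesis unfolding Suc
  by (intro Ck_on_SucI[where f' = "%_. f"]) (auto intro: bounded_linear_imp_has_derivative)
qed (simp add: linear_continuous_on)

lemma Ck_on_plus:
 assumes S: "open S"
 shows "Ck_on k f S ==> Ck_on k g S ==> Ck_on k (%x. f x + g x) S"
proof (induction k arbitrary: f g)
 case 0
 thus ?case by (auto intro: continuous_on_add)
next
 case (Suc k)
 show ?case
  by (intro Ck_on_SucI[OF S, where f' = "%x v. fd f (at x) v + fd g (at x) v"]
    has_derivative_add Suc.IH Ck_on_SucE[OF Suc.prems(1) S] Ck_on_SucE[OF Suc.prems(2) S])
qed

lemma Ck_on_bilinear: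
 assumes B: "bounded_bilinear B" and S: "open S"
 shows "Ck_on k f S ==> Ck_on k g S ==> Ck_on k (%x. B (f x) (g x)) S"
proof (induction k arbitrary: f g)
 case 0
 thus ?case by (auto intro: bounded_bilinear.continuous_on[OF B])
next
 case (Suc k)
 show ?case
  by (intro Ck_on_SucI[OF S, where f' = "%x v. B (f x) (fd g (at x) v) + B (fd f (at x) v) (g x)"]
    Ck_on_plus Suc.IH Ck_on_SucE[OF Suc.prems(1) S] Ck_on_SucE[OF Suc.prems(2) S] S
    Ck_on_SucD[OF Suc.prems(1)] Ck_on_SucD[OF Suc.prems(2)] bounded_bilinear.FDERIV[OF B])
qed

lemmas Ck_on_scaleR = Ck_on_bilinear[OF bounded_bilinear_scaleR]
lemmas Ck_on_mult = Ck_on_bilinear[OF bounded_bilinear_mult]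

lemma Ck_on_sum:
 assumes "open S" "\<And>i. i \<in> F ==> Ck_on k (f i) S"
 shows "Ck_on k (%x. \<Sum>i\<in>F. f i x) S"
 using assms(2)
proof (induction F rule: infinite_finite_induct)
 case (insert i F)
 hence "Ck_on k (%x. f i x + (\<Sum>i\<in>F. f i x)) S"
  by (intro Ck_on_plus[OF assms(1)]) auto
 with insert show ?case by simp
qed auto

lemma Ck_on_compose:
 fixes f :: "'a::euclidean_space => 'b::euclidean_space"
 assumes "open S" "open T" "Ck_on k f S" "Ck_on k g T" "f ` S \<subseteq> T"
 shows "Ck_on k (%x. g (f x)) S"
 using assms(3-)
proof (induction k arbitrary: g)
 case 0
 thus ?case by (auto intro: continuous_on_compose2)
next
 case (Suc k)
 \<comment> \<open>The chain rule expanded over \<open>Basis\<close>: the induction covers the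
   partial derivatives of \<open>g\<close> along fixed vectors, not its derivative along the moving
   vector \<open>fd f (at x) v\<close>.\<close>
 let ?f' = "%x v. \<Sum>b\<in>Basis. (fd f (at x) v \<bullet> b) *\<^sub>R fd g (at (f x)) b"
 show ?case
 proof (rule Ck_on_SucI[where f' = ?f', OF assms(1)])
  fix x assume x: "x \<in> S"
  have df: "(f has_derivative fd f (at x)) (at x)"
   using Ck_on_SucE(1)[OF Suc.prems(1) assms(1)] x by simp
  have dg: "(g has_derivative fd g (at (f x))) (at (f x))"
   using Ck_on_SucE(1)[OF Suc.prems(2) assms(2)] x Suc.prems(3) by auto
  interpret g: bounded_linear "fd g (at (f x))"
   using dg by (rule has_derivative_bounded_linear)
  have eq: "fd g (at (f x)) w = (\<Sum>b\<in>Basis. (w \<bullet> b) *\<^sub>R fd g (at (f x)) b)" for w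
  proof -
   have "fd g (at (f x)) w = fd g (at (f x)) (\<Sum>b\<in>Basis. (w \<bullet> b) *\<^sub>R b)"
    by (simp add: euclidean_representation)
   thus ?thesis by (simp add: g.sum g.scaleR)
  qed
  show "((%x. g (f x)) has_derivative ?f' x) (at x)"
   by (rule has_derivative_eq_rhs[OF has_derivative_compose[OF df dg]]) (rule ext, rule eq)
 next
  fix v
  show "Ck_on k (%x. ?f' x v) S"
  proof (intro Ck_on_sum Ck_on_scaleR assms(1))
   fix b :: 'b
   show "Ck_on k (%x. fd f (at x) v \<bullet> b) S"
    by (intro Ck_on_bilinear[OF bounded_bilinear_inner assms(1)] Ck_on_SucE(2)[OF Suc.prems(1) assms(1)]) simp
   show "Ck_on k (%x. fd g (at (f x)) b) S"
    by (rule Suc.IH[OF Ck_on_SucD[OF Suc.prems(1)] Ck_on_SucE(2)[OF Suc.prems(2) assms(2)] Suc.prems(3)])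
  qed
 qed
qed

text \<open>Smoothness is treated as a property of germs, so that later arguments need not name the
  neighbourhoods on which composite maps are defined.\<close>

definition smooth_near :: "('a::euclidean_space => 'b::real_normed_vector) => 'a => bool" where
 "smooth_near f p \<longleftrightarrow> (\<exists>N. open N \<and> p \<in> N \<and> smooth_on f N)"

lemma smooth_nearI: "smooth_on f N ==> open N ==> p \<in> N ==> smooth_near f p"
 unfolding smooth_near_def by blast

lemma Ck_on_union_local:
 assumes "open S" "\<And>p. p \<in> S ==> \<exists>N. open N \<and> p \<in> N \<and> Ck_on k f N"
 shows "Ck_on k f S"
 using assms(2)
proof (induction k arbitrary: f)
 case 0
 hence "\<And>p. p \<in> S ==> continuous (at p) f"
  by (metis Ck_on.simps(1) continuous_on_eq_continuous_at)
 thus ?case by (simp add: continuous_at_imp_continuous_on)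
next
 case (Suc k)
 have "f differentiable_on S"
  using Suc.prems assms(1) by (metis Ck_on.simps(2) differentiable_on_eq_differentiable_at)
 moreover have "Ck_on k (%x. fd f (at x) v) S" for v
  by (rule Suc.IH) (use Suc.prems in force)
 ultimately show ?case by simp
qed

lemma smooth_onI:
 assumes "open S" "\<And>p. p \<in> S ==> smooth_near f p"
 shows "smooth_on f S"
 unfolding smooth_on_def
proof
 fix k show "Ck_on k f S"
  using assms unfolding smooth_near_def smooth_on_def by (intro Ck_on_union_local) blast+
qed

lemma smooth_near_const [simp]: "smooth_near (%x. c) p"
 unfolding smooth_near_def smooth_on_def by (rule exI[of _ UNIV]) auto

lemma smooth_near_linear: "bounded_linear f ==> smooth_near f p"
 unfolding smooth_near_def smooth_on_def by (rule exI[of _ UNIV]) (auto intro: Ck_on_linear)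

lemma smooth_near_bilinear:
 assumes "bounded_bilinear B" "smooth_near f p" "smooth_near g p"
 shows "smooth_near (%x. B (f x) (g x)) p"
proof -
 obtain U V where "open U" "p \<in> U" "smooth_on f U" "open V" "p \<in> V" "smooth_on g V"
  using assms(2,3) unfolding smooth_near_def by blast
 thus ?thesis unfolding smooth_near_def smooth_on_def
  by (intro exI[of _ "U \<inter> V"]) (auto intro!: Ck_on_bilinear[OF assms(1)] intro: Ck_on_subset)
qed

lemma smooth_near_add:
 assumes "smooth_near f p" "smooth_near g p"
 shows "smooth_near (%x. f x + g x) p"
proof -
 obtain U V where "open U" "p \<in> U" "smooth_on f U" "open V" "p \<in> V" "smooth_on g V"
  using assms unfolding smooth_near_def by blast
 thus ?thesis unfolding smooth_near_def smooth_on_def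
  by (intro exI[of _ "U \<inter> V"]) (auto intro!: Ck_on_plus intro: Ck_on_subset)
qed

lemmas smooth_near_mult = smooth_near_bilinear[OF bounded_bilinear_mult]
lemmas smooth_near_scaleR = smooth_near_bilinear[OF bounded_bilinear_scaleR]
lemmas smooth_near_inner = smooth_near_bilinear[OF bounded_bilinear_inner]

lemma smooth_near_sum:
 assumes "\<And>i. i \<in> F ==> smooth_near (f i) p"
 shows "smooth_near (%x. \<Sum>i\<in>F. f i x) p"
 using assms
proof (induction F rule: infinite_finite_induct)
 case (insert i F)
 hence "smooth_near (%x. f i x + (\<Sum>i\<in>F. f i x)) p"
  by (intro smooth_near_add) auto
 with insert show ?case by simp
qed auto

lemma smooth_on_continuous: "smooth_on f S ==> continuous_on S f"
 unfolding smooth_on_def using Ck_on_continuous by blast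

lemma smooth_near_isCont: "smooth_near f p ==> isCont f p"
 unfolding smooth_near_def using smooth_on_continuous continuous_on_eq_continuous_at by blast

lemma smooth_near_compose:
 fixes f :: "'a::euclidean_space => 'b::euclidean_space"
 assumes "smooth_near f p" "smooth_near g (f p)"
 shows "smooth_near (%x. g (f x)) p"
proof -
 obtain U V where U: "open U" "p \<in> U" "smooth_on f U" and V: "open V" "f p \<in> V" "smooth_on g V"
  using assms unfolding smooth_near_def by blast
 let ?W = "U \<inter> f -` V"
 have o: "open ?W"
  using continuous_on_open_vimage[OF U(1)] smooth_on_continuous[OF U(3)] V(1)
  by (metis Int_commute)
 have "smooth_on (%x. g (f x)) ?W"
  unfolding smooth_on_def
 proof
  fix k
  show "Ck_on k (%x. g (f x)) ?W"
   by (rule Ck_on_compose[OF o V(1)]) (use U V in \<open>auto simp: smooth_on_def intro: Ck_on_subset\<close>)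
 qed
 thus ?thesis using smooth_nearI[OF _ o] U V by auto
qed

lemma smooth_near_cong:
 assumes "smooth_near f p" "open N" "p \<in> N" "\<And>x. x \<in> N ==> f x = g x"
 shows "smooth_near g p"
proof -
 obtain U where U: "open U" "p \<in> U" "smooth_on f U"
  using assms(1) unfolding smooth_near_def by blast
 have "smooth_on g (U \<inter> N)"
  unfolding smooth_on_def
 proof
  fix k
  have "Ck_on k f (U \<inter> N)" using U(3) Ck_on_subset[of k f U "U \<inter> N"] by (simp add: smooth_on_def)
  thus "Ck_on k g (U \<inter> N)"
   by (rule Ck_on_cong) (use U assms in auto)
 qed
 thus ?thesis using U assms by (intro smooth_nearI[of _ "U \<inter> N"]) auto
qed

lemma smooth_near_frechet: "smooth_near f p ==> smooth_near (%x. fd f (at x) v) p"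
 unfolding smooth_near_def smooth_on_def using Ck_on_SucE(2)[of _ f] by blast

lemma smooth_near_has_derivative:
 "smooth_near f p ==> (f has_derivative fd f (at p)) (at p)"
 unfolding smooth_near_def smooth_on_def using Ck_on_SucE(1) by blast

lemma smooth_near_open: "smooth_near f p ==> \<exists>N. open N \<and> p \<in> N \<and> (\<forall>x\<in>N. smooth_near f x)"
 unfolding smooth_near_def by blast

lemma smooth_near_Pair:
 fixes f :: "'a::euclidean_space => 'b::euclidean_space" and g :: "'a => 'c::euclidean_space"
 assumes "smooth_near f p" "smooth_near g p"
 shows "smooth_near (%x. (f x, g x)) p"
proof -
 have "smooth_near (%x. (f x, 0) + (0, g x)) p"
  using smooth_near_compose[OF assms(1) smooth_near_linear[OF bounded_linear_Pair[OF bounded_linear_ident bounded_linear_zero]]]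
   smooth_near_compose[OF assms(2) smooth_near_linear[OF bounded_linear_Pair[OF bounded_linear_zero bounded_linear_ident]]]
  by (intro smooth_near_add)
 thus ?thesis by simp
qed

lemma smooth_near_fst: "smooth_near fst (p::'a::euclidean_space \<times> 'b::euclidean_space)"
 and smooth_near_snd: "smooth_near snd p"
 by (auto intro: smooth_near_linear bounded_linear_fst bounded_linear_snd)

lemma smooth_near_ident [simp]: "smooth_near (%x. x) p"
 by (auto intro: smooth_near_linear bounded_linear_ident)

lemma smooth_near_uminus: "smooth_near f p ==> smooth_near (%x. - f x) p"
 using smooth_near_scaleR[of "%_. -1" p f] by simp

lemma smooth_near_diff: "smooth_near f p ==> smooth_near g p ==> smooth_near (%x. f x - g x) p"
 using smooth_near_add[of f p "%x. - g x"] smooth_near_uminus[of g p] by simp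

lemma smooth_near_of_real:
 fixes f :: "'a::euclidean_space => real"
 shows "smooth_near f p ==> smooth_near (%x. complex_of_real (f x)) p"
 by (rule smooth_near_compose[OF _ smooth_near_linear[OF bounded_linear_of_real]])

subsection \<open>Bump functions\<close>

text \<open>\<open>flat 0\<close> is \<open>exp (- 1 / t)\<close> continued by 0. The inverse powers
  make the family closed under differentiation up to linear combinations, so that smoothness of all
  members is a single induction.\<close>

definition flat :: "nat => real => real" where
 "flat n t = (if t > 0 then exp (- inverse t) * inverse t ^ n else 0)"

lemma DERIV_inverse_power:
 assumes "t \<noteq> (0::real)"
 shows "((%t. inverse t ^ n) has_real_derivative - (real n * inverse t ^ (n + 1))) (at t)"
proof (cases n)
 case (Suc m)
 show ?thesis unfolding Suc
  by (rule DERIV_cong[OF DERIV_power[OF DERIV_inverse[OF assms], of "Suc m"]]) (simp add: power2_eq_square)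
qed simp

lemma flat_DERIV: "(flat n has_real_derivative flat (n + 2) t - real n * flat (n + 1) t) (at t)"
proof (cases t "0::real" rule: linorder_cases)
 case less
 have "((%_. 0) has_real_derivative 0) (at t)" by simp
 hence "(flat n has_real_derivative 0) (at t)"
  by (rule has_field_derivative_transform_within_open[of _ _ _ "{..<0}"]) (use less in \<open>auto simp: flat_def\<close>)
 thus ?thesis using less by (simp add: flat_def)
next
 case greater
 have "((%t. exp (- inverse t) * inverse t ^ n) has_real_derivative
   flat (n + 2) t - real n * flat (n + 1) t) (at t)"
 proof -
  have "((%t. exp (- inverse t)) has_real_derivative exp (- inverse t) * inverse t ^ 2) (at t)"
   by (rule DERIV_cong[OF DERIV_chain2[OF DERIV_exp DERIV_minus[OF DERIV_inverse]]]) 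
    (use greater in \<open>auto simp: numeral_2_eq_2\<close>)
  hence "((%t. exp (- inverse t) * inverse t ^ n) has_real_derivative
    exp (- inverse t) * (- (real n * inverse t ^ (n + 1))) + exp (- inverse t) * inverse t ^ 2 * inverse t ^ n) (at t)"
   using DERIV_mult'[OF _ DERIV_inverse_power[of t n]] greater by fastforce
  moreover have "exp (- inverse t) * (- (real n * inverse t ^ (n + 1))) + exp (- inverse t) * inverse t ^ 2 * inverse t ^ n
    = flat (n + 2) t - real n * flat (n + 1) t"
   using greater unfolding flat_def power_add by (simp add: algebra_simps)
  ultimately show ?thesis by simp
 qed
 thus ?thesis
  by (rule has_field_derivative_transform_within_open[of _ _ _ "{0<..}"]) (use greater in \<open>auto simp: flat_def\<close>)
next
 case equal
 have l: "((%h. exp (- inverse h) * inverse h ^ n / h) \<longlongrightarrow> 0) (at_right (0::real))" for n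
  by real_asymp
 have "((%h. flat n h / h) \<longlongrightarrow> 0) (at_right (0::real))"
  by (rule Lim_transform_eventually[OF l[of n]]) (auto simp: flat_def eventually_at_filter)
 moreover have "((%h. flat n h / h) \<longlongrightarrow> 0) (at_left (0::real))"
  by (rule Lim_transform_eventually[OF tendsto_const]) (auto simp: flat_def eventually_at_filter)
 ultimately have "((%h. flat n h / h) \<longlongrightarrow> 0) (at (0::real))"
  by (simp add: filterlim_split_at)
 thus ?thesis using equal by (simp add: has_field_derivative_iff flat_def)
qed

lemma flat_Ck: "Ck_on k (flat n) UNIV"
proof (induction k arbitrary: n)
 case 0
 show ?case by (auto simp: continuous_on_eq_continuous_at intro: DERIV_isCont[OF flat_DERIV])
next
 case (Suc k)
 show ?case
 proof (rule Ck_on_SucI[where f' = "%x v. (flat (n+2) x + (- real n) * flat (n+1) x) * v"])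
  show "(flat n has_derivative (%v. (flat (n+2) x + (- real n) * flat (n+1) x) * v)) (at x)" for x
   using flat_DERIV[of n x] by (simp add: has_field_derivative_def)
  show "Ck_on k (%x. (flat (n+2) x + (- real n) * flat (n+1) x) * v) UNIV" for v
   by (intro Ck_on_mult Ck_on_plus Suc.IH open_UNIV Ck_on_const)
 qed simp
qed

lemma flat_smooth: "smooth_near (flat n) t"
 by (rule smooth_nearI[of _ UNIV]) (auto simp: smooth_on_def flat_Ck)

lemma inverse_power_Ck: "Ck_on k (%t::real. inverse t ^ n) (- {0})"
proof (induction k arbitrary: n)
 case 0
 show ?case by (auto intro!: continuous_intros)
next
 case (Suc k)
 show ?case
 proof (rule Ck_on_SucI[where f' = "%x v. (- real n * inverse x ^ (n + 1)) * v"])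
  show "((%t. inverse t ^ n) has_derivative (%v. (- real n * inverse x ^ (n + 1)) * v)) (at x)"
   if "x \<in> - {0}" for x :: real
  proof -
   have "((%t. inverse t ^ n) has_real_derivative (- real n * inverse x ^ (n + 1))) (at x)"
    using DERIV_inverse_power[of x n] that by simp
   thus ?thesis
    unfolding has_field_derivative_def by (rule has_derivative_eq_rhs) (simp add: fun_eq_iff)
  qed
  show "Ck_on k (%x::real. (- real n * inverse x ^ (n + 1)) * v) (- {0})" for v
   by (intro Ck_on_mult Suc.IH Ck_on_const) auto
 qed auto
qed

lemma smooth_near_inverse: "t \<noteq> 0 ==> smooth_near (inverse :: real => real) t"
 by (rule smooth_nearI[of _ "- {0}"]) (use inverse_power_Ck[where n = 1] in \<open>auto simp: smooth_on_def\<close>)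

text \<open>A smooth transition from 0 to 1 on the unit interval. The denominator is positive
  because \<open>t\<close> and \<open>1 - t\<close> are never both nonpositive.\<close>

definition step :: "real => real" where
 "step t = flat 0 t * inverse (flat 0 t + flat 0 (1 - t))"

lemma step_smooth: "smooth_near step t"
proof -
 have pos: "flat 0 t + flat 0 (1 - t) \<noteq> 0"
  by (auto simp: flat_def add_pos_pos[THEN less_imp_neq, symmetric])
 have 1: "smooth_near (%t. flat 0 t + flat 0 (1 - t)) t"
  by (intro smooth_near_add flat_smooth smooth_near_compose[OF _ flat_smooth] smooth_near_diff) auto
 have "smooth_near (%t. flat 0 t * inverse (flat 0 t + flat 0 (1 - t))) t"
  by (intro smooth_near_mult flat_smooth smooth_near_compose[OF 1 smooth_near_inverse[OF pos]])
 thus ?thesis by (simp add: step_def[abs_def])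
qed

lemma step_simps: "t \<le> 0 ==> step t = 0" "t \<ge> 1 ==> step t = 1"
 by (auto simp: step_def flat_def)

lemma bump_exists:
 fixes p :: "'a::euclidean_space"
 assumes "open N" "p \<in> N"
 obtains b :: "'a => complex" and r s where "\<And>x. smooth_near b x" "r > 0" "s > 0" "\<And>x. x \<in> ball p r ==> b x = 1"
  "cball p s \<subseteq> N" "\<And>x. x \<notin> cball p s ==> b x = 0"
proof -
 obtain s where s: "s > 0" "cball p s \<subseteq> N" using assms open_contains_cball by blast
 define r where "r = s / 2"
 \<comment> \<open>With \<open>r = s / 2\<close> the argument of \<open>step\<close> is at least 1
   within distance \<open>r\<close> of \<open>p\<close> and at most -2 beyond distance
   \<open>s\<close>; the squared norm keeps it smooth at the centre.\<close>
 define b where "b x = complex_of_real (step (2 - (x - p) \<bullet> (x - p) / r^2))" for x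
 have "smooth_near b x" for x
  unfolding b_def[abs_def] divide_inverse
  by (intro smooth_near_of_real smooth_near_compose[OF _ step_smooth] smooth_near_diff smooth_near_mult smooth_near_inner)
   auto
 moreover have "b x = 1" if "x \<in> ball p r" for x
 proof -
  have "norm (x - p) < r" using that by (simp add: dist_norm norm_minus_commute)
  hence "norm (x - p) ^ 2 \<le> r ^ 2" by (intro power_mono) auto
  hence "(x - p) \<bullet> (x - p) / r^2 \<le> 1"
   using s by (auto simp: power2_norm_eq_inner r_def divide_le_eq)
  thus ?thesis by (simp add: b_def step_simps)
 qed
 moreover have "b x = 0" if "x \<notin> cball p s" for x
 proof -
  have "norm (x - p) > 2 * r" using that by (simp add: dist_norm norm_minus_commute r_def)
  hence "norm (x - p) ^ 2 \<ge> (2 * r) ^ 2" using s by (intro power_mono) (auto simp: r_def)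
  hence "(x - p) \<bullet> (x - p) \<ge> 4 * r^2" by (simp add: power2_norm_eq_inner power_mult_distrib)
  hence "(x - p) \<bullet> (x - p) / r^2 \<ge> 4" using s by (simp add: r_def le_divide_eq)
  thus ?thesis by (simp add: b_def step_simps)
 qed
 ultimately show ?thesis using that[of b r s] s by (auto simp: r_def)
qed

subsection \<open>Hadamard's lemma\<close>

lemma segment_in_ball:
 fixes p :: "'a::real_normed_vector"
 assumes "x \<in> ball p r" "t \<in> {0..1}"
 shows "p + t *\<^sub>R (x - p) \<in> ball p r"
proof -
 have "norm (t *\<^sub>R (x - p)) \<le> norm (x - p)" using assms by (simp add: mult_left_le_one_le)
 thus ?thesis using assms by (simp add: dist_norm norm_minus_commute)
qed

text \<open>The factor \<open>t ^ n\<close> is there for the induction: each derivative under the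
  integral contributes one more \<open>t\<close>.\<close>

lemma param_integral_Ck:
 fixes h :: "'a::euclidean_space => 'b::banach"
 shows "Ck_on k h (ball p r) ==>
  Ck_on k (%x. integral (cbox 0 1) (%t::real. t ^ n *\<^sub>R h (p + t *\<^sub>R (x - p)))) (ball p r)"
proof (induction k arbitrary: n h)
 case 0
 hence c: "continuous_on (ball p r) h" by simp
 have "continuous_on (ball p r \<times> cbox 0 1) (%z. snd z ^ n *\<^sub>R h (p + snd z *\<^sub>R (fst z - p)))"
  by (intro continuous_intros continuous_on_compose2[OF c])
   (use segment_in_ball[of _ p r] in auto)
 thus ?case
  unfolding Ck_on.simps by (intro integral_continuous_on_param) (simp add: split_beta)
next
 case (Suc k)
 let ?h' = "%b x. fd h (at x) b"
 have ch: "continuous_on (ball p r) h" by (rule Ck_on_continuous[OF Suc.prems])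
 have ch': "continuous_on (ball p r) (?h' b)" for b
  by (rule Ck_on_continuous[OF Ck_on_SucE(2)[OF Suc.prems open_ball]])
 \<comment> \<open>\<open>leibniz_rule\<close> asks for the derivative in \<open>x\<close> as a
   continuous family of bounded linear maps; it is assembled from its values on
   \<open>Basis\<close>.\<close>
 define fx where "fx x t = (\<Sum>b\<in>Basis. blinfun_scaleR_left (t ^ Suc n *\<^sub>R ?h' b (p + t *\<^sub>R (x - p))) o\<^sub>L blinfun_inner_left b)"
  for x and t :: real
 have cfx: "continuous_on (ball p r \<times> cbox 0 1) (%z. fx (fst z) (snd z))"
  unfolding fx_def
  by (intro continuous_intros continuous_on_compose2[OF ch'] bounded_bilinear.continuous_on[OF bounded_bilinear_blinfun_compose]
    bounded_linear.continuous_on[OF bounded_linear_blinfun_scaleR_left])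
   (use segment_in_ball[of _ p r] in auto)
 have rep: "fx x t v = t ^ Suc n *\<^sub>R ?h' v (p + t *\<^sub>R (x - p))" if "x \<in> ball p r" "t \<in> cbox 0 1" for x t v
 proof -
  have "(h has_derivative fd h (at (p + t *\<^sub>R (x - p)))) (at (p + t *\<^sub>R (x - p)))"
   by (rule Ck_on_SucE(1)[OF Suc.prems open_ball segment_in_ball]) (use that in auto)
  then interpret l: bounded_linear "fd h (at (p + t *\<^sub>R (x - p)))"
   by (rule has_derivative_bounded_linear)
  have "?h' v (p + t *\<^sub>R (x - p)) = ?h' (\<Sum>b\<in>Basis. (v \<bullet> b) *\<^sub>R b) (p + t *\<^sub>R (x - p))"
   by (simp add: euclidean_representation)
  also have "\<dots> = (\<Sum>b\<in>Basis. (v \<bullet> b) *\<^sub>R ?h' b (p + t *\<^sub>R (x - p)))"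
   by (simp only: l.sum l.scaleR)
  finally have *: "?h' v (p + t *\<^sub>R (x - p)) = (\<Sum>b\<in>Basis. (v \<bullet> b) *\<^sub>R ?h' b (p + t *\<^sub>R (x - p)))" .
  show ?thesis
   by (subst *) (simp add: fx_def blinfun.sum_left scaleR_right.sum scaleR_left_commute scaleR_sum_right mult.commute)
 qed
 have int: "integral (cbox 0 1) (fx x) v = integral (cbox 0 1) (%t. t ^ Suc n *\<^sub>R ?h' v (p + t *\<^sub>R (x - p)))"
  if "x \<in> ball p r" for x v
 proof -
  have "continuous_on (cbox 0 (1::real)) (%t. (x, t))" by (intro continuous_intros)
  from continuous_on_compose2[OF cfx this] have "continuous_on (cbox 0 1) (fx x)" using that by force
  hence i: "fx x integrable_on cbox 0 1" by (rule integrable_continuous)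
  have "integral (cbox 0 1) ((%B. blinfun_apply B v) \<circ> fx x) = blinfun_apply (integral (cbox 0 1) (fx x)) v"
   by (rule integral_linear[OF i]) (rule blinfun.bounded_linear_left)
  thus ?thesis
   by (subst (asm) integral_cong[where g = "%t. t ^ Suc n *\<^sub>R ?h' v (p + t *\<^sub>R (x - p))"]) 
    (use rep that in \<open>auto simp del: power_Suc\<close>)
 qed
 show ?case
 proof (rule Ck_on_SucI[where f' = "%x v. integral (cbox 0 1) (%t. t ^ Suc n *\<^sub>R ?h' v (p + t *\<^sub>R (x - p)))"])
  fix x0 assume x0: "x0 \<in> ball p r"
  have "((%x. integral (cbox 0 1) (%t. t ^ n *\<^sub>R h (p + t *\<^sub>R (x - p)))) has_derivative
    integral (cbox 0 1) (fx x0)) (at x0 within ball p r)"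
  proof (rule leibniz_rule)
   fix x :: 'a and t :: real assume xt: "x \<in> ball p r" "t \<in> cbox 0 1"
   have h: "(h has_derivative fd h (at (p + t *\<^sub>R (x - p)))) (at (p + t *\<^sub>R (x - p)))"
    by (rule Ck_on_SucE(1)[OF Suc.prems open_ball segment_in_ball]) (use xt in auto)
   then interpret l: bounded_linear "fd h (at (p + t *\<^sub>R (x - p)))"
    by (rule has_derivative_bounded_linear)
   have a: "((%x. p + t *\<^sub>R (x - p)) has_derivative (%v. t *\<^sub>R v)) (at x)"
    by (auto intro!: derivative_eq_intros)
   have eq: "t ^ n *\<^sub>R ?h' (t *\<^sub>R v) (p + t *\<^sub>R (x - p)) = fx x t v" for v
    unfolding rep[OF xt] l.scaleR by (simp add: mult.commute)
   show "((%x. t ^ n *\<^sub>R h (p + t *\<^sub>R (x - p))) has_derivative blinfun_apply (fx x t)) (at x within ball p r)"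
    by (rule has_derivative_at_withinI, rule has_derivative_eq_rhs[OF has_derivative_scaleR_right[OF has_derivative_compose[OF a h]]])
     (rule ext, rule eq)
  next
   fix x assume "x \<in> ball p r"
   thus "(%t. t ^ n *\<^sub>R h (p + t *\<^sub>R (x - p))) integrable_on cbox 0 1"
    by (intro integrable_continuous continuous_intros continuous_on_compose2[OF ch])
     (use segment_in_ball[of x p r] in auto)
  next
   show "continuous_on (ball p r \<times> cbox 0 1) (%(x, t). fx x t)"
    using cfx by (simp add: split_beta)
  qed (use x0 in auto)
  hence "((%x. integral (cbox 0 1) (%t. t ^ n *\<^sub>R h (p + t *\<^sub>R (x - p)))) has_derivative
    integral (cbox 0 1) (fx x0)) (at x0)" using x0 at_within_open[OF x0 open_ball] by simp
  thus "((%x. integral (cbox 0 1) (%t. t ^ n *\<^sub>R h (p + t *\<^sub>R (x - p)))) has_derivative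
    (%v. integral (cbox 0 1) (%t. t ^ Suc n *\<^sub>R ?h' v (p + t *\<^sub>R (x0 - p))))) (at x0)"
   by (rule has_derivative_eq_rhs) (rule ext, rule int[OF x0])
 next
  fix v
  show "Ck_on k (%x. integral (cbox 0 1) (%t. t ^ Suc n *\<^sub>R ?h' v (p + t *\<^sub>R (x - p)))) (ball p r)"
   by (rule Suc.IH[OF Ck_on_SucE(2)[OF Suc.prems open_ball]])
 qed simp
qed

text \<open>Integrate the derivative of \<open>f\<close> along the segment from \<open>p\<close> to
  \<open>x\<close>. The coefficients are averaged partial derivatives, smooth by
  \<open>param_integral_Ck\<close>. A derivation at \<open>p\<close> then sees only the values
  \<open>g b p\<close>.\<close>

lemma hadamard:
 fixes f :: "'a::euclidean_space => 'b::banach"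
 assumes "smooth_near f p"
 obtains r g where "r > 0" "\<And>b x. x \<in> ball p r ==> smooth_near (g b) x"
  "\<And>x. x \<in> ball p r ==> f x = f p + (\<Sum>b\<in>Basis. ((x - p) \<bullet> b) *\<^sub>R g b x)"
  "\<And>b. g b p = fd f (at p) b"
proof -
 obtain N where N: "open N" "p \<in> N" "smooth_on f N" using assms unfolding smooth_near_def by blast
 then obtain r where r: "r > 0" "ball p r \<subseteq> N" using open_contains_ball by blast
 have Ck: "Ck_on k f (ball p r)" for k using N(3) r(2) unfolding smooth_on_def by (blast intro: Ck_on_subset)
 define g where "g b x = integral (cbox 0 1) (%t::real. t ^ 0 *\<^sub>R fd f (at (p + t *\<^sub>R (x - p))) b)" for b x
 have "smooth_near (g b) x" if "x \<in> ball p r" for b x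
  by (rule smooth_nearI[OF _ open_ball that])
   (unfold smooth_on_def g_def, intro allI param_integral_Ck Ck_on_SucE(2)[OF Ck open_ball])
 moreover have "f x = f p + (\<Sum>b\<in>Basis. ((x - p) \<bullet> b) *\<^sub>R g b x)" if x: "x \<in> ball p r" for x
 proof -
  let ?D = "%t. fd f (at (p + t *\<^sub>R (x - p)))"
  have d: "(f has_derivative ?D t) (at (p + t *\<^sub>R (x - p)))" if "t \<in> {0..1}" for t
   by (rule Ck_on_SucE(1)[OF Ck open_ball segment_in_ball[OF x that]])
  have lin: "?D t (x - p) = (\<Sum>b\<in>Basis. ((x - p) \<bullet> b) *\<^sub>R ?D t b)" if t: "t \<in> {0..1}" for t
  proof -
   interpret l: bounded_linear "?D t" using d[OF t] by (rule has_derivative_bounded_linear)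
   have "?D t (x - p) = ?D t (\<Sum>b\<in>Basis. ((x - p) \<bullet> b) *\<^sub>R b)" by (simp add: euclidean_representation)
   thus ?thesis by (simp only: l.sum l.scaleR)
  qed
  have vd: "((%t. f (p + t *\<^sub>R (x - p))) has_vector_derivative ?D t (x - p)) (at t within {0..1})" if t: "t \<in> {0..1}" for t
  proof -
   interpret l: bounded_linear "?D t" using d[OF t] by (rule has_derivative_bounded_linear)
   have a: "((%t. p + t *\<^sub>R (x - p)) has_derivative (%s. s *\<^sub>R (x - p))) (at t)"
    by (auto intro!: derivative_eq_intros)
   have "((%t. f (p + t *\<^sub>R (x - p))) has_derivative (%s. ?D t (s *\<^sub>R (x - p)))) (at t)"
    by (rule has_derivative_compose[OF a d[OF t]])
   thus ?thesis
    by (simp add: has_vector_derivative_def l.scaleR has_derivative_at_withinI)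
  qed
  have "((%t. ?D t (x - p)) has_integral f (p + 1 *\<^sub>R (x - p)) - f (p + 0 *\<^sub>R (x - p))) {0..1}"
   by (rule fundamental_theorem_of_calculus[OF _ vd]) auto
  hence 1: "integral {0..1} (%t. ?D t (x - p)) = f x - f p" by (simp add: integral_unique)
  have ib: "(%t. ?D t b) integrable_on {0..1}" for b
  proof -
   have "continuous_on (ball p r) (%x. fd f (at x) b)"
    by (rule Ck_on_continuous[OF Ck_on_SucE(2)[OF Ck open_ball]])
   hence "continuous_on {0..1} (%t. ?D t b)"
    by (rule continuous_on_compose2) (use segment_in_ball[OF x] in \<open>auto intro!: continuous_intros\<close>)
   thus ?thesis by (rule integrable_continuous_real)
  qed
  have "integral {0..1} (%t. ?D t (x - p)) = integral {0..1} (%t. \<Sum>b\<in>Basis. ((x - p) \<bullet> b) *\<^sub>R ?D t b)"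
   by (rule integral_cong) (rule lin)
  also have "\<dots> = (\<Sum>b\<in>Basis. ((x - p) \<bullet> b) *\<^sub>R integral {0..1} (%t. ?D t b))"
   by (subst integral_sum) (auto intro: integrable_cmul ib)
  finally show ?thesis using 1 by (simp add: g_def diff_eq_eq add.commute)
 qed
 moreover have "g b p = fd f (at p) b" for b by (simp add: g_def)
 ultimately show ?thesis using that r(1) by blast
qed

lemma frechet_derivative_sum_rep:
 assumes "smooth_near f p"
 shows "fd f (at p) v = (\<Sum>b\<in>Basis. (v \<bullet> b) *\<^sub>R fd f (at p) b)"
proof -
 interpret l: bounded_linear "fd f (at p)"
  using smooth_near_has_derivative[OF assms] by (rule has_derivative_bounded_linear)
 have "fd f (at p) v = fd f (at p) (\<Sum>b\<in>Basis. (v \<bullet> b) *\<^sub>R b)"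
  by (simp add: euclidean_representation)
 thus ?thesis by (simp only: l.sum l.scaleR)
qed

text \<open>Differentiating the decomposition of \<open>hadamard\<close> twice gives an expression symmetric in the two directions.\<close>
lemma frechet_derivative_symmetric:
 fixes f :: "'a::euclidean_space => 'b::banach"
 assumes "smooth_near f p"
 shows "fd (%x. fd f (at x) u) (at p) v =
  fd (%x. fd f (at x) v) (at p) u"
proof -
 obtain r g where r: "r > 0" and g: "\<And>b x. x \<in> ball p r ==> smooth_near (g b) x"
  and fg: "\<And>x. x \<in> ball p r ==> f x = f p + (\<Sum>b\<in>Basis. ((x - p) \<bullet> b) *\<^sub>R g b x)"
  using hadamard[OF assms] by metis
 let ?g' = "%b x. fd (g b) (at x)"
 have 1: "fd f (at x) u = (\<Sum>b\<in>Basis. ((x - p) \<bullet> b) *\<^sub>R ?g' b x u + (u \<bullet> b) *\<^sub>R g b x)"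
  if x: "x \<in> ball p r" for x u
 proof -
  have "fd f (at x) = fd (%x. f p + (\<Sum>b\<in>Basis. ((x - p) \<bullet> b) *\<^sub>R g b x)) (at x)"
   by (rule frechet_derivative_cong_open[OF open_ball x fg])
  moreover have "((%x. f p + (\<Sum>b\<in>Basis. ((x - p) \<bullet> b) *\<^sub>R g b x)) has_derivative
   (%u. 0 + (\<Sum>b\<in>Basis. ((x - p) \<bullet> b) *\<^sub>R ?g' b x u + ((u - 0) \<bullet> b) *\<^sub>R g b x))) (at x)"
   by (intro has_derivative_add has_derivative_sum has_derivative_scaleR has_derivative_inner_left
     has_derivative_diff has_derivative_ident has_derivative_const smooth_near_has_derivative[OF g[OF x]])
  ultimately show ?thesis using frechet_derivative_eqI by force
 qed
 have p: "p \<in> ball p r" using r by simp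
 have 2: "fd (%x. fd f (at x) u) (at p) v =
  (\<Sum>b\<in>Basis. (v \<bullet> b) *\<^sub>R ?g' b p u + (u \<bullet> b) *\<^sub>R ?g' b p v)" for u v
 proof -
  have "fd (%x. fd f (at x) u) (at p) =
    fd (%x. \<Sum>b\<in>Basis. ((x - p) \<bullet> b) *\<^sub>R ?g' b x u + (u \<bullet> b) *\<^sub>R g b x) (at p)"
   by (rule frechet_derivative_cong_open[OF open_ball p 1])
  moreover have "((%x. \<Sum>b\<in>Basis. ((x - p) \<bullet> b) *\<^sub>R ?g' b x u + (u \<bullet> b) *\<^sub>R g b x) has_derivative
   (%v. \<Sum>b\<in>Basis. (((p - p) \<bullet> b) *\<^sub>R fd (%x. ?g' b x u) (at p) v + ((v - 0) \<bullet> b) *\<^sub>R ?g' b p u)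
     + (u \<bullet> b) *\<^sub>R ?g' b p v)) (at p)"
   by (intro has_derivative_add has_derivative_sum has_derivative_scaleR has_derivative_inner_left
     has_derivative_diff has_derivative_ident has_derivative_const has_derivative_scaleR_right
     smooth_near_has_derivative[OF g[OF p]] smooth_near_has_derivative[OF smooth_near_frechet[OF g[OF p]]])
  ultimately show ?thesis using frechet_derivative_eqI by force
 qed
 show ?thesis unfolding 2 by (rule sum.cong) (auto simp: add.commute)
qed

section \<open>Lie groups\<close>

locale lie_grp =
 fixes G :: "('g::{t2_space, second_countable_topology}, 'r) monoid_scheme" (structure)
  and A :: "('g, 'e::euclidean_space) chart set"
 assumes lie_group: "lie_group G A"
begin

lemma is_group: "group G" and carrier_UNIV [simp]: "carrier G = UNIV" and atlas: "smooth_atlas A"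
 using lie_group unfolding lie_group_def by auto

sublocale group G by (rule is_group)

lemma grp_simps [simp]:
 "(x \<otimes> y) \<otimes> z = x \<otimes> (y \<otimes> z)" "\<one> \<otimes> x = x" "x \<otimes> \<one> = x" "inv x \<otimes> x = \<one>" "x \<otimes> inv x = \<one>"
 "inv x \<otimes> (x \<otimes> y) = y" "x \<otimes> (inv x \<otimes> y) = y" "inv (inv x) = x" "inv (x \<otimes> y) = inv y \<otimes> inv x"
 using m_assoc[of x y z] inv_mult_group[of x y] by (simp_all add: m_assoc[symmetric])

lemma chart:
 assumes "(U, \<phi>) \<in> A"
 shows chart_open: "open U" "open (\<phi> ` U)"
  and chart_cont: "continuous_on U \<phi>" "continuous_on (\<phi> ` U) (inv_into U \<phi>)"
  and chart_inv: "x \<in> U ==> inv_into U \<phi> (\<phi> x) = x"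
  and chart_inv': "p \<in> \<phi> ` U ==> \<phi> (inv_into U \<phi> p) = p" "p \<in> \<phi> ` U ==> inv_into U \<phi> p \<in> U"
proof -
 have "open U \<and> open (\<phi> ` U) \<and> homeomorphism U (\<phi> ` U) \<phi> (inv_into U \<phi>)"
  using atlas assms unfolding smooth_atlas_def by auto
 thus "open U" "open (\<phi> ` U)" "continuous_on U \<phi>" "continuous_on (\<phi> ` U) (inv_into U \<phi>)"
  "x \<in> U ==> inv_into U \<phi> (\<phi> x) = x"
  "p \<in> \<phi> ` U ==> \<phi> (inv_into U \<phi> p) = p" "p \<in> \<phi> ` U ==> inv_into U \<phi> p \<in> U"
  by (auto simp: homeomorphism_def)
qed

lemma chart_ex: obtains U \<phi> where "(U, \<phi>) \<in> A" "x \<in> U"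
proof -
 have "x \<in> (\<Union>(U, \<phi>)\<in>A. U)" using atlas unfolding smooth_atlas_def by simp
 thus ?thesis using that by auto
qed

lemma chart_image_open:
 assumes "(U, \<phi>) \<in> A" "open S" "S \<subseteq> U"
 shows "open (\<phi> ` S)"
proof -
 have "\<phi> ` S = \<phi> ` U \<inter> inv_into U \<phi> -` S"
  using chart_inv[OF assms(1)] chart_inv'[OF assms(1)] assms(3) by (auto simp: image_iff)
 thus ?thesis
  using continuous_on_open_vimage[OF chart_open(2)[OF assms(1)]] chart_cont(2)[OF assms(1)] assms(2)
  by (metis Int_commute)
qed

lemma transition_smooth:
 assumes "(U, \<phi>) \<in> A" "(V, \<psi>) \<in> A" "p \<in> \<phi> ` (U \<inter> V)"
 shows "smooth_near (%x. \<psi> (inv_into U \<phi> x)) p"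
proof -
 have "smooth_on (%x. \<psi> (inv_into U \<phi> x)) (\<phi> ` (U \<inter> V))"
  using atlas[unfolded smooth_atlas_def, THEN conjunct2, THEN conjunct2, THEN bspec[OF _ assms(1)], unfolded split_conv,
    THEN bspec[OF _ assms(2)], unfolded split_conv] .
 thus ?thesis
  by (rule smooth_nearI) (use assms chart_image_open[OF assms(1), of "U \<inter> V"] chart_open(1) in auto)
qed

text \<open>Maps from a Euclidean parameter space into the group. Computations with group elements
  are phrased through them, so that only derivatives between Euclidean spaces occur;
  \<open>smap_coord\<close> shows that the choice of chart does not matter.\<close>

definition smap :: "('p::euclidean_space => 'g) => 'p => bool" where
 "smap F p \<longleftrightarrow> (\<exists>(W, \<t>)\<in>A. \<exists>N. open N \<and> p \<in> N \<and> F ` N \<subseteq> W \<and> smooth_on (%x. \<t> (F x)) N)"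

lemma smapE:
 assumes "smap F p"
 obtains W \<t> N where "(W, \<t>) \<in> A" "open N" "p \<in> N" "\<And>x. x \<in> N ==> F x \<in> W"
  "\<And>x. x \<in> N ==> smooth_near (%x. \<t> (F x)) x"
proof -
 obtain W \<t> N where "(W, \<t>) \<in> A" "open N" "p \<in> N" "F ` N \<subseteq> W" "smooth_on (%x. \<t> (F x)) N"
  using assms unfolding smap_def by blast
 thus ?thesis using that[of W \<t> N] smooth_nearI[of "%x. \<t> (F x)" N] by blast
qed

lemma smapI:
 assumes "(W, \<t>) \<in> A" "open N" "p \<in> N" "\<And>x. x \<in> N ==> F x \<in> W"
  "\<And>x. x \<in> N ==> smooth_near (%x. \<t> (F x)) x"
 shows "smap F p"
proof -
 have "smooth_on (%x. \<t> (F x)) N" by (rule smooth_onI[OF assms(2,5)])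
 moreover have "F ` N \<subseteq> W" using assms(4) by auto
 ultimately show ?thesis unfolding smap_def using assms(1,2,3) by blast
qed

lemma smap_nearby:
 assumes "smap F p"
 obtains N where "open N" "p \<in> N" "\<And>x. x \<in> N ==> smap F x"
proof -
 obtain W \<t> N where W: "(W, \<t>) \<in> A" and N: "open N" "p \<in> N" "\<And>x. x \<in> N ==> F x \<in> W"
  and s: "\<And>x. x \<in> N ==> smooth_near (%x. \<t> (F x)) x" using smapE[OF assms] by metis
 show ?thesis by (rule that[OF N(1,2)]) (rule smapI[OF W N(1) _ N(3) s])
qed

lemma smap_isCont: "smap F p ==> isCont F p"
proof -
 assume F: "smap F p"
 obtain W \<t> N where W: "(W, \<t>) \<in> A" and N: "open N" "p \<in> N" "\<And>x. x \<in> N ==> F x \<in> W"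
  and s: "\<And>x. x \<in> N ==> smooth_near (%x. \<t> (F x)) x" using smapE[OF F] by metis
 have "continuous_on N (%x. \<t> (F x))"
  using s smooth_near_isCont by (auto simp: continuous_on_eq_continuous_at[OF N(1)])
 hence "continuous_on N (%x. inv_into W \<t> (\<t> (F x)))"
  by (rule continuous_on_compose2[OF chart_cont(2)[OF W]]) (use N in auto)
 hence "continuous_on N F"
  by (rule continuous_on_eq) (use chart_inv[OF W] N in auto)
 thus "isCont F p" using N by (simp add: continuous_on_eq_continuous_at)
qed

lemma smap_open_vimage:
 assumes "smap F p" "open W" "F p \<in> W"
 obtains N where "open N" "p \<in> N" "\<And>x. x \<in> N ==> F x \<in> W" "\<And>x. x \<in> N ==> smap F x"
proof -
 obtain N where N: "open N" "p \<in> N" "\<And>x. x \<in> N ==> smap F x" using smap_nearby[OF assms(1)] by metis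
 hence "continuous_on N F" by (simp add: continuous_on_eq_continuous_at smap_isCont)
 hence "open (F -` W \<inter> N)" using continuous_on_open_vimage[OF N(1)] assms(2) by blast
 thus ?thesis using that[of "F -` W \<inter> N"] N assms by auto
qed

lemma smap_coord:
 assumes "smap F p" "(V, \<psi>) \<in> A" "F p \<in> V"
 shows "smooth_near (%x. \<psi> (F x)) p"
proof -
 obtain W \<t> N where W: "(W, \<t>) \<in> A" and N: "open N" "p \<in> N" "\<And>x. x \<in> N ==> F x \<in> W"
  and s: "\<And>x. x \<in> N ==> smooth_near (%x. \<t> (F x)) x" using smapE[OF assms(1)] by metis
 have "smooth_near (%x. \<psi> (inv_into W \<t> (\<t> (F x)))) p"
  by (rule smooth_near_compose[OF s[OF N(2)] transition_smooth[OF W assms(2)]]) (use N assms in auto)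
 thus ?thesis
  by (rule smooth_near_cong[OF _ N(1,2)]) (use chart_inv[OF W] N in auto)
qed

lemma smap_compose:
 fixes h :: "'q::euclidean_space => 'p::euclidean_space"
 assumes "smap F (h p)" "smooth_near h p"
 shows "smap (%x. F (h x)) p"
proof -
 obtain W \<t> N where W: "(W, \<t>) \<in> A" and N: "open N" "h p \<in> N" "\<And>x. x \<in> N ==> F x \<in> W"
  and s: "\<And>x. x \<in> N ==> smooth_near (%x. \<t> (F x)) x" using smapE[OF assms(1)] by metis
 obtain N' where N': "open N'" "p \<in> N'" "\<And>x. x \<in> N' ==> smooth_near h x"
  using smooth_near_open[OF assms(2)] by auto
 have "continuous_on N' h" using N' by (simp add: continuous_on_eq_continuous_at smooth_near_isCont)
 hence o: "open (h -` N \<inter> N')" using continuous_on_open_vimage[OF N'(1)] N(1) by blast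
 show ?thesis
  by (rule smapI[OF W o]) (use N N' s in \<open>auto intro: smooth_near_compose[of h _ "%x. \<t> (F x)"]\<close>)
qed

lemma smap_const [simp]: "smap (%_. a) p"
proof -
 obtain U \<phi> where "(U, \<phi>) \<in> A" "a \<in> U" by (rule chart_ex)
 thus ?thesis by (intro smapI[of U \<phi> UNIV]) auto
qed

lemma smap_chart_inv:
 assumes "(U, \<phi>) \<in> A" "p \<in> \<phi> ` U"
 shows "smap (inv_into U \<phi>) p"
proof (rule smapI[OF assms(1) chart_open(2)[OF assms(1)] assms(2)])
 fix x assume x: "x \<in> \<phi> ` U"
 show "inv_into U \<phi> x \<in> U" by (rule chart_inv'(2)[OF assms(1) x])
 show "smooth_near (%x. \<phi> (inv_into U \<phi> x)) x"
  by (rule smooth_near_cong[OF smooth_near_ident chart_open(2)[OF assms(1)] x])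
   (simp add: chart_inv'(1)[OF assms(1)])
qed

lemma mult_cont: "continuous_on UNIV (%(x, y). x \<otimes> y)" and inv_cont: "continuous_on UNIV (%x. inv x)"
 using lie_group unfolding lie_group_def by auto

lemma tendsto_m [tendsto_intros]:
 assumes "(f \<longlongrightarrow> a) F" "(h \<longlongrightarrow> b) F"
 shows "((%x. f x \<otimes> h x) \<longlongrightarrow> a \<otimes> b) F"
 using continuous_on_tendsto_compose[OF mult_cont, of "%x. (f x, h x)" "(a, b)"] tendsto_Pair[OF assms] by simp

lemma tendsto_i [tendsto_intros]:
 assumes "(f \<longlongrightarrow> a) F"
 shows "((%x. inv (f x)) \<longlongrightarrow> inv a) F"
 using continuous_on_tendsto_compose[OF inv_cont assms] by simp

lemma continuous_on_m [continuous_intros]: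
 "continuous_on S f ==> continuous_on S h ==> continuous_on S (%x. f x \<otimes> h x)"
 unfolding continuous_on_def by (auto intro: tendsto_m)

lemma continuous_on_i [continuous_intros]: "continuous_on S f ==> continuous_on S (%x. inv (f x))"
 unfolding continuous_on_def by (auto intro: tendsto_i)

lemma smap_mult:
 assumes "smap F p" "smap H p"
 shows "smap (%x. F x \<otimes> H x) p"
proof -
 obtain U \<phi> N1 where U: "(U, \<phi>) \<in> A" and N1: "open N1" "p \<in> N1" "\<And>x. x \<in> N1 ==> F x \<in> U"
  and s1: "\<And>x. x \<in> N1 ==> smooth_near (%x. \<phi> (F x)) x" using smapE[OF assms(1)] by metis
 obtain V \<psi> N2 where V: "(V, \<psi>) \<in> A" and N2: "open N2" "p \<in> N2" "\<And>x. x \<in> N2 ==> H x \<in> V"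
  and s2: "\<And>x. x \<in> N2 ==> smooth_near (%x. \<psi> (H x)) x" using smapE[OF assms(2)] by metis
 obtain W \<t> where W: "(W, \<t>) \<in> A" "F p \<otimes> H p \<in> W" by (rule chart_ex)
 have cF: "continuous_on (N1 \<inter> N2) F" "continuous_on (N1 \<inter> N2) H"
  using N1 N2 smapI[OF U N1(1) _ N1(3) s1] smapI[OF V N2(1) _ N2(3) s2]
  by (auto simp: continuous_on_eq_continuous_at open_Int intro!: smap_isCont)
 let ?N = "(%x. F x \<otimes> H x) -` W \<inter> (N1 \<inter> N2)"
 have oN: "open ?N"
  using continuous_on_open_vimage[OF open_Int[OF N1(1) N2(1)]] continuous_on_m[OF cF] chart_open(1)[OF W(1)] by blast
 let ?S = "{(x, y). x \<in> \<phi> ` U \<and> y \<in> \<psi> ` V \<and> inv_into U \<phi> x \<otimes> inv_into V \<psi> y \<in> W}"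
 let ?m = "%(x, y). \<t> (inv_into U \<phi> x \<otimes> inv_into V \<psi> y)"
 have "continuous_on (\<phi> ` U \<times> \<psi> ` V) (%z. inv_into U \<phi> (fst z) \<otimes> inv_into V \<psi> (snd z))"
  by (intro continuous_intros continuous_on_compose2[OF chart_cont(2)[OF U]] continuous_on_compose2[OF chart_cont(2)[OF V]]) auto
 hence "open ((%z. inv_into U \<phi> (fst z) \<otimes> inv_into V \<psi> (snd z)) -` W \<inter> \<phi> ` U \<times> \<psi> ` V)"
  using continuous_on_open_vimage[OF open_Times[OF chart_open(2)[OF U] chart_open(2)[OF V]]] chart_open(1)[OF W(1)] by blast
 also have "((%z. inv_into U \<phi> (fst z) \<otimes> inv_into V \<psi> (snd z)) -` W \<inter> \<phi> ` U \<times> \<psi> ` V) = ?S" by auto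
 finally have oS: "open ?S" .
 have sm: "smooth_on ?m ?S"
  using lie_group[unfolded lie_group_def, THEN conjunct2, THEN conjunct2, THEN conjunct2, THEN conjunct2, THEN conjunct2, THEN conjunct1,
    THEN bspec[OF _ U], unfolded split_conv, THEN bspec[OF _ V], unfolded split_conv, THEN bspec[OF _ W(1)], unfolded split_conv] .
 show ?thesis
 proof (rule smapI[OF W(1) oN])
  fix x assume x: "x \<in> ?N"
  have "smooth_near (%x. (\<phi> (F x), \<psi> (H x))) x"
   using s1 s2 x by (intro smooth_near_Pair) auto
  hence "smooth_near (%x. ?m (\<phi> (F x), \<psi> (H x))) x"
  proof (rule smooth_near_compose)
   show "smooth_near ?m (\<phi> (F x), \<psi> (H x))"
    by (rule smooth_nearI[OF sm oS]) (use x N1 N2 chart_inv[OF U] chart_inv[OF V] in auto)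
  qed
  thus "smooth_near (%x. \<t> (F x \<otimes> H x)) x"
   by (rule smooth_near_cong[OF _ oN x]) (use N1 N2 chart_inv[OF U] chart_inv[OF V] in auto)
 qed (use W N1 N2 in auto)
qed

lemma smap_inv:
 assumes "smap F p"
 shows "smap (%x. inv (F x)) p"
proof -
 obtain U \<phi> N1 where U: "(U, \<phi>) \<in> A" and N1: "open N1" "p \<in> N1" "\<And>x. x \<in> N1 ==> F x \<in> U"
  and s1: "\<And>x. x \<in> N1 ==> smooth_near (%x. \<phi> (F x)) x" using smapE[OF assms(1)] by metis
 obtain W \<t> where W: "(W, \<t>) \<in> A" "inv (F p) \<in> W" by (rule chart_ex)
 have cF: "continuous_on N1 F"
  using N1 smapI[OF U N1(1) _ N1(3) s1] by (auto simp: continuous_on_eq_continuous_at intro!: smap_isCont)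
 let ?N = "(%x. inv (F x)) -` W \<inter> N1"
 have oN: "open ?N"
  using continuous_on_open_vimage[OF N1(1)] continuous_on_i[OF cF] chart_open(1)[OF W(1)] by blast
 let ?S = "{x. x \<in> \<phi> ` U \<and> inv (inv_into U \<phi> x) \<in> W}"
 let ?m = "%x. \<t> (inv (inv_into U \<phi> x))"
 have "open ((%z. inv (inv_into U \<phi> z)) -` W \<inter> \<phi> ` U)"
  using continuous_on_open_vimage[OF chart_open(2)[OF U]] continuous_on_i[OF chart_cont(2)[OF U]] chart_open(1)[OF W(1)] by blast
 also have "((%z. inv (inv_into U \<phi> z)) -` W \<inter> \<phi> ` U) = ?S" by auto
 finally have oS: "open ?S" .
 have sm: "smooth_on ?m ?S"
  using lie_group[unfolded lie_group_def, THEN conjunct2, THEN conjunct2, THEN conjunct2, THEN conjunct2, THEN conjunct2, THEN conjunct2,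
    THEN bspec[OF _ U], unfolded split_conv, THEN bspec[OF _ W(1)], unfolded split_conv] .
 show ?thesis
 proof (rule smapI[OF W(1) oN])
  fix x assume x: "x \<in> ?N"
  have "smooth_near (%x. ?m (\<phi> (F x))) x"
  proof (rule smooth_near_compose[where g = ?m])
   show "smooth_near ?m (\<phi> (F x))"
    by (rule smooth_nearI[OF sm oS]) (use x N1 chart_inv[OF U] in auto)
  qed (use s1 x in auto)
  thus "smooth_near (%x. \<t> (inv (F x))) x"
   by (rule smooth_near_cong[OF _ oN x]) (use N1 chart_inv[OF U] in auto)
 qed (use W N1 in auto)
qed

subsection \<open>Smooth functions near a point\<close>

definition fsmooth :: "('g => complex) => 'g => bool" where
 "fsmooth f x \<longleftrightarrow> (\<exists>(U, \<phi>)\<in>A. x \<in> U \<and> smooth_near (%z. f (inv_into U \<phi> z)) (\<phi> x))"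

lemma fsmooth_smap:
 assumes "fsmooth f (F p)" "smap F p"
 shows "smooth_near (%x. f (F x)) p"
proof -
 obtain U \<phi> where U: "(U, \<phi>) \<in> A" "F p \<in> U" and s: "smooth_near (%z. f (inv_into U \<phi> z)) (\<phi> (F p))"
  using assms(1) unfolding fsmooth_def by blast
 obtain N where N: "open N" "p \<in> N" "\<And>x. x \<in> N ==> F x \<in> U"
  using smap_open_vimage[OF assms(2) chart_open(1)[OF U(1)] U(2)] by metis
 have "smooth_near (%x. f (inv_into U \<phi> (\<phi> (F x)))) p"
  by (rule smooth_near_compose[OF smap_coord[OF assms(2) U] s])
 thus ?thesis by (rule smooth_near_cong[OF _ N(1,2)]) (use N chart_inv[OF U(1)] in auto)
qed

lemma fsmooth_iff:
 assumes "(U, \<phi>) \<in> A" "x \<in> U"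
 shows "fsmooth f x \<longleftrightarrow> smooth_near (%z. f (inv_into U \<phi> z)) (\<phi> x)"
 using fsmooth_smap[of f "inv_into U \<phi>" "\<phi> x"] smap_chart_inv[OF assms(1), of "\<phi> x"] chart_inv[OF assms] assms
 unfolding fsmooth_def by auto

lemma smooth_functions_iff: "f \<in> smooth_functions A \<longleftrightarrow> (\<forall>x. fsmooth f x)"
proof
 assume "f \<in> smooth_functions A"
 show "\<forall>x. fsmooth f x"
 proof
  fix x
  obtain U \<phi> where U: "(U, \<phi>) \<in> A" "x \<in> U" by (rule chart_ex)
  hence "smooth_on (%x. f (inv_into U \<phi> x)) (\<phi> ` U)"
   using \<open>f \<in> smooth_functions A\<close> unfolding smooth_functions_def by blast
  thus "fsmooth f x"
   unfolding fsmooth_iff[OF U] by (rule smooth_nearI) (use U chart_open(2) in auto)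
 qed
next
 assume f: "\<forall>x. fsmooth f x"
 have "smooth_on (%x. f (inv_into U \<phi> x)) (\<phi> ` U)" if U: "(U, \<phi>) \<in> A" for U \<phi>
  by (rule smooth_onI[OF chart_open(2)[OF U]]) (use f fsmooth_iff[OF U] in auto)
 thus "f \<in> smooth_functions A" unfolding smooth_functions_def by auto
qed

lemma fsmooth_const [simp]: "fsmooth (%_. c) x"
 unfolding fsmooth_def by (rule chart_ex[of x]) auto

lemma fsmooth_add: "fsmooth f x ==> fsmooth h x ==> fsmooth (%x. f x + h x) x"
 by (rule chart_ex[of x]) (simp add: fsmooth_iff smooth_near_add)

lemma fsmooth_mult: "fsmooth f x ==> fsmooth h x ==> fsmooth (%x. f x * h x) x"
 by (rule chart_ex[of x]) (simp add: fsmooth_iff smooth_near_mult)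

lemma fsmooth_sum: "(\<And>i. i \<in> F ==> fsmooth (f i) x) ==> fsmooth (%x. \<Sum>i\<in>F. f i x) x"
 by (rule chart_ex[of x]) (simp add: fsmooth_iff smooth_near_sum)

lemma fsmooth_cong:
 assumes "fsmooth f x" "open N" "x \<in> N" "\<And>y. y \<in> N ==> f y = h y"
 shows "fsmooth h x"
proof -
 obtain U \<phi> where U: "(U, \<phi>) \<in> A" "x \<in> U" by (rule chart_ex)
 have "smooth_near (%z. h (inv_into U \<phi> z)) (\<phi> x)"
  by (rule smooth_near_cong[of "%z. f (inv_into U \<phi> z)" _ "\<phi> ` (U \<inter> N)"])
   (use assms U chart_image_open[OF U(1), of "U \<inter> N"] chart_open(1)[OF U(1)] chart_inv[OF U(1)] in \<open>auto simp: fsmooth_iff[OF U]\<close>)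
 thus ?thesis by (simp add: fsmooth_iff[OF U])
qed

lemma fsmooth_compose_chart:
 assumes "(U, \<phi>) \<in> A" "x \<in> U" "smooth_near k (\<phi> x)"
 shows "fsmooth (%y. k (\<phi> y)) x"
 unfolding fsmooth_iff[OF assms(1,2)]
 by (rule smooth_near_cong[OF assms(3) chart_open(2)[OF assms(1)]]) (use assms chart_inv[OF assms(1)] in auto)

lemma fsmooth_translate: "fsmooth f (a \<otimes> x) ==> fsmooth (%x. f (a \<otimes> x)) x"
proof -
 assume f: "fsmooth f (a \<otimes> x)"
 obtain U \<phi> where U: "(U, \<phi>) \<in> A" "x \<in> U" by (rule chart_ex)
 show "fsmooth (%x. f (a \<otimes> x)) x"
  unfolding fsmooth_iff[OF U]
  by (rule fsmooth_smap[of f "%z. a \<otimes> inv_into U \<phi> z"])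
   (use f U chart_inv[OF U] in \<open>auto intro!: smap_mult smap_chart_inv\<close>)
qed

end

subsection \<open>Left-invariant vector fields\<close>

lemma frechet_derivative_partial:
 assumes "smooth_near K (z, w)"
 shows "fd (%w. K (z, w)) (at w) v = fd K (at (z, w)) (0, v)"
proof (rule frechet_derivative_eqI)
 have "((%w. (z, w)) has_derivative (%v. (0, v))) (at w)"
  by (auto intro!: derivative_eq_intros)
 thus "((%w. K (z, w)) has_derivative (%v. fd K (at (z, w)) (0, v))) (at w)"
  by (rule has_derivative_compose) (rule smooth_near_has_derivative[OF assms])
qed

lemma continuous_on_pairE:
 assumes "continuous_on UNIV F" "open W" "F (a, b) \<in> W"
 obtains S T where "open S" "open T" "a \<in> S" "b \<in> T" "\<And>x y. x \<in> S ==> y \<in> T ==> F (x, y) \<in> W"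
proof -
 have "open (F -` W)" by (rule open_vimage[OF assms(2,1)])
 then obtain S T where "open S" "open T" "(a, b) \<in> S \<times> T" "S \<times> T \<subseteq> F -` W"
  using open_prod_elim[of "F -` W" "(a, b)"] assms(3) by blast
 thus ?thesis by (intro that[of S T]) auto
qed

lemma frechet_derivative_compose_near:
 fixes f :: "'a::euclidean_space => 'b::euclidean_space"
 assumes "smooth_near f p" "smooth_near k (f p)"
 shows "fd (%x. k (f x)) (at p) v = fd k (at (f p)) (fd f (at p) v)"
 by (rule frechet_derivative_eqI, rule has_derivative_compose)
  (intro smooth_near_has_derivative assms)+

lemma frechet_derivative_fun_mult:
 fixes f h :: "'a::euclidean_space => complex"
 assumes "smooth_near f p" "smooth_near h p"
 shows "fd (%x. f x * h x) (at p) v = f p * fd h (at p) v + h p * fd f (at p) v"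
 using frechet_derivative_eqI[OF has_derivative_mult[OF smooth_near_has_derivative[OF assms(1)] smooth_near_has_derivative[OF assms(2)]], of v]
 by (simp add: mult.commute)

lemma frechet_derivative_lincomb:
 fixes f h :: "'a::euclidean_space => complex"
 assumes "smooth_near f p" "smooth_near h p"
 shows "fd (%x. a * f x + b * h x) (at p) v = a * fd f (at p) v + b * fd h (at p) v"
 by (rule frechet_derivative_eqI)
  (intro has_derivative_add has_derivative_mult_right smooth_near_has_derivative assms)

context lie_grp
begin

definition one_chart :: "('g, 'e) chart" where
 "one_chart = (SOME c. c \<in> A \<and> \<one> \<in> fst c)"

text \<open>A chart at the unit recentred at 0, taking the place of the exponential map; near the
  unit \<open>lc\<close> is its inverse.\<close>

definition ex :: "'e => 'g" where
 "ex w = inv_into (fst one_chart) (snd one_chart) (snd one_chart \<one> + w)"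

definition lc :: "'g => 'e" where
 "lc y = snd one_chart y - snd one_chart \<one>"

lemma one_chart: "(fst one_chart, snd one_chart) \<in> A" "\<one> \<in> fst one_chart"
proof -
 obtain U \<phi> where "(U, \<phi>) \<in> A" "\<one> \<in> U" by (rule chart_ex)
 hence "\<exists>c. c \<in> A \<and> \<one> \<in> fst c" by force
 from someI_ex[OF this] show "(fst one_chart, snd one_chart) \<in> A" "\<one> \<in> fst one_chart"
  unfolding one_chart_def[symmetric] by auto
qed

lemma ex_0 [simp]: "ex 0 = \<one>" and lc_one [simp]: "lc \<one> = 0"
 using chart_inv[OF one_chart] by (simp_all add: ex_def lc_def)

lemma smap_ex [simp]: "smap ex 0"
proof -
 have "smap (inv_into (fst one_chart) (snd one_chart)) (snd one_chart \<one> + 0)"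
  using one_chart by (intro smap_chart_inv) auto
 thus ?thesis unfolding ex_def[abs_def]
  by (rule smap_compose) (intro smooth_near_add smooth_near_const smooth_near_ident)
qed

lemma smap_lc:
 assumes "smap F p" "F p = \<one>"
 shows "smooth_near (%x. lc (F x)) p"
 unfolding lc_def using assms one_chart by (intro smooth_near_diff smap_coord) auto

lemma ex_lc: "y \<in> fst one_chart ==> ex (lc y) = y"
 using chart_inv[OF one_chart(1)] by (simp add: ex_def lc_def)

lemma lc_ex:
 obtains N where "open N" "0 \<in> N" "\<And>w. w \<in> N ==> lc (ex w) = w"
proof -
 let ?N = "(%w. snd one_chart \<one> + w) -` (snd one_chart ` fst one_chart)"
 have "open ?N"
  by (rule open_vimage[OF chart_open(2)[OF one_chart(1)]]) (intro continuous_intros)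
 moreover have "0 \<in> ?N" using one_chart by auto
 moreover have "lc (ex w) = w" if "w \<in> ?N" for w
  using chart_inv'(1)[OF one_chart(1), of "snd one_chart \<one> + w"] that by (simp add: lc_def ex_def)
 ultimately show ?thesis using that by blast
qed

abbreviation "C \<equiv> smooth_functions A"

text \<open>The left-invariant field with value \<open>v\<close> at the unit. It is 0 off
  \<open>C\<close> because derivations are normalised that way.\<close>

definition LX :: "'e => 'g vf" where
 "LX v g = (if g \<in> C then (%y. fd (%w. g (y \<otimes> ex w)) (at 0) v) else 0)"

lemma C_smooth: "g \<in> C ==> smap F p ==> smooth_near (%x. g (F x)) p"
 using fsmooth_smap smooth_functions_iff by blast

lemma C_ex: "g \<in> C ==> smooth_near (%w. g (y \<otimes> ex w)) 0"
 by (intro C_smooth smap_mult) auto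

text \<open>Any smooth family through the unit may replace \<open>ex\<close>: close to
  \<open>p\<close> it equals \<open>ex (lc (h x))\<close>, so by the chain rule only the velocity of
  \<open>lc (h x)\<close> enters.\<close>

lemma LX_curve:
 fixes h :: "'p::euclidean_space => 'g"
 assumes "g \<in> C" "smap h p" "h p = \<one>"
 shows "fd (%x. g (y \<otimes> h x)) (at p) v = LX (fd (%x. lc (h x)) (at p) v) g y"
proof -
 obtain N where N: "open N" "p \<in> N" "\<And>x. x \<in> N ==> h x \<in> fst one_chart"
  using smap_open_vimage[OF assms(2) chart_open(1)[OF one_chart(1)]] assms(3) one_chart(2) by metis
 have "fd (%x. g (y \<otimes> h x)) (at p) v = fd (%x. g (y \<otimes> ex (lc (h x)))) (at p) v"
  by (subst frechet_derivative_cong_open[OF N(1,2)]) (simp_all add: ex_lc N(3))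
 also have "\<dots> = fd (%w. g (y \<otimes> ex w)) (at (lc (h p))) (fd (%x. lc (h x)) (at p) v)"
  by (rule frechet_derivative_compose_near[where k = "%w. g (y \<otimes> ex w)"])
   (use assms C_ex smap_lc in auto)
 finally show ?thesis using assms by (simp add: LX_def)
qed

text \<open>A derivative in the parameter is a partial derivative of a jointly smooth function,
  hence smooth in the base point. The parameter value \<open>q\<close> at which it is taken may move
  with the base point, as it does in \<open>D_frame\<close>.\<close>

lemma fsmooth_partial:
 fixes K :: "'g => 'p::euclidean_space => complex"
 assumes "(U, \<phi>) \<in> A" "x \<in> U"
  and K: "\<And>z. z \<in> \<phi> ` U ==> smooth_near (%(z, w). K (inv_into U \<phi> z) w) (z, q z)"
  and q: "smooth_near q (\<phi> x)"
 shows "fsmooth (%y. fd (K y) (at (q (\<phi> y))) v) x"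
proof -
 let ?K = "%(z, w). K (inv_into U \<phi> z) w"
 have "smooth_near (%z. fd ?K (at (z, q z)) (0, v)) (\<phi> x)"
  by (rule smooth_near_compose[where g = "%y. fd ?K (at y) (0, v)"])
   (use assms in \<open>auto intro!: smooth_near_Pair smooth_near_frechet\<close>)
 hence "fsmooth (%y. fd ?K (at (\<phi> y, q (\<phi> y))) (0, v)) x"
  by (rule fsmooth_compose_chart[OF assms(1,2)])
 thus ?thesis
 proof (rule fsmooth_cong[OF _ chart_open(1)[OF assms(1)] assms(2)])
  fix y assume y: "y \<in> U"
  show "fd ?K (at (\<phi> y, q (\<phi> y))) (0, v) = fd (K y) (at (q (\<phi> y))) v"
   using frechet_derivative_partial[of ?K "\<phi> y" "q (\<phi> y)" v] K[of "\<phi> y"] y chart_inv[OF assms(1) y] by auto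
 qed
qed

lemma LX_C:
 assumes "g \<in> C"
 shows "LX v g \<in> C"
 unfolding smooth_functions_iff
proof
 fix x
 obtain U \<phi> where U: "(U, \<phi>) \<in> A" "x \<in> U" by (rule chart_ex)
 have "smooth_near (%(z, w). g (inv_into U \<phi> z \<otimes> ex w)) (z, 0)" if "z \<in> \<phi> ` U" for z
  unfolding split_beta
  by (intro C_smooth[OF assms] smap_mult smap_compose[of "inv_into U \<phi>" fst] smap_compose[of ex snd] smooth_near_fst smooth_near_snd)
   (use that smap_chart_inv[OF U(1)] in auto)
 hence "fsmooth (%y. fd (%w. g (y \<otimes> ex w)) (at 0) v) x"
  using fsmooth_partial[OF U, of "%y w. g (y \<otimes> ex w)" "%_. 0"] by simp
 thus "fsmooth (LX v g) x" using assms by (simp add: LX_def)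
qed

lemma C_mult: "f \<in> C ==> g \<in> C ==> (%x. f x * g x) \<in> C"
 and C_add: "f \<in> C ==> g \<in> C ==> (%x. f x + g x) \<in> C"
 and C_const: "(%x. c) \<in> C"
 and C_translate: "f \<in> C ==> (%x. f (a \<otimes> x)) \<in> C"
 unfolding smooth_functions_iff
 by (auto intro: fsmooth_mult fsmooth_add fsmooth_translate)

lemma LX_translate:
 assumes "g \<in> C"
 shows "LX v (%x. g (a \<otimes> x)) y = LX v g (a \<otimes> y)"
 using assms by (simp add: LX_def C_translate)

lemma LX_mult: "f \<in> C ==> g \<in> C ==> LX v (%x. f x * g x) y = f y * LX v g y + g y * LX v f y"
 by (simp add: LX_def C_mult frechet_derivative_fun_mult C_ex)

lemma LX_lin: "f \<in> C ==> g \<in> C ==> LX v (%x. a * f x + b * g x) y = a * LX v f y + b * LX v g y"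
 by (simp add: LX_def C_mult C_add C_const frechet_derivative_lincomb C_ex)

lemma LX_basis: "g \<in> C ==> LX v g y = (\<Sum>b\<in>Basis. of_real (v \<bullet> b) * LX b g y)"
 using frechet_derivative_sum_rep[OF C_ex, of g y v] by (simp add: LX_def scaleR_conv_of_real)

lemma LX_left_invariant: "LX v \<in> left_invariant_fields G A"
proof -
 have "LX v \<in> derivations C"
  unfolding derivations_def
  by (auto simp: LX_C LX_lin LX_mult fun_eq_iff times_fun_def) (simp add: LX_def)
 moreover have "translate_vf G a (LX v) = LX v" for a
 proof
  fix g
  have "(%x. g (a \<otimes> x)) \<in> C \<longleftrightarrow> g \<in> C"
   using C_translate[of g a] C_translate[of "%x. g (a \<otimes> x)" "inv a"] by auto
  thus "translate_vf G a (LX v) g = LX v g"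
   using LX_translate[of g v a] by (cases "g \<in> C") (auto simp: translate_vf_def translate_fn_def LX_def fun_eq_iff)
 qed
 ultimately show ?thesis by (simp add: left_invariant_fields_def)
qed

subsection \<open>Functions invariant under a discrete subgroup\<close>

text \<open>Functions on the space of right cosets, pulled back to the group. The trivial subgroup
  gives \<open>C\<close> itself, so results on \<open>PI\<close> serve the group and the quotient
  alike.\<close>

definition PI :: "'g set => ('g => complex) set" where
 "PI \<Gamma> = {f \<in> C. \<forall>\<g>\<in>\<Gamma>. \<forall>x. f (\<g> \<otimes> x) = f x}"

text \<open>A local function is cut off inside a set whose translates by \<open>\<Gamma>\<close> are
  disjoint and is then spread over the orbit. The last conclusion locates the support, which is what
  localising a derivation requires.\<close>

lemma extension:
 assumes \<Gamma>: "subgroup \<Gamma> G" "discrete \<Gamma>"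
  and N: "open N" "x \<in> N" "\<And>y. y \<in> N ==> fsmooth f y"
 obtains h N' where "h \<in> PI \<Gamma>" "open N'" "x \<in> N'" "\<And>y. y \<in> N' ==> h y = f y"
  "\<And>y. h y \<noteq> 0 ==> \<exists>\<g>\<in>\<Gamma>. \<g> \<otimes> y \<in> N"
proof -
 have "\<one> isolated_in \<Gamma>" using \<Gamma> unfolding discrete_def by (simp add: subgroup.one_closed)
 then obtain W0 where W0: "open W0" "W0 \<inter> \<Gamma> = {\<one>}" unfolding isolated_in_def by blast
 have 1: "\<one> \<in> W0" using W0 by blast
 \<comment> \<open>If two elements of \<open>\<Gamma>\<close> move \<open>y\<close> into
   \<open>O1 \<inter> O2\<close>, their quotient lies in \<open>W0\<close>, which meets
   \<open>\<Gamma>\<close> only in the unit; so the translates of \<open>U'\<close> below are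
   disjoint.\<close>
 obtain O1 O2 where O: "open O1" "open O2" "x \<in> O1" "x \<in> O2" "\<And>a b. a \<in> O1 ==> b \<in> O2 ==> a \<otimes> inv b \<in> W0"
 proof (rule continuous_on_pairE[of "%z. fst z \<otimes> inv (snd z)" W0 x x])
  show "continuous_on UNIV (%z. fst z \<otimes> inv (snd z))" by (intro continuous_intros)
 qed (use W0(1) 1 in auto)
 obtain U \<phi> where U: "(U, \<phi>) \<in> A" "x \<in> U" by (rule chart_ex)
 define U' where "U' = N \<inter> O1 \<inter> O2"
 have U': "open U'" "x \<in> U'" using O N by (auto simp: U'_def)
 \<comment> \<open>Room around the support: \<open>K0\<close> may be multiplied by \<open>W\<close>
   on the right without leaving \<open>U'\<close>. Hence a point whose orbit avoids
   \<open>U'\<close> has a whole neighbourhood on which \<open>h\<close> vanishes.\<close>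
 obtain K0 W where K0: "open K0" "open W" "x \<in> K0" "\<one> \<in> W" "\<And>a b. a \<in> K0 ==> b \<in> W ==> a \<otimes> b \<in> U'"
 proof (rule continuous_on_pairE[of "%z. fst z \<otimes> snd z" U' x \<one>])
  show "continuous_on UNIV (%z. fst z \<otimes> snd z)" by (intro continuous_intros)
 qed (use U' in auto)
 define K where "K = K0 \<inter> U' \<inter> U"
 have K: "open K" "x \<in> K" "K \<subseteq> U" using K0 U' U chart_open(1)[OF U(1)] by (auto simp: K_def)
 obtain b :: "'e => complex" and r s where b: "\<And>z. smooth_near b z" "r > 0" "s > 0" "\<And>z. z \<in> ball (\<phi> x) r ==> b z = 1"
  "cball (\<phi> x) s \<subseteq> \<phi> ` K" "\<And>z. z \<notin> cball (\<phi> x) s ==> b z = 0"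
  using bump_exists[OF chart_image_open[OF U(1) K(1,3)], of "\<phi> x"] K(2) by blast
 define k where "k y = (if y \<in> K then b (\<phi> y) * f y else 0)" for y
 define \<kappa> where "\<kappa> = inv_into U \<phi> ` cball (\<phi> x) s"
 have "compact \<kappa>" unfolding \<kappa>_def
  by (rule compact_continuous_image[OF continuous_on_subset[OF chart_cont(2)[OF U(1)]] compact_cball])
   (use b(5) K(3) in auto)
 hence \<kappa>: "closed \<kappa>" by (rule compact_imp_closed)
 have \<kappa>K: "\<kappa> \<subseteq> K"
 proof
  fix y assume "y \<in> \<kappa>"
  then obtain w where "w \<in> K" "y = inv_into U \<phi> (\<phi> w)" using b(5) unfolding \<kappa>_def by blast
  thus "y \<in> K" using chart_inv[OF U(1)] K(3) by auto
 qed
 have k0: "k y = 0" if "y \<notin> \<kappa>" for y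
 proof (cases "y \<in> K")
  case True
  hence "\<phi> y \<notin> cball (\<phi> x) s" using that chart_inv[OF U(1), of y] K(3) unfolding \<kappa>_def by force
  thus ?thesis by (simp add: k_def b)
 qed (simp add: k_def)
 have ks: "fsmooth k y" for y
 proof (cases "y \<in> K")
  case True
  hence "fsmooth (%y. b (\<phi> y) * f y) y"
   using K N(3) U b(1) by (intro fsmooth_mult fsmooth_compose_chart[OF U(1)]) (auto simp: K_def U'_def)
  thus ?thesis by (rule fsmooth_cong[OF _ K(1) True]) (simp add: k_def)
 next
  case False
  show ?thesis by (rule fsmooth_cong[OF fsmooth_const, of "- \<kappa>"]) (use \<kappa> \<kappa>K False k0 in auto)
 qed
 have uniq: "\<g> = \<g>'" if "\<g> \<in> \<Gamma>" "\<g>' \<in> \<Gamma>" "\<g> \<otimes> y \<in> U'" "\<g>' \<otimes> y \<in> U'" for \<g> \<g>' y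
 proof -
  have "(\<g> \<otimes> y) \<otimes> inv (\<g>' \<otimes> y) \<in> W0" by (rule O(5)) (use that in \<open>auto simp: U'_def\<close>)
  hence "\<g> \<otimes> inv \<g>' \<in> W0" by simp
  moreover have "\<g> \<otimes> inv \<g>' \<in> \<Gamma>" using \<Gamma>(1) that by (simp add: subgroup.m_closed subgroup.m_inv_closed)
  ultimately have "\<g> \<otimes> inv \<g>' = \<one>" using W0 by blast
  thus ?thesis by (metis carrier_UNIV grp_simps(2) grp_simps(4) m_assoc UNIV_I r_one)
 qed
 define h where "h y = (if \<exists>\<g>\<in>\<Gamma>. \<g> \<otimes> y \<in> U' then k ((SOME \<g>. \<g> \<in> \<Gamma> \<and> \<g> \<otimes> y \<in> U') \<otimes> y) else 0)" for y
 have hk: "h y = k (\<g> \<otimes> y)" if "\<g> \<in> \<Gamma>" "\<g> \<otimes> y \<in> U'" for \<g> y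
 proof -
  have "(SOME \<g>. \<g> \<in> \<Gamma> \<and> \<g> \<otimes> y \<in> U') = \<g>"
   by (rule some_equality) (use that uniq in auto)
  thus ?thesis using that unfolding h_def by auto
 qed
 have h0: "h y = 0" if "\<And>\<g>. \<g> \<in> \<Gamma> ==> \<g> \<otimes> y \<notin> U'" for y
  using that unfolding h_def by auto
 have inv: "h (\<d> \<otimes> y) = h y" if "\<d> \<in> \<Gamma>" for \<d> y
 proof (cases "\<exists>\<g>\<in>\<Gamma>. \<g> \<otimes> (\<d> \<otimes> y) \<in> U'")
  case True
  then obtain \<g> where g: "\<g> \<in> \<Gamma>" "\<g> \<otimes> (\<d> \<otimes> y) \<in> U'" by blast
  thus ?thesis using hk[of \<g> "\<d> \<otimes> y"] hk[of "\<g> \<otimes> \<d>" y] that subgroup.m_closed[OF \<Gamma>(1)] by simp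
 next
  case False
  have "\<g> \<otimes> y \<notin> U'" if g: "\<g> \<in> \<Gamma>" for \<g>
  proof -
   have "\<g> \<otimes> inv \<d> \<in> \<Gamma>" using \<Gamma>(1) g \<open>\<d> \<in> \<Gamma>\<close> by (simp add: subgroup.m_closed subgroup.m_inv_closed)
   hence "(\<g> \<otimes> inv \<d>) \<otimes> (\<d> \<otimes> y) \<notin> U'" using False by blast
   thus ?thesis by simp
  qed
  thus ?thesis using False h0[of y] h0[of "\<d> \<otimes> y"] by auto
 qed
 have hs: "fsmooth h y" for y
 proof (cases "\<exists>\<g>\<in>\<Gamma>. \<g> \<otimes> y \<in> U'")
  case True
  then obtain \<g> where g: "\<g> \<in> \<Gamma>" "\<g> \<otimes> y \<in> U'" by blast
  have "open ((%y. \<g> \<otimes> y) -` U')"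
   by (rule open_vimage[OF U'(1)]) (intro continuous_intros)
  thus ?thesis
   by (rule fsmooth_cong[OF fsmooth_translate[OF ks, of \<g>]]) (use g hk in auto)
 next
  case False
  have o: "open ((%y'. inv y' \<otimes> y) -` W)"
   by (rule open_vimage[OF K0(2)]) (intro continuous_intros)
  have "h y' = 0" if y': "y' \<in> (%y'. inv y' \<otimes> y) -` W" for y'
  proof (rule ccontr)
   assume n: "h y' \<noteq> 0"
   then obtain \<g> where g: "\<g> \<in> \<Gamma>" "\<g> \<otimes> y' \<in> U'" using h0 by blast
   hence "\<g> \<otimes> y' \<in> K" using n hk[OF g] by (auto simp: k_def split: if_splits)
   have "(\<g> \<otimes> y') \<otimes> (inv y' \<otimes> y) \<in> U'" by (rule K0(5)) (use y' \<open>\<g> \<otimes> y' \<in> K\<close> in \<open>auto simp: K_def\<close>)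
   thus False using False g(1) by simp
  qed
  thus ?thesis by (intro fsmooth_cong[OF fsmooth_const o]) (use K0 in auto)
 qed
 let ?N' = "K \<inter> (\<phi> -` ball (\<phi> x) r \<inter> U)"
 have "open (\<phi> -` ball (\<phi> x) r \<inter> U)"
  using continuous_on_open_vimage[OF chart_open(1)[OF U(1)]] chart_cont(1)[OF U(1)] open_ball by blast
 hence o: "open ?N'" using K(1) by blast
 show ?thesis
 proof (rule that[OF _ o])
  show "h \<in> PI \<Gamma>" using hs inv unfolding PI_def smooth_functions_iff by blast
  show "x \<in> ?N'" using K(2) U b(2) by auto
  show "h y = f y" if "y \<in> ?N'" for y
   using hk[of \<one> y] that subgroup.one_closed[OF \<Gamma>(1)] b(4) by (auto simp: k_def K_def)
  show "\<exists>\<g>\<in>\<Gamma>. \<g> \<otimes> y \<in> N" if "h y \<noteq> 0" for y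
   using h0[of y] that unfolding U'_def by blast
 qed
qed

end

subsection \<open>Derivations of the invariant functions\<close>

context lie_grp
begin

lemma PI_C: "f \<in> PI \<Gamma> ==> f \<in> C" by (simp add: PI_def)

lemma PI_fsmooth: "f \<in> PI \<Gamma> ==> fsmooth f x"
 using PI_C smooth_functions_iff by blast

lemma PI_inv: "f \<in> PI \<Gamma> ==> \<g> \<in> \<Gamma> ==> f (\<g> \<otimes> x) = f x" by (simp add: PI_def)

lemma PI_mult: "f \<in> PI \<Gamma> ==> g \<in> PI \<Gamma> ==> (%x. f x * g x) \<in> PI \<Gamma>"
 and PI_add: "f \<in> PI \<Gamma> ==> g \<in> PI \<Gamma> ==> (%x. f x + g x) \<in> PI \<Gamma>"
 and PI_const: "(%x. c) \<in> PI \<Gamma>"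
 unfolding PI_def using C_mult C_add C_const by auto

lemma PI_scale: "f \<in> PI \<Gamma> ==> (%x. a * f x) \<in> PI \<Gamma>"
 using PI_mult[OF PI_const] .

lemma PI_sum: "(\<And>i. i \<in> F ==> f i \<in> PI \<Gamma>) ==> (%x. \<Sum>i\<in>F. f i x) \<in> PI \<Gamma>"
 by (induction F rule: infinite_finite_induct) (auto intro: PI_const PI_add)

lemma LX_PI: "f \<in> PI \<Gamma> ==> LX v f \<in> PI \<Gamma>"
proof -
 assume f: "f \<in> PI \<Gamma>"
 have "LX v f (\<g> \<otimes> x) = LX v f x" if "\<g> \<in> \<Gamma>" for \<g> x
  using LX_translate[OF PI_C[OF f], of v \<g> x] PI_inv[OF f that] by simp
 thus ?thesis using LX_C[OF PI_C[OF f]] by (simp add: PI_def)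
qed

end

locale invariant_derivation = lie_grp G A for G :: "('g::{t2_space, second_countable_topology}, 'r) monoid_scheme" (structure)
  and A :: "('g, 'e::euclidean_space) chart set" +
 fixes \<Gamma> :: "'g set" and D :: "'g vf"
 assumes \<Gamma>: "subgroup \<Gamma> G" "discrete \<Gamma>" and D: "D \<in> derivations (PI \<Gamma>)"
begin

abbreviation "P \<equiv> PI \<Gamma>"

lemma D_P: "f \<in> P ==> D f \<in> P"
 and D_lin: "f \<in> P ==> g \<in> P ==> D (%x. a * f x + b * g x) y = a * D f y + b * D g y"
 and D_mult: "f \<in> P ==> g \<in> P ==> D (%x. f x * g x) y = f y * D g y + g y * D f y"
 using D unfolding derivations_def by (auto simp: times_fun_def plus_fun_def)

lemma D_const: "D (%x. c) y = 0"
proof -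
 have "D (%x. 1) y = 0" using D_mult[OF PI_const PI_const, of 1 1 y] by simp
 thus ?thesis using D_lin[OF PI_const PI_const, of c 1 0 1 y] by simp
qed

lemma D_add: "f \<in> P ==> g \<in> P ==> D (%x. f x + g x) y = D f y + D g y"
 using D_lin[of f g 1 1] by simp

lemma D_sum: "finite F ==> (\<And>i. i \<in> F ==> f i \<in> P) ==> D (%x. \<Sum>i\<in>F. f i x) y = (\<Sum>i\<in>F. D (f i) y)"
proof (induction F rule: finite_induct)
 case (insert i F)
 hence "D (%x. f i x + (\<Sum>i\<in>F. f i x)) y = D (f i) y + D (%x. \<Sum>i\<in>F. f i x) y"
  by (intro D_add PI_sum) auto
 thus ?case using insert by simp
qed (simp add: D_const)

text \<open>For a periodic cutoff \<open>b\<close> around \<open>y\<close> the product of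
  \<open>b\<close> with \<open>f - g\<close> vanishes identically, and the Leibniz rule at
  \<open>y\<close> turns this into \<open>D (f - g) y = 0\<close>.\<close>

lemma D_local:
 assumes f: "f \<in> P" and g: "g \<in> P" and N: "open N" "y \<in> N" "\<And>x. x \<in> N ==> f x = g x"
 shows "D f y = D g y"
proof -
 obtain b N' where b: "b \<in> P" "open N'" "y \<in> N'" "\<And>x. x \<in> N' ==> b x = 1"
  and b0: "\<And>x. b x \<noteq> 0 ==> \<exists>\<g>\<in>\<Gamma>. \<g> \<otimes> x \<in> N"
  using extension[OF \<Gamma> N(1,2), of "%_. 1"] by auto
 define h where "h x = 1 * f x + (-1) * g x" for x
 have h: "h \<in> P" unfolding h_def using f g by (intro PI_add PI_scale)
 have z: "b x * h x = 0" for x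
 proof (cases "b x = 0")
  case False
  then obtain \<g> where "\<g> \<in> \<Gamma>" "\<g> \<otimes> x \<in> N" using b0 by blast
  hence "h x = 0" using PI_inv[OF f, of \<g> x] PI_inv[OF g, of \<g> x] N(3)[of "\<g> \<otimes> x"] by (simp add: h_def)
  thus ?thesis by simp
 qed simp
 have "0 = D (%x. b x * h x) y" unfolding z by (simp add: D_const)
 also have "\<dots> = b y * D h y + h y * D b y" by (rule D_mult[OF b(1) h])
 also have "\<dots> = D h y" using b N by (simp add: h_def)
 also have "\<dots> = D f y - D g y" unfolding h_def using D_lin[OF f g, of 1 "-1" y] by simp
 finally show ?thesis by simp
qed

text \<open>Hadamard's lemma writes \<open>g\<close> near \<open>y\<close> as its value plus
  coordinate differences times smooth factors. Coordinates and factors exist only locally, so they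
  are replaced by periodic extensions, which \<open>D_local\<close> permits.\<close>

lemma D_chart:
 assumes U: "(U, \<phi>) \<in> A" "x \<in> U"
 shows "\<exists>c N. (\<forall>i\<in>Basis. c i \<in> P) \<and> open N \<and> x \<in> N \<and> N \<subseteq> U \<and>
  (\<forall>y\<in>N. \<forall>g\<in>P. D g y = (\<Sum>i\<in>Basis. D (c i) y * fd (%z. g (inv_into U \<phi> z)) (at (\<phi> y)) i))"
proof -
 have "\<exists>h N'. h \<in> P \<and> open N' \<and> x \<in> N' \<and> (\<forall>y\<in>N'. h y = complex_of_real (\<phi> y \<bullet> i))" for i
 proof -
  have "fsmooth (%y. complex_of_real (\<phi> y \<bullet> i)) y" if "y \<in> U" for y
   by (rule fsmooth_compose_chart[OF U(1) that, of "%z. complex_of_real (z \<bullet> i)"])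
    (intro smooth_near_of_real smooth_near_inner smooth_near_ident smooth_near_const)
  thus ?thesis using extension[OF \<Gamma> chart_open(1)[OF U(1)] U(2), of "%y. complex_of_real (\<phi> y \<bullet> i)"]
   by metis
 qed
 then obtain c Nc where c: "\<And>i. c i \<in> P" "\<And>i. open (Nc i)" "\<And>i. x \<in> Nc i"
  "\<And>i y. y \<in> Nc i ==> c i y = complex_of_real (\<phi> y \<bullet> i)" by metis
 define N where "N = U \<inter> (\<Inter>i\<in>Basis. Nc i)"
 have N: "open N" "x \<in> N" "N \<subseteq> U"
  using c U chart_open(1)[OF U(1)] by (auto simp: N_def intro!: open_Int open_INT)
 have "D g y = (\<Sum>i\<in>Basis. D (c i) y * fd (%z. g (inv_into U \<phi> z)) (at (\<phi> y)) i)"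
  if g: "g \<in> P" and y: "y \<in> N" for g y
 proof -
  have yU: "y \<in> U" using y N by auto
  let ?g = "%z. g (inv_into U \<phi> z)"
  have "smooth_near ?g (\<phi> y)"
   using C_smooth[OF PI_C[OF g] smap_chart_inv[OF U(1)]] yU by auto
  then obtain r k where r: "r > 0" and k: "\<And>b x. x \<in> ball (\<phi> y) r ==> smooth_near (k b) x"
   and gk: "\<And>x. x \<in> ball (\<phi> y) r ==> ?g x = ?g (\<phi> y) + (\<Sum>b\<in>Basis. ((x - \<phi> y) \<bullet> b) *\<^sub>R k b x)"
   and k0: "\<And>b. k b (\<phi> y) = fd ?g (at (\<phi> y)) b" by (rule hadamard) blast
  define B where "B = \<phi> -` ball (\<phi> y) r \<inter> U"
  have B: "open B" "y \<in> B"
   using continuous_on_open_vimage[OF chart_open(1)[OF U(1)]] chart_cont(1)[OF U(1)] yU r by (auto simp: B_def)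
  have "\<exists>h N'. h \<in> P \<and> open N' \<and> y \<in> N' \<and> (\<forall>x\<in>N'. h x = k b (\<phi> x))" for b
  proof -
   have "fsmooth (%x. k b (\<phi> x)) x" if "x \<in> B" for x
    by (rule fsmooth_compose_chart[OF U(1)]) (use that k in \<open>auto simp: B_def\<close>)
   thus ?thesis using extension[OF \<Gamma> B, of "%x. k b (\<phi> x)"] by metis
  qed
  then obtain K Nk where K: "\<And>b. K b \<in> P" "\<And>b. open (Nk b)" "\<And>b. y \<in> Nk b"
   "\<And>b x. x \<in> Nk b ==> K b x = k b (\<phi> x)" by metis
  define S where "S = B \<inter> N \<inter> (\<Inter>i\<in>Basis. Nk i)"
  have S: "open S" "y \<in> S" using B N y K by (auto simp: S_def intro!: open_Int open_INT)
  \<comment> \<open>Coordinates shifted to vanish at \<open>y\<close>, so that the Leibniz rule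
    leaves only \<open>D (c i) y\<close> times the value of \<open>K i\<close> at
    \<open>y\<close>.\<close>
  define c' where "c' i z = 1 * c i z + (- c i y) * 1" for i z
  have c': "c' i \<in> P" for i unfolding c'_def by (intro PI_add PI_scale c PI_const)
  have Dc': "D (c' i) y = D (c i) y" for i
   unfolding c'_def using D_lin[OF c(1)[of i] PI_const[of 1], of 1 "- c i y" y] by (simp add: D_const)
  define H where "H z = g y + (\<Sum>i\<in>Basis. c' i z * K i z)" for z
  have sP: "(%z. \<Sum>i\<in>Basis. c' i z * K i z) \<in> P" by (intro PI_sum PI_mult c' K)
  have H: "H \<in> P" unfolding H_def by (intro PI_add PI_const sP)
  have "g z = H z" if z: "z \<in> S" for z
  proof -
   have "\<phi> z \<in> ball (\<phi> y) r" "z \<in> U" "z \<in> N" using z by (auto simp: S_def B_def)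
   hence "g z = g y + (\<Sum>b\<in>Basis. ((\<phi> z - \<phi> y) \<bullet> b) *\<^sub>R k b (\<phi> z))"
    using gk[of "\<phi> z"] chart_inv[OF U(1)] yU by simp
   also have "(\<Sum>b\<in>Basis. ((\<phi> z - \<phi> y) \<bullet> b) *\<^sub>R k b (\<phi> z)) = (\<Sum>i\<in>Basis. c' i z * K i z)"
   proof (rule sum.cong[OF refl])
    fix i :: 'e assume i: "i \<in> Basis"
    have "c i z = of_real (\<phi> z \<bullet> i)" "c i y = of_real (\<phi> y \<bullet> i)" "K i z = k i (\<phi> z)"
     using z y i c(4) K(4) by (auto simp: S_def N_def)
    thus "((\<phi> z - \<phi> y) \<bullet> i) *\<^sub>R k i (\<phi> z) = c' i z * K i z"
     by (simp add: c'_def inner_diff_left scaleR_conv_of_real)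
   qed
   finally show ?thesis by (simp add: H_def)
  qed
  hence "D g y = D H y" by (rule D_local[OF g H S])
  also have "\<dots> = (\<Sum>i\<in>Basis. D (%z. c' i z * K i z) y)"
   unfolding H_def using D_add[OF PI_const sP] D_sum[of Basis "%i z. c' i z * K i z" y] by (simp add: D_const PI_mult c' K)
  also have "\<dots> = (\<Sum>i\<in>Basis. D (c i) y * fd ?g (at (\<phi> y)) i)"
  proof (rule sum.cong[OF refl])
   fix i :: 'e assume i: "i \<in> Basis"
   have "K i y = k i (\<phi> y)" using K(3,4) by auto
   thus "D (%z. c' i z * K i z) y = D (c i) y * fd ?g (at (\<phi> y)) i"
    using D_mult[OF c'[of i] K(1)[of i], of y] Dc'[of i] k0[of i] by (simp add: c'_def)
  qed
  finally show ?thesis .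
 qed
 thus ?thesis using c(1) N by blast
qed

text \<open>The coordinates \<open>lc (inv y \<otimes> z)\<close> near \<open>y\<close>, extended
  periodically, are dual to the frame \<open>LX\<close> at \<open>y\<close>. They serve to read off
  the coefficients of a field at a prescribed point.\<close>

lemma dual_functions:
 obtains \<t> where "\<And>b. \<t> b \<in> P" "\<And>b v. LX v (\<t> b) y = complex_of_real (v \<bullet> b)"
proof -
 define N where "N = (%z. inv y \<otimes> z) -` fst one_chart"
 have N: "open N" "y \<in> N"
  unfolding N_def using chart_open(1)[OF one_chart(1)] one_chart(2) 
  by (auto intro!: open_vimage[OF chart_open(1)[OF one_chart(1)]] continuous_intros)
 have "\<exists>h. h \<in> P \<and> (\<forall>v. LX v h y = complex_of_real (v \<bullet> b))" for b
 proof -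
  have "fsmooth (%z. complex_of_real (lc (inv y \<otimes> z) \<bullet> b)) z" if "z \<in> N" for z
  proof (rule fsmooth_translate)
   show "fsmooth (%z. complex_of_real (lc z \<bullet> b)) (inv y \<otimes> z)"
    unfolding lc_def
    by (rule fsmooth_compose_chart[OF one_chart(1), of _ "%w. complex_of_real ((w - snd one_chart \<one>) \<bullet> b)"])
     (use that in \<open>auto simp: N_def intro!: smooth_near_of_real smooth_near_inner smooth_near_diff\<close>)
  qed
  then obtain h N' where h: "h \<in> P" "open N'" "y \<in> N'" "\<And>z. z \<in> N' ==> h z = complex_of_real (lc (inv y \<otimes> z) \<bullet> b)"
   using extension[OF \<Gamma> N, of "%z. complex_of_real (lc (inv y \<otimes> z) \<bullet> b)"] by metis
  have "smap (%w. y \<otimes> ex w) 0" by (intro smap_mult) auto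
  moreover have "y \<otimes> ex 0 \<in> N'" using h(3) by simp
  ultimately obtain N1 where N1: "open N1" "0 \<in> N1" "\<And>w. w \<in> N1 ==> y \<otimes> ex w \<in> N'"
   using smap_open_vimage[OF _ h(2)] by metis
  obtain N2 where N2: "open N2" "0 \<in> N2" "\<And>w. w \<in> N2 ==> lc (ex w) = w" using lc_ex by metis
  have "LX v h y = complex_of_real (v \<bullet> b)" for v
  proof -
   have "LX v h y = fd (%w. h (y \<otimes> ex w)) (at 0) v" using h(1) by (simp add: LX_def PI_def)
   also have "fd (%w. h (y \<otimes> ex w)) (at 0) = fd (%w. complex_of_real (w \<bullet> b)) (at 0)"
    by (rule frechet_derivative_cong_open[of "N1 \<inter> N2"]) (use N1 N2 h in auto)
   also have "\<dots> v = complex_of_real (v \<bullet> b)"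
    by (rule frechet_derivative_eqI) (auto intro!: derivative_eq_intros)
   finally show ?thesis .
  qed
  thus ?thesis using h(1) by blast
 qed
 thus ?thesis using that by metis
qed

text \<open>Coefficients exist locally, by passing from the coordinate fields of a chart to the
  left-invariant frame. The dual functions make them unique, and uniqueness both glues them and
  shows that they are invariant under \<open>\<Gamma>\<close>.\<close>

theorem D_frame:
 obtains f where "\<And>b. b \<in> Basis ==> f b \<in> P" "\<And>g y. g \<in> P ==> D g y = (\<Sum>b\<in>Basis. f b y * LX b g y)"
proof -
 have loc: "\<exists>k N. open N \<and> x \<in> N \<and> (\<forall>b\<in>Basis. fsmooth (k b) x) \<and>
   (\<forall>y\<in>N. \<forall>g\<in>P. D g y = (\<Sum>b\<in>Basis. k b y * LX b g y))" for x
 proof -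
  obtain U \<phi> where U: "(U, \<phi>) \<in> A" "x \<in> U" by (rule chart_ex)
  obtain c N where cN: "(\<forall>i\<in>Basis. c i \<in> P) \<and> open N \<and> x \<in> N \<and> N \<subseteq> U \<and>
   (\<forall>y\<in>N. \<forall>g\<in>P. D g y = (\<Sum>i\<in>Basis. D (c i) y * fd (%z. g (inv_into U \<phi> z)) (at (\<phi> y)) i))"
   using D_chart[OF U] by (elim exE) (rule that)
  hence c: "\<And>i. i \<in> Basis ==> c i \<in> P" and N: "open N" "x \<in> N" "N \<subseteq> U"
   and Dc: "\<And>g y. g \<in> P ==> y \<in> N ==>
     D g y = (\<Sum>i\<in>Basis. D (c i) y * fd (%z. g (inv_into U \<phi> z)) (at (\<phi> y)) i)"
   by simp_all
  \<comment> \<open>The transition matrix from the coordinate fields to the frame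
    \<open>LX b\<close>: the velocity at \<open>z = \<phi> y\<close> of
    \<open>inv y \<otimes> inv_into U \<phi> z\<close>, a family through the unit to which
    \<open>LX_curve\<close> applies.\<close>
  define e where "e i b y = complex_of_real (fd (%z. lc (inv y \<otimes> inv_into U \<phi> z)) (at (\<phi> y)) i \<bullet> b)" for i b y
  have sm: "smooth_near (%(a, z). lc (inv (inv_into U \<phi> a) \<otimes> inv_into U \<phi> z)) (a, a)" if "a \<in> \<phi> ` U" for a
   unfolding split_beta
   by (intro smap_lc smap_mult smap_inv smap_compose[of "inv_into U \<phi>" fst] smap_compose[of "inv_into U \<phi>" snd] smooth_near_fst smooth_near_snd)
    (use that smap_chart_inv[OF U(1)] in auto)
  have e: "fsmooth (e i b) x" for i b
  proof -
   have "fsmooth (%y. fd (%z. complex_of_real (lc (inv y \<otimes> inv_into U \<phi> z) \<bullet> b)) (at (\<phi> y)) i) x"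
   proof (rule fsmooth_partial[OF U, of "%y z. complex_of_real (lc (inv y \<otimes> inv_into U \<phi> z) \<bullet> b)" "%z. z"])
    fix z assume "z \<in> \<phi> ` U"
    from smooth_near_of_real[OF smooth_near_inner[OF sm[OF this] smooth_near_const[of b]]]
    show "smooth_near (%(z, w). complex_of_real (lc (inv (inv_into U \<phi> z) \<otimes> inv_into U \<phi> w) \<bullet> b)) (z, z)"
     unfolding case_prod_unfold by simp
   qed simp
   thus ?thesis
   proof (rule fsmooth_cong[OF _ chart_open(1)[OF U(1)] U(2)])
    fix y assume y: "y \<in> U"
    have "smooth_near (%z. lc (inv y \<otimes> inv_into U \<phi> z)) (\<phi> y)"
     using y chart_inv[OF U(1) y] smap_chart_inv[OF U(1)] by (intro smap_lc smap_mult) auto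
    hence "((%z. complex_of_real (lc (inv y \<otimes> inv_into U \<phi> z) \<bullet> b)) has_derivative
     (%i. complex_of_real (fd (%z. lc (inv y \<otimes> inv_into U \<phi> z)) (at (\<phi> y)) i \<bullet> b))) (at (\<phi> y))"
     by (intro has_derivative_of_real has_derivative_inner_left smooth_near_has_derivative)
    thus "fd (%z. complex_of_real (lc (inv y \<otimes> inv_into U \<phi> z) \<bullet> b)) (at (\<phi> y)) i = e i b y"
     unfolding e_def by (rule frechet_derivative_eqI)
   qed
  qed
  have g: "fd (%z. g (inv_into U \<phi> z)) (at (\<phi> y)) i = (\<Sum>b\<in>Basis. e i b y * LX b g y)"
   if "g \<in> P" "y \<in> U" for g y i
  proof -
   have "fd (%z. g (inv_into U \<phi> z)) (at (\<phi> y)) i =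
     fd (%z. g (y \<otimes> (inv y \<otimes> inv_into U \<phi> z))) (at (\<phi> y)) i" by simp
   also have "\<dots> = LX (fd (%z. lc (inv y \<otimes> inv_into U \<phi> z)) (at (\<phi> y)) i) g y"
    by (rule LX_curve) (use that chart_inv[OF U(1)] smap_chart_inv[OF U(1)] in \<open>auto simp: PI_C intro!: smap_mult\<close>)
   also have "\<dots> = (\<Sum>b\<in>Basis. e i b y * LX b g y)"
    unfolding e_def by (rule LX_basis[OF PI_C[OF that(1)]])
   finally show ?thesis .
  qed
  define k where "k b y = (\<Sum>i\<in>Basis. D (c i) y * e i b y)" for b y
  have "fsmooth (k b) x" for b
   unfolding k_def by (intro fsmooth_sum fsmooth_mult e PI_fsmooth[OF D_P[OF c]])
  moreover have "D g y = (\<Sum>b\<in>Basis. k b y * LX b g y)" if y: "y \<in> N" and gP: "g \<in> P" for g y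
  proof -
   have "D g y = (\<Sum>i\<in>Basis. \<Sum>b\<in>Basis. D (c i) y * (e i b y * LX b g y))"
    using Dc[OF gP y] g[OF gP] y N(3) by (simp add: sum_distrib_left subset_iff)
   also have "\<dots> = (\<Sum>b\<in>Basis. \<Sum>i\<in>Basis. D (c i) y * (e i b y * LX b g y))" by (rule sum.swap)
   finally show ?thesis by (simp add: k_def sum_distrib_right mult.assoc)
  qed
  ultimately show ?thesis using N by blast
 qed
 have "\<forall>y. \<exists>\<t>. (\<forall>b. \<t> b \<in> P) \<and> (\<forall>b v. LX v (\<t> b) y = complex_of_real (v \<bullet> b))"
  using dual_functions by metis
 then obtain \<t> where \<t>: "\<And>y b. \<t> y b \<in> P" "\<And>y b v. LX v (\<t> y b) y = complex_of_real (v \<bullet> b)" by metis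
 have coef: "D (\<t> y b) y = k b" if "\<And>g. g \<in> P ==> D g y = (\<Sum>b\<in>Basis. k b * LX b g y)" "b \<in> Basis" for y b k
 proof -
  have "D (\<t> y b) y = (\<Sum>b'\<in>Basis. k b' * complex_of_real (b' \<bullet> b))" using that \<t> by simp
  also have "\<dots> = (\<Sum>b'\<in>Basis. if b' = b then k b else 0)"
   by (rule sum.cong) (use that in \<open>auto simp: inner_Basis\<close>)
  finally show ?thesis using that by simp
 qed
 \<comment> \<open>Test functions chosen point by point define the coefficients without reference to
   charts; the local formula then shows that they are smooth.\<close>
 define f where "f b y = D (\<t> y b) y" for b y
 have fs: "fsmooth (f b) x" if b: "b \<in> Basis" for b x
 proof -
  obtain k N where k: "open N" "x \<in> N" "\<forall>b\<in>Basis. fsmooth (k b) x"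
   "\<forall>y\<in>N. \<forall>g\<in>P. D g y = (\<Sum>b\<in>Basis. k b y * LX b g y)" using loc[of x] by (elim exE conjE) (rule that; assumption)
  have "f b y = k b y" if "y \<in> N" for y
   unfolding f_def using coef[of y "%b. k b y" b] k(4) that b by blast
  thus ?thesis using fsmooth_cong[of "k b" x N "f b"] k b by auto
 qed
 have fD: "D g y = (\<Sum>b\<in>Basis. f b y * LX b g y)" if "g \<in> P" for g y
 proof -
  obtain k N where k: "y \<in> N" "\<forall>y\<in>N. \<forall>g\<in>P. D g y = (\<Sum>b\<in>Basis. k b y * LX b g y)" using loc[of y] by (elim exE conjE) (rule that; assumption)
  have "f b y = k b y" if "b \<in> Basis" for b
   unfolding f_def using coef[of y "%b. k b y" b] k that by blast
  thus ?thesis using k \<open>g \<in> P\<close> by simp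
 qed
 have "f b (\<g> \<otimes> y) = f b y" if "\<g> \<in> \<Gamma>" "b \<in> Basis" for b \<g> y
 proof -
  have "D g y = (\<Sum>b\<in>Basis. f b (\<g> \<otimes> y) * LX b g y)" if g: "g \<in> P" for g
   using fD[OF g, of "\<g> \<otimes> y"] PI_inv[OF D_P[OF g] \<open>\<g> \<in> \<Gamma>\<close>] PI_inv[OF LX_PI[OF g] \<open>\<g> \<in> \<Gamma>\<close>] by simp
  from coef[OF this that(2)] show ?thesis by (simp add: f_def)
 qed
 hence "f b \<in> P" if "b \<in> Basis" for b
  unfolding PI_def mem_Collect_eq smooth_functions_iff using fs that by blast
 thus ?thesis using fD that by blast
qed

end

section \<open>Derivations of a function algebra\<close>

global_interpretation cv: vector_space "cmul :: complex => ('a => 'm fn) => ('a => 'm fn)"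
 by unfold_locales (auto simp: cmul_def fun_eq_iff algebra_simps)

lemma cmul_apply: "cmul c X f x = c * X f x"
 by (simp add: cmul_def)

lemma fmul_apply: "fmul h X f x = h x * X f x"
 by (simp add: fmul_def)

lemma sum_fun_apply: "sum f F x = (\<Sum>i\<in>F. f i x)"
 by (induction F rule: infinite_finite_induct) auto

lemma sum_closed:
 fixes f :: "'i => 'a::comm_monoid_add"
 assumes "0 \<in> S" "\<And>x y. x \<in> S ==> y \<in> S ==> x + y \<in> S" "\<And>i. i \<in> F ==> f i \<in> S"
 shows "sum f F \<in> S"
 using assms(3) by (induction F rule: infinite_finite_induct) (auto intro: assms)

lemma sum_additive:
 fixes f :: "'i => 'a::comm_monoid_add" and h :: "'a => 'b::comm_monoid_add"
 assumes "h 0 = 0" "\<And>x y. x \<in> S ==> y \<in> S ==> h (x + y) = h x + h y"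
  "0 \<in> S" "\<And>x y. x \<in> S ==> y \<in> S ==> x + y \<in> S" "\<And>i. i \<in> F ==> f i \<in> S"
 shows "h (sum f F) = (\<Sum>i\<in>F. h (f i))"
 using assms(5)
proof (induction F rule: infinite_finite_induct)
 case (insert i F)
 hence "sum f F \<in> S" by (intro sum_closed[of S, OF assms(3,4)]) auto
 thus ?case using insert assms(2)[of "f i" "sum f F"] by simp
qed (simp_all add: assms(1))

text \<open>Constants are not among the closure conditions: on the quotient all functions vanish off
  the cosets, so the constant 1 is not one of them, and the indicator of the points takes its
  place.\<close>

locale fun_algebra =
 fixes C :: "'m fn set"
 assumes alg_add: "f \<in> C ==> g \<in> C ==> (%x. f x + g x) \<in> C"
  and alg_mult: "f \<in> C ==> g \<in> C ==> (%x. f x * g x) \<in> C"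
  and alg_scale: "f \<in> C ==> (%x. c * f x) \<in> C"
  and alg_nonempty: "C \<noteq> {}"
begin

abbreviation "Der \<equiv> derivations C"

lemma alg_zero: "(%x. 0) \<in> C"
proof -
 obtain f where "f \<in> C" using alg_nonempty by blast
 thus ?thesis using alg_scale[of f 0] by simp
qed

lemma alg_zero' [simp]: "0 \<in> C" using alg_zero by (simp add: zero_fun_def)

lemma alg_lincomb: "f \<in> C ==> g \<in> C ==> (%x. a * f x + b * g x) \<in> C"
 by (intro alg_add alg_scale)

lemma alg_uminus: "f \<in> C ==> (%x. - f x) \<in> C" using alg_scale[of f "-1"] by simp

lemma alg_diff: "f \<in> C ==> g \<in> C ==> (%x. f x - g x) \<in> C" using alg_lincomb[of f g 1 "-1"] by simp

lemma alg_plus' [intro]: "f \<in> C ==> g \<in> C ==> f + g \<in> C"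
 and alg_mult' [intro]: "f \<in> C ==> g \<in> C ==> f * g \<in> C"
 and alg_diff' [intro]: "f \<in> C ==> g \<in> C ==> f - g \<in> C"
 and alg_uminus' [intro]: "f \<in> C ==> - f \<in> C"
 using alg_add[of f g] alg_mult[of f g] alg_diff[of f g] alg_uminus[of f]
 by (simp_all add: plus_fun_def times_fun_def fun_diff_def fun_Compl_def)

lemma alg_sum [intro]: "(\<And>i. i \<in> F ==> f i \<in> C) ==> sum f F \<in> C"
 by (induction F rule: infinite_finite_induct) auto

lemma Der_C [simp]: "X \<in> Der ==> f \<in> C ==> X f \<in> C"
 and Der_outside: "X \<in> Der ==> f \<notin> C ==> X f = 0"
 and Der_lin: "X \<in> Der ==> f \<in> C ==> g \<in> C ==> X (%x. a * f x + b * g x) = (%x. a * X f x + b * X g x)"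
 and Der_mult: "X \<in> Der ==> f \<in> C ==> g \<in> C ==> X (f * g) = f * X g + g * X f"
 unfolding derivations_def by auto

lemma Der_zero [simp]: "X \<in> Der ==> X 0 = 0"
proof -
 assume "X \<in> Der"
 from Der_lin[OF this alg_zero alg_zero, of 0 0] show ?thesis by (simp add: zero_fun_def)
qed

lemma Der_zero' [simp]: "X \<in> Der ==> X (%x. 0) = 0"
 using Der_zero by (simp add: zero_fun_def)

lemma Der_C': "X \<in> Der ==> X f \<in> C"
 using Der_outside[of X f] by (cases "f \<in> C") auto

lemma Der_add: "X \<in> Der ==> f \<in> C ==> g \<in> C ==> X (f + g) = X f + X g"
 and Der_diff: "X \<in> Der ==> f \<in> C ==> g \<in> C ==> X (f - g) = X f - X g"
 and Der_scale: "X \<in> Der ==> f \<in> C ==> X (%x. c * f x) = (%x. c * X f x)"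
 and Der_uminus: "X \<in> Der ==> f \<in> C ==> X (- f) = - X f"
 using Der_lin[of X f g 1 1] Der_lin[of X f g 1 "-1"] Der_lin[of X f f c 0] Der_lin[of X f f "-1" 0]
 by (simp_all add: plus_fun_def fun_diff_def fun_Compl_def)

lemma Der_add': "X \<in> Der ==> f \<in> C ==> g \<in> C ==> X (%a. f a + g a) = (%a. X f a + X g a)"
 and Der_diff'': "X \<in> Der ==> f \<in> C ==> g \<in> C ==> X (%a. f a - g a) = (%a. X f a - X g a)"
 and Der_mult': "X \<in> Der ==> f \<in> C ==> g \<in> C ==> X (%a. f a * g a) = (%a. f a * X g a + g a * X f a)"
 using Der_add[of X f g] Der_diff[of X f g] Der_mult[of X f g]
 by (simp_all add: plus_fun_def fun_diff_def times_fun_def)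

lemmas Der_simps = Der_add Der_add' Der_diff Der_diff'' Der_mult Der_mult' Der_C' Der_scale

lemma DerI:
 assumes "\<And>f. f \<in> C ==> X f \<in> C" "\<And>f. f \<notin> C ==> X f = 0"
  "\<And>f g. f \<in> C ==> g \<in> C ==> X (f + g) = X f + X g"
  "\<And>f c. f \<in> C ==> X (%x. c * f x) = (%x. c * X f x)"
  "\<And>f g. f \<in> C ==> g \<in> C ==> X (f * g) = f * X g + g * X f"
 shows "X \<in> Der"
proof -
 have "X (%x. a * f x + b * g x) = (%x. a * X f x + b * X g x)" if "f \<in> C" "g \<in> C" for a b f g
  using assms(3)[of "%x. a * f x" "%x. b * g x"] assms(4)[of f a] assms(4)[of g b] that alg_scale
  by (simp add: plus_fun_def)
 thus ?thesis using assms unfolding derivations_def by simp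
qed

lemma Der_fmul [intro]: "X \<in> Der ==> h \<in> C ==> fmul h X \<in> Der"
 by (rule DerI) (auto simp: fmul_def Der_add Der_scale Der_mult Der_outside algebra_simps fun_eq_iff)

lemma Der_cmul [intro]: "X \<in> Der ==> cmul c X \<in> Der"
 by (rule DerI) (auto simp: cmul_def Der_add Der_scale Der_mult Der_outside algebra_simps fun_eq_iff alg_scale)

lemma Der_plus [intro]: "X \<in> Der ==> Y \<in> Der ==> X + Y \<in> Der"
 by (rule DerI) (auto simp: Der_add Der_scale Der_mult Der_outside algebra_simps fun_eq_iff)

lemma Der_0 [simp]: "0 \<in> Der"
 by (rule DerI) (auto simp: fun_eq_iff)

lemma Der_neg [intro]: "X \<in> Der ==> - X \<in> Der"
 by (rule DerI) (auto simp: Der_add Der_scale Der_mult Der_outside algebra_simps fun_eq_iff)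

lemma Der_minus [intro]: "X \<in> Der ==> Y \<in> Der ==> X - Y \<in> Der"
 using Der_plus[of X "- Y"] by auto

lemma Der_Sum [intro]: "(\<And>i. i \<in> F ==> X i \<in> Der) ==> sum X F \<in> Der"
 by (induction F rule: infinite_finite_induct) auto

lemma Der_lie [intro]: "X \<in> Der ==> Y \<in> Der ==> lie X Y \<in> Der"
proof (rule DerI)
 fix f g assume XY: "X \<in> Der" "Y \<in> Der" and fg: "f \<in> C" "g \<in> C"
 have "X (Y (f * g)) = X (f * Y g + g * Y f)" "Y (X (f * g)) = Y (f * X g + g * X f)"
  using XY fg by (simp_all only: Der_mult)
 moreover have "X (f * Y g + g * Y f) = (f * X (Y g) + Y g * X f) + (g * X (Y f) + Y f * X g)"
  "Y (f * X g + g * X f) = (f * Y (X g) + X g * Y f) + (g * Y (X f) + X f * Y g)"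
  using XY fg by (simp_all only: Der_add Der_mult Der_C alg_mult')
 ultimately show "lie X Y (f * g) = f * lie X Y g + g * lie X Y f"
  by (simp only: lie_def) (simp add: algebra_simps)
qed (auto simp: lie_def Der_simps Der_outside fun_eq_iff algebra_simps)

lemma Der_subspace: "cv.subspace Der"
 by (rule cv.subspaceI) auto

lemma lie_skew: "lie X Y = - lie Y X"
 by (simp add: lie_def fun_eq_iff)

lemma lie_add_right: "X \<in> Der ==> Y \<in> Der ==> Z \<in> Der ==> lie X (Y + Z) = lie X Y + lie X Z"
 by (rule ext)+ (simp add: lie_def Der_simps algebra_simps)

lemma lie_add_left: "X \<in> Der ==> Y \<in> Der ==> Z \<in> Der ==> lie (Y + Z) X = lie Y X + lie Z X"
 by (rule ext)+ (simp add: lie_def Der_simps algebra_simps)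

lemma lie_cmul_right: "X \<in> Der ==> Y \<in> Der ==> lie X (cmul c Y) = cmul c (lie X Y)"
 by (rule ext) (simp add: lie_def cmul_def Der_scale Der_C' fun_eq_iff algebra_simps)

lemma lie_cmul_left: "X \<in> Der ==> Y \<in> Der ==> lie (cmul c Y) X = cmul c (lie Y X)"
 by (rule ext) (simp add: lie_def cmul_def Der_scale Der_C' fun_eq_iff algebra_simps)

lemma lie_fmul_right: "X \<in> Der ==> Y \<in> Der ==> h \<in> C ==> lie X (fmul h Y) = fmul (X h) Y + fmul h (lie X Y)"
 by (rule ext)+ (simp add: lie_def fmul_def Der_simps algebra_simps)

lemma lie_jacobi:
 "X \<in> Der ==> Y \<in> Der ==> Z \<in> Der ==> lie X (lie Y Z) = lie (lie X Y) Z + lie Y (lie X Z)"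
 by (rule ext)+ (simp add: lie_def Der_simps algebra_simps)

lemma lie_zero [simp]: "X \<in> Der ==> lie X 0 = 0" "X \<in> Der ==> lie 0 X = 0"
 by (simp_all add: lie_def fun_eq_iff)

end

lemma (in lie_grp) fun_algebra_PI: "fun_algebra (PI \<Gamma>)"
 by unfold_locales (use PI_add PI_mult PI_scale PI_const in \<open>blast+\<close>)

lemma (in lie_grp) fun_algebra_C: "fun_algebra C"
 by unfold_locales (use C_add C_mult C_mult[OF C_const] C_const in \<open>blast+\<close>)

section \<open>The Lie algebra of a nilpotent Lie group\<close>

context lie_grp
begin

sublocale G: fun_algebra C by (rule fun_algebra_C)

abbreviation "\<gg> \<equiv> left_invariant_fields G A"

lemma \<gg>_Der: "X \<in> \<gg> ==> X \<in> derivations C"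
 by (simp add: left_invariant_fields_def)

lemma \<gg>_at_one:
 assumes "X \<in> \<gg>" "g \<in> C"
 shows "X g y = X (%x. g (y \<otimes> x)) \<one>"
proof -
 have "translate_vf G y X = X" using assms by (simp add: left_invariant_fields_def)
 hence "X g y = translate_vf G y X g y" by simp
 thus ?thesis by (simp add: translate_vf_def translate_fn_def)
qed

text \<open>\<open>D_frame\<close> for the trivial subgroup expands \<open>X\<close> in the frame;
  by left invariance the coefficients at the unit serve at every point.\<close>

lemma \<gg>_rep:
 assumes X: "X \<in> \<gg>"
 obtains c where "X = (\<Sum>b\<in>Basis. cmul (c b) (LX b))"
proof -
 have PI1: "PI {\<one>} = C" by (auto simp: PI_def)
 interpret invariant_derivation G A "{\<one>}" X
 proof (rule invariant_derivation.intro[OF lie_grp_axioms invariant_derivation_axioms.intro])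
  show "subgroup {\<one>} G" by (rule triv_subgroup)
  show "discrete {\<one>}" by (auto simp: discrete_def isolated_in_def intro: exI[of _ UNIV])
  show "X \<in> derivations (PI {\<one>})" using X by (simp add: PI1 left_invariant_fields_def)
 qed
 obtain f where f: "\<And>g y. g \<in> C ==> X g y = (\<Sum>b\<in>Basis. f b y * LX b g y)" using D_frame unfolding PI1 by metis
 have "X g y = (\<Sum>b\<in>Basis. f b \<one> * LX b g y)" for g y
 proof (cases "g \<in> C")
  case True
  thus ?thesis using \<gg>_at_one[OF X True, of y] f[OF C_translate[OF True, of y], of \<one>] LX_translate[OF True] by simp
 next
  case False
  thus ?thesis using G.Der_outside[OF \<gg>_Der[OF X]] by (simp add: LX_def)
 qed
 hence "X = (\<Sum>b\<in>Basis. cmul (f b \<one>) (LX b))" by (simp add: fun_eq_iff sum_fun_apply cmul_apply)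
 thus ?thesis by (rule that)
qed

lemma \<gg>_subspace: "cv.subspace \<gg>"
proof (rule cv.subspaceI)
 show "0 \<in> \<gg>" by (simp add: left_invariant_fields_def translate_vf_def translate_fn_def fun_eq_iff)
next
 fix X Y assume "X \<in> \<gg>" "Y \<in> \<gg>"
 thus "X + Y \<in> \<gg>" by (auto simp: left_invariant_fields_def translate_vf_def translate_fn_def fun_eq_iff)
next
 fix c X assume "X \<in> \<gg>"
 thus "cmul c X \<in> \<gg>" by (auto simp: left_invariant_fields_def translate_vf_def translate_fn_def fun_eq_iff cmul_apply)
qed

lemma \<gg>_span: "\<gg> = cv.span (LX ` Basis)"
proof
 show "\<gg> \<subseteq> cv.span (LX ` Basis)"
 proof
  fix X assume "X \<in> \<gg>"
  then obtain c where "X = (\<Sum>b\<in>Basis. cmul (c b) (LX b))" by (rule \<gg>_rep)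
  show "X \<in> cv.span (LX ` Basis)" unfolding \<open>X = _\<close>
   by (intro cv.span_sum cv.span_scale cv.span_base imageI)
 qed
 show "cv.span (LX ` Basis) \<subseteq> \<gg>" by (rule cv.span_minimal) (auto simp: \<gg>_subspace LX_left_invariant)
qed

lemma LX_add: "LX (u + v) = LX u + LX v" and LX_scale: "LX (r *\<^sub>R v) = cmul (of_real r) (LX v)"
proof -
 have "linear (%v. fd (%w. g (y \<otimes> ex w)) (at 0) v)" if "g \<in> C" for g y
  using has_derivative_linear[OF smooth_near_has_derivative[OF C_ex[OF that, of y]]] .
 thus "LX (u + v) = LX u + LX v" "LX (r *\<^sub>R v) = cmul (of_real r) (LX v)"
  by (auto simp: LX_def fun_eq_iff cmul_apply linear_add linear_scale scaleR_conv_of_real)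
qed

section \<open>The adjoint action and the central series\<close>

definition Ad :: "'g => 'e => 'e" where
 "Ad a v = fd (%w. lc (a \<otimes> ex w \<otimes> inv a)) (at 0) v"

lemma conj_smooth: "smooth_near (%w. lc (a \<otimes> ex w \<otimes> inv a)) 0"
 by (intro smap_lc smap_mult) auto

lemma Ad_linear: "linear (Ad a)"
 using has_derivative_linear[OF smooth_near_has_derivative[OF conj_smooth]] unfolding Ad_def[abs_def] .

definition tang :: "(real => 'g) => 'e" where
 "tang \<g> = fd (%t. lc (\<g> t)) (at 0) 1"

text \<open>The total derivative is linear on \<open>(v, v) = (v, 0) + (0, v)\<close>. This is the
  product rule in a form that applies to any smooth map of two arguments, in particular to products
  in the group.\<close>

lemma frechet_derivative_diag:
 fixes H :: "'a::euclidean_space \<times> 'a => 'b::real_normed_vector"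
 assumes "smooth_near H (p, p)"
 shows "fd (%t. H (t, t)) (at p) v =
  fd (%t. H (t, p)) (at p) v + fd (%t. H (p, t)) (at p) v"
proof -
 let ?D = "fd H (at (p, p))"
 have D: "(H has_derivative ?D) (at (p, p))" by (rule smooth_near_has_derivative[OF assms])
 interpret l: bounded_linear ?D using D by (rule has_derivative_bounded_linear)
 have d: "((%t. (t, t)) has_derivative (%v. (v, v))) (at p)" "((%t. (t, p)) has_derivative (%v. (v, 0))) (at p)"
  "((%t. (p, t)) has_derivative (%v. (0, v))) (at p)" by (auto intro!: derivative_eq_intros)
 have "fd (%t. H (t, t)) (at p) v = ?D (v, v)"
  by (rule frechet_derivative_eqI, rule has_derivative_compose[OF d(1) D])
 moreover have "fd (%t. H (t, p)) (at p) v = ?D (v, 0)"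
  by (rule frechet_derivative_eqI, rule has_derivative_compose[OF d(2) D])
 moreover have "fd (%t. H (p, t)) (at p) v = ?D (0, v)"
  by (rule frechet_derivative_eqI, rule has_derivative_compose[OF d(3) D])
 ultimately show ?thesis using l.add[of "(v, 0)" "(0, v)"] by simp
qed

lemma tang_conj:
 assumes "smap \<g> 0" "\<g> 0 = \<one>"
 shows "tang (%t. a \<otimes> \<g> t \<otimes> inv a) = Ad a (tang \<g>)"
proof -
 obtain N where N: "open N" "0 \<in> N" "\<And>t. t \<in> N ==> \<g> t \<in> fst one_chart"
  using smap_open_vimage[OF assms(1) chart_open(1)[OF one_chart(1)]] assms(2) one_chart(2) by metis
 have "tang (%t. a \<otimes> \<g> t \<otimes> inv a) = fd (%t. lc (a \<otimes> ex (lc (\<g> t)) \<otimes> inv a)) (at 0) 1"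
  unfolding tang_def by (subst frechet_derivative_cong_open[OF N(1,2)]) (simp_all add: ex_lc N(3))
 also have "\<dots> = fd (%w. lc (a \<otimes> ex w \<otimes> inv a)) (at (lc (\<g> 0))) (tang \<g>)"
  unfolding tang_def
  by (rule frechet_derivative_compose_near[of "%t. lc (\<g> t)" 0 "%w. lc (a \<otimes> ex w \<otimes> inv a)"])
   (use assms conj_smooth in \<open>auto intro: smap_lc\<close>)
 finally show ?thesis using assms by (simp add: Ad_def)
qed

lemma smooth_prod_curve:
 fixes \<g> \<d> :: "real => 'g"
 assumes "smap \<g> 0" "smap \<d> 0" "\<g> 0 = \<one>" "\<d> 0 = \<one>"
 shows "tang (%t. \<g> t \<otimes> \<d> t) = tang \<g> + tang \<d>"
proof -
 have "smooth_near (%z. lc (\<g> (fst z) \<otimes> \<d> (snd z))) (0, 0)"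
  by (intro smap_lc smap_mult smap_compose[of \<g> fst] smap_compose[of \<d> snd] smooth_near_fst smooth_near_snd)
   (use assms in auto)
 from frechet_derivative_diag[OF this, of 1] show ?thesis using assms by (simp add: tang_def)
qed

lemma tang_const [simp]: "tang (%t. a) = 0"
 by (simp add: tang_def)

text \<open>Velocities of curves through the unit add under products, and the commutator is the
  conjugated curve times the inverse curve.\<close>

lemma tang_commutator:
 assumes "smap \<g> 0" "\<g> 0 = \<one>"
 shows "tang (%t. a \<otimes> \<g> t \<otimes> inv a \<otimes> inv (\<g> t)) = Ad a (tang \<g>) - tang \<g>"
proof -
 have i: "smap (%t. inv (\<g> t)) 0" by (intro smap_inv assms)
 have "tang (%t. \<g> t \<otimes> inv (\<g> t)) = tang \<g> + tang (%t. inv (\<g> t))"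
  by (rule smooth_prod_curve[OF assms(1) i]) (use assms in auto)
 hence "tang (%t. inv (\<g> t)) = - tang \<g>" by (simp add: add_eq_0_iff2)
 moreover have "tang (%t. (a \<otimes> \<g> t \<otimes> inv a) \<otimes> inv (\<g> t)) = tang (%t. a \<otimes> \<g> t \<otimes> inv a) + tang (%t. inv (\<g> t))"
  by (rule smooth_prod_curve[OF _ i]) (use assms in \<open>auto intro!: smap_mult\<close>)
 ultimately show ?thesis using tang_conj[OF assms, of a] by simp
qed

text \<open>The upper central series of the Lie algebra, expressed by \<open>Ad\<close> of all group
  elements rather than by the bracket, so that it can be compared with the commutators of the
  abstract group.\<close>

primrec ucs :: "nat => 'e set" where
 "ucs 0 = {0}"
| "ucs (Suc j) = {v. \<forall>a. Ad a v - v \<in> ucs j}"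

lemma ucs_subspace: "subspace (ucs j)"
proof (induction j)
 case (Suc j)
 show ?case unfolding subspace_def
 proof (intro conjI allI ballI)
  show "0 \<in> ucs (Suc j)" using Suc by (simp add: linear_0[OF Ad_linear] subspace_0)
 next
  fix x y assume xy: "x \<in> ucs (Suc j)" "y \<in> ucs (Suc j)"
  have "Ad a (x + y) - (x + y) = (Ad a x - x) + (Ad a y - y)" for a by (simp add: linear_add[OF Ad_linear])
  thus "x + y \<in> ucs (Suc j)" using xy Suc
   by (simp only: ucs.simps mem_Collect_eq) (simp add: subspace_add)
 next
  fix r x assume x: "x \<in> ucs (Suc j)"
  have "Ad a (r *\<^sub>R x) - r *\<^sub>R x = r *\<^sub>R (Ad a x - x)" for a
   by (simp add: linear_scale[OF Ad_linear] scaleR_diff_right)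
  thus "r *\<^sub>R x \<in> ucs (Suc j)" using x Suc
   by (simp only: ucs.simps mem_Collect_eq) (simp add: subspace_scale)
 qed
qed simp

text \<open>The commutator of \<open>a\<close> with a curve in term \<open>i\<close> of the lower
  central series runs in term \<open>Suc i\<close>, and its velocity is \<open>Ad a v - v\<close>.
  Arguing with curves avoids any question about these terms being closed subgroups.\<close>

lemma tang_ucs:
 assumes "lower_central_series G c = {\<one>}"
 shows "smap \<g> 0 ==> \<g> 0 = \<one> ==> (\<And>t. \<g> t \<in> lower_central_series G i) ==> i + j = c ==> tang \<g> \<in> ucs j"
proof (induction j arbitrary: i \<g>)
 case 0
 hence "\<g> = (%t. \<one>)" using assms by auto
 thus ?case by simp
next
 case (Suc j)
 have "tang (%t. a \<otimes> \<g> t \<otimes> inv a \<otimes> inv (\<g> t)) \<in> ucs j" for a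
 proof (rule Suc.IH[of _ "Suc i"])
  show "smap (%t. a \<otimes> \<g> t \<otimes> inv a \<otimes> inv (\<g> t)) 0"
   by (intro smap_mult smap_inv smap_const Suc.prems)
  show "a \<otimes> \<g> t \<otimes> inv a \<otimes> inv (\<g> t) \<in> lower_central_series G (Suc i)" for t
   unfolding lower_central_series.simps
   by (rule generate.incl) (use Suc.prems(3)[of t] in auto)
 qed (use Suc.prems in auto)
 thus ?case using tang_commutator[OF Suc.prems(1,2)] by simp
qed

lemma tang_ex: "smap (%t. ex (t *\<^sub>R v)) 0" "tang (%t. ex (t *\<^sub>R v)) = v"
proof -
 have "smooth_near (%t. t *\<^sub>R v) (0::real)" by (intro smooth_near_scaleR smooth_near_ident smooth_near_const)
 thus "smap (%t. ex (t *\<^sub>R v)) 0" using smap_compose[of ex "%t. t *\<^sub>R v" "0::real"] by simp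
 obtain N where N: "open N" "0 \<in> N" "\<And>w. w \<in> N ==> lc (ex w) = w" using lc_ex by metis
 have o: "open ((%t::real. t *\<^sub>R v) -` N)" by (rule open_vimage[OF N(1)]) (intro continuous_intros)
 have "fd (%t. lc (ex (t *\<^sub>R v))) (at 0) 1 = fd (%t. t *\<^sub>R v) (at (0::real)) 1"
  by (subst frechet_derivative_cong_open[OF o]) (use N in auto)
 also have "\<dots> = 1 *\<^sub>R v"
  by (rule frechet_derivative_eqI) (auto intro!: derivative_eq_intros)
 finally show "tang (%t. ex (t *\<^sub>R v)) = v" by (simp add: tang_def)
qed

lemma ucs_UNIV:
 assumes "lower_central_series G c = {\<one>}"
 shows "ucs c = UNIV"
proof -
 have "v \<in> ucs c" for v
  using tang_ucs[OF assms tang_ex(1)[of v], of 0 c] tang_ex(2)[of v] by simp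
 thus ?thesis by blast
qed

end

section \<open>The bracket of left-invariant fields as the derivative of the adjoint action\<close>

context lie_grp
begin

text \<open>The differential of \<open>Ad\<close> at the unit; \<open>lie_LX\<close> identifies it
  with the bracket of left-invariant fields.\<close>

definition bk :: "'e => 'e => 'e" where
 "bk u v = fd (%w. Ad (ex w) v) (at 0) u"

lemma conj_smooth2: "smooth_near (%z. lc (ex (fst z) \<otimes> ex (snd z) \<otimes> inv (ex (fst z)))) (0, 0)"
 by (intro smap_lc smap_mult smap_inv smap_compose[of ex fst] smap_compose[of ex snd] smooth_near_fst smooth_near_snd) auto

lemma Ad_smooth: "smooth_near (%w. Ad (ex w) v) 0"
proof -
 let ?K = "%z. lc (ex (fst z) \<otimes> ex (snd z) \<otimes> inv (ex (fst z)))"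
 obtain N where N: "open N" "(0, 0) \<in> N" "\<And>z. z \<in> N ==> smooth_near ?K z"
  using smooth_near_open[OF conj_smooth2] by blast
 have o: "open ((%w. (w, 0)) -` N)" by (rule open_vimage[OF N(1)]) (intro continuous_intros)
 have "smooth_near (%w. fd ?K (at (w, 0)) (0, v)) 0"
  by (rule smooth_near_compose[where g = "%y. fd ?K (at y) (0, v)"])
   (use conj_smooth2 in \<open>auto intro!: smooth_near_Pair smooth_near_frechet\<close>)
 thus ?thesis
 proof (rule smooth_near_cong[OF _ o])
  fix w assume "w \<in> (%w. (w, 0)) -` N"
  hence "smooth_near ?K (w, 0)" using N(3) by simp
  from frechet_derivative_partial[OF this, of v]
  show "fd ?K (at (w, 0)) (0, v) = Ad (ex w) v" by (simp add: Ad_def)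
 qed (use N in simp)
qed

lemma frechet_derivative_sub:
 fixes F :: "'a::euclidean_space => 'b::euclidean_space"
 assumes "smooth_near K (F p)" "(F has_derivative F') (at p)"
 shows "fd (%x. K (F x)) (at p) v = fd K (at (F p)) (F' v)"
 by (rule frechet_derivative_eqI, rule has_derivative_compose[OF assms(2) smooth_near_has_derivative[OF assms(1)]])

lemma deriv_inv_ex:
 assumes "g \<in> C"
 shows "fd (%w. g (y \<otimes> inv (ex w))) (at 0) u = - LX u g y"
proof -
 have "smooth_near (%z. g (y \<otimes> ex (fst z) \<otimes> inv (ex (snd z)))) (0, 0)"
  by (intro C_smooth[OF assms] smap_mult smap_inv smap_compose[of ex fst] smap_compose[of ex snd] smooth_near_fst smooth_near_snd) auto
 from frechet_derivative_diag[OF this, of u] assms show ?thesis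
  by (simp add: LX_def add_eq_0_iff)
qed

text \<open>Differentiate \<open>g (y \<otimes> ex p \<otimes> ex s \<otimes> inv (ex q))\<close> in
  \<open>s\<close> along \<open>v\<close>, then in \<open>(p, q)\<close> along \<open>u\<close>. The
  diagonal \<open>p = q\<close> gives the derivative of \<open>Ad\<close>, \<open>p\<close> alone
  gives \<open>LX u (LX v g)\<close>, and \<open>q\<close> alone gives
  \<open>- LX v (LX u g)\<close>; \<open>frechet_derivative_diag\<close> compares the three.\<close>

lemma lie_LX:
 assumes g: "g \<in> C"
 shows "lie (LX u) (LX v) g y = LX (bk u v) g y"
proof -
 define K where "K = (%z. g (y \<otimes> ex (fst (fst z)) \<otimes> ex (snd z) \<otimes> inv (ex (snd (fst z)))))"
 have K: "smooth_near K ((0, 0), 0)"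
  unfolding K_def
  by (intro C_smooth[OF g] smap_mult smap_inv smap_compose[of ex "%z. fst (fst z)"] smap_compose[of ex "%z. snd (fst z)"]
    smap_compose[of ex snd] smooth_near_snd smooth_near_compose[of fst _ fst] smooth_near_compose[of fst _ snd] smooth_near_fst) auto
 obtain N where N: "open N" "((0, 0), 0) \<in> N" "\<And>z. z \<in> N ==> smooth_near K z"
  using smooth_near_open[OF K] by blast
 define H where "H = (%z. fd K (at (z, 0)) ((0, 0), v))"
 have H: "smooth_near H (0, 0)" unfolding H_def
  by (rule smooth_near_compose[where g = "%y. fd K (at y) ((0, 0), v)"])
   (use K in \<open>auto intro!: smooth_near_Pair smooth_near_frechet\<close>)
 have Hp: "H z = fd (%s. K (z, s)) (at 0) v" if "(z, 0) \<in> N" for z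
  unfolding H_def using frechet_derivative_partial[OF N(3)[OF that], of v] by (simp add: zero_prod_def)
 have o: "open ((%w. ((w, w), 0)) -` N)" "open ((%w. ((w, 0), 0)) -` N)"
  by (rule open_vimage[OF N(1)], intro continuous_intros)+
 have 1: "fd (%w. H (w, w)) (at 0) u = LX (bk u v) g y"
 proof -
  have l: "(%x. LX x g y) = fd (%w. g (y \<otimes> ex w)) (at 0)" using g by (simp add: LX_def)
  have bl: "bounded_linear (%x. LX x g y)"
   unfolding l by (rule has_derivative_bounded_linear[OF smooth_near_has_derivative[OF C_ex[OF g]]])
  have A: "fd (%w. H (w, w)) (at 0) = fd (%w. LX (Ad (ex w) v) g y) (at 0)"
  proof (rule frechet_derivative_cong_open[OF o(1)])
   fix w assume "w \<in> (%w. ((w, w), 0)) -` N"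
   hence "((w, w), 0) \<in> N" by simp
   hence "H (w, w) = fd (%s. g (y \<otimes> (ex w \<otimes> ex s \<otimes> inv (ex w)))) (at 0) v"
    by (simp add: Hp K_def)
   also have "\<dots> = LX (Ad (ex w) v) g y"
    unfolding Ad_def by (rule LX_curve[OF g]) (auto intro!: smap_mult)
   finally show "H (w, w) = LX (Ad (ex w) v) g y" .
  qed (use N in simp)
  show ?thesis
   unfolding bk_def A
   by (rule frechet_derivative_eqI, rule bounded_linear.has_derivative[OF bl])
    (rule smooth_near_has_derivative[OF Ad_smooth])
 qed
 have 2: "fd (%w. H (w, 0)) (at 0) u = LX u (LX v g) y"
 proof -
  have "fd (%w. H (w, 0)) (at 0) = fd (%w. LX v g (y \<otimes> ex w)) (at 0)"
  proof (rule frechet_derivative_cong_open[OF o(2)])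
   fix w assume "w \<in> (%w. ((w, 0), 0)) -` N"
   hence "((w, 0), 0) \<in> N" by simp
   thus "H (w, 0) = LX v g (y \<otimes> ex w)"
    using g by (simp add: Hp K_def LX_def)
  qed (use N in simp)
  thus ?thesis using LX_C[OF g] by (simp add: LX_def)
 qed
 \<comment> \<open>Here the derivative in \<open>s\<close> comes before the one in \<open>w\<close>.
   Symmetry of second derivatives exchanges them, after which the inner one is computed by
   \<open>deriv_inv_ex\<close>.\<close>
 have 3: "fd (%w. H (0, w)) (at 0) u = - LX v (LX u g) y"
 proof -
  have "fd (%w. H (0, w)) (at 0) u = fd H (at (0, 0)) (0, u)"
   by (rule frechet_derivative_partial[OF H])
  also have "\<dots> = fd (%z. fd K (at z) ((0, 0), v)) (at ((0, 0), 0)) ((0, u), 0)"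
   unfolding H_def
   by (rule frechet_derivative_sub[of "%z. fd K (at z) ((0, 0), v)" "%z. (z, 0)" _ "%z. (z, 0)"])
    (auto intro!: smooth_near_frechet K derivative_eq_intros)
  also have "\<dots> = fd (%z. fd K (at z) ((0, u), 0)) (at ((0, 0), 0)) ((0, 0), v)"
   by (rule frechet_derivative_symmetric[OF K])
  also have "\<dots> = fd (%s. fd K (at ((0, 0), s)) ((0, u), 0)) (at 0) v"
   by (rule frechet_derivative_sub[symmetric, of "%z. fd K (at z) ((0, u), 0)" "%s. ((0, 0), s)" _ "%s. ((0, 0), s)"])
    (auto intro!: smooth_near_frechet K derivative_eq_intros simp: zero_prod_def)
  also have "fd (%s. fd K (at ((0, 0), s)) ((0, u), 0)) (at 0) =
    fd (%s. - LX u g (y \<otimes> ex s)) (at 0)"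
  proof (rule frechet_derivative_cong_open[of "(%s. ((0, 0), s)) -` N"])
   show "open ((%s. ((0, 0), s)) -` N)" by (rule open_vimage[OF N(1)]) (intro continuous_intros)
   fix s assume "s \<in> (%s. ((0, 0), s)) -` N"
   hence s: "smooth_near K ((0, 0), s)" using N(3) by simp
   have "fd (%w. K ((0, w), s)) (at 0) u = fd K (at ((0, 0), s)) ((0, u), 0)"
    by (rule frechet_derivative_sub[of K "%w. ((0, w), s)" 0 "%w. ((0, w), 0)"])
     (use s in \<open>auto intro!: derivative_eq_intros\<close>)
   moreover have "fd (%w. K ((0, w), s)) (at 0) u = - LX u g (y \<otimes> ex s)"
    using deriv_inv_ex[OF g, of "y \<otimes> ex s" u] by (simp add: K_def)
   ultimately show "fd K (at ((0, 0), s)) ((0, u), 0) = - LX u g (y \<otimes> ex s)" by simp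
  qed (use N in \<open>simp add: zero_prod_def\<close>)
  also have "fd (%s. - LX u g (y \<otimes> ex s)) (at 0) v = - fd (%s. LX u g (y \<otimes> ex s)) (at 0) v"
   by (rule frechet_derivative_eqI, rule has_derivative_minus, rule smooth_near_has_derivative, rule C_ex[OF LX_C[OF g]])
  finally show ?thesis using LX_C[OF g] by (simp add: LX_def)
 qed
 show ?thesis
  using frechet_derivative_diag[OF H, of u] 1 2 3 by (simp add: lie_def)
qed

lemma lie_LX': "lie (LX u) (LX v) = LX (bk u v)"
proof
 fix g
 show "lie (LX u) (LX v) g = LX (bk u v) g"
 proof (cases "g \<in> C")
  case True
  thus ?thesis using lie_LX by (simp add: fun_eq_iff)
 next
  case False
  have "LX u 0 = 0" "LX v 0 = 0"
   using G.Der_zero[OF \<gg>_Der[OF LX_left_invariant]] by auto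
  thus ?thesis using False by (simp add: lie_def LX_def)
 qed
qed

text \<open>The map \<open>Ad (ex w) v - v\<close> stays in the subspace \<open>ucs j\<close>, hence
  so does its derivative at 0. The subspace is tested through its orthogonal complement, where the
  functions to be differentiated are identically 0.\<close>

lemma bk_ucs:
 assumes "v \<in> ucs (Suc j)"
 shows "bk u v \<in> ucs j"
proof -
 have s: "(ucs j)\<^sup>\<bottom>\<^sup>\<bottom> = ucs j" by (rule orthogonal_comp_self[OF ucs_subspace])
 have "bk u v \<bullet> z = 0" if z: "z \<in> (ucs j)\<^sup>\<bottom>" for z
 proof -
  have "((%w. (Ad (ex w) v - v) \<bullet> z) has_derivative (%u. (bk u v - 0) \<bullet> z)) (at 0)"
   unfolding bk_def
   by (intro has_derivative_inner_left has_derivative_diff has_derivative_const smooth_near_has_derivative Ad_smooth)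
  moreover have "(Ad (ex w) v - v) \<bullet> z = 0" for w
   using assms z by (auto simp: orthogonal_comp_def orthogonal_def)
  ultimately have "((%w. 0) has_derivative (%u. (bk u v - 0) \<bullet> z)) (at 0)" by simp
  from has_derivative_unique[OF this has_derivative_const] show ?thesis by (metis diff_zero)
 qed
 hence "bk u v \<in> (ucs j)\<^sup>\<bottom>\<^sup>\<bottom>" by (auto simp: orthogonal_comp_def orthogonal_def inner_commute)
 thus ?thesis by (simp add: s)
qed

lemma \<gg>_lie: "X \<in> \<gg> ==> Y \<in> \<gg> ==> lie X Y \<in> \<gg>"
proof -
 assume X: "X \<in> \<gg>" and Y: "Y \<in> \<gg>"
 have t: "translate_fn G a (X' f) = X' (translate_fn G a f)" if X': "X' \<in> \<gg>" for X' a f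
 proof -
  have "translate_vf G (inv a) X' = X'" using X' by (simp add: left_invariant_fields_def)
  hence "X' (translate_fn G a f) = translate_vf G (inv a) X' (translate_fn G a f)" by simp
  thus ?thesis by (simp add: translate_vf_def translate_fn_def)
 qed
 have tt: "translate_fn G (inv a) (translate_fn G a f) = f" for a and f :: "'g fn" by (simp add: translate_fn_def)
 have td: "translate_fn G a (f - h) = translate_fn G a f - translate_fn G a h" for a and f h :: "'g fn"
  by (simp add: translate_fn_def fun_eq_iff)
 have "translate_vf G a (lie X Y) = lie X Y" for a
  by (rule ext) (simp add: translate_vf_def lie_def td t[OF X] t[OF Y] tt)
 thus ?thesis using G.Der_lie[OF \<gg>_Der[OF X] \<gg>_Der[OF Y]] by (simp add: left_invariant_fields_def)
qed

text \<open>The series \<open>ucs\<close> consists of real subspaces; their complex spans filter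
  \<open>\<gg>\<close>, and bilinearity of the bracket reduces the claim to
  \<open>bk_ucs\<close>.\<close>

lemma lie_span_ucs:
 assumes X: "X \<in> \<gg>" and Y: "Y \<in> cv.span (LX ` ucs (Suc j))"
 shows "lie X Y \<in> cv.span (LX ` ucs j)"
proof -
 let ?S = "cv.span (LX ` ucs j)"
 have sub: "cv.subspace {Y \<in> derivations C. lie X Y \<in> ?S}" if X: "X \<in> derivations C" for X
 proof (rule cv.subspaceI)
  show "0 \<in> {Y \<in> derivations C. lie X Y \<in> ?S}" using G.lie_zero[OF X] by (simp add: cv.span_zero)
  show "Y + Z \<in> {Y \<in> derivations C. lie X Y \<in> ?S}"
   if "Y \<in> {Y \<in> derivations C. lie X Y \<in> ?S}" "Z \<in> {Y \<in> derivations C. lie X Y \<in> ?S}" for Y Z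
   using that G.lie_add_right[OF X] by (auto intro: cv.span_add)
  show "cmul c Y \<in> {Y \<in> derivations C. lie X Y \<in> ?S}"
   if "Y \<in> {Y \<in> derivations C. lie X Y \<in> ?S}" for c Y
   using that G.lie_cmul_right[OF X] by (auto intro: cv.span_scale)
 qed
 have 1: "lie (LX b) Y \<in> ?S" for b
 proof -
  have "cv.span (LX ` ucs (Suc j)) \<subseteq> {Y \<in> derivations C. lie (LX b) Y \<in> ?S}"
  proof (rule cv.span_minimal[OF _ sub])
   show "LX ` ucs (Suc j) \<subseteq> {Y \<in> derivations C. lie (LX b) Y \<in> ?S}"
    using \<gg>_Der[OF LX_left_invariant] bk_ucs by (auto simp: lie_LX' intro!: cv.span_base imageI simp del: ucs.simps)
  qed (rule \<gg>_Der[OF LX_left_invariant])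
  thus ?thesis using Y by blast
 qed
 have Yd: "Y \<in> derivations C"
  using Y cv.span_minimal[of "LX ` ucs (Suc j)" "derivations C"] G.Der_subspace \<gg>_Der[OF LX_left_invariant] by blast
 have "cv.subspace {X \<in> derivations C. lie X Y \<in> ?S}"
 proof (rule cv.subspaceI)
  show "0 \<in> {X \<in> derivations C. lie X Y \<in> ?S}" using G.lie_zero[OF Yd] by (simp add: cv.span_zero)
  show "X + Z \<in> {X \<in> derivations C. lie X Y \<in> ?S}"
   if "X \<in> {X \<in> derivations C. lie X Y \<in> ?S}" "Z \<in> {X \<in> derivations C. lie X Y \<in> ?S}" for X Z
   using that G.lie_add_left[OF Yd] by (auto intro: cv.span_add)
  show "cmul c X \<in> {X \<in> derivations C. lie X Y \<in> ?S}"
   if "X \<in> {X \<in> derivations C. lie X Y \<in> ?S}" for c X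
   using that G.lie_cmul_left[OF Yd] by (auto intro: cv.span_scale)
 qed
 hence "cv.span (LX ` Basis) \<subseteq> {X \<in> derivations C. lie X Y \<in> ?S}"
  by (intro cv.span_minimal) (use 1 \<gg>_Der[OF LX_left_invariant] in auto)
 thus ?thesis using X by (auto simp: \<gg>_span)
qed

theorem \<gg>_nilpotent:
 assumes "nilpotent_group G"
 shows "\<exists>k. \<forall>Xs Y. length Xs = k --> set Xs \<subseteq> \<gg> --> Y \<in> \<gg> --> foldr lie Xs Y = 0"
proof -
 obtain c where "lower_central_series G c = {\<one>}" using assms by (auto simp: nilpotent_group_def)
 hence U: "ucs c = UNIV" by (rule ucs_UNIV)
 have a: "foldr lie Xs Y \<in> cv.span (LX ` ucs j)"
  if "length Xs + j = c" "set Xs \<subseteq> \<gg>" "Y \<in> \<gg>" for Xs Y j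
  using that
 proof (induction Xs arbitrary: j)
  case Nil
  have "cv.span (LX ` Basis) \<subseteq> cv.span (range LX)" by (rule cv.span_mono) auto
  thus ?case using Nil U by (auto simp: \<gg>_span)
 next
  case (Cons X Xs)
  thus ?case using lie_span_ucs[of X "foldr lie Xs Y" j] by (simp del: ucs.simps)
 qed
 have "LX ` ucs 0 = {0}" by (auto simp: LX_scale[of 0 0, simplified])
 hence "foldr lie Xs Y = 0" if "length Xs = c" "set Xs \<subseteq> \<gg>" "Y \<in> \<gg>" for Xs Y
  using a[of Xs 0 Y] that by simp
 thus ?thesis by blast
qed

end

section \<open>The quotient by a lattice\<close>

text \<open>
 What the rest of the proof uses about a nilmanifold: \<open>I\<close> is a finite-dimensional nilpotent Lie
 algebra of vector fields that frames the tangent bundle over the function algebra.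
\<close>
locale framed_manifold =
 fixes M :: "('m, 'z) complex_manifold_scheme" and I :: "'m vf set"
 assumes alg: "fun_algebra (Cinf M)"
  and unit_C: "(%x. if x \<in> points M then 1 else 0) \<in> Cinf M"
  and off_points: "\<And>f x. f \<in> Cinf M ==> x \<notin> points M ==> f x = 0"
  and points_ne: "points M \<noteq> {}"
  and I_subspace: "cv.subspace I" and I_Der: "I \<subseteq> derivations (Cinf M)"
  and I_frame: "\<exists>F. finite F \<and> F \<subseteq> I \<and> I = cv.span F \<and>
   (\<forall>Y\<in>derivations (Cinf M). \<exists>f. (\<forall>i\<in>F. f i \<in> Cinf M) \<and> Y = (\<Sum>i\<in>F. fmul (f i) i))"
  and I_point: "\<And>Y c. Y \<in> I ==> c \<in> points M ==> (\<And>f. f \<in> Cinf M ==> Y f c = 0) ==> Y = 0"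
  and I_lie: "\<And>X Y. X \<in> I ==> Y \<in> I ==> lie X Y \<in> I"
  and I_nilpotent: "\<exists>k. \<forall>Xs Y. length Xs = k --> set Xs \<subseteq> I --> Y \<in> I --> foldr lie Xs Y = 0"
  and J_Der: "\<And>Y. Y \<in> derivations (Cinf M) ==> Jop M Y \<in> derivations (Cinf M)"
  and J_lin: "\<And>f X Y. f \<in> Cinf M ==> X \<in> derivations (Cinf M) ==> Y \<in> derivations (Cinf M) ==>
   Jop M (fmul f X + Y) = fmul f (Jop M X) + Jop M Y"
  and J_J: "\<And>Y. Y \<in> derivations (Cinf M) ==> Jop M (Jop M Y) = - Y"
  and J_I: "\<And>Y. Y \<in> I ==> Jop M Y \<in> I"
  and J_int: "\<And>X Y. X \<in> derivations (Cinf M) ==> Y \<in> derivations (Cinf M) ==>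
   lie (Jop M X) (Jop M Y) = lie X Y + Jop M (lie (Jop M X) Y + lie X (Jop M Y))"

locale nilmfd = lie_grp G A for G :: "('g::{t2_space, second_countable_topology}, 'r) monoid_scheme" (structure)
  and A :: "('g, 'e::euclidean_space) chart set" +
 fixes \<Gamma> :: "'g set" and J :: "'g vf => 'g vf"
 assumes lattice: "subgroup \<Gamma> G" "discrete \<Gamma>"
  and J_inv: "left_invariant_complex_structure G A J"
  and nilp: "nilpotent_group G"
begin

section \<open>Functions and fields on the quotient and their lifts\<close>

abbreviation "Q \<equiv> quotient_functions G A \<Gamma>"
abbreviation "MM \<equiv> nilmanifold G A \<Gamma> J"
abbreviation "proj \<equiv> projects_to G A \<Gamma>"

definition up :: "'g set fn => 'g fn" where "up f = (%x. f (\<Gamma> #> x))"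

definition down :: "'g fn => 'g set fn" where
 "down p = (%c. if c \<in> rcosets \<Gamma> then p (SOME x. x \<in> c) else 0)"

lemma coset_in: "\<Gamma> #> x \<in> rcosets \<Gamma>"
 by (auto simp: RCOSETS_def)

lemma coset_eqI: "z \<in> \<Gamma> #> x ==> \<Gamma> #> z = \<Gamma> #> x"
 using repr_independence[OF _ _ lattice(1), of z x] by simp

lemma self_in: "x \<in> \<Gamma> #> x"
 using rcos_self[OF _ lattice(1), of x] by simp

lemma coset_repr: "c \<in> rcosets \<Gamma> ==> \<Gamma> #> (SOME x. x \<in> c) = c"
proof -
 assume "c \<in> rcosets \<Gamma>"
 then obtain x where x: "c = \<Gamma> #> x" by (auto simp: RCOSETS_def)
 hence "(SOME x. x \<in> c) \<in> c" using self_in by (metis someI)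
 thus ?thesis using coset_eqI x by auto
qed

lemma up_PI: "f \<in> Q ==> up f \<in> PI \<Gamma>"
proof -
 assume f: "f \<in> Q"
 have "\<Gamma> #> (\<g> \<otimes> x) = \<Gamma> #> x" if "\<g> \<in> \<Gamma>" for \<g> x
  by (rule coset_eqI) (use that in \<open>auto simp: r_coset_def\<close>)
 thus ?thesis using f by (auto simp: quotient_functions_def PI_def up_def)
qed

lemma up_down: "p \<in> PI \<Gamma> ==> up (down p) = p"
proof
 fix x assume p: "p \<in> PI \<Gamma>"
 have "(SOME z. z \<in> \<Gamma> #> x) \<in> \<Gamma> #> x" using self_in[of x] by (rule someI)
 then obtain \<g> where "\<g> \<in> \<Gamma>" "(SOME z. z \<in> \<Gamma> #> x) = \<g> \<otimes> x" by (auto simp: r_coset_def)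
 thus "up (down p) x = p x" using p by (simp add: up_def down_def coset_in PI_inv)
qed

lemma Q_off: "f \<in> Q ==> c \<notin> rcosets \<Gamma> ==> f c = 0"
 by (simp add: quotient_functions_def)

lemma down_Q: "p \<in> PI \<Gamma> ==> down p \<in> Q"
 using up_down[of p] PI_C[of p \<Gamma>] by (simp add: quotient_functions_def up_def down_def)

lemma up_inj: "f \<in> Q ==> h \<in> Q ==> up f = up h ==> f = h"
proof
 fix c assume *: "f \<in> Q" "h \<in> Q" "up f = up h"
 show "f c = h c"
 proof (cases "c \<in> rcosets \<Gamma>")
  case True
  hence "f c = up f (SOME x. x \<in> c)" "h c = up h (SOME x. x \<in> c)" by (simp_all add: up_def coset_repr)
  thus ?thesis using * by simp
 next
  case False
  thus ?thesis using Q_off[OF *(1)] Q_off[OF *(2)] by simp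
 qed
qed

lemma down_up: "f \<in> Q ==> down (up f) = f"
 by (rule up_inj) (simp_all add: down_Q up_PI up_down)

lemma fun_algebra_Q: "fun_algebra Q"
proof
 have z: "(%x. 0) \<in> C" by (rule C_const)
 show "Q \<noteq> {}" using z by (auto simp: quotient_functions_def intro: exI[of _ "%_. 0"])
qed (auto simp: quotient_functions_def intro: C_add C_mult C_mult[OF C_const])

sublocale Q: fun_algebra Q by (rule fun_algebra_Q)
sublocale P: fun_algebra "PI \<Gamma>" by (rule fun_algebra_PI)

lemma Q_if: "(%x. f (\<Gamma> #> x)) \<in> C ==> (\<And>c. c \<notin> rcosets \<Gamma> ==> f c = 0) ==> f \<in> Q"
 by (simp add: quotient_functions_def)

lemma up_simps: "up (f + h) = up f + up h" "up (f * h) = up f * up h" "up (%c. a * f c) = (%x. a * up f x)"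
 "up (- f) = - up f" "up 0 = 0" "up (f - h) = up f - up h"
 by (simp_all add: up_def fun_eq_iff)

lemma down_simps: "down (p + q) = down p + down q" "down (p * q) = down p * down q"
 "down (%c. a * p c) = (%x. a * down p x)"
 by (simp_all add: down_def fun_eq_iff)

lemma projD: "proj X Y ==> f \<in> Q ==> X (up f) = up (Y f)"
 and projD1: "proj X Y ==> X \<in> derivations C"
 and projD2: "proj X Y ==> Y \<in> derivations Q"
 by (auto simp: projects_to_def up_def fun_eq_iff)

lemma projI: "X \<in> derivations C ==> Y \<in> derivations Q ==> (\<And>f. f \<in> Q ==> X (up f) = up (Y f)) ==> proj X Y"
 by (auto simp: projects_to_def up_def fun_eq_iff)

lemma proj_unique: "proj X Y ==> proj X Y' ==> Y = Y'"
proof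
 fix f assume *: "proj X Y" "proj X Y'"
 note D = projD2[OF *(1)] projD2[OF *(2)]
 show "Y f = Y' f"
 proof (cases "f \<in> Q")
  case True
  thus ?thesis using projD[OF *(1)] projD[OF *(2)] D by (intro up_inj) auto
 qed (simp add: Q.Der_outside[OF D(1)] Q.Der_outside[OF D(2)])
qed

lemma dual_test:
 obtains \<t> where "\<And>b. \<t> b \<in> PI \<Gamma>" "\<And>b v. LX v (\<t> b) y = complex_of_real (v \<bullet> b)"
proof -
 interpret invariant_derivation G A \<Gamma> 0
  by (rule invariant_derivation.intro[OF lie_grp_axioms invariant_derivation_axioms.intro[OF lattice P.Der_0]])
 show ?thesis using dual_functions that by metis
qed

lemma dual_coef:
 assumes "\<And>b. \<t> b \<in> PI \<Gamma>" "\<And>b v. LX v (\<t> b) y = complex_of_real (v \<bullet> b)" "b \<in> Basis"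
 shows "(\<Sum>b'\<in>Basis. k b' * LX b' (\<t> b) y) = k b"
proof -
 have "(\<Sum>b'\<in>Basis. k b' * LX b' (\<t> b) y) = (\<Sum>b'\<in>Basis. if b' = b then k b else 0)"
  by (rule sum.cong) (use assms in \<open>auto simp: inner_Basis\<close>)
 thus ?thesis using assms by simp
qed

lemma Der_C_rep:
 assumes "X \<in> derivations C"
 obtains f where "\<And>b. b \<in> Basis ==> f b \<in> C" "\<And>g y. g \<in> C ==> X g y = (\<Sum>b\<in>Basis. f b y * LX b g y)"
proof -
 have PI1: "PI {\<one>} = C" by (auto simp: PI_def)
 interpret invariant_derivation G A "{\<one>}" X
 proof (rule invariant_derivation.intro[OF lie_grp_axioms invariant_derivation_axioms.intro])
  show "subgroup {\<one>} G" by (rule triv_subgroup)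
  show "discrete {\<one>}" by (auto simp: discrete_def isolated_in_def intro: exI[of _ UNIV])
  show "X \<in> derivations (PI {\<one>})" using assms by (simp add: PI1)
 qed
 show ?thesis using D_frame that unfolding PI1 by metis
qed

text \<open>The periodic functions contain dual test functions at every point, so a derivation of
  \<open>C\<close> that kills all of them is 0.\<close>

lemma proj_unique_left: "proj X Y ==> proj X' Y ==> X = X'"
proof -
 assume *: "proj X Y" "proj X' Y"
 define Z where "Z = X - X'"
 have Zd: "Z \<in> derivations C" unfolding Z_def using projD1[OF *(1)] projD1[OF *(2)] by auto
 have Z0: "Z p = 0" if p: "p \<in> PI \<Gamma>" for p
  using projD[OF *(1) down_Q[OF p]] projD[OF *(2) down_Q[OF p]] by (simp add: Z_def up_down[OF p])
 obtain f where f: "\<And>b. b \<in> Basis ==> f b \<in> C" "\<And>g y. g \<in> C ==> Z g y = (\<Sum>b\<in>Basis. f b y * LX b g y)"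
  using Der_C_rep[OF Zd] by metis
 have "f b y = 0" if b: "b \<in> Basis" for b y
 proof -
  obtain \<t> where \<t>: "\<And>b. \<t> b \<in> PI \<Gamma>" "\<And>b v. LX v (\<t> b) y = complex_of_real (v \<bullet> b)" using dual_test by metis
  have "f b y = Z (\<t> b) y" using f(2)[OF PI_C[OF \<t>(1)], of b y] dual_coef[OF \<t> b, of "%b. f b y"] by simp
  thus ?thesis using Z0[OF \<t>(1)] by simp
 qed
 hence "Z g = 0" if "g \<in> C" for g using f(2)[OF that] by (simp add: fun_eq_iff)
 hence "Z = 0" using G.Der_outside[OF Zd] by (auto simp: fun_eq_iff)
 thus ?thesis by (simp add: Z_def)
qed

definition push :: "'g vf => 'g set vf" where
 "push X = (%f. if f \<in> Q then down (X (up f)) else 0)"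

lemma proj_push:
 assumes X: "X \<in> derivations C" and P: "\<And>p. p \<in> PI \<Gamma> ==> X p \<in> PI \<Gamma>"
 shows "proj X (push X)"
proof (rule projI[OF X])
 show "push X \<in> derivations Q"
 proof (rule Q.DerI)
  fix f g assume fg: "f \<in> Q" "g \<in> Q"
  note C = PI_C[OF up_PI[OF fg(1)]] PI_C[OF up_PI[OF fg(2)]]
  show "push X (f + g) = push X f + push X g"
   using fg G.Der_add[OF X C] by (simp add: push_def up_simps down_simps Q.alg_plus')
  show "push X (f * g) = f * push X g + g * push X f"
   using fg G.Der_mult[OF X C] by (simp add: push_def up_simps down_simps Q.alg_mult' down_up)
 next
  fix f c assume f: "f \<in> Q"
  show "push X (%x. c * f x) = (%x. c * push X f x)"
   using f G.Der_scale[OF X PI_C[OF up_PI[OF f]], of c] Q.alg_scale[OF f, of c]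
   by (simp add: push_def up_simps down_simps)
 qed (simp_all add: push_def down_Q P up_PI)
 show "X (up f) = up (push X f)" if "f \<in> Q" for f
  using that by (simp add: push_def up_down P up_PI)
qed

lemma \<gg>_PI: "X \<in> \<gg> ==> p \<in> PI \<Gamma> ==> X p \<in> PI \<Gamma>"
proof -
 assume X: "X \<in> \<gg>" and p: "p \<in> PI \<Gamma>"
 obtain c where "X = (\<Sum>b\<in>Basis. cmul (c b) (LX b))" using \<gg>_rep[OF X] by metis
 hence "X p = (%x. \<Sum>b\<in>Basis. c b * LX b p x)" by (simp add: fun_eq_iff sum_fun_apply cmul_apply)
 thus ?thesis using p by (auto intro!: PI_sum PI_scale LX_PI)
qed

lemma proj_push_\<gg>: "X \<in> \<gg> ==> proj X (push X)"
proof -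
 assume X: "X \<in> \<gg>"
 show "proj X (push X)" by (rule proj_push[OF \<gg>_Der[OF X]]) (rule \<gg>_PI[OF X])
qed

lemma J_facts:
 shows JD: "X \<in> derivations C ==> J X \<in> derivations C"
  and JJ: "X \<in> derivations C ==> J (J X) = - X"
  and JL: "f \<in> C ==> X \<in> derivations C ==> Y \<in> derivations C ==> J (fmul f X + Y) = fmul f (J X) + J Y"
  and JI: "X \<in> derivations C ==> Y \<in> derivations C ==> lie (J X) (J Y) = lie X Y + J (lie (J X) Y + lie X (J Y))"
  and JT: "X \<in> derivations C ==> J (translate_vf G a X) = translate_vf G a (J X)"
proof -
 have a: "complex_structure C J" using J_inv unfolding left_invariant_complex_structure_def by (rule conjunct1)
 have b: "\<forall>a\<in>UNIV. \<forall>X\<in>derivations C. J (translate_vf G a X) = translate_vf G a (J X)"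
  using J_inv unfolding left_invariant_complex_structure_def carrier_UNIV by (rule conjunct2)
 note c = a[unfolded complex_structure_def]
 have c1: "\<forall>X\<in>derivations C. J X \<in> derivations C \<and> J (J X) = - X \<and> J (conj_vf X) = conj_vf (J X)"
  using c by (rule conjunct1)
 have c2: "\<forall>f\<in>C. \<forall>X\<in>derivations C. \<forall>Y\<in>derivations C. J (fmul f X + Y) = fmul f (J X) + J Y"
  using c[THEN conjunct2] by (rule conjunct1)
 have c3: "\<forall>X\<in>derivations C. \<forall>Y\<in>derivations C. lie (J X) (J Y) = lie X Y + J (lie (J X) Y + lie X (J Y))"
  using c[THEN conjunct2] by (rule conjunct2)
 show "J X \<in> derivations C" if "X \<in> derivations C" by (rule c1[rule_format, OF that, THEN conjunct1])
 show "J (J X) = - X" if "X \<in> derivations C" by (rule c1[rule_format, OF that, THEN conjunct2, THEN conjunct1])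
 show "J (fmul f X + Y) = fmul f (J X) + J Y" if "f \<in> C" "X \<in> derivations C" "Y \<in> derivations C"
  by (rule c2[rule_format, OF that])
 show "lie (J X) (J Y) = lie X Y + J (lie (J X) Y + lie X (J Y))" if "X \<in> derivations C" "Y \<in> derivations C"
  by (rule c3[rule_format, OF that])
 show "J (translate_vf G a X) = translate_vf G a (J X)" if "X \<in> derivations C"
  by (rule b[rule_format, OF UNIV_I that])
qed

lemma J\<gg>: "X \<in> \<gg> ==> J X \<in> \<gg>"
 using JD JT by (simp add: left_invariant_fields_def) metis

lemma J_zero: "J 0 = 0"
proof -
 have "fmul 0 0 + 0 = (0 :: 'g vf)" by (simp add: fmul_def fun_eq_iff)
 moreover have "J (fmul 0 0 + 0) = fmul 0 (J 0) + J 0" by (rule JL) auto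
 moreover have "0 \<in> derivations C" by simp
 hence "J (J 0) = - 0" by (rule JJ)
 moreover have "J (fmul (%_. -1) 0 + 0) = fmul (%_. -1) (J 0) + J 0" by (rule JL) (auto simp: C_const)
 moreover have "fmul (%_. -1) 0 + 0 = (0 :: 'g vf)" by (simp add: fmul_def fun_eq_iff)
 ultimately show ?thesis by (simp add: fun_eq_iff fmul_def)
qed

lemma J_sum:
 assumes "finite F" "\<And>i. i \<in> F ==> f i \<in> C" "\<And>i. i \<in> F ==> X i \<in> derivations C"
 shows "J (\<Sum>i\<in>F. fmul (f i) (X i)) = (\<Sum>i\<in>F. fmul (f i) (J (X i)))"
 using assms
proof (induction F rule: finite_induct)
 case (insert i F)
 hence "J (fmul (f i) (X i) + (\<Sum>i\<in>F. fmul (f i) (X i))) = fmul (f i) (J (X i)) + J (\<Sum>i\<in>F. fmul (f i) (X i))"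
  by (intro JL) auto
 moreover have "J (\<Sum>i\<in>F. fmul (f i) (X i)) = (\<Sum>i\<in>F. fmul (f i) (J (X i)))" using insert by auto
 ultimately show ?case unfolding sum.insert[OF insert.hyps] by (simp only:)
qed (simp add: J_zero)

text \<open>\<open>Y\<close> is transported to a derivation of the periodic functions and expanded
  there by \<open>D_frame\<close>; the coefficients found then define a derivation of all of
  \<open>C\<close>.\<close>

lemma lift_ex:
 assumes Y: "Y \<in> derivations Q"
 shows "\<exists>f. (\<forall>b\<in>Basis. f b \<in> PI \<Gamma>) \<and> proj (\<Sum>b\<in>Basis. fmul (f b) (LX b)) Y"
proof -
 define D where "D p = (if p \<in> PI \<Gamma> then up (Y (down p)) else 0)" for p
 have D: "D \<in> derivations (PI \<Gamma>)"
 proof (rule P.DerI)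
  fix f g assume fg: "f \<in> PI \<Gamma>" "g \<in> PI \<Gamma>"
  note C = down_Q[OF fg(1)] down_Q[OF fg(2)]
  show "D (f + g) = D f + D g"
   using fg Q.Der_add[OF Y C] by (simp add: D_def up_simps down_simps P.alg_plus')
  show "D (f * g) = f * D g + g * D f"
   using fg Q.Der_mult[OF Y C] by (simp add: D_def up_simps down_simps P.alg_mult' up_down)
 next
  fix f c assume f: "f \<in> PI \<Gamma>"
  show "D (%x. c * f x) = (%x. c * D f x)"
   using f Q.Der_scale[OF Y down_Q[OF f], of c] P.alg_scale[OF f, of c]
   by (simp add: D_def up_simps down_simps)
 qed (simp_all add: D_def down_Q up_PI Y)
 interpret invariant_derivation G A \<Gamma> D
  by (rule invariant_derivation.intro[OF lie_grp_axioms invariant_derivation_axioms.intro[OF lattice D]])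
 obtain f where f: "\<And>b. b \<in> Basis ==> f b \<in> PI \<Gamma>" "\<And>g y. g \<in> PI \<Gamma> ==> D g y = (\<Sum>b\<in>Basis. f b y * LX b g y)"
  using D_frame by metis
 have "proj (\<Sum>b\<in>Basis. fmul (f b) (LX b)) Y"
 proof (rule projI[OF _ Y])
  show "(\<Sum>b\<in>Basis. fmul (f b) (LX b)) \<in> derivations C"
  proof (rule G.Der_Sum)
   fix b :: 'e assume "b \<in> Basis"
   thus "fmul (f b) (LX b) \<in> derivations C"
    by (intro G.Der_fmul[OF \<gg>_Der[OF LX_left_invariant]] PI_C[OF f(1)])
  qed
  show "(\<Sum>b\<in>Basis. fmul (f b) (LX b)) (up h) = up (Y h)" if h: "h \<in> Q" for h
   using f(2)[OF up_PI[OF h]] up_PI[OF h] h by (simp add: D_def down_up fun_eq_iff sum_fun_apply fmul_apply)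
 qed
 thus ?thesis using f(1) by blast
qed

lemma J_proj_ex:
 assumes Y: "Y \<in> derivations Q"
 obtains X Y' where "proj X Y" "proj (J X) Y'"
proof -
 obtain f where f: "\<And>b. b \<in> Basis ==> f b \<in> PI \<Gamma>" and p: "proj (\<Sum>b\<in>Basis. fmul (f b) (LX b)) Y"
  using lift_ex[OF Y] by blast
 let ?X = "\<Sum>b\<in>Basis. fmul (f b) (LX b)"
 have JX: "J ?X = (\<Sum>b\<in>Basis. fmul (f b) (J (LX b)))"
 proof (rule J_sum)
  show "f b \<in> C" if "b \<in> Basis" for b by (rule PI_C[OF f[OF that]])
 qed (simp_all add: \<gg>_Der[OF LX_left_invariant])
 have "proj (J ?X) (push (J ?X))"
 proof (rule proj_push[OF JD[OF projD1[OF p]]])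
  fix q assume q: "q \<in> PI \<Gamma>"
  have "J ?X q = (%x. \<Sum>b\<in>Basis. f b x * J (LX b) q x)" by (simp add: JX fun_eq_iff sum_fun_apply fmul_apply)
  also have "\<dots> \<in> PI \<Gamma>"
   by (rule PI_sum, rule PI_mult) (simp_all add: f q \<gg>_PI J\<gg> LX_left_invariant)
  finally show "J ?X q \<in> PI \<Gamma>" .
 qed
 from that[OF p this] show ?thesis .
qed

lemma Cinf_MM [simp]: "Cinf MM = Q" and points_MM [simp]: "points MM = rcosets \<Gamma>"
 by (simp_all add: nilmanifold_def)

text \<open>Lifts are unique, and so are projections of a lift; together these resolve the
  \<open>THE\<close> in \<open>nilmanifold\<close>.\<close>

lemma Jop_eq:
 assumes "proj X Y" "proj (J X) Y'"
 shows "Jop MM Y = Y'"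
proof -
 have "(THE Y'. \<exists>X. proj X Y \<and> proj (J X) Y') = Y'"
 proof (rule the_equality)
  fix Y'' assume "\<exists>X. proj X Y \<and> proj (J X) Y''"
  then obtain X' where X': "proj X' Y" "proj (J X') Y''" by blast
  hence "X' = X" using proj_unique_left assms by blast
  thus "Y'' = Y'" using X'(2) assms(2) proj_unique by blast
 qed (use assms in blast)
 thus ?thesis by (simp add: nilmanifold_def)
qed

lemma Jop_proj: "proj X Y ==> proj (J X) (Jop MM Y)"
proof -
 assume p: "proj X Y"
 obtain X' Y' where "proj X' Y" "proj (J X') Y'" using J_proj_ex[OF projD2[OF p]] by metis
 moreover hence "X' = X" using p proj_unique_left by blast
 ultimately show ?thesis using Jop_eq by auto
qed

lemma proj_ex: "Y \<in> derivations Q ==> \<exists>X. proj X Y"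
 using J_proj_ex by metis

lemma proj_add: "proj X Y ==> proj X' Y' ==> proj (X + X') (Y + Y')"
 by (rule projI) (auto dest: projD1 projD2 simp: projD up_simps)

lemma proj_neg: "proj X Y ==> proj (- X) (- Y)"
 by (rule projI) (auto dest: projD1 projD2 simp: projD up_simps)

lemma proj_fmul: "proj X Y ==> h \<in> Q ==> proj (fmul (up h) X) (fmul h Y)"
proof (rule projI)
 assume p: "proj X Y" and h: "h \<in> Q"
 show "fmul (up h) X \<in> derivations C" by (rule G.Der_fmul[OF projD1[OF p] PI_C[OF up_PI[OF h]]])
 show "fmul h Y \<in> derivations Q" by (rule Q.Der_fmul[OF projD2[OF p] h])
qed (simp add: projD up_simps fmul_def)

lemma proj_cmul: "proj X Y ==> proj (cmul c X) (cmul c Y)"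
proof (rule projI)
 assume p: "proj X Y"
 show "cmul c X \<in> derivations C" by (rule G.Der_cmul[OF projD1[OF p]])
 show "cmul c Y \<in> derivations Q" by (rule Q.Der_cmul[OF projD2[OF p]])
qed (simp add: projD up_simps cmul_def)

lemma proj_lie: "proj X Y ==> proj X' Y' ==> proj (lie X X') (lie Y Y')"
proof (rule projI)
 assume p: "proj X Y" "proj X' Y'"
 note d = projD1[OF p(1)] projD1[OF p(2)] projD2[OF p(1)] projD2[OF p(2)]
 show "lie X X' \<in> derivations C" "lie Y Y' \<in> derivations Q" using d by auto
 show "lie X X' (up f) = up (lie Y Y' f)" if f: "f \<in> Q" for f
  using f d by (simp add: lie_def projD[OF p(1)] projD[OF p(2)] up_simps)
qed

lemma proj_zero: "proj 0 Y ==> Y = 0"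
 using proj_unique[of 0 Y 0] projI[of 0 0] by (simp add: up_simps)

lemma induced_iff: "Y \<in> induced_fields G A \<Gamma> \<longleftrightarrow> (\<exists>X\<in>\<gg>. proj X Y)"
 by (simp add: induced_fields_def)

lemma proj_foldr: "list_all2 proj Xs Ys ==> proj X Y ==> proj (foldr lie Xs X) (foldr lie Ys Y)"
 by (induction Xs Ys rule: list_all2_induct) (auto intro: proj_lie)

lemma proj_sum: "finite F ==> (\<And>i. i \<in> F ==> proj (X i) (Y i)) ==> proj (sum X F) (sum Y F)"
proof (induction F rule: finite_induct)
 case (insert i F)
 hence "proj (X i + sum X F) (Y i + sum Y F)" by (intro proj_add) auto
 thus ?case unfolding sum.insert[OF insert.hyps] .
qed (auto intro!: projI simp: up_simps)

lemma induced_span: "induced_fields G A \<Gamma> = cv.span ((%b. push (LX b)) ` Basis)"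
proof
 show "induced_fields G A \<Gamma> \<subseteq> cv.span ((%b. push (LX b)) ` Basis)"
 proof
  fix Y assume "Y \<in> induced_fields G A \<Gamma>"
  then obtain X where X: "X \<in> \<gg>" "proj X Y" by (auto simp: induced_iff)
  obtain c where c: "X = (\<Sum>b\<in>Basis. cmul (c b) (LX b))" using \<gg>_rep[OF X(1)] by metis
  have "proj X (\<Sum>b\<in>Basis. cmul (c b) (push (LX b)))"
   unfolding c by (intro proj_sum proj_cmul proj_push_\<gg> LX_left_invariant) auto
  hence "Y = (\<Sum>b\<in>Basis. cmul (c b) (push (LX b)))" using X(2) proj_unique by blast
  show "Y \<in> cv.span ((%b. push (LX b)) ` Basis)" unfolding \<open>Y = _\<close>
   by (intro cv.span_sum cv.span_scale cv.span_base imageI)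
 qed
 have "cv.subspace (induced_fields G A \<Gamma>)"
 proof (rule cv.subspaceI)
  show "0 \<in> induced_fields G A \<Gamma>"
   unfolding induced_iff using cv.subspace_0[OF \<gg>_subspace] projI[of 0 0] by (auto simp: up_simps)
 next
  fix X Y assume "X \<in> induced_fields G A \<Gamma>" "Y \<in> induced_fields G A \<Gamma>"
  thus "X + Y \<in> induced_fields G A \<Gamma>"
   unfolding induced_iff using cv.subspace_add[OF \<gg>_subspace] proj_add by blast
 next
  fix c X assume "X \<in> induced_fields G A \<Gamma>"
  thus "cmul c X \<in> induced_fields G A \<Gamma>"
   unfolding induced_iff using cv.subspace_scale[OF \<gg>_subspace] proj_cmul by blast
 qed
 thus "cv.span ((%b. push (LX b)) ` Basis) \<subseteq> induced_fields G A \<Gamma>"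
  by (intro cv.span_minimal) (use proj_push_\<gg>[OF LX_left_invariant] LX_left_invariant in \<open>auto simp: induced_iff intro!: bexI\<close>)
qed

theorem framed: "framed_manifold MM (induced_fields G A \<Gamma>)"
proof (rule framed_manifold.intro, unfold Cinf_MM points_MM)
 show "fun_algebra Q" by (rule fun_algebra_Q)
 have "up (%x. if x \<in> rcosets \<Gamma> then 1 else 0) = (%x. 1)" by (simp add: up_def coset_in)
 thus "(%x. if x \<in> rcosets \<Gamma> then 1 else 0) \<in> Q" using C_const[of 1] by (intro Q_if) (auto simp: up_def)
 show "f x = 0" if "f \<in> Q" "x \<notin> rcosets \<Gamma>" for f x using Q_off that .
 show "rcosets \<Gamma> \<noteq> {}" using coset_in by blast
 show "cv.subspace (induced_fields G A \<Gamma>)" by (simp add: induced_span cv.subspace_span)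
 show "induced_fields G A \<Gamma> \<subseteq> derivations Q" using projD2 by (auto simp: induced_iff)
 show "\<exists>F. finite F \<and> F \<subseteq> induced_fields G A \<Gamma> \<and> induced_fields G A \<Gamma> = cv.span F \<and>
   (\<forall>Y\<in>derivations Q. \<exists>f. (\<forall>i\<in>F. f i \<in> Q) \<and> Y = (\<Sum>i\<in>F. fmul (f i) i))"
 proof (rule exI[of _ "(%b. push (LX b)) ` Basis"], intro conjI ballI)
  let ?F = "(%b. push (LX b)) ` Basis"
  show "finite ?F" "?F \<subseteq> induced_fields G A \<Gamma>" "induced_fields G A \<Gamma> = cv.span ?F"
   by (auto simp: induced_span intro: cv.span_base)
  fix Y assume Y: "Y \<in> derivations Q"
  obtain f where f: "\<And>b. b \<in> Basis ==> f b \<in> PI \<Gamma>" and p: "proj (\<Sum>b\<in>Basis. fmul (f b) (LX b)) Y"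
   using lift_ex[OF Y] by blast
  have "proj (\<Sum>b\<in>Basis. fmul (f b) (LX b)) (\<Sum>b\<in>Basis. fmul (down (f b)) (push (LX b)))"
  proof (rule proj_sum)
   fix b :: 'e assume b: "b \<in> Basis"
   show "proj (fmul (f b) (LX b)) (fmul (down (f b)) (push (LX b)))"
    using proj_fmul[OF proj_push_\<gg>[OF LX_left_invariant[of b]] down_Q[OF f[OF b]]] by (simp add: up_down[OF f[OF b]])
  qed simp
  hence "Y = (\<Sum>b\<in>Basis. fmul (down (f b)) (push (LX b)))" using p proj_unique by blast
  \<comment> \<open>The frame is a set of fields, so the coefficients of basis vectors with the same
    image are added up.\<close>
  also have "\<dots> = (\<Sum>i\<in>?F. \<Sum>b\<in>{b\<in>Basis. push (LX b) = i}. fmul (down (f b)) (push (LX b)))"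
   by (rule sum.image_gen) simp
  also have "\<dots> = (\<Sum>i\<in>?F. fmul (\<Sum>b\<in>{b\<in>Basis. push (LX b) = i}. down (f b)) i)"
   by (rule sum.cong[OF refl]) (simp add: fun_eq_iff fmul_apply sum_fun_apply sum_distrib_right)
  finally show "\<exists>f. (\<forall>i\<in>?F. f i \<in> Q) \<and> Y = (\<Sum>i\<in>?F. fmul (f i) i)"
   using down_Q[OF f] by (intro exI[of _ "%i. \<Sum>b\<in>{b\<in>Basis. push (LX b) = i}. down (f b)"]) auto
 qed
 show "Y = 0" if Y: "Y \<in> induced_fields G A \<Gamma>" and c: "c \<in> rcosets \<Gamma>" and 0: "\<And>f. f \<in> Q ==> Y f c = 0" for Y c
 proof -
  obtain X where X: "X \<in> \<gg>" "proj X Y" using Y by (auto simp: induced_iff)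
  obtain k where k: "X = (\<Sum>b\<in>Basis. cmul (k b) (LX b))" using \<gg>_rep[OF X(1)] by metis
  obtain y where y: "c = \<Gamma> #> y" using c by (auto simp: RCOSETS_def)
  obtain \<t> where \<t>: "\<And>b. \<t> b \<in> PI \<Gamma>" "\<And>b v. LX v (\<t> b) y = complex_of_real (v \<bullet> b)" using dual_test by metis
  have "k b = 0" if b: "b \<in> Basis" for b
  proof -
   have "X (\<t> b) y = k b" using dual_coef[OF \<t> b, of k] by (simp add: k sum_fun_apply cmul_apply)
   moreover have "X (\<t> b) y = up (Y (down (\<t> b))) y"
    using projD[OF X(2) down_Q[OF \<t>(1)]] by (simp add: up_down[OF \<t>(1)])
   ultimately show ?thesis using 0[OF down_Q[OF \<t>(1)]] y by (simp add: up_def)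
  qed
  hence "X = 0" unfolding k by (simp add: fun_eq_iff sum_fun_apply cmul_apply)
  thus ?thesis using X(2) proj_zero by simp
 qed
 show "lie X Y \<in> induced_fields G A \<Gamma>" if "X \<in> induced_fields G A \<Gamma>" "Y \<in> induced_fields G A \<Gamma>" for X Y
  using that proj_lie \<gg>_lie unfolding induced_iff by blast
 obtain k where k: "\<And>Xs Y. length Xs = k ==> set Xs \<subseteq> \<gg> ==> Y \<in> \<gg> ==> foldr lie Xs Y = 0"
  using \<gg>_nilpotent[OF nilp] by blast
 have "foldr lie Ys Y = 0" if len: "length Ys = k" and sub: "set Ys \<subseteq> induced_fields G A \<Gamma>" and Y: "Y \<in> induced_fields G A \<Gamma>" for Ys Y
 proof -
  have "\<exists>Xs. set Xs \<subseteq> \<gg> \<and> list_all2 proj Xs Ys" using sub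
  proof (induction Ys)
   case (Cons a Ys)
   then obtain Xs X where "set Xs \<subseteq> \<gg>" "list_all2 proj Xs Ys" "X \<in> \<gg>" "proj X a" by (auto simp: induced_iff)
   thus ?case by (intro exI[of _ "X # Xs"]) simp
  qed simp
  then obtain Xs X where "set Xs \<subseteq> \<gg>" "list_all2 proj Xs Ys" "X \<in> \<gg>" "proj X Y"
   using Y by (auto simp: induced_iff)
  thus ?thesis using k[of Xs X] proj_foldr[of Xs Ys X Y] len proj_zero list_all2_lengthD by metis
 qed
 thus "\<exists>k. \<forall>Xs Y. length Xs = k --> set Xs \<subseteq> induced_fields G A \<Gamma> --> Y \<in> induced_fields G A \<Gamma> --> foldr lie Xs Y = 0"
  by blast
 show "Jop MM Y \<in> derivations Q" if "Y \<in> derivations Q" for Y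
  using proj_ex[OF that] projD2[OF Jop_proj] by (elim exE)
 show "Jop MM (fmul f X + Y) = fmul f (Jop MM X) + Jop MM Y"
  if "f \<in> Q" "X \<in> derivations Q" "Y \<in> derivations Q" for f X Y
 proof -
  obtain X' where p1: "proj X' X" using proj_ex[OF \<open>X \<in> _\<close>] by (elim exE)
  obtain Y' where p2: "proj Y' Y" using proj_ex[OF \<open>Y \<in> _\<close>] by (elim exE)
  note p = p1 p2
  have "J (fmul (up f) X' + Y') = fmul (up f) (J X') + J Y'"
   by (rule JL) (use p projD1 PI_C[OF up_PI[OF that(1)]] in auto)
  thus ?thesis
   using Jop_eq[OF proj_add[OF proj_fmul[OF p(1) that(1)] p(2)]] proj_add[OF proj_fmul[OF Jop_proj[OF p(1)] that(1)] Jop_proj[OF p(2)]]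
   by simp
 qed
 show "Jop MM (Jop MM Y) = - Y" if "Y \<in> derivations Q" for Y
 proof -
  obtain X where p: "proj X Y" using proj_ex[OF \<open>Y \<in> _\<close>] by (elim exE)
  thus ?thesis using Jop_eq[OF Jop_proj[OF p]] proj_neg[OF p] JJ[OF projD1[OF p]] by simp
 qed
 show "Jop MM Y \<in> induced_fields G A \<Gamma>" if "Y \<in> induced_fields G A \<Gamma>" for Y
 proof -
  obtain X where "X \<in> \<gg>" "proj X Y" using \<open>Y \<in> _\<close> unfolding induced_iff by blast
  hence "J X \<in> \<gg> \<and> proj (J X) (Jop MM Y)" using J\<gg> Jop_proj by simp
  thus ?thesis unfolding induced_iff by (intro bexI[of _ "J X"]) simp_all
 qed
 show "lie (Jop MM X) (Jop MM Y) = lie X Y + Jop MM (lie (Jop MM X) Y + lie X (Jop MM Y))"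
  if "X \<in> derivations Q" "Y \<in> derivations Q" for X Y
 proof -
  obtain X' where p1: "proj X' X" using proj_ex[OF \<open>X \<in> _\<close>] by (elim exE)
  obtain Y' where p2: "proj Y' Y" using proj_ex[OF \<open>Y \<in> _\<close>] by (elim exE)
  note p = p1 p2
  note j = Jop_proj[OF p(1)] Jop_proj[OF p(2)]
  have 1: "proj (lie (J X') (J Y')) (lie (Jop MM X) (Jop MM Y))" by (rule proj_lie[OF j])
  have 2: "proj (lie X' Y' + J (lie (J X') Y' + lie X' (J Y'))) (lie X Y + Jop MM (lie (Jop MM X) Y + lie X (Jop MM Y)))"
   by (intro proj_add proj_lie Jop_proj p j)
  show ?thesis using proj_unique[OF 1] 2 JI[OF projD1[OF p(1)] projD1[OF p(2)]] by simp
 qed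
qed

end

section \<open>Alternating forms\<close>

lemmas fun_app = plus_fun_apply zero_fun_apply times_fun_apply one_fun_apply uminus_apply minus_apply

text \<open>Forms are functions with values in functions. Simplification should evaluate them at
  argument lists, which \<open>form_app\<close> does, but not go on to evaluate at points.\<close>

declare fun_app [simp del]

lemma form_app [simp]:
 fixes \<w> \<eta> :: "'v list => 'm fn"
 shows "(\<w> + \<eta>) l = \<w> l + \<eta> l" "(\<w> - \<eta>) l = \<w> l - \<eta> l" "(- \<w>) l = - \<w> l" "(0 :: 'v list => 'm fn) l = 0"
  "fmul f \<w> l = f * \<w> l"
 by (simp_all add: fun_app fmul_def)

text \<open>The interior product. Most identities for forms below are proved by inserting one
  argument and inducting on the degree or on the argument list.\<close>

definition ip :: "'v => ('v list => 'm fn) => 'v list => 'm fn" where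
 "ip v \<w> = (%l. \<w> (v # l))"

lemma ip_simps [simp]: "ip v (\<w> + \<eta>) = ip v \<w> + ip v \<eta>" "ip v (\<w> - \<eta>) = ip v \<w> - ip v \<eta>" "ip v (- \<w>) = - ip v \<w>"
 "ip v 0 = 0" "ip v (cmul c \<w>) = cmul c (ip v \<w>)" "ip v (fmul f \<w>) = fmul f (ip v \<w>)"
 by (auto simp: ip_def fun_eq_iff cmul_def fmul_def fun_app)

lemma ip_apply: "ip v \<w> l = \<w> (v # l)"
 by (simp add: ip_def)

lemma ip_sum: "ip v (sum \<w> F) = (\<Sum>i\<in>F. ip v (\<w> i))"
 by (simp add: ip_def fun_eq_iff sum_fun_apply)

lemma fmul_simps [simp]: "fmul f (X + Y) = fmul f X + fmul f Y" "fmul f (X - Y) = fmul f X - fmul f Y"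
 "fmul f 0 = 0" "fmul 0 X = 0" "fmul f (- X) = - fmul f X" "fmul (f * g) X = fmul f (fmul g X)" 
 "fmul (f + g) X = fmul f X + fmul g X" "fmul (- f) X = - fmul f X" "fmul (f - g) X = fmul f X - fmul g X"
 by (auto simp: fmul_def fun_eq_iff algebra_simps fun_app)

lemma fmul_sum: "fmul f (sum X F) = (\<Sum>i\<in>F. fmul f (X i))"
 by (simp add: fmul_def fun_eq_iff sum_fun_apply sum_distrib_left fun_app)

subsection \<open>Wedge products\<close>

definition sgn_fn :: "nat => 'm fn" where "sgn_fn k = (- 1) ^ k"

lemma sgn_fn_simps [simp]: "sgn_fn 0 = 1" "sgn_fn (Suc k) = - sgn_fn k" "sgn_fn k * sgn_fn k = 1"
 by (auto simp: sgn_fn_def power_mult_distrib[symmetric])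

lemma sgn_fn_add: "sgn_fn (k + l) = sgn_fn k * sgn_fn l"
 by (simp add: sgn_fn_def power_add)

lemma sgn_fn_apply: "sgn_fn k x = (- 1) ^ k"
 by (induction k) (auto simp: sgn_fn_def fun_app)

lemma sgn_fn_sq [simp]: "sgn_fn m * (sgn_fn m * x) = x"
 by (simp add: mult.assoc[symmetric])

lemma sgn_fn_or: "(sgn_fn k :: 'm fn) = 1 \<or> (sgn_fn k :: 'm fn) = - 1"
proof (induction k)
 case (Suc k)
 thus ?case by (elim disjE) simp_all
qed simp

text \<open>Only the length of the argument list is fixed, with no linearity or alternation: this is
  what the sign in \<open>wedge_Cons\<close> depends on, and it is stable under contraction.\<close>

definition homog :: "nat => ('v list => 'm fn) => bool" where
 "homog k \<w> \<longleftrightarrow> (\<forall>l. length l \<noteq> k --> \<w> l = 0)"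

lemma homogD: "homog k \<w> ==> length l \<noteq> k ==> \<w> l = 0"
 by (simp add: homog_def)

lemma homog_ip [simp]: "homog (Suc k) \<w> ==> homog k (ip v \<w>)"
 by (simp add: homog_def ip_def)

lemma homog_ip': "homog k \<w> ==> homog (k - 1) (ip v \<w>)"
 by (auto simp: homog_def ip_def)

lemma ip_homog_0 [simp]: "homog 0 \<w> ==> ip v \<w> = 0"
 by (simp add: homog_def ip_def fun_eq_iff fun_app)

lemma wedge_Nil: "wedge \<w> \<eta> [] = \<w> [] * \<eta> []"
 by (simp add: wedge_def)

lemma sum_Pow_Suc:
 "(\<Sum>S\<in>Pow {..<Suc n}. g S) = (\<Sum>T\<in>Pow {..<n}. g (insert 0 (Suc ` T))) + (\<Sum>T\<in>Pow {..<n}. g (Suc ` T))"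
proof -
 have "{..<Suc n} = insert 0 (Suc ` {..<n})" by (rule lessThan_Suc_eq_insert_0)
 hence P: "Pow {..<Suc n} = Pow (Suc ` {..<n}) \<union> insert 0 ` Pow (Suc ` {..<n})"
  by (simp only: Pow_insert)
 have i: "Pow (Suc ` {..<n}) = (`) Suc ` Pow {..<n}" by (simp add: image_Pow_surj)
 have inj1: "inj_on ((`) Suc) (Pow {..<n})" by (auto simp: inj_on_def inj_image_eq_iff)
 have inj2: "inj_on (insert 0) (Pow (Suc ` {..<n}))" by (auto simp: inj_on_def)
 have d: "Pow (Suc ` {..<n}) \<inter> insert 0 ` Pow (Suc ` {..<n}) = {}" by auto
 show ?thesis
  unfolding P
  by (subst sum.union_disjoint) (simp_all add: d sum.reindex[OF inj2] i[symmetric] o_def, simp add: i sum.reindex[OF inj1] add.commute)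
qed

lemma map_prod_Suc_iff [simp]: "(Suc i, Suc j) \<in> map_prod Suc Suc ` X \<longleftrightarrow> (i, j) \<in> X"
 "(0, j) \<notin> map_prod Suc Suc ` X" "(i, 0) \<notin> map_prod Suc Suc ` X"
 by force+

text \<open>Shuffles are split by the factor that receives the first argument. If it goes to
  \<open>\<eta>\<close>, it is inverted with each of the \<open>k\<close> arguments of
  \<open>\<w>\<close>, whence the sign.\<close>

lemma wedge_Cons:
 assumes "homog k \<w>"
 shows "wedge \<w> \<eta> (v # l) = wedge (ip v \<w>) \<eta> l + sgn_fn k * wedge \<w> (ip v \<eta>) l"
proof -
 let ?n = "length l"
 let ?inv = "%n S. card {(i, j). i \<in> S \<and> j \<in> {..<n} - S \<and> j < i}"
 let ?g = "%S. (- 1) ^ ?inv (Suc ?n) S * \<w> (nths (v # l) S) * \<eta> (nths (v # l) (- S))"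
 have 1: "?g (insert 0 (Suc ` T)) = (- 1) ^ ?inv ?n T * ip v \<w> (nths l T) * \<eta> (nths l (- T))" for T
 proof -
  have "{(i, j). i \<in> insert 0 (Suc ` T) \<and> j \<in> {..<Suc ?n} - insert 0 (Suc ` T) \<and> j < i} =
   map_prod Suc Suc ` {(i, j). i \<in> T \<and> j \<in> {..<?n} - T \<and> j < i}"
  proof (rule Set.set_eqI)
   fix p :: "nat \<times> nat"
   obtain i j where p: "p = (i, j)" by (cases p)
   show "p \<in> {(i, j). i \<in> insert 0 (Suc ` T) \<and> j \<in> {..<Suc ?n} - insert 0 (Suc ` T) \<and> j < i} \<longleftrightarrow>
    p \<in> map_prod Suc Suc ` {(i, j). i \<in> T \<and> j \<in> {..<?n} - T \<and> j < i}"
    unfolding p by (cases i; cases j) auto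
  qed
  hence "?inv (Suc ?n) (insert 0 (Suc ` T)) = ?inv ?n T"
   by (simp add: card_image inj_on_def)
  moreover have "{j. Suc j \<in> insert 0 (Suc ` T)} = T" "{j. Suc j \<in> - insert 0 (Suc ` T)} = - T" by auto
  ultimately show ?thesis by (simp add: nths_Cons ip_def)
 qed
 have 2: "?g (Suc ` T) = sgn_fn k * ((- 1) ^ ?inv ?n T * \<w> (nths l T) * ip v \<eta> (nths l (- T)))" if T: "T \<subseteq> {..<?n}" for T
 proof -
  have fT: "finite T" using T finite_subset by blast
  have "{(i, j). i \<in> Suc ` T \<and> j \<in> {..<Suc ?n} - Suc ` T \<and> j < i} =
   map_prod Suc Suc ` {(i, j). i \<in> T \<and> j \<in> {..<?n} - T \<and> j < i} \<union> (%i. (Suc i, 0)) ` T" (is "_ = ?A \<union> ?B")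
  proof (rule Set.set_eqI)
   fix p :: "nat \<times> nat"
   obtain i j where p: "p = (i, j)" by (cases p)
   show "p \<in> {(i, j). i \<in> Suc ` T \<and> j \<in> {..<Suc ?n} - Suc ` T \<and> j < i} \<longleftrightarrow> p \<in> ?A \<union> ?B"
    unfolding p by (cases i; cases j) auto
  qed
  moreover have "finite ?A" by (rule finite_imageI, rule finite_subset[of _ "T \<times> {..<?n}"]) (use fT in auto)
  moreover have "?A \<inter> ?B = {}" "finite ?B" using fT by auto
  ultimately have "?inv (Suc ?n) (Suc ` T) = card ?A + card ?B" by (simp add: card_Un_disjoint)
  hence c: "?inv (Suc ?n) (Suc ` T) = ?inv ?n T + card T"
   by (simp add: card_image inj_on_def)
  have s: "{j. Suc j \<in> Suc ` T} = T" "{j. Suc j \<notin> Suc ` T} = - T" by auto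
  have n: "nths (v # l) (Suc ` T) = nths l T" "nths (v # l) (- Suc ` T) = v # nths l (- T)"
   by (simp_all add: nths_Cons s)
  show ?thesis
  proof (cases "card T = k")
   case True
   thus ?thesis unfolding c n by (simp add: ip_def power_add sgn_fn_def ac_simps)
  next
   case False
   have "length (nths l T) = card T"
    using T by (simp add: length_nths) (metis (mono_tags, lifting) Collect_mem_eq Collect_cong lessThan_iff subsetD)
   hence "\<w> (nths l T) = 0" using homogD[OF assms] False by simp
   thus ?thesis unfolding n by simp
  qed
 qed
 have "wedge \<w> \<eta> (v # l) = (\<Sum>S\<in>Pow {..<Suc ?n}. ?g S)" by (simp add: wedge_def)
 also have "\<dots> = (\<Sum>T\<in>Pow {..<?n}. ?g (insert 0 (Suc ` T))) + (\<Sum>T\<in>Pow {..<?n}. ?g (Suc ` T))"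
  by (rule sum_Pow_Suc)
 also have "(\<Sum>T\<in>Pow {..<?n}. ?g (insert 0 (Suc ` T))) = wedge (ip v \<w>) \<eta> l"
  unfolding 1 wedge_def ..
 also have "(\<Sum>T\<in>Pow {..<?n}. ?g (Suc ` T)) = sgn_fn k * wedge \<w> (ip v \<eta>) l"
  unfolding wedge_def sum_distrib_left by (rule sum.cong[OF refl], rule 2) auto
 finally show ?thesis .
qed

lemma ip_wedge: "homog k \<w> ==> ip v (wedge \<w> \<eta>) = wedge (ip v \<w>) \<eta> + fmul (sgn_fn k) (wedge \<w> (ip v \<eta>))"
 by (rule ext) (simp add: ip_apply wedge_Cons)

lemma wedge_lin [simp]:
 "wedge (\<w> + \<w>') \<eta> = wedge \<w> \<eta> + wedge \<w>' \<eta>" "wedge \<w> (\<eta> + \<eta>') = wedge \<w> \<eta> + wedge \<w> \<eta>'"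
 "wedge (\<w> - \<w>') \<eta> = wedge \<w> \<eta> - wedge \<w>' \<eta>" "wedge \<w> (\<eta> - \<eta>') = wedge \<w> \<eta> - wedge \<w> \<eta>'"
 "wedge (- \<w>) \<eta> = - wedge \<w> \<eta>" "wedge \<w> (- \<eta>) = - wedge \<w> \<eta>"
 "wedge 0 \<eta> = 0" "wedge \<w> 0 = 0"
 "wedge (fmul f \<w>) \<eta> = fmul f (wedge \<w> \<eta>)" "wedge \<w> (fmul f \<eta>) = fmul f (wedge \<w> \<eta>)"
 "wedge (cmul c \<w>) \<eta> = cmul c (wedge \<w> \<eta>)" "wedge \<w> (cmul c \<eta>) = cmul c (wedge \<w> \<eta>)"
 by (rule ext; simp add: wedge_def fmul_def distrib_left distrib_right sum.distrib sum_subtractf right_diff_distrib left_diff_distrib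
   sum_negf sum_distrib_left mult.left_commute mult.assoc fun_app; fail)+
  (rule ext, rule ext, simp add: wedge_def cmul_def sum_fun_apply sum_distrib_left mult.left_commute mult.assoc fun_app; fail)+

lemma wedge_sum_right: "wedge \<w> (sum \<eta> F) = (\<Sum>i\<in>F. wedge \<w> (\<eta> i))"
 by (rule ext) (simp add: wedge_def sum_fun_apply sum_distrib_left sum_distrib_right sum.swap[of _ F])

lemma homog_wedge: "homog k \<w> ==> homog m \<eta> ==> homog (k + m) (wedge \<w> \<eta>)"
proof -
 have "length l \<noteq> k + m ==> wedge \<w> \<eta> l = 0" if "homog k \<w>" "homog m \<eta>" for l k m and \<w> \<eta> :: "'v list => 'm fn"
  using that
 proof (induction l arbitrary: k m \<w> \<eta>)
  case Nil
  thus ?case using homogD[of k \<w> "[]"] homogD[of m \<eta> "[]"] by (auto simp: wedge_Nil)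
 next
  case (Cons v l)
  have "wedge (ip v \<w>) \<eta> l = 0"
  proof (cases k)
   case 0
   thus ?thesis using Cons.prems by simp
  next
   case (Suc k')
   thus ?thesis using Cons.IH[of k' m "ip v \<w>" \<eta>] Cons.prems by auto
  qed
  moreover have "wedge \<w> (ip v \<eta>) l = 0"
  proof (cases m)
   case 0
   thus ?thesis using Cons.prems by simp
  next
   case (Suc m')
   thus ?thesis using Cons.IH[of k m' \<w> "ip v \<eta>"] Cons.prems by auto
  qed
  ultimately show ?case using wedge_Cons[OF Cons.prems(2)] by simp
 qed
 thus "homog k \<w> ==> homog m \<eta> ==> homog (k + m) (wedge \<w> \<eta>)" unfolding homog_def by blast
qed

lemma wedge_commute:
 assumes "homog k \<w>" "homog m \<eta>"
 shows "wedge \<w> \<eta> l = sgn_fn (k * m) * wedge \<eta> \<w> l"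
 using assms
proof (induction l arbitrary: k m \<w> \<eta>)
 case Nil
 show ?case
 proof (cases "k = 0 \<or> m = 0")
  case False
  hence "\<w> [] = 0" "\<eta> [] = 0" using Nil homogD[of k \<w> "[]"] homogD[of m \<eta> "[]"] by auto
  thus ?thesis by (simp add: wedge_Nil)
 qed (auto simp: wedge_Nil mult.commute)
next
 case (Cons v l)
 have 1: "wedge (ip v \<w>) \<eta> l = sgn_fn (k * m) * (sgn_fn m * wedge \<eta> (ip v \<w>) l)"
 proof (cases k)
  case 0
  thus ?thesis using Cons.prems by simp
 next
  case (Suc k')
  thus ?thesis using Cons.IH[of k' "ip v \<w>" m \<eta>] Cons.prems Suc by (simp add: sgn_fn_add ac_simps)
 qed
 have 2: "sgn_fn k * wedge \<w> (ip v \<eta>) l = sgn_fn (k * m) * wedge (ip v \<eta>) \<w> l"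
 proof (cases m)
  case 0
  thus ?thesis using Cons.prems by simp
 next
  case (Suc m')
  thus ?thesis using Cons.IH[of k \<w> m' "ip v \<eta>"] Cons.prems Suc by (simp add: sgn_fn_add ac_simps)
 qed
 show ?case unfolding wedge_Cons[OF Cons.prems(1)] wedge_Cons[OF Cons.prems(2)]
  by (simp add: 1 2 distrib_left add.commute)
qed

text \<open>The derivation of the wedge algebra given by \<open>D\<close> on functions and by the transpose of \<open>-\<t>\<close> on arguments.\<close>
definition LD :: "'v set => 'm vf => ('v => 'v) => ('v list => 'm fn) => 'v list => 'm fn" where
 "LD S D \<t> \<w> l = (if set l \<subseteq> S then D (\<w> l) - (\<Sum>i<length l. \<w> (l[i := \<t> (l ! i)])) else 0)"

lemma LD_Nil: "LD S D \<t> \<w> [] = D (\<w> [])"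
 by (simp add: LD_def)

lemma LD_Cons: "v \<in> S ==> LD S D \<t> \<w> (v # l) = LD S D \<t> (ip v \<w>) l - (if set l \<subseteq> S then \<w> (\<t> v # l) else 0)"
 by (auto simp: LD_def ip_def lessThan_Suc_eq_insert_0 sum.reindex algebra_simps)

lemma LD_outside: "\<not> set l \<subseteq> S ==> LD S D \<t> \<w> l = 0"
 by (auto simp: LD_def)

lemma homog_LD: "homog k \<w> ==> D 0 = 0 ==> homog k (LD S D \<t> \<w>)"
 by (simp add: homog_def LD_def)

text \<open>Induction along the argument list by \<open>wedge_Cons\<close>. The map
  \<open>\<t>\<close> on arguments is arbitrary, so the lemma serves both for the bracket of an
  algebroid and for the substitutions on frame elements in \<open>br_LD\<close>.\<close>

lemma (in fun_algebra) LD_wedge: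
 assumes D: "D \<in> Der"
 shows "homog k \<w> ==> (\<And>l. \<w> l \<in> C) ==> (\<And>l. \<eta> l \<in> C) ==> set l \<subseteq> S ==>
  LD S D \<t> (wedge \<w> \<eta>) l = wedge (LD S D \<t> \<w>) \<eta> l + wedge \<w> (LD S D \<t> \<eta>) l"
proof (induction l arbitrary: k \<w> \<eta>)
 case Nil
 thus ?case by (simp add: LD_Nil wedge_Nil Der_mult[OF D] algebra_simps)
next
 case (Cons v l)
 have v: "v \<in> S" "set l \<subseteq> S" using Cons.prems by auto
 have h: "homog (k - 1) (ip v \<w>)" "homog k (LD S D \<t> \<w>)" "homog k (LD S D \<t> \<eta>) \<or> True"
  using Cons.prems homog_LD[of k \<w> D S \<t>] homog_ip' D by auto
 have ld: "LD S D \<t> (\<w>1 + \<w>2) l = LD S D \<t> \<w>1 l + LD S D \<t> \<w>2 l" if "\<And>l. \<w>1 l \<in> C" "\<And>l. \<w>2 l \<in> C" for \<w>1 \<w>2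
  using that v by (simp add: LD_def Der_add[OF D] sum.distrib)
 have ldm: "LD S D \<t> (fmul (sgn_fn k) \<w>1) l = sgn_fn k * LD S D \<t> \<w>1 l" if "\<And>l. \<w>1 l \<in> C" for \<w>1 k
  using sgn_fn_or[where 'm = 'm, of k] that v by (auto simp: LD_def Der_uminus[OF D] sum_negf)
 have ipC: "ip v \<w> l \<in> C" "ip v \<eta> l \<in> C" for l using Cons.prems by (auto simp: ip_def)
 have wC: "wedge \<w>1 \<w>2 l \<in> C" if "\<And>l. \<w>1 l \<in> C" "\<And>l. \<w>2 l \<in> C" for \<w>1 \<w>2 l
 proof -
  have "(- 1) ^ n * f \<in> C" if "f \<in> C" for n and f
   using that sgn_fn_or[where 'm = 'm, of n] by (auto simp: sgn_fn_def)
  note m = this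
  show ?thesis unfolding wedge_def by (rule alg_sum, rule alg_mult'[OF m]) (use that in auto)
 qed
 have ipLD: "ip v (LD S D \<t> \<rho>) l' = LD S D \<t> (ip v \<rho>) l' - (if set l' \<subseteq> S then ip (\<t> v) \<rho> l' else 0)" for \<rho> l'
  by (simp add: ip_apply LD_Cons[OF v(1)])
 define r where "r \<rho> l' = (if set l' \<subseteq> S then ip (\<t> v) \<rho> l' else 0)" for \<rho> :: "'a list => 'm fn" and l'
 have ipLD': "ip v (LD S D \<t> \<rho>) = LD S D \<t> (ip v \<rho>) - r \<rho>" for \<rho>
  by (rule ext) (simp add: ipLD r_def)
 have wr: "wedge (r \<w>) \<eta> l = wedge (ip (\<t> v) \<w>) \<eta> l" "wedge \<w> (r \<eta>) l = wedge \<w> (ip (\<t> v) \<eta>) l"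
  using v(2) by (auto simp: wedge_def r_def subset_iff dest!: in_set_nthsD intro!: sum.cong)
 have "LD S D \<t> (wedge \<w> \<eta>) (v # l) = LD S D \<t> (wedge (ip v \<w>) \<eta> + fmul (sgn_fn k) (wedge \<w> (ip v \<eta>))) l - ip (\<t> v) (wedge \<w> \<eta>) l"
  using v(2) ip_wedge[OF Cons.prems(1), of v \<eta>] by (simp add: LD_Cons[OF v(1)] ip_apply)
 also have "\<dots> = LD S D \<t> (wedge (ip v \<w>) \<eta>) l + sgn_fn k * LD S D \<t> (wedge \<w> (ip v \<eta>)) l
   - (wedge (ip (\<t> v) \<w>) \<eta> l + sgn_fn k * wedge \<w> (ip (\<t> v) \<eta>) l)"
 proof -
  have c1: "wedge (ip v \<w>) \<eta> l' \<in> C" for l' by (rule wC) (use Cons.prems ipC in auto)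
  have c2: "wedge \<w> (ip v \<eta>) l' \<in> C" for l' by (rule wC) (use Cons.prems ipC in auto)
  have c3: "fmul (sgn_fn k) (wedge \<w> (ip v \<eta>)) l' \<in> C" for l'
   using sgn_fn_or[where 'm = 'm, of k] by (elim disjE) (simp_all add: c2 alg_uminus')
  show ?thesis unfolding ip_wedge[OF Cons.prems(1)] ld[OF c1 c3] ldm[OF c2] by simp
 qed
 also have "LD S D \<t> (wedge (ip v \<w>) \<eta>) l = wedge (LD S D \<t> (ip v \<w>)) \<eta> l + wedge (ip v \<w>) (LD S D \<t> \<eta>) l"
  by (rule Cons.IH[OF h(1)]) (use Cons.prems ipC v in auto)
 also have "LD S D \<t> (wedge \<w> (ip v \<eta>)) l = wedge (LD S D \<t> \<w>) (ip v \<eta>) l + wedge \<w> (LD S D \<t> (ip v \<eta>)) l"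
  by (rule Cons.IH[OF Cons.prems(1)]) (use Cons.prems ipC v in auto)
 finally show ?case
  unfolding wedge_Cons[OF h(2)] wedge_Cons[OF Cons.prems(1)] ipLD'
  by (simp add: wr algebra_simps)
qed

subsection \<open>Alternating forms on a module\<close>

locale fmodule = fun_algebra C for C :: "'m fn set" +
 fixes sm :: "'m fn => 'v::ab_group_add => 'v" and V :: "'v set" and uC :: "'m fn"
 assumes unit_C: "uC \<in> C" and unit_mult: "\<And>f. f \<in> C ==> uC * f = f" and sm_unit: "\<And>v. v \<in> V ==> sm uC v = v"
  and V_0 [simp]: "0 \<in> V" and V_add: "\<And>v w. v \<in> V ==> w \<in> V ==> v + w \<in> V"
  and V_sm: "\<And>f v. f \<in> C ==> v \<in> V ==> sm f v \<in> V" and V_neg: "\<And>v. v \<in> V ==> - v \<in> V"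
begin

abbreviation "Alt k \<equiv> alt C sm V k"

lemma Alt_support: "\<w> \<in> Alt k ==> \<not> (length l = k \<and> set l \<subseteq> V) ==> \<w> l = 0"
 unfolding alt_def by blast

lemma Alt_homog [simp]: "\<w> \<in> Alt k ==> homog k \<w>"
 using Alt_support unfolding homog_def by blast

lemma Alt_C [simp]: "\<w> \<in> Alt k ==> \<w> l \<in> C"
 using Alt_support[of \<w> k l] unfolding alt_def by (cases "length l = k \<and> set l \<subseteq> V") auto

lemma Alt_out: "\<w> \<in> Alt k ==> v \<notin> V ==> ip v \<w> = 0"
 by (rule ext) (auto simp: ip_def intro: Alt_support)

lemma Alt_upd: "\<w> \<in> Alt k ==> length l = k ==> set l \<subseteq> V ==> i < k ==> f \<in> C ==> u \<in> V ==> w \<in> V ==>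
  \<w> (l[i := sm f u + w]) = f * \<w> (l[i := u]) + \<w> (l[i := w])"
 and Alt_same: "\<w> \<in> Alt k ==> length l = k ==> set l \<subseteq> V ==> i < k ==> j < k ==> i \<noteq> j ==> l ! i = l ! j ==> \<w> l = 0"
 unfolding alt_def by blast+

lemma AltI:
 assumes "\<And>l. \<not> (length l = k \<and> set l \<subseteq> V) ==> \<w> l = 0"
  "\<And>l. length l = k ==> set l \<subseteq> V ==> \<w> l \<in> C"
  "\<And>l i f u w. length l = k ==> set l \<subseteq> V ==> i < k ==> f \<in> C ==> u \<in> V ==> w \<in> V ==>
   \<w> (l[i := sm f u + w]) = f * \<w> (l[i := u]) + \<w> (l[i := w])"
  "\<And>l i j. length l = k ==> set l \<subseteq> V ==> i < k ==> j < k ==> i \<noteq> j ==> l ! i = l ! j ==> \<w> l = 0"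
 shows "\<w> \<in> Alt k"
 unfolding alt_def using assms by blast

lemma Alt_0_iff: "\<w> \<in> Alt 0 \<longleftrightarrow> \<w> [] \<in> C \<and> (\<forall>l. l \<noteq> [] --> \<w> l = 0)"
 unfolding alt_def by auto

lemma Alt_ip_V:
 assumes "\<w> \<in> Alt (Suc k)" "v \<in> V"
 shows "ip v \<w> \<in> Alt k"
proof (rule AltI)
 fix l assume "\<not> (length l = k \<and> set l \<subseteq> V)"
 thus "ip v \<w> l = 0" unfolding ip_def by (intro Alt_support[OF assms(1)]) auto
next
 fix l i f u w assume *: "length l = k" "set l \<subseteq> V" "i < k" "f \<in> C" "u \<in> V" "w \<in> V"
 show "ip v \<w> (l[i := sm f u + w]) = f * ip v \<w> (l[i := u]) + ip v \<w> (l[i := w])"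
  using Alt_upd[OF assms(1), of "v # l" "Suc i" f u w] * assms(2) by (simp add: ip_def)
next
 fix l i j assume *: "length l = k" "set l \<subseteq> V" "i < k" "j < k" "i \<noteq> j" "l ! i = l ! j"
 show "ip v \<w> l = 0"
  using Alt_same[OF assms(1), of "v # l" "Suc i" "Suc j"] * assms(2) by (simp add: ip_def)
qed (use assms in \<open>simp add: ip_def\<close>)

lemma Alt_lin:
 assumes "\<w> \<in> Alt (Suc k)" "f \<in> C" "u \<in> V" "w \<in> V"
 shows "ip (sm f u + w) \<w> = fmul f (ip u \<w>) + ip w \<w>"
proof
 fix l
 show "ip (sm f u + w) \<w> l = (fmul f (ip u \<w>) + ip w \<w>) l"
 proof (cases "length l = k \<and> set l \<subseteq> V")
  case True
  thus ?thesis using Alt_upd[OF assms(1), of "u # l" 0 f u w] assms by (simp add: ip_def)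
 next
  case False
  hence "\<w> (x # l) = 0" for x by (intro Alt_support[OF assms(1)]) auto
  thus ?thesis by (simp add: ip_def)
 qed
qed

lemma Alt_double: "\<w> \<in> Alt k ==> ip v (ip v \<w>) = 0"
proof
 fix l assume w: "\<w> \<in> Alt k"
 show "ip v (ip v \<w>) l = 0 l"
 proof (cases "length (v # v # l) = k \<and> set (v # v # l) \<subseteq> V")
  case True
  thus ?thesis using Alt_same[OF w, of "v # v # l" 0 1] by (auto simp: ip_def)
 qed (simp add: ip_def Alt_support[OF w])
qed

lemma Alt_add_arg: "\<w> \<in> Alt k ==> u \<in> V ==> w \<in> V ==> ip (u + w) \<w> = ip u \<w> + ip w \<w>"
proof (cases k)
 case (Suc j)
 assume *: "\<w> \<in> Alt k" "u \<in> V" "w \<in> V"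
 have "fmul uC (ip u \<w>) = ip u \<w>" by (rule ext) (simp add: ip_def unit_mult Alt_C[OF *(1)])
 thus ?thesis using Alt_lin[of \<w> j uC u w] * Suc unit_C sm_unit[of u] by simp
qed simp

lemma Alt_zero_arg: "\<w> \<in> Alt k ==> ip 0 \<w> = 0"
 using Alt_add_arg[of \<w> k 0 0] by simp

lemma Alt_neg_arg: "\<w> \<in> Alt k ==> u \<in> V ==> ip (- u) \<w> = - ip u \<w>"
 using Alt_add_arg[of \<w> k u "- u"] V_neg[of u] Alt_zero_arg[of \<w> k] by (simp add: eq_neg_iff_add_eq_0 add.commute)

lemma Alt_sm_arg: "\<w> \<in> Alt k ==> f \<in> C ==> u \<in> V ==> ip (sm f u) \<w> = fmul f (ip u \<w>)"
proof (cases k)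
 case (Suc j)
 assume *: "\<w> \<in> Alt k" "f \<in> C" "u \<in> V"
 thus ?thesis using Alt_lin[of \<w> j f u 0] Suc Alt_zero_arg[of \<w> k] by simp
qed simp

lemma Alt_zero [simp]: "0 \<in> Alt k"
 by (rule AltI) auto

lemma Alt_ip [simp]: "\<w> \<in> Alt k ==> ip v \<w> \<in> Alt (k - 1)"
 using Alt_ip_V[of \<w> "k - 1" v] Alt_out[of \<w> k v] by (cases k; cases "v \<in> V") auto

lemma Alt_skew: "\<w> \<in> Alt k ==> ip v (ip w \<w>) = - ip w (ip v \<w>)"
proof (cases "v \<in> V \<and> w \<in> V")
 case True
 assume w: "\<w> \<in> Alt k"
 have "0 = ip (v + w) (ip (v + w) \<w>)" by (simp add: Alt_double[OF w])
 also have "\<dots> = ip v (ip v \<w>) + ip v (ip w \<w>) + (ip w (ip v \<w>) + ip w (ip w \<w>))"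
  using w True Alt_add_arg[OF Alt_ip[OF w], of v w] by (simp add: Alt_add_arg algebra_simps)
 finally show ?thesis by (simp add: Alt_double[OF w] eq_neg_iff_add_eq_0)
next
 case False
 assume w: "\<w> \<in> Alt k"
 hence "ip v \<w> = 0 \<or> ip w \<w> = 0" using False Alt_out[OF w] by blast
 moreover have "ip v (ip w \<w>) = 0 \<or> ip v \<w> \<noteq> 0" "ip w (ip v \<w>) = 0 \<or> ip w \<w> \<noteq> 0"
  using False Alt_out[OF w] Alt_out[OF Alt_ip[OF w]] by (metis ip_simps(4))+
 ultimately show ?thesis using False Alt_out[OF w] Alt_out[OF Alt_ip[OF w]] by (metis ip_simps(4) neg_equal_0_iff_equal)
qed

lemma Alt_move: "\<w> \<in> Alt k ==> \<w> (xs @ v # ys) = sgn_fn (length xs) * \<w> (v # xs @ ys)"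
proof (induction xs arbitrary: k \<w>)
 case (Cons x xs)
 have "\<w> ((x # xs) @ v # ys) = ip x \<w> (xs @ v # ys)" by (simp add: ip_def)
 also have "\<dots> = sgn_fn (length xs) * ip x \<w> (v # xs @ ys)" by (rule Cons.IH[OF Alt_ip[OF Cons.prems]])
 also have "ip x \<w> (v # xs @ ys) = - \<w> (v # x # xs @ ys)"
  using fun_cong[OF Alt_skew[OF Cons.prems, of v x], of "xs @ ys"] by (simp add: ip_def)
 finally show ?case by simp
qed simp

lemma Alt_not_distinct: "\<w> \<in> Alt k ==> \<not> distinct l ==> \<w> l = 0"
proof -
 assume w: "\<w> \<in> Alt k" and "\<not> distinct l"
 then obtain xs y ys zs where l: "l = xs @ y # ys @ y # zs" using not_distinct_decomp[of l] by auto
 have "ip y \<w> ((xs @ ys) @ y # zs) = sgn_fn (length (xs @ ys)) * ip y \<w> (y # (xs @ ys) @ zs)"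
  by (rule Alt_move[OF Alt_ip[OF w]])
 moreover have "ip y \<w> (y # (xs @ ys) @ zs) = 0"
  using fun_cong[OF Alt_double[OF w, of y], of "(xs @ ys) @ zs"] by (simp add: ip_def)
 ultimately show ?thesis using Alt_move[OF w, of xs y "ys @ y # zs"] by (simp add: l ip_def)
qed

text \<open>The sign may stay open, because the lemma serves to transport the vanishing of a value
  from one ordering of the arguments to another.\<close>

lemma Alt_perm: "\<w> \<in> Alt k ==> mset xs = mset ys ==> \<w> xs = \<w> ys \<or> \<w> xs = - \<w> ys"
proof (induction xs arbitrary: k \<w> ys)
 case (Cons x xs)
 have "x \<in> set ys" using Cons.prems(2) by (metis list.set_intros(1) set_mset_mset)
 then obtain as bs where ys: "ys = as @ x # bs" by (meson split_list)
 have "mset xs = mset (as @ bs)" using Cons.prems(2) by (simp add: ys)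
 hence "ip x \<w> xs = ip x \<w> (as @ bs) \<or> ip x \<w> xs = - ip x \<w> (as @ bs)"
  by (rule Cons.IH[OF Alt_ip[OF Cons.prems(1)]])
 moreover have "\<w> ys = sgn_fn (length as) * ip x \<w> (as @ bs)"
  unfolding ys ip_def by (rule Alt_move[OF Cons.prems(1)])
 ultimately show ?case using sgn_fn_or[where 'm = 'm, of "length as"] by (auto simp: ip_def)
qed simp

text \<open>The inductive criterion for being alternating. A repetition involving the first slot is
  brought into the first two slots by \<open>Alt_move\<close>, applied inside
  \<open>ip v \<w>\<close>, and there \<open>dbl\<close> applies.\<close>

lemma Alt_SucI:
 assumes "\<w> [] = 0" "\<And>v l. v \<notin> V ==> \<w> (v # l) = 0" and i: "\<And>v. v \<in> V ==> ip v \<w> \<in> Alt k"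
  and lin: "\<And>f u w. f \<in> C ==> u \<in> V ==> w \<in> V ==> ip (sm f u + w) \<w> = fmul f (ip u \<w>) + ip w \<w>"
  and dbl: "\<And>v. v \<in> V ==> ip v (ip v \<w>) = 0"
 shows "\<w> \<in> Alt (Suc k)"
proof (rule AltI)
 fix l assume l: "\<not> (length l = Suc k \<and> set l \<subseteq> V)"
 show "\<w> l = 0"
 proof (cases l)
  case (Cons v l')
  show ?thesis
  proof (cases "v \<in> V")
   case True
   hence "ip v \<w> l' = 0" using l Cons by (intro Alt_support[OF i[OF True]]) auto
   thus ?thesis by (simp add: Cons ip_def)
  qed (simp add: Cons assms)
 qed (simp add: assms)
next
 fix l assume l: "length l = Suc k" "set l \<subseteq> V"
 thus "\<w> l \<in> C" using Alt_C[OF i, of "hd l" "tl l"] by (cases l) (auto simp: ip_def)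
next
 fix l j f u w assume l: "length l = Suc k" "set l \<subseteq> V" and j: "j < Suc k" and fuw: "f \<in> C" "u \<in> V" "w \<in> V"
 obtain v l' where vl: "l = v # l'" "v \<in> V" "length l' = k" "set l' \<subseteq> V" using l by (cases l) auto
 show "\<w> (l[j := sm f u + w]) = f * \<w> (l[j := u]) + \<w> (l[j := w])"
 proof (cases j)
  case 0
  thus ?thesis using fun_cong[OF lin[OF fuw], of l'] by (simp add: vl ip_def)
 next
  case (Suc j')
  thus ?thesis using Alt_upd[OF i[OF vl(2)] vl(3,4) _ fuw, of j'] j by (simp add: vl ip_def)
 qed
next
 fix l p q assume l: "length l = Suc k" "set l \<subseteq> V" and pq: "p < Suc k" "q < Suc k" "p \<noteq> q" "l ! p = l ! q"
 obtain v l' where vl: "l = v # l'" "v \<in> V" "length l' = k" "set l' \<subseteq> V" using l by (cases l) auto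
 have z: "\<w> (v # l') = 0" if "r < k" "l' ! r = v" for r
 proof -
  have "l' = take r l' @ v # drop (Suc r) l'" using that vl(3) id_take_nth_drop[of r l'] by simp
  hence "ip v \<w> l' = sgn_fn (length (take r l')) * ip v \<w> (v # take r l' @ drop (Suc r) l')"
   using Alt_move[OF i[OF vl(2)], of "take r l'" v "drop (Suc r) l'"] by metis
  moreover have "ip v \<w> (v # take r l' @ drop (Suc r) l') = 0"
   using fun_cong[OF dbl[OF vl(2)], of "take r l' @ drop (Suc r) l'"] by (simp add: ip_def)
  ultimately show ?thesis by (simp add: ip_def)
 qed
 show "\<w> l = 0"
 proof (cases p)
  case 0
  thus ?thesis using z[of "q - 1"] pq by (cases q) (auto simp: vl)
 next
  case (Suc p')
  show ?thesis
  proof (cases q)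
   case 0
   thus ?thesis using z[of p'] pq Suc by (auto simp: vl)
  next
   case (Suc q')
   thus ?thesis using Alt_same[OF i[OF vl(2)] vl(3,4), of p' q'] pq \<open>p = Suc p'\<close> by (simp add: vl ip_def)
  qed
 qed
qed

lemma Alt_add: "\<w> \<in> Alt k ==> \<eta> \<in> Alt k ==> \<w> + \<eta> \<in> Alt k"
proof -
 assume a: "\<w> \<in> Alt k" "\<eta> \<in> Alt k"
 show ?thesis
 proof (rule AltI)
  fix l i f u w assume "length l = k" "set l \<subseteq> V" "i < k" "f \<in> C" "u \<in> V" "w \<in> V"
  thus "(\<w> + \<eta>) (l[i := sm f u + w]) = f * (\<w> + \<eta>) (l[i := u]) + (\<w> + \<eta>) (l[i := w])"
   by (simp add: Alt_upd[OF a(1)] Alt_upd[OF a(2)]) (simp add: algebra_simps)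
 qed (auto simp: Alt_support[OF a(1)] Alt_support[OF a(2)] Alt_C[OF a(1)] Alt_C[OF a(2)] Alt_same[OF a(1)] Alt_same[OF a(2)])
qed

lemma Alt_fmul: "\<w> \<in> Alt k ==> h \<in> C ==> fmul h \<w> \<in> Alt k"
proof -
 assume a: "\<w> \<in> Alt k" "h \<in> C"
 show ?thesis
 proof (rule AltI)
  fix l i f u w assume "length l = k" "set l \<subseteq> V" "i < k" "f \<in> C" "u \<in> V" "w \<in> V"
  thus "fmul h \<w> (l[i := sm f u + w]) = f * fmul h \<w> (l[i := u]) + fmul h \<w> (l[i := w])"
   by (simp add: Alt_upd[OF a(1)]) (simp add: algebra_simps)
 qed (auto simp: Alt_support[OF a(1)] Alt_C[OF a(1)] Alt_same[OF a(1)] a(2))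
qed

lemma fmul_const: "\<w> \<in> Alt k ==> fmul (%x. c * uC x) \<w> = cmul c \<w>"
proof
 fix l assume w: "\<w> \<in> Alt k"
 have "uC * \<w> l = \<w> l" by (rule unit_mult[OF Alt_C[OF w]])
 hence "uC x * \<w> l x = \<w> l x" for x by (metis times_fun_apply)
 thus "fmul (%x. c * uC x) \<w> l = cmul c \<w> l"
  by (simp add: fun_eq_iff times_fun_apply cmul_def mult.assoc)
qed

lemma Alt_cmul: "\<w> \<in> Alt k ==> cmul c \<w> \<in> Alt k"
 using Alt_fmul[of \<w> k "%x. c * uC x"] fmul_const[of \<w> k c] alg_scale[OF unit_C, of c] by simp

lemma cmul_minus_one: "cmul (- 1) \<w> = - \<w>"
 by (simp add: cmul_def fun_eq_iff fun_app)

lemma Alt_neg: "\<w> \<in> Alt k ==> - \<w> \<in> Alt k"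
 using Alt_cmul[of \<w> k "-1"] by (simp add: cmul_minus_one)

lemma Alt_diff: "\<w> \<in> Alt k ==> \<eta> \<in> Alt k ==> \<w> - \<eta> \<in> Alt k"
 using Alt_add[of \<w> k "- \<eta>"] Alt_neg[of \<eta> k] by simp

lemma Alt_sum: "(\<And>i. i \<in> F ==> \<w> i \<in> Alt k) ==> sum \<w> F \<in> Alt k"
 by (rule sum_closed[OF Alt_zero Alt_add])

lemma Alt_sgn: "\<w> \<in> Alt k ==> fmul (sgn_fn j) \<w> \<in> Alt k"
proof -
 assume w: "\<w> \<in> Alt k"
 have "fmul (sgn_fn j) \<w> = \<w> \<or> fmul (sgn_fn j) \<w> = - \<w>"
  using sgn_fn_or[where 'm = 'm, of j] by (auto simp: fmul_def fun_eq_iff fun_app)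
 thus ?thesis using w Alt_neg by auto
qed

lemma Alt_eqI: "\<w> \<in> Alt (Suc k) ==> \<eta> \<in> Alt (Suc k) ==> (\<And>v. v \<in> V ==> ip v \<w> = ip v \<eta>) ==> \<w> = \<eta>"
proof
 fix l assume a: "\<w> \<in> Alt (Suc k)" "\<eta> \<in> Alt (Suc k)" "\<And>v. v \<in> V ==> ip v \<w> = ip v \<eta>"
 show "\<w> l = \<eta> l"
 proof (cases "length l = Suc k \<and> set l \<subseteq> V")
  case True
  then obtain v l' where "l = v # l'" "v \<in> V" by (cases l) auto
  thus ?thesis using fun_cong[OF a(3), of v l'] by (simp add: ip_def)
 qed (simp add: Alt_support[OF a(1)] Alt_support[OF a(2)])
qed

lemma Alt_wedge: "\<w> \<in> Alt k ==> \<eta> \<in> Alt m ==> wedge \<w> \<eta> \<in> Alt (k + m)"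
proof -
 have "\<w> \<in> Alt k ==> \<eta> \<in> Alt m ==> k + m = n ==> wedge \<w> \<eta> \<in> Alt n" for n k m \<w> \<eta>
 proof (induction n arbitrary: k m \<w> \<eta>)
  case 0
  hence "wedge \<w> \<eta> l = 0" if "l \<noteq> []" for l
   using homogD[OF homog_wedge[of k \<w> m \<eta>], of l] that by simp
  thus ?case using 0 unfolding Alt_0_iff by (auto simp: wedge_Nil)
 next
  case (Suc n)
  note h = Alt_homog[OF Suc.prems(1)] Alt_homog[OF Suc.prems(2)]
  have w1: "wedge (ip v \<w>) \<eta> \<in> Alt n" for v
  proof (cases k)
   case 0
   thus ?thesis using h by simp
  next
   case (Suc k')
   thus ?thesis using Suc.IH[OF Alt_ip[OF Suc.prems(1)] Suc.prems(2)] Suc.prems(3) by simp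
  qed
  have w2: "wedge \<w> (ip v \<eta>) \<in> Alt n" for v
  proof (cases m)
   case 0
   thus ?thesis using h by simp
  next
   case (Suc k')
   thus ?thesis using Suc.IH[OF Suc.prems(1) Alt_ip[OF Suc.prems(2)]] Suc.prems(3) by simp
  qed
  show ?case
  proof (rule Alt_SucI)
   have "\<w> [] = 0 \<or> \<eta> [] = 0" using homogD[OF h(1), of "[]"] homogD[OF h(2), of "[]"] Suc.prems(3) by (cases k) auto
   thus "wedge \<w> \<eta> [] = 0" by (auto simp: wedge_Nil)
   show "wedge \<w> \<eta> (v # l) = 0" if "v \<notin> V" for v l
    using Alt_out[OF Suc.prems(1) that] Alt_out[OF Suc.prems(2) that] by (simp add: wedge_Cons[OF h(1)])
   show "ip v (wedge \<w> \<eta>) \<in> Alt n" for v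
    unfolding ip_wedge[OF h(1)] by (intro Alt_add Alt_sgn w1 w2)
   show "ip (sm f u + w) (wedge \<w> \<eta>) = fmul f (ip u (wedge \<w> \<eta>)) + ip w (wedge \<w> \<eta>)"
    if "f \<in> C" "u \<in> V" "w \<in> V" for f u w
   proof -
    have "ip (sm f u + w) \<rho> = fmul f (ip u \<rho>) + ip w \<rho>" if "\<rho> \<in> Alt j" for \<rho> j
     using Alt_add_arg[OF that V_sm[OF \<open>f \<in> C\<close> \<open>u \<in> V\<close>] \<open>w \<in> V\<close>] Alt_sm_arg[OF that \<open>f \<in> C\<close> \<open>u \<in> V\<close>] by simp
    from this[OF Suc.prems(1)] this[OF Suc.prems(2)]
    show ?thesis unfolding ip_wedge[OF h(1)] 
     by (simp add: algebra_simps) (simp add: fmul_def fun_eq_iff fun_app mult.left_commute)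
   qed
   show "ip v (ip v (wedge \<w> \<eta>)) = 0" if "v \<in> V" for v
   proof (cases k)
    case 0
    thus ?thesis using Alt_double[OF Suc.prems(2)] h by (simp add: ip_wedge[OF h(1)])
   next
    case (Suc k')
    have h': "homog k' (ip v \<w>)" using h Suc by simp
    show ?thesis using Alt_double[OF Suc.prems(1)] Alt_double[OF Suc.prems(2)]
     by (simp add: ip_wedge[OF h(1)] ip_wedge[OF h'] Suc)
   qed
  qed
 qed
 thus "\<w> \<in> Alt k ==> \<eta> \<in> Alt m ==> wedge \<w> \<eta> \<in> Alt (k + m)" by blast
qed

end

subsection \<open>Decomposition into bidegrees\<close>

lemma sum_card_Suc:
 "(\<Sum>S\<in>{S. S \<subseteq> {..<Suc n} \<and> card S = p}. g S) =
  (case p of 0 => 0 | Suc p' => \<Sum>T\<in>{T. T \<subseteq> {..<n} \<and> card T = p'}. g (insert 0 (Suc ` T)))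
  + (\<Sum>T\<in>{T. T \<subseteq> {..<n} \<and> card T = p}. g (Suc ` T))"
proof -
 have c: "card (Suc ` T) = card T" for T by (simp add: card_image)
 have c': "card (insert 0 (Suc ` T)) = Suc (card T)" if "T \<subseteq> {..<n}" for T
  using finite_subset[OF that] by (subst card_insert_disjoint) (auto simp: c)
 have "(\<Sum>S\<in>{S. S \<subseteq> {..<Suc n} \<and> card S = p}. g S) = (\<Sum>S\<in>Pow {..<Suc n}. if card S = p then g S else 0)"
  by (rule sum.mono_neutral_cong_left) auto
 also have "\<dots> = (\<Sum>T\<in>Pow {..<n}. if card (insert 0 (Suc ` T)) = p then g (insert 0 (Suc ` T)) else 0)
   + (\<Sum>T\<in>Pow {..<n}. if card (Suc ` T) = p then g (Suc ` T) else 0)"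
  by (rule sum_Pow_Suc)
 also have "(\<Sum>T\<in>Pow {..<n}. if card (Suc ` T) = p then g (Suc ` T) else 0) = (\<Sum>T\<in>{T. T \<subseteq> {..<n} \<and> card T = p}. g (Suc ` T))"
  unfolding c by (rule sum.mono_neutral_cong_right) auto
 also have "(\<Sum>T\<in>Pow {..<n}. if card (insert 0 (Suc ` T)) = p then g (insert 0 (Suc ` T)) else 0) =
   (case p of 0 => 0 | Suc p' => \<Sum>T\<in>{T. T \<subseteq> {..<n} \<and> card T = p'}. g (insert 0 (Suc ` T)))"
 proof (cases p)
  case 0
  thus ?thesis by (auto simp: c' intro!: sum.neutral)
 next
  case (Suc p')
  thus ?thesis by (simp, intro sum.mono_neutral_cong_right) (auto simp: c')
 qed
 finally show ?thesis .
qed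

lemma component_Cons:
 assumes "v \<in> V"
 shows "ip v (component V P' P'' p \<w>) =
  (case p of 0 => 0 | Suc p' => component V P' P'' p' (ip (P' v) \<w>)) + component V P' P'' p (ip (P'' v) \<w>)"
proof
 fix l
 let ?m = "%l S. map (%i. if i \<in> S then P' (l ! i) else P'' (l ! i)) [0..<length l]"
 have m: "?m (v # l) (insert 0 (Suc ` T)) = P' v # ?m l T" "?m (v # l) (Suc ` T) = P'' v # ?m l T" for T
  by (auto simp: map_upt_Suc simp del: upt_Suc intro!: map_cong)
 show "ip v (component V P' P'' p \<w>) l =
  ((case p of 0 => 0 | Suc p' => component V P' P'' p' (ip (P' v) \<w>)) + component V P' P'' p (ip (P'' v) \<w>)) l"
 proof (cases "set l \<subseteq> V")
  case True
  have "ip v (component V P' P'' p \<w>) l = (\<Sum>S\<in>{S. S \<subseteq> {..<Suc (length l)} \<and> card S = p}. \<w> (?m (v # l) S))"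
   using True assms by (simp add: ip_def component_def)
  also have "\<dots> = (case p of 0 => 0 | Suc p' => \<Sum>T\<in>{T. T \<subseteq> {..<length l} \<and> card T = p'}. \<w> (?m (v # l) (insert 0 (Suc ` T))))
   + (\<Sum>T\<in>{T. T \<subseteq> {..<length l} \<and> card T = p}. \<w> (?m (v # l) (Suc ` T)))" by (rule sum_card_Suc)
  finally show ?thesis using True unfolding m by (simp add: component_def ip_def split: nat.split)
 next
  case False
  thus ?thesis using assms by (simp add: ip_def component_def split: nat.split)
 qed
qed

lemma component_Nil: "component V P' P'' p \<w> [] = (if p = 0 then \<w> [] else 0)"
proof -
 have "{S :: nat set. S \<subseteq> {} \<and> card S = p} = (if p = 0 then {{}} else {})" by auto
 thus ?thesis by (simp add: component_def)
qed

lemma component_outside: "v \<notin> V ==> component V P' P'' p \<w> (v # l) = 0"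
 by (simp add: component_def)

lemma component_lin: "component V P' P'' p (\<w> + \<eta>) = component V P' P'' p \<w> + component V P' P'' p \<eta>"
 "component V P' P'' p 0 = 0" "component V P' P'' p (fmul f \<w>) = fmul f (component V P' P'' p \<w>)"
 "component V P' P'' p (- \<w>) = - component V P' P'' p \<w>"
 by (rule ext, simp add: component_def sum.distrib sum_distrib_left sum_negf)+

locale split_module = fmodule C sm V uC for C :: "'m fn set" and sm :: "'m fn => 'v::ab_group_add => 'v" and V uC +
 fixes P' P'' :: "'v => 'v"
 assumes P_V: "\<And>v. v \<in> V ==> P' v \<in> V" "\<And>v. v \<in> V ==> P'' v \<in> V"
  and P_lin: "\<And>f v w. f \<in> C ==> v \<in> V ==> w \<in> V ==> P' (sm f v + w) = sm f (P' v) + P' w"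
   "\<And>f v w. f \<in> C ==> v \<in> V ==> w \<in> V ==> P'' (sm f v + w) = sm f (P'' v) + P'' w"
  and P_P: "\<And>v. v \<in> V ==> P' (P' v) = P' v" "\<And>v. v \<in> V ==> P'' (P'' v) = P'' v"
   "\<And>v. v \<in> V ==> P' (P'' v) = 0" "\<And>v. v \<in> V ==> P'' (P' v) = 0"
  and P_sum: "\<And>v. v \<in> V ==> P' v + P'' v = v"
begin

abbreviation "cpt \<equiv> component V P' P''"

lemma comp_Alt: "\<w> \<in> Alt k ==> cpt p \<w> \<in> Alt k"
proof (induction k arbitrary: p \<w>)
 case 0
 have "cpt p \<w> l = 0" if "l \<noteq> []" for l
 proof (cases l)
  case (Cons v l')
  show ?thesis
  proof (cases "v \<in> V")
   case True
   have "ip v (cpt p \<w>) = 0"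
    unfolding component_Cons[OF True] using Alt_homog[OF 0] by (simp add: component_lin split: nat.split)
   hence "ip v (cpt p \<w>) l' = 0" by simp
   thus ?thesis by (simp add: Cons ip_def)
  qed (simp add: Cons component_outside)
 qed (use that in simp)
 thus ?case using 0 by (auto simp: Alt_0_iff component_Nil)
next
 case (Suc k)
 have lin: "ip (sm f u + w) \<w> = fmul f (ip u \<w>) + ip w \<w>" if "f \<in> C" "u \<in> V" "w \<in> V" for f u w
  by (rule Alt_lin[OF Suc.prems that])
 show ?case
 proof (rule Alt_SucI)
  show "cpt p \<w> [] = 0" using homogD[OF Alt_homog[OF Suc.prems], of "[]"] by (simp add: component_Nil)
  show "cpt p \<w> (v # l) = 0" if "v \<notin> V" for v l by (rule component_outside[OF that])
  have i: "ip v \<w> \<in> Alt k" for v using Alt_ip[OF Suc.prems] by simp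
  show "ip v (cpt p \<w>) \<in> Alt k" if "v \<in> V" for v
   unfolding component_Cons[OF that] by (auto intro!: Alt_add Suc.IH i split: nat.split)
  show "ip (sm f u + w) (cpt p \<w>) = fmul f (ip u (cpt p \<w>)) + ip w (cpt p \<w>)"
   if "f \<in> C" "u \<in> V" "w \<in> V" for f u w
   unfolding component_Cons[OF that(2)] component_Cons[OF that(3)] component_Cons[OF V_add[OF V_sm[OF that(1,2)] that(3)]]
   using that by (cases p; simp add: P_lin lin P_V component_lin; (simp add: ac_simps)?)
  show "ip v (ip v (cpt p \<w>)) = 0" if "v \<in> V" for v
  proof -
   note d = Alt_double[OF Suc.prems] and sk = Alt_skew[OF Suc.prems, of "P'' v" "P' v"]
   show ?thesis
    unfolding component_Cons[OF that] ip_simps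
    by (cases p; cases "p - 1") (auto simp: component_Cons[OF that] d sk component_lin)
  qed
 qed
qed

lemma comp_idem: "\<w> \<in> Alt k ==> cpt p (cpt p \<w>) = cpt p \<w>"
proof (induction k arbitrary: p \<w>)
 case 0
 have "cpt p \<w> = (if p = 0 then \<w> else 0)"
 proof
  fix l
  show "cpt p \<w> l = (if p = 0 then \<w> else 0) l"
   using comp_Alt[OF 0, of p] 0 by (cases l) (auto simp: component_Nil Alt_0_iff)
 qed
 thus ?case by (auto simp: component_lin)
next
 case (Suc k)
 have i: "ip v \<w> \<in> Alt k" for v using Alt_ip[OF Suc.prems] by simp
 have i0: "ip 0 \<w> = 0" by (rule Alt_zero_arg[OF Suc.prems])
 show ?case
 proof (rule Alt_eqI[OF comp_Alt[OF comp_Alt[OF Suc.prems]] comp_Alt[OF Suc.prems]])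
  fix v assume v: "v \<in> V"
  note cc = component_Cons[OF v] component_Cons[OF P_V(1)[OF v]] component_Cons[OF P_V(2)[OF v]]
  show "ip v (cpt p (cpt p \<w>)) = ip v (cpt p \<w>)"
   by (cases p) (simp_all add: cc P_P[OF v] i0 component_lin Suc.IH[OF i])
 qed
qed

lemma comp_sum: "\<w> \<in> Alt k ==> (\<Sum>p\<le>k. cpt p \<w>) = \<w>"
proof (induction k arbitrary: \<w>)
 case 0
 have "cpt 0 \<w> l = \<w> l" for l
  using comp_Alt[OF 0, of 0] 0 by (cases l) (auto simp: component_Nil Alt_0_iff)
 thus ?case by (simp add: fun_eq_iff)
next
 case (Suc k)
 have i: "ip v \<w> \<in> Alt k" for v using Alt_ip[OF Suc.prems] by simp
 have top: "cpt (Suc k) \<eta> = 0" if "\<eta> \<in> Alt k" for \<eta>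
 proof
  fix l :: "'v list"
  have "{S. S \<subseteq> {..<length l} \<and> card S = Suc k} = {}" if "length l = k"
   using that by (auto dest!: card_mono[OF finite_lessThan])
  note e = this
  show "cpt (Suc k) \<eta> l = 0 l"
  proof (cases "length l = k")
   case True
   show ?thesis unfolding component_def e[OF True] by simp
  qed (use Alt_support[OF comp_Alt[OF that], of l] in auto)
 qed
 show ?case
 proof (rule Alt_eqI[OF Alt_sum[OF comp_Alt[OF Suc.prems]] Suc.prems])
  fix v assume v: "v \<in> V"
  have "ip v (\<Sum>p\<le>Suc k. cpt p \<w>) = (\<Sum>p\<le>Suc k. ip v (cpt p \<w>))" by (rule ip_sum)
  also have "\<dots> = (\<Sum>p\<le>Suc k. case p of 0 => 0 | Suc p' => cpt p' (ip (P' v) \<w>)) + (\<Sum>p\<le>Suc k. cpt p (ip (P'' v) \<w>))"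
   unfolding component_Cons[OF v] by (rule sum.distrib)
  also have "(\<Sum>p\<le>Suc k. case p of 0 => 0 | Suc p' => cpt p' (ip (P' v) \<w>)) = (\<Sum>p\<le>k. cpt p (ip (P' v) \<w>))"
   by (subst sum.atMost_Suc_shift) simp
  also have "(\<Sum>p\<le>Suc k. cpt p (ip (P'' v) \<w>)) = (\<Sum>p\<le>k. cpt p (ip (P'' v) \<w>))"
   by (simp add: top[OF i])
  also have "(\<Sum>p\<le>k. cpt p (ip (P' v) \<w>)) + (\<Sum>p\<le>k. cpt p (ip (P'' v) \<w>)) = ip (P' v) \<w> + ip (P'' v) \<w>"
   by (simp only: Suc.IH[OF i])
  also have "\<dots> = ip v \<w>" using Alt_add_arg[OF Suc.prems P_V(1)[OF v] P_V(2)[OF v]] by (simp add: P_sum[OF v])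
  finally show "ip v (\<Sum>p\<le>Suc k. cpt p \<w>) = ip v \<w>" .
 qed
qed

end

subsection \<open>The differential of a Lie algebroid\<close>

lemma nths_minus: "i < length l ==> nths l (- {i}) = take i l @ drop (Suc i) l"
proof (induction l arbitrary: i)
 case (Cons x l)
 have "{j. Suc j \<noteq> 0} = UNIV" "{j. Suc j \<noteq> Suc i'} = - {i'}" for i' by auto
 thus ?case using Cons by (cases i) (auto simp: nths_Cons nths_all)
qed simp

definition fn0 :: "'m fn => 'v list => 'm fn" where
 "fn0 f = (%l. if l = [] then f else 0)"

lemma homog_fn0 [simp]: "homog 0 (fn0 f)"
 by (simp add: homog_def fn0_def)

lemma wedge_fn0: "wedge (fn0 f) \<w> = fmul f \<w>"
proof
 fix l
 show "wedge (fn0 f) \<w> l = fmul f \<w> l"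
 proof (induction l arbitrary: \<w>)
  case (Cons v l)
  show "wedge (fn0 f) \<w> (v # l) = fmul f \<w> (v # l)"
   unfolding wedge_Cons[OF homog_fn0] Cons[of "ip v \<w>"] by (simp add: ip_apply)
 qed (simp add: wedge_Nil fn0_def)
qed

lemma form_eqI:
 assumes "F [] = H []" "\<And>v l. v \<notin> V ==> F (v # l) = 0" "\<And>v l. v \<notin> V ==> H (v # l) = 0" "\<And>v. v \<in> V ==> ip v F = ip v H"
 shows "F = H"
proof
 fix l
 show "F l = H l"
 proof (cases l)
  case (Cons v l')
  thus ?thesis using assms(2,3)[of v l'] fun_cong[OF assms(4), of v l'] by (cases "v \<in> V") (auto simp: ip_def)
 qed (simp add: assms)
qed

lemma koszul_Nil: "koszul V a br k \<w> [] = 0"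
 by (simp add: koszul_def)

lemma koszul_outside: "v \<notin> V ==> koszul V a br k \<w> (v # l) = 0"
 by (simp add: koszul_def)

lemma homog_koszul: "homog (Suc k) (koszul V a br k \<w>)"
 by (auto simp: homog_def koszul_def)

locale algebroid = fmodule C sm V uC for C :: "'m fn set" and sm :: "'m fn => 'v::ab_group_add => 'v" and V uC +
 fixes a :: "'v => 'm vf" and br :: "'v => 'v => 'v"
 assumes a_Der: "\<And>v. v \<in> V ==> a v \<in> Der" and br_V: "\<And>v w. v \<in> V ==> w \<in> V ==> br v w \<in> V"
  and br_skew: "\<And>v w. v \<in> V ==> w \<in> V ==> br v w = - br w v"
  and br_add: "\<And>v w u. v \<in> V ==> w \<in> V ==> u \<in> V ==> br v (w + u) = br v w + br v u"
  and br_sm: "\<And>f v w. f \<in> C ==> v \<in> V ==> w \<in> V ==> br v (sm f w) = sm (a v f) w + sm f (br v w)"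
  and a_add: "\<And>v w. v \<in> V ==> w \<in> V ==> a (v + w) = a v + a w"
  and a_sm: "\<And>f v. f \<in> C ==> v \<in> V ==> a (sm f v) = fmul f (a v)"
  and a_br: "\<And>v w. v \<in> V ==> w \<in> V ==> a (br v w) = lie (a v) (a w)"
  and jacobi: "\<And>v w u. v \<in> V ==> w \<in> V ==> u \<in> V ==> br v (br w u) = br (br v w) u + br w (br v u)"
begin

abbreviation "\<d> k \<equiv> koszul V a br k"
abbreviation "Lv v \<equiv> LD V (a v) (br v)"

lemma a_C [simp]: "v \<in> V ==> a v f \<in> C" and a_0 [simp]: "v \<in> V ==> a v 0 = 0"
 using Der_C' Der_zero a_Der by blast+

lemma Lv_ip: "\<w> \<in> Alt k ==> v \<in> V ==> w \<in> V ==> ip w (Lv v \<w>) = Lv v (ip w \<w>) - ip (br v w) \<w>"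
proof
 fix l assume w: "\<w> \<in> Alt k" "v \<in> V" "w \<in> V"
 have "\<w> (br v w # l) = 0" if "\<not> set l \<subseteq> V" by (rule Alt_support[OF w(1)]) (use that in auto)
 thus "ip w (Lv v \<w>) l = (Lv v (ip w \<w>) - ip (br v w) \<w>) l"
  by (simp add: ip_apply LD_Cons[OF w(3)])
qed

lemma Lv_out: "w \<notin> V ==> Lv v \<w> (w # l) = 0"
 by (rule LD_outside) simp

lemma Lv_lin:
 assumes v: "v \<in> V" and w: "\<w> \<in> Alt k" and e: "\<eta> \<in> Alt k"
 shows Lv_add: "Lv v (\<w> + \<eta>) = Lv v \<w> + Lv v \<eta>" and Lv_diff: "Lv v (\<w> - \<eta>) = Lv v \<w> - Lv v \<eta>"
  and Lv_neg: "Lv v (- \<w>) = - Lv v \<w>"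
  and Lv_fmul: "f \<in> C ==> Lv v (fmul f \<w>) = fmul (a v f) \<w> + fmul f (Lv v \<w>)"
proof -
 note D = a_Der[OF v]
 show "Lv v (\<w> + \<eta>) = Lv v \<w> + Lv v \<eta>" "Lv v (\<w> - \<eta>) = Lv v \<w> - Lv v \<eta>" "Lv v (- \<w>) = - Lv v \<w>"
  by (rule ext, simp add: LD_def Der_add[OF D] Der_diff[OF D] Der_uminus[OF D] Alt_C[OF w] Alt_C[OF e]
    sum.distrib sum_subtractf sum_negf)+
 show "Lv v (fmul f \<w>) = fmul (a v f) \<w> + fmul f (Lv v \<w>)" if f: "f \<in> C"
 proof
  fix l
  show "Lv v (fmul f \<w>) l = (fmul (a v f) \<w> + fmul f (Lv v \<w>)) l"
  proof (cases "set l \<subseteq> V")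
   case True
   thus ?thesis
    by (simp add: LD_def Der_mult[OF D f Alt_C[OF w]] sum_distrib_left right_diff_distrib)
  next
   case False
   hence "\<w> l = 0" by (intro Alt_support[OF w]) auto
   thus ?thesis using False by (simp add: LD_def)
  qed
 qed
qed

lemma Lv_zero [simp]: "v \<in> V ==> Lv v 0 = 0"
 by (rule ext) (simp add: LD_def)

lemma Alt_0_eqI: "\<w> \<in> Alt 0 ==> \<eta> \<in> Alt 0 ==> \<w> [] = \<eta> [] ==> \<w> = \<eta>"
 unfolding Alt_0_iff by (rule ext, rename_tac l, case_tac l) auto

lemma Lv_Alt: "\<w> \<in> Alt k ==> v \<in> V ==> Lv v \<w> \<in> Alt k"
proof (induction k arbitrary: \<w>)
 case 0
 have "Lv v \<w> l = 0" if "l \<noteq> []" for l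
  by (rule homogD[OF homog_LD[OF Alt_homog[OF 0(1)], where D = "a v"]]) (use that 0(2) in simp_all)
 thus ?case using 0 by (auto simp: Alt_0_iff LD_Nil)
next
 case (Suc k)
 note v = Suc.prems(2) and w = Suc.prems(1)
 have i: "ip u \<w> \<in> Alt k" for u using Alt_ip[OF w] by simp
 show ?case
 proof (rule Alt_SucI)
  have "\<w> [] = 0" using homogD[OF Alt_homog[OF w], of "[]"] by simp
  thus "Lv v \<w> [] = 0" using v by (simp add: LD_Nil)
  show "Lv v \<w> (w # l) = 0" if "w \<notin> V" for w l by (rule Lv_out[OF that])
  show "ip u (Lv v \<w>) \<in> Alt k" if "u \<in> V" for u
   unfolding Lv_ip[OF w v that] by (intro Alt_diff Suc.IH i v)
  show "ip (sm f u + x) (Lv v \<w>) = fmul f (ip u (Lv v \<w>)) + ip x (Lv v \<w>)"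
   if fux: "f \<in> C" "u \<in> V" "x \<in> V" for f u x
  proof -
   have b: "br v (sm f u + x) = sm (a v f) u + (sm f (br v u) + br v x)"
    using fux v by (simp add: br_add br_sm V_sm add.assoc)
   have "ip (br v (sm f u + x)) \<w> = fmul (a v f) (ip u \<w>) + (fmul f (ip (br v u) \<w>) + ip (br v x) \<w>)"
    unfolding b using fux v by (simp add: Alt_lin[OF w] V_add V_sm br_V)
   moreover have "Lv v (ip (sm f u + x) \<w>) = fmul (a v f) (ip u \<w>) + fmul f (Lv v (ip u \<w>)) + Lv v (ip x \<w>)"
    unfolding Alt_lin[OF w fux] Lv_add[OF v Alt_fmul[OF i fux(1)] i] Lv_fmul[OF v i i fux(1)] ..
   ultimately show ?thesis
    unfolding Lv_ip[OF w v V_add[OF V_sm[OF fux(1,2)] fux(3)]] Lv_ip[OF w v fux(2)] Lv_ip[OF w v fux(3)]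
    by (simp add: algebra_simps)
  qed
  show "ip u (ip u (Lv v \<w>)) = 0" if u: "u \<in> V" for u
  proof -
   have 1: "ip u (ip u (Lv v \<w>)) = ip u (Lv v (ip u \<w>)) - ip u (ip (br v u) \<w>)"
    unfolding Lv_ip[OF w v u] by simp
   have 2: "ip u (Lv v (ip u \<w>)) = - ip (br v u) (ip u \<w>)"
    unfolding Lv_ip[OF i v u] Alt_double[OF w] using v by simp
   show "ip u (ip u (Lv v \<w>)) = 0" unfolding 1 2 unfolding Alt_skew[OF w, of u "br v u"] by simp
  qed
 qed
qed

lemma Lv_add_arg: "\<w> \<in> Alt k ==> u \<in> V ==> w \<in> V ==> Lv (u + w) \<w> = Lv u \<w> + Lv w \<w>"
proof (induction k arbitrary: \<w>)
 case 0
 thus ?case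
  by (intro Alt_0_eqI Alt_add Lv_Alt V_add) (simp_all add: LD_Nil a_add plus_fun_apply)
next
 case (Suc k)
 note uw = Suc.prems(2,3)
 show "Lv (u + w) \<w> = Lv u \<w> + Lv w \<w>"
 proof (rule Alt_eqI)
  show "Lv (u + w) \<w> \<in> Alt (Suc k)" "Lv u \<w> + Lv w \<w> \<in> Alt (Suc k)"
   using Suc.prems by (auto intro!: Alt_add Lv_Alt V_add)
  fix x assume x: "x \<in> V"
  have b: "br (u + w) x = br u x + br w x"
   using br_skew[of "u + w" x] br_skew[of u x] br_skew[of w x] br_add[of x u w] uw x by (simp add: V_add)
  have "Lv (u + w) (ip x \<w>) = Lv u (ip x \<w>) + Lv w (ip x \<w>)" by (rule Suc.IH) (use Alt_ip[OF Suc.prems(1)] uw in simp_all)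
  thus "ip x (Lv (u + w) \<w>) = ip x (Lv u \<w> + Lv w \<w>)"
   unfolding Lv_ip[OF Suc.prems(1) V_add[OF uw] x] ip_simps Lv_ip[OF Suc.prems(1) uw(1) x] Lv_ip[OF Suc.prems(1) uw(2) x] b
   using Alt_add_arg[OF Suc.prems(1), of "br u x" "br w x"] uw x by (simp add: br_V)
 qed
qed

text \<open>Cartan's formula \<open>i_v d + d i_v = L_v\<close>, obtained from Koszul's sum by
  separating the terms in which index 0 takes part. It opens the way to inductions on the degree for
  nearly all properties of \<open>\<d>\<close>.\<close>

lemma \<d>_ip:
 assumes w: "\<w> \<in> Alt k" and v: "v \<in> V"
 shows "ip v (\<d> k \<w>) = Lv v \<w> - \<d> (k - 1) (ip v \<w>)"
proof
 fix l
 show "ip v (\<d> k \<w>) l = (Lv v \<w> - \<d> (k - 1) (ip v \<w>)) l"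
 proof (cases "length l = k \<and> set l \<subseteq> V")
  case True
  have a0: "a (l ! j) 0 = 0" if "j < length l" for j by (rule a_0) (use True nth_mem[OF that] in auto)
  have s1: "(\<Sum>i\<le>k. (- 1) ^ i * a ((v # l) ! i) (\<w> (nths (v # l) (- {i})))) =
   a v (\<w> l) - (\<Sum>i<k. (- 1) ^ i * a (l ! i) (ip v \<w> (nths l (- {i}))))"
  proof -
   have n: "nths (v # l) (- {0}) = l" "nths (v # l) (- {Suc i}) = v # nths l (- {i})" for i
   proof -
    have "{j. Suc j \<noteq> 0} = UNIV" "{j. Suc j \<noteq> Suc i} = - {i}" by auto
    thus "nths (v # l) (- {0}) = l" "nths (v # l) (- {Suc i}) = v # nths l (- {i})" by (auto simp: nths_Cons nths_all)
   qed
   show ?thesis unfolding lessThan_Suc_atMost[symmetric] sum.lessThan_Suc_shift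
    by (simp add: n ip_def sum_negf)
  qed
  have s2: "(\<Sum>j\<le>k. \<Sum>i<j. (- 1) ^ (i + j) * \<w> (br ((v # l) ! i) ((v # l) ! j) # nths (v # l) (- {i, j}))) =
   (\<Sum>j<k. - ((- 1) ^ j * \<w> (br v (l ! j) # nths l (- {j})))) -
   (\<Sum>j<k. \<Sum>i<j. (- 1) ^ (i + j) * ip v \<w> (br (l ! i) (l ! j) # nths l (- {i, j})))"
  proof -
   have n: "nths (v # l) (- {0, Suc j}) = nths l (- {j})" "nths (v # l) (- {Suc i, Suc j}) = v # nths l (- {i, j})" for i j
   proof -
    have "{i. Suc i \<noteq> 0 \<and> Suc i \<noteq> Suc j} = - {j}" "{k. Suc k \<noteq> Suc i \<and> Suc k \<noteq> Suc j} = - {i, j}" by auto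
    thus "nths (v # l) (- {0, Suc j}) = nths l (- {j})" "nths (v # l) (- {Suc i, Suc j}) = v # nths l (- {i, j})"
     by (auto simp: nths_Cons)
   qed
   have sk: "\<w> (x # v # r) = - ip v \<w> (x # r)" for x r
    using fun_cong[OF Alt_skew[OF w, of v x], of r] by (simp add: ip_def)
   show ?thesis unfolding lessThan_Suc_atMost[symmetric] sum.lessThan_Suc_shift
    by (simp add: n sk sum_negf sum.distrib sum_subtractf)
  qed
  \<comment> \<open>Moving the bracket from the front back to slot \<open>j\<close> uses up the sign
    \<open>(- 1) ^ j\<close>; what remains are the substitution terms of \<open>Lv\<close>.\<close>
  have s3: "(\<Sum>j<k. - ((- 1) ^ j * \<w> (br v (l ! j) # nths l (- {j})))) = - (\<Sum>j<length l. \<w> (l[j := br v (l ! j)]))"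
  proof -
   have "(- 1) ^ j * \<w> (br v (l ! j) # nths l (- {j})) = \<w> (l[j := br v (l ! j)])" if "j < k" for j
   proof -
    have j: "j < length l" using that True by simp
    show ?thesis
     unfolding upd_conv_take_nth_drop[OF j] nths_minus[OF j]
     using Alt_move[OF w, of "take j l" "br v (l ! j)" "drop (Suc j) l"] j by (simp add: sgn_fn_def)
   qed
   thus ?thesis using True by (simp add: sum_negf)
  qed
  have L: "Lv v \<w> l = a v (\<w> l) - (\<Sum>j<length l. \<w> (l[j := br v (l ! j)]))" using True by (simp add: LD_def)
  have d: "\<d> (k - 1) (ip v \<w>) l = (\<Sum>i<k. (- 1) ^ i * a (l ! i) (ip v \<w> (nths l (- {i})))) +
   (\<Sum>j<k. \<Sum>i<j. (- 1) ^ (i + j) * ip v \<w> (br (l ! i) (l ! j) # nths l (- {i, j})))"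
  proof (cases k)
   case 0
   thus ?thesis using True by (simp add: koszul_def)
  next
   case (Suc k')
   thus ?thesis using True unfolding koszul_def lessThan_Suc_atMost[symmetric] by simp
  qed
  have "ip v (\<d> k \<w>) l = (\<Sum>i\<le>k. (- 1) ^ i * a ((v # l) ! i) (\<w> (nths (v # l) (- {i})))) +
   (\<Sum>j\<le>k. \<Sum>i<j. (- 1) ^ (i + j) * \<w> (br ((v # l) ! i) ((v # l) ! j) # nths (v # l) (- {i, j})))"
   using True v by (simp add: ip_def koszul_def)
  thus ?thesis unfolding s1 s2 s3 form_app L d by simp
 next
  case False
  have "\<d> (k - 1) (ip v \<w>) l = 0"
  proof (cases k)
   case 0
   hence "ip v \<w> = 0" using w by simp
   moreover have "a (l ! 0) 0 = 0" if "length l = Suc 0" "set l \<subseteq> V"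
    by (rule a_0) (use that nth_mem[of 0 l] in auto)
   ultimately show ?thesis using 0 by (cases l) (auto simp: koszul_def)
  qed (use False in \<open>auto simp: koszul_def\<close>)
  moreover have "Lv v \<w> l = 0" using Alt_support[OF Lv_Alt[OF w v]] False by blast
  ultimately show ?thesis using False v by (auto simp: ip_def koszul_def)
 qed
qed

lemma \<d>_lin:
 assumes w: "\<w> \<in> Alt k" and e: "\<eta> \<in> Alt k"
 shows \<d>_add: "\<d> k (\<w> + \<eta>) = \<d> k \<w> + \<d> k \<eta>"
proof -
 have "a (l ! i) (\<w> r + \<eta> r) = a (l ! i) (\<w> r) + a (l ! i) (\<eta> r)" if "set l \<subseteq> V" "i < length l" for l i r
  by (rule Der_add[OF a_Der]) (use that nth_mem[OF that(2)] w e in auto)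
 thus ?thesis
  by (intro ext[where 'a = "'v list"]) (simp add: koszul_def sum.distrib distrib_left)
qed

lemma \<d>_zero [simp]: "\<d> k 0 = 0"
 using \<d>_add[of 0 k 0] by simp

lemma \<d>_neg: "\<w> \<in> Alt k ==> \<d> k (- \<w>) = - \<d> k \<w>"
 using \<d>_add[of \<w> k "- \<w>"] Alt_neg[of \<w> k] by (simp add: eq_neg_iff_add_eq_0 add.commute)

lemma \<d>_diff: "\<w> \<in> Alt k ==> \<eta> \<in> Alt k ==> \<d> k (\<w> - \<eta>) = \<d> k \<w> - \<d> k \<eta>"
 using \<d>_add[of \<w> k "- \<eta>"] Alt_neg[of \<eta> k] by (simp add: \<d>_neg)

definition df :: "'m fn => 'v list => 'm fn" where "df f = \<d> 0 (fn0 f)"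

lemma fn0_Alt: "f \<in> C ==> fn0 f \<in> Alt 0"
 by (simp add: Alt_0_iff fn0_def)

lemma df_ip: "f \<in> C ==> v \<in> V ==> ip v (df f) = fn0 (a v f)"
proof -
 assume f: "f \<in> C" and v: "v \<in> V"
 have "ip v (df f) = Lv v (fn0 f)"
  unfolding df_def \<d>_ip[OF fn0_Alt[OF f] v] using fn0_Alt[OF f] by simp
 also have "\<dots> = fn0 (a v f)"
  by (rule Alt_0_eqI[OF Lv_Alt[OF fn0_Alt[OF f] v] fn0_Alt[OF a_C[OF v]]]) (simp add: LD_Nil fn0_def)
 finally show ?thesis .
qed

lemma df_Alt: "f \<in> C ==> df f \<in> Alt 1"
 unfolding One_nat_def
proof (rule Alt_SucI)
 assume f: "f \<in> C"
 show "df f [] = 0" by (simp add: df_def koszul_Nil)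
 show "df f (v # l) = 0" if "v \<notin> V" for v l unfolding df_def by (rule koszul_outside[OF that])
 show "ip v (df f) \<in> Alt 0" if "v \<in> V" for v unfolding df_ip[OF f that] by (rule fn0_Alt) (simp add: that)
 show "ip (sm g u + w) (df f) = fmul g (ip u (df f)) + ip w (df f)" if *: "g \<in> C" "u \<in> V" "w \<in> V" for g u w
  unfolding df_ip[OF f *(2)] df_ip[OF f *(3)] df_ip[OF f V_add[OF V_sm[OF *(1,2)] *(3)]] a_add[OF V_sm[OF *(1,2)] *(3)] a_sm[OF *(1,2)]
  by (rule ext) (simp add: fn0_def fmul_def fun_app(1)[where f = "%a. _ * _ a"])
 show "ip v (ip v (df f)) = 0" if "v \<in> V" for v
  unfolding df_ip[OF f that] using fn0_Alt[OF a_C[OF that, of f]] by simp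
qed

lemma wedge_df: "f \<in> C ==> v \<in> V ==> ip v (wedge (df f) \<w>) = fmul (a v f) \<w> - wedge (df f) (ip v \<w>)"
proof -
 assume f: "f \<in> C" and v: "v \<in> V"
 have "homog 1 (df f)" using df_Alt[OF f] by simp
 from ip_wedge[OF this, of v \<w>] show ?thesis
  by (simp add: df_ip[OF f v] wedge_fn0) (simp add: fmul_def fun_eq_iff fun_app)
qed

text \<open>Placed before \<open>\<d>_Alt\<close>, since the function-linearity of
  \<open>\<d> k \<w>\<close> in its arguments rests on this rule.\<close>

lemma \<d>_fmul: "\<w> \<in> Alt k ==> f \<in> C ==> \<d> k (fmul f \<w>) = wedge (df f) \<w> + fmul f (\<d> k \<w>)"
proof (induction k arbitrary: \<w> rule: nat_less_induct)
 case (1 k)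
 note w = 1(2) and f = 1(3)
 have d0: "df f [] = 0" by (simp add: df_def koszul_Nil)
 show "\<d> k (fmul f \<w>) = wedge (df f) \<w> + fmul f (\<d> k \<w>)"
 proof (rule form_eqI[where V = V])
  show "\<d> k (fmul f \<w>) [] = (wedge (df f) \<w> + fmul f (\<d> k \<w>)) []" by (simp add: koszul_Nil wedge_Nil d0)
  show "\<d> k (fmul f \<w>) (v # l) = 0" if "v \<notin> V" for v l by (rule koszul_outside[OF that])
  have "homog 1 (df f)" using df_Alt[OF f] by simp
  thus "(wedge (df f) \<w> + fmul f (\<d> k \<w>)) (v # l) = 0" if "v \<notin> V" for v l
   using Alt_out[OF df_Alt[OF f] that] Alt_out[OF w that] by (simp add: wedge_Cons koszul_outside[OF that])
 next
  fix v assume v: "v \<in> V"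
  have i: "ip v \<w> \<in> Alt (k - 1)" by (rule Alt_ip[OF w])
  have "\<d> (k - 1) (fmul f (ip v \<w>)) = wedge (df f) (ip v \<w>) + fmul f (\<d> (k - 1) (ip v \<w>))"
  proof (cases k)
   case 0
   hence "ip v \<w> = 0" using w by simp
   thus ?thesis by simp
  next
   case (Suc k')
   show ?thesis by (rule 1(1)[rule_format]) (use Suc i f in simp_all)
  qed
  thus "ip v (\<d> k (fmul f \<w>)) = ip v (wedge (df f) \<w> + fmul f (\<d> k \<w>))"
   unfolding \<d>_ip[OF Alt_fmul[OF w f] v] ip_simps wedge_df[OF f v] \<d>_ip[OF w v] Lv_fmul[OF v w w f]
   by simp
 qed
qed

lemma \<d>_cmul: "\<w> \<in> Alt k ==> \<d> k (cmul c \<w>) = cmul c (\<d> k \<w>)"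
proof -
 assume w: "\<w> \<in> Alt k"
 have "a (l ! i) (cmul c \<w> r) = (%x. c * a (l ! i) (\<w> r) x)" if "set l \<subseteq> V" "i < length l" for l i r
  unfolding cmul_def by (rule Der_scale[OF a_Der]) (use that nth_mem[OF that(2)] w in auto)
 thus ?thesis
  by (intro ext[where 'a = "'v list"] ext[where 'a = 'm])
   (simp add: koszul_def sum_fun_apply fun_app cmul_def sum_distrib_left distrib_left mult.left_commute sgn_fn_apply[unfolded sgn_fn_def])
qed

text \<open>The defect of function-linearity in the section along which the derivative is taken. In
  \<open>\<d>_Alt\<close> it cancels against the same term of \<open>\<d>_fmul\<close>.\<close>

lemma Lv_sm: "\<w> \<in> Alt k ==> f \<in> C ==> u \<in> V ==> Lv (sm f u) \<w> = fmul f (Lv u \<w>) + wedge (df f) (ip u \<w>)"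
proof (induction k arbitrary: \<w>)
 case 0
 have "Lv (sm f u) \<w> = fmul f (Lv u \<w>)"
  by (rule Alt_0_eqI[OF Lv_Alt[OF 0(1) V_sm[OF 0(2,3)]] Alt_fmul[OF Lv_Alt[OF 0(1,3)] 0(2)]])
   (use 0 in \<open>simp add: LD_Nil a_sm fmul_def\<close>)
 moreover have "ip u \<w> = 0" using 0 by simp
 ultimately show "Lv (sm f u) \<w> = fmul f (Lv u \<w>) + wedge (df f) (ip u \<w>)" by simp
next
 case (Suc k)
 note w = Suc.prems(1) and f = Suc.prems(2) and u = Suc.prems(3)
 have i: "ip x \<w> \<in> Alt k" for x using Alt_ip[OF w] by simp
 show "Lv (sm f u) \<w> = fmul f (Lv u \<w>) + wedge (df f) (ip u \<w>)"
 proof (rule Alt_eqI)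
  show "Lv (sm f u) \<w> \<in> Alt (Suc k)" by (intro Lv_Alt V_sm w f u)
  have "wedge (df f) (ip u \<w>) \<in> Alt (1 + k)" by (intro Alt_wedge df_Alt f i)
  thus "fmul f (Lv u \<w>) + wedge (df f) (ip u \<w>) \<in> Alt (Suc k)" by (intro Alt_add Alt_fmul Lv_Alt w f u) simp
  fix x assume x: "x \<in> V"
  have "br (sm f u) x = - (sm (a x f) u + sm f (br x u))"
   using br_skew[OF V_sm[OF f u] x] br_sm[OF f x u] by simp
  hence "ip (br (sm f u) x) \<w> = - fmul (a x f) (ip u \<w>) - fmul f (ip (br x u) \<w>)"
   using Alt_neg_arg[OF w, of "sm (a x f) u + sm f (br x u)"] Alt_lin[OF w, of "a x f" u "sm f (br x u)"] Alt_sm_arg[OF w f, of "br x u"] x u f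
   by (simp add: V_add V_sm br_V)
  moreover have "ip (br x u) \<w> = - ip (br u x) \<w>"
   using Alt_neg_arg[OF w, of "br u x"] br_skew[OF x u] br_V[OF u x] by simp
  moreover have "ip x (ip u \<w>) = - ip u (ip x \<w>)" by (rule Alt_skew[OF w])
  ultimately show "ip x (Lv (sm f u) \<w>) = ip x (fmul f (Lv u \<w>) + wedge (df f) (ip u \<w>))"
   unfolding Lv_ip[OF w V_sm[OF f u] x] ip_simps Lv_ip[OF w u x] wedge_df[OF f x] Suc.IH[OF i f u] by simp
 qed
qed

lemma \<d>_Alt: "\<w> \<in> Alt k ==> \<d> k \<w> \<in> Alt (Suc k)"
proof (induction k arbitrary: \<w> rule: nat_less_induct)
 case (1 k)
 note w = 1(2)
 have i: "ip x \<w> \<in> Alt (k - 1)" for x using Alt_ip[OF w] .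
 have d: "\<d> (k - 1) (ip x \<w>) \<in> Alt k" for x
 proof (cases k)
  case 0
  hence "ip x \<w> = 0" using w by simp
  thus ?thesis by simp
 qed (use 1(1) i[of x] in auto)
 show ?case
 proof (rule Alt_SucI)
  show "\<d> k \<w> [] = 0" by (rule koszul_Nil)
  show "\<d> k \<w> (v # l) = 0" if "v \<notin> V" for v l by (rule koszul_outside[OF that])
  show "ip v (\<d> k \<w>) \<in> Alt k" if "v \<in> V" for v
   unfolding \<d>_ip[OF w that] by (intro Alt_diff Lv_Alt w that d)
  show "ip (sm f u + x) (\<d> k \<w>) = fmul f (ip u (\<d> k \<w>)) + ip x (\<d> k \<w>)"
   if fux: "f \<in> C" "u \<in> V" "x \<in> V" for f u x
  proof -
   have 1: "Lv (sm f u + x) \<w> = fmul f (Lv u \<w>) + wedge (df f) (ip u \<w>) + Lv x \<w>"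
    using Lv_add_arg[OF w V_sm[OF fux(1,2)] fux(3)] Lv_sm[OF w fux(1,2)] by simp
   have "ip (sm f u + x) \<w> = fmul f (ip u \<w>) + ip x \<w>"
    using Alt_add_arg[OF w V_sm[OF fux(1,2)] fux(3)] Alt_sm_arg[OF w fux(1,2)] by simp
   hence 2: "\<d> (k - 1) (ip (sm f u + x) \<w>) = wedge (df f) (ip u \<w>) + fmul f (\<d> (k - 1) (ip u \<w>)) + \<d> (k - 1) (ip x \<w>)"
    by (simp only: \<d>_add[OF Alt_fmul[OF i fux(1)] i] \<d>_fmul[OF i fux(1)])
   show ?thesis
    unfolding \<d>_ip[OF w fux(2)] \<d>_ip[OF w fux(3)] \<d>_ip[OF w V_add[OF V_sm[OF fux(1,2)] fux(3)]] 1 2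
    by (simp add: algebra_simps)
  qed
  show "ip v (ip v (\<d> k \<w>)) = 0" if v: "v \<in> V" for v
  proof -
   have b: "br v v = 0 \<or> br v v \<noteq> 0" by simp
   have "ip (br v v) \<w> = - ip (br v v) \<w>"
    using Alt_neg_arg[OF w br_V[OF v v]] br_skew[OF v v] by simp
   hence bb: "ip (br v v) \<w> = 0"
    by (auto simp: fun_eq_iff fun_app)
   have "\<d> (k - 1 - 1) (ip v (ip v \<w>)) = 0" using Alt_double[OF w] by simp
   thus ?thesis
    unfolding \<d>_ip[OF w v] ip_simps Lv_ip[OF w v v] \<d>_ip[OF i v] bb by simp
  qed
 qed
qed

lemma Lv_Lv: "\<w> \<in> Alt k ==> v \<in> V ==> w \<in> V ==> Lv v (Lv w \<w>) = Lv w (Lv v \<w>) + Lv (br v w) \<w>"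
proof (induction k arbitrary: \<w>)
 case 0
 have "a (br v w) (\<w> []) = a v (a w (\<w> [])) - a w (a v (\<w> []))" using 0 by (simp add: a_br lie_def)
 thus ?case using 0
  by (intro Alt_0_eqI Alt_add Lv_Alt br_V) (auto simp: LD_Nil)
next
 case (Suc k)
 note o = Suc.prems(1) and v = Suc.prems(2) and w = Suc.prems(3)
 have i: "ip x \<w> \<in> Alt k" for x using Alt_ip[OF o] by simp
 show "Lv v (Lv w \<w>) = Lv w (Lv v \<w>) + Lv (br v w) \<w>"
 proof (rule Alt_eqI)
  show "Lv v (Lv w \<w>) \<in> Alt (Suc k)" "Lv w (Lv v \<w>) + Lv (br v w) \<w> \<in> Alt (Suc k)"
   by (intro Alt_add Lv_Alt br_V o v w)+
  fix u assume u: "u \<in> V"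
  have x: "ip u (Lv v' (Lv w' \<w>)) = Lv v' (Lv w' (ip u \<w>)) - Lv v' (ip (br w' u) \<w>) - Lv w' (ip (br v' u) \<w>) + ip (br w' (br v' u)) \<w>"
   if "v' \<in> V" "w' \<in> V" for v' w'
   unfolding Lv_ip[OF Lv_Alt[OF o that(2)] that(1) u] Lv_ip[OF o that(2) u] Lv_ip[OF o that(2) br_V[OF that(1) u]]
    Lv_diff[OF that(1) Lv_Alt[OF i that(2)] i] by simp
  have "br v (br w u) = br (br v w) u + br w (br v u)" by (rule jacobi[OF v w u])
  hence j: "ip (br v (br w u)) \<w> = ip (br (br v w) u) \<w> + ip (br w (br v u)) \<w>"
   using Alt_add_arg[OF o, of "br (br v w) u" "br w (br v u)"] v w u by (simp add: br_V)
  show "ip u (Lv v (Lv w \<w>)) = ip u (Lv w (Lv v \<w>) + Lv (br v w) \<w>)"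
   unfolding ip_simps x[OF v w] x[OF w v] Lv_ip[OF o br_V[OF v w] u] Suc.IH[OF i v w] j by simp
 qed
qed

lemma Lv_\<d>: "\<w> \<in> Alt k ==> v \<in> V ==> Lv v (\<d> k \<w>) = \<d> k (Lv v \<w>)"
proof (induction k arbitrary: \<w> rule: nat_less_induct)
 case (1 k)
 note o = 1(2) and v = 1(3)
 have i: "ip x \<w> \<in> Alt (k - 1)" for x using Alt_ip[OF o] .
 have d: "\<d> (k - 1) (ip x \<w>) \<in> Alt k" for x
 proof (cases k)
  case 0
  hence "ip x \<w> = 0" using o by simp
  thus ?thesis by simp
 qed (use \<d>_Alt[OF i[of x]] in simp)
 show "Lv v (\<d> k \<w>) = \<d> k (Lv v \<w>)"
 proof (rule Alt_eqI)
  show "Lv v (\<d> k \<w>) \<in> Alt (Suc k)" "\<d> k (Lv v \<w>) \<in> Alt (Suc k)" by (intro Lv_Alt \<d>_Alt o v)+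
  fix w assume w: "w \<in> V"
  have IH: "Lv v (\<d> (k - 1) (ip w \<w>)) = \<d> (k - 1) (Lv v (ip w \<w>))"
  proof (cases k)
   case 0
   hence "ip w \<w> = 0" using o by simp
   thus ?thesis using v by simp
  qed (use 1(1) i[of w] v in auto)
  have l: "ip w (Lv v (\<d> k \<w>)) = Lv v (Lv w \<w>) - Lv v (\<d> (k - 1) (ip w \<w>)) - (Lv (br v w) \<w> - \<d> (k - 1) (ip (br v w) \<w>))"
   unfolding Lv_ip[OF \<d>_Alt[OF o] v w] \<d>_ip[OF o w] \<d>_ip[OF o br_V[OF v w]] Lv_diff[OF v Lv_Alt[OF o w] d] ..
  have r: "ip w (\<d> k (Lv v \<w>)) = Lv w (Lv v \<w>) - (\<d> (k - 1) (Lv v (ip w \<w>)) - \<d> (k - 1) (ip (br v w) \<w>))"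
   unfolding \<d>_ip[OF Lv_Alt[OF o v] w] Lv_ip[OF o v w] \<d>_diff[OF Lv_Alt[OF i v] i] ..
  show "ip w (Lv v (\<d> k \<w>)) = ip w (\<d> k (Lv v \<w>))"
   unfolding l r Lv_Lv[OF o v w] IH by simp
 qed
qed

text \<open>Cartan's formula applied twice gives \<open>i_v d d = L_v d - d L_v + d d i_v\<close>;
  the first two terms cancel by \<open>Lv_\<d>\<close> and the last is the induction hypothesis. The
  Jacobi identity enters through \<open>Lv_Lv\<close>.\<close>

lemma \<d>_\<d>: "\<w> \<in> Alt k ==> \<d> (Suc k) (\<d> k \<w>) = 0"
proof (induction k arbitrary: \<w> rule: nat_less_induct)
 case (1 k)
 note o = 1(2)
 have i: "ip x \<w> \<in> Alt (k - 1)" for x using Alt_ip[OF o] .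
 show "\<d> (Suc k) (\<d> k \<w>) = 0"
 proof (rule Alt_eqI)
  show "\<d> (Suc k) (\<d> k \<w>) \<in> Alt (Suc (Suc k))" by (intro \<d>_Alt o)
  show "0 \<in> Alt (Suc (Suc k))" by simp
  fix v assume v: "v \<in> V"
  have IH: "\<d> k (\<d> (k - 1) (ip v \<w>)) = 0" and d: "\<d> (k - 1) (ip v \<w>) \<in> Alt k"
  proof -
   have "\<d> k (\<d> (k - 1) (ip v \<w>)) = 0 \<and> \<d> (k - 1) (ip v \<w>) \<in> Alt k"
   proof (cases k)
    case 0
    hence "ip v \<w> = 0" using o by simp
    thus ?thesis by simp
   qed (use 1(1) i[of v] \<d>_Alt[OF i[of v]] in auto)
   thus "\<d> k (\<d> (k - 1) (ip v \<w>)) = 0" "\<d> (k - 1) (ip v \<w>) \<in> Alt k" by auto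
  qed
  have "ip v (\<d> (Suc k) (\<d> k \<w>)) = Lv v (\<d> k \<w>) - \<d> k (Lv v \<w> - \<d> (k - 1) (ip v \<w>))"
   unfolding \<d>_ip[OF \<d>_Alt[OF o] v] \<d>_ip[OF o v] by simp
  also have "\<dots> = 0"
   unfolding \<d>_diff[OF Lv_Alt[OF o v] d] IH Lv_\<d>[OF o v] by simp
  finally show "ip v (\<d> (Suc k) (\<d> k \<w>)) = ip v 0" by simp
 qed
qed

lemma Lv_wedge:
 assumes "\<w> \<in> Alt k" "\<eta> \<in> Alt m" "v \<in> V"
 shows "Lv v (wedge \<w> \<eta>) = wedge (Lv v \<w>) \<eta> + wedge \<w> (Lv v \<eta>)"
proof
 fix l
 show "Lv v (wedge \<w> \<eta>) l = (wedge (Lv v \<w>) \<eta> + wedge \<w> (Lv v \<eta>)) l"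
 proof (cases "set l \<subseteq> V")
  case True
  thus ?thesis using LD_wedge[OF a_Der[OF assms(3)] Alt_homog[OF assms(1)] Alt_C[OF assms(1)] Alt_C[OF assms(2)]] by simp
 next
  case False
  have "wedge (Lv v \<w>) \<eta> \<in> Alt (k + m)" "wedge \<w> (Lv v \<eta>) \<in> Alt (k + m)"
   by (intro Alt_wedge Lv_Alt assms)+
  thus ?thesis using False Alt_support[of _ "k + m" l] by (simp add: LD_outside)
 qed
qed

lemma \<d>_wedge: "\<w> \<in> Alt k ==> \<eta> \<in> Alt m ==>
  \<d> (k + m) (wedge \<w> \<eta>) = wedge (\<d> k \<w>) \<eta> + fmul (sgn_fn k) (wedge \<w> (\<d> m \<eta>))"
proof (induction "k + m" arbitrary: k m \<w> \<eta> rule: nat_less_induct)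
 case 1
 note o = 1(2) and e = 1(3)
 note IH = 1(1)[rule_format, OF _ refl]
 have hs: "homog (Suc k) (\<d> k \<w>)" by (rule homog_koszul)
 have "\<d> k \<w> [] = 0" "\<d> m \<eta> [] = 0" by (rule koszul_Nil)+
 show "\<d> (k + m) (wedge \<w> \<eta>) = wedge (\<d> k \<w>) \<eta> + fmul (sgn_fn k) (wedge \<w> (\<d> m \<eta>))"
 proof (rule Alt_eqI)
  show "\<d> (k + m) (wedge \<w> \<eta>) \<in> Alt (Suc (k + m))" by (intro \<d>_Alt Alt_wedge o e)
  have "wedge (\<d> k \<w>) \<eta> \<in> Alt (Suc k + m)" "wedge \<w> (\<d> m \<eta>) \<in> Alt (k + Suc m)"
   by (intro \<d>_Alt Alt_wedge o e)+
  thus "wedge (\<d> k \<w>) \<eta> + fmul (sgn_fn k) (wedge \<w> (\<d> m \<eta>)) \<in> Alt (Suc (k + m))"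
   by (intro Alt_add Alt_sgn) simp_all
  fix v assume v: "v \<in> V"
  have h: "homog k \<w>" using o by simp
  have w1: "wedge (ip v \<w>) \<eta> \<in> Alt (k + m - 1)"
  proof (cases k)
   case 0
   hence "ip v \<w> = 0" using o by simp
   thus ?thesis by simp
  qed (use Alt_wedge[OF Alt_ip[OF o] e] in simp)
  have w2: "wedge \<w> (ip v \<eta>) \<in> Alt (k + m - 1)"
  proof (cases m)
   case 0
   hence "ip v \<eta> = 0" using e by simp
   thus ?thesis by simp
  qed (use Alt_wedge[OF o Alt_ip[OF e]] in simp)
  have d1: "\<d> (k + m - 1) (wedge (ip v \<w>) \<eta>) = wedge (\<d> (k - 1) (ip v \<w>)) \<eta> - fmul (sgn_fn k) (wedge (ip v \<w>) (\<d> m \<eta>))"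
  proof (cases k)
   case 0
   hence "ip v \<w> = 0" using o by simp
   thus ?thesis by simp
  next
   case (Suc k')
   have "\<d> (k' + m) (wedge (ip v \<w>) \<eta>) = wedge (\<d> k' (ip v \<w>)) \<eta> + fmul (sgn_fn k') (wedge (ip v \<w>) (\<d> m \<eta>))"
    by (rule IH) (use Suc Alt_ip[OF o] e in auto)
   thus ?thesis by (simp add: Suc)
  qed
  have d2: "\<d> (k + m - 1) (fmul (sgn_fn k) (wedge \<w> (ip v \<eta>))) = fmul (sgn_fn k) (wedge (\<d> k \<w>) (ip v \<eta>)) + wedge \<w> (\<d> (m - 1) (ip v \<eta>))"
  proof (cases m)
   case 0
   hence "ip v \<eta> = 0" using e by simp
   thus ?thesis by simp
  next
   case (Suc m')
   have "\<d> (k + m') (wedge \<w> (ip v \<eta>)) = wedge (\<d> k \<w>) (ip v \<eta>) + fmul (sgn_fn k) (wedge \<w> (\<d> m' (ip v \<eta>)))"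
    by (rule IH) (use Suc Alt_ip[OF e] o in auto)
   moreover have "\<d> (k + m') (fmul (sgn_fn k) \<rho>) = fmul (sgn_fn k) (\<d> (k + m') \<rho>)" if "\<rho> \<in> Alt (k + m')" for \<rho>
    using sgn_fn_or[where 'm = 'm, of k]
   proof
    assume "(sgn_fn k :: 'm fn) = 1"
    thus ?thesis by (simp add: fmul_def)
   next
    assume "(sgn_fn k :: 'm fn) = - 1"
    moreover have "fmul (- 1) \<w> = - \<w>" for \<w> :: "'v list => 'm fn" by (simp add: fmul_def fun_eq_iff fun_app)
    ultimately show ?thesis using \<d>_neg[OF that] by simp
   qed
   moreover have "fmul (sgn_fn k) (fmul (sgn_fn k) \<rho>) = \<rho>" for \<rho> :: "'v list => 'm fn"
    by (rule ext) simp
   ultimately show ?thesis using w2 by (simp add: Suc)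
  qed
  have ds: "wedge \<w> (\<d> (m - 1) (ip v \<eta>)) = fmul (sgn_fn k) (fmul (sgn_fn k) (wedge \<w> (\<d> (m - 1) (ip v \<eta>))))"
   by (rule ext) simp
  have ss: "fmul (sgn_fn k) (fmul (sgn_fn k) \<rho>) = \<rho>" for \<rho> :: "'v list => 'm fn"
   by (rule ext) simp
  have lhs: "ip v (\<d> (k + m) (wedge \<w> \<eta>)) = wedge (Lv v \<w>) \<eta> + wedge \<w> (Lv v \<eta>)
    - (wedge (\<d> (k - 1) (ip v \<w>)) \<eta> - fmul (sgn_fn k) (wedge (ip v \<w>) (\<d> m \<eta>))
    + (fmul (sgn_fn k) (wedge (\<d> k \<w>) (ip v \<eta>)) + wedge \<w> (\<d> (m - 1) (ip v \<eta>))))"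
   unfolding \<d>_ip[OF Alt_wedge[OF o e] v] Lv_wedge[OF o e v] ip_wedge[OF h] \<d>_add[OF w1 Alt_sgn[OF w2]] d1 d2 ..
  have rhs: "ip v (wedge (\<d> k \<w>) \<eta> + fmul (sgn_fn k) (wedge \<w> (\<d> m \<eta>))) =
    wedge (Lv v \<w>) \<eta> - wedge (\<d> (k - 1) (ip v \<w>)) \<eta> - fmul (sgn_fn k) (wedge (\<d> k \<w>) (ip v \<eta>))
    + (fmul (sgn_fn k) (wedge (ip v \<w>) (\<d> m \<eta>)) + (wedge \<w> (Lv v \<eta>) - wedge \<w> (\<d> (m - 1) (ip v \<eta>))))"
   unfolding ip_simps ip_wedge[OF hs] ip_wedge[OF h] \<d>_ip[OF o v] \<d>_ip[OF e v] by (simp add: ss)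
  show "ip v (\<d> (k + m) (wedge \<w> \<eta>)) = ip v (wedge (\<d> k \<w>) \<eta> + fmul (sgn_fn k) (wedge \<w> (\<d> m \<eta>)))"
   unfolding lhs rhs by simp
 qed
qed

end

declare One_nat_def [simp del]

section \<open>The Lie algebroid of a complex manifold\<close>

context fmodule
begin

lemma Alt_1_lin: "\<a> \<in> Alt 1 ==> f \<in> C ==> u \<in> V ==> w \<in> V ==> \<a> [sm f u + w] = f * \<a> [u] + \<a> [w]"
 and Alt_1_add: "\<a> \<in> Alt 1 ==> u \<in> V ==> w \<in> V ==> \<a> [u + w] = \<a> [u] + \<a> [w]"
 and Alt_1_sm: "\<a> \<in> Alt 1 ==> f \<in> C ==> u \<in> V ==> \<a> [sm f u] = f * \<a> [u]"
 and Alt_1_zero: "\<a> \<in> Alt 1 ==> \<a> [0] = 0"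
 and Alt_1_neg: "\<a> \<in> Alt 1 ==> u \<in> V ==> \<a> [- u] = - \<a> [u]"
 using fun_cong[OF Alt_lin[of \<a> 0 f u w], of "[]"] fun_cong[OF Alt_add_arg[of \<a> 1 u w], of "[]"]
  fun_cong[OF Alt_sm_arg[of \<a> 1 f u], of "[]"] fun_cong[OF Alt_zero_arg[of \<a> 1], of "[]"]
  fun_cong[OF Alt_neg_arg[of \<a> 1 u], of "[]"] by (simp_all add: ip_apply One_nat_def)

lemma V_sum: "(\<And>i. i \<in> F ==> v i \<in> V) ==> sum v F \<in> V"
 by (rule sum_closed[OF V_0 V_add])

lemma Alt_1_sum:
 assumes a: "\<a> \<in> Alt 1" and v: "\<And>i. i \<in> F ==> v i \<in> V"
 shows "\<a> [sum v F] = (\<Sum>i\<in>F. \<a> [v i])"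
 by (rule sum_additive[where h = "%v. \<a> [v]" and S = V]) (simp_all add: Alt_1_zero[OF a] Alt_1_add[OF a] V_add v)

lemma Alt_1_eqI: "\<a> \<in> Alt 1 ==> \<beta> \<in> Alt 1 ==> (\<And>v. v \<in> V ==> \<a> [v] = \<beta> [v]) ==> \<a> = \<beta>"
proof
 fix l assume ab: "\<a> \<in> Alt 1" "\<beta> \<in> Alt 1" and v: "\<And>v. v \<in> V ==> \<a> [v] = \<beta> [v]"
 show "\<a> l = \<beta> l"
 proof (cases "length l = 1 \<and> set l \<subseteq> V")
  case True
  then obtain w where "l = [w]" by (auto simp: length_Suc_conv One_nat_def)
  thus ?thesis using True v by simp
 qed (simp add: Alt_support[OF ab(1)] Alt_support[OF ab(2)])
qed

lemma Alt_1I: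
 assumes "\<And>l. \<not> (length l = 1 \<and> set l \<subseteq> V) ==> \<w> l = 0" "\<And>v. v \<in> V ==> \<w> [v] \<in> C"
  "\<And>f u w. f \<in> C ==> u \<in> V ==> w \<in> V ==> \<w> [sm f u + w] = f * \<w> [u] + \<w> [w]"
 shows "\<w> \<in> Alt 1"
proof (rule AltI)
 fix l :: "'v list" and i :: nat and f u w assume "length l = 1" "i < 1" "f \<in> C" "u \<in> V" "w \<in> V"
 moreover from this obtain x where "l = [x]" by (auto simp: length_Suc_conv One_nat_def)
 ultimately show "\<w> (l[i := sm f u + w]) = f * \<w> (l[i := u]) + \<w> (l[i := w])" using assms(3) by simp
next
 fix l assume "length l = 1" "set l \<subseteq> V"
 thus "\<w> l \<in> C" using assms(2) by (cases l) (auto simp: length_Suc_conv One_nat_def)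
qed (use assms(1) in auto)

lemma ip_Alt_1_0: "\<a> \<in> Alt 1 ==> \<a> [v] = 0 ==> ip v \<a> = 0"
proof
 fix l assume "\<a> \<in> Alt 1" "\<a> [v] = 0"
 thus "ip v \<a> l = 0 l" using homogD[OF Alt_homog[of \<a> 1], of "v # l"] by (cases l) (auto simp: ip_apply)
qed

end

context framed_manifold
begin

definition uC :: "'m fn" where "uC = (%x. if x \<in> points M then 1 else 0)"

sublocale fun_algebra "Cinf M" by (rule alg)

lemma uC: "uC \<in> Cinf M" "f \<in> Cinf M ==> uC * f = f" "f \<in> Cinf M ==> f * uC = f"
 using unit_C off_points[of f] by (auto simp: uC_def fun_eq_iff fun_app)

lemma uC_fmul: "X \<in> Der ==> fmul uC X = X"
 by (auto simp: fmul_def uC(2) Der_C')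

definition cC :: "complex => 'm fn" where "cC c = (%x. c * uC x)"

lemma cC_C [simp]: "cC c \<in> Cinf M"
 unfolding cC_def using alg_scale uC(1) .

lemma cC_mult: "f \<in> Cinf M ==> cC c * f = (%x. c * f x)"
 using off_points[of f] by (auto simp: cC_def uC_def fun_eq_iff fun_app)

lemma cC_fmul: "X \<in> Der ==> fmul (cC c) X = cmul c X"
 by (auto simp: fmul_def cmul_def cC_mult Der_C')

lemma J_add: "X \<in> Der ==> Y \<in> Der ==> Jop M (X + Y) = Jop M X + Jop M Y"
 using J_lin[OF uC(1), of X Y] by (simp add: uC_fmul J_Der)

lemma J_zero: "Jop M 0 = 0"
 using J_add[of 0 0] by simp

lemma J_fmul: "f \<in> Cinf M ==> X \<in> Der ==> Jop M (fmul f X) = fmul f (Jop M X)"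
 using J_lin[of f X 0] by (simp add: J_zero)

lemma J_cmul: "X \<in> Der ==> Jop M (cmul c X) = cmul c (Jop M X)"
 using J_fmul[of "cC c" X] by (simp add: cC_fmul J_Der)

lemma J_neg: "X \<in> Der ==> Jop M (- X) = - Jop M X"
 using J_cmul[of X "- 1"] by (simp add: cmul_def fun_Compl_def)

lemma J_diff: "X \<in> Der ==> Y \<in> Der ==> Jop M (X - Y) = Jop M X - Jop M Y"
 using J_add[of X "- Y"] J_neg[of Y] by auto

lemma pr_T: "X \<in> Der ==> pr10 M X \<in> T10 M" "X \<in> Der ==> pr01 M X \<in> T01 M"
 unfolding T10_def T01_def pr10_def pr01_def
 by (auto simp: J_cmul J_diff J_add J_J J_Der Der_cmul Der_minus Der_plus)
  (auto simp: fun_eq_iff fun_app cmul_def algebra_simps)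

lemma pr_of_T: "X \<in> T10 M ==> pr10 M X = X" "X \<in> T01 M ==> pr01 M X = X" "X \<in> T10 M ==> pr01 M X = 0" "X \<in> T01 M ==> pr10 M X = 0"
 unfolding T10_def T01_def pr10_def pr01_def by (auto simp: fun_eq_iff fun_app cmul_def algebra_simps)

lemma pr_sum: "pr10 M X + pr01 M X = X"
 unfolding pr10_def pr01_def by (auto simp: fun_eq_iff fun_app cmul_def algebra_simps)

lemma pr_lin: "f \<in> Cinf M ==> X \<in> Der ==> Y \<in> Der ==> pr10 M (fmul f X + Y) = fmul f (pr10 M X) + pr10 M Y"
 "f \<in> Cinf M ==> X \<in> Der ==> Y \<in> Der ==> pr01 M (fmul f X + Y) = fmul f (pr01 M X) + pr01 M Y"
 unfolding pr10_def pr01_def J_lin by (auto simp: fun_eq_iff fun_app cmul_def fmul_def algebra_simps)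

lemma pr_I: "X \<in> I ==> pr10 M X \<in> I" "X \<in> I ==> pr01 M X \<in> I"
 unfolding pr10_def pr01_def
 by (auto intro!: cv.subspace_scale[OF I_subspace] cv.subspace_add[OF I_subspace] cv.subspace_diff[OF I_subspace] J_I)

lemma T_Der: "X \<in> T10 M ==> X \<in> Der" "Z \<in> T01 M ==> Z \<in> Der"
 by (auto simp: T10_def T01_def)

lemma T_0 [simp]: "0 \<in> T10 M" "0 \<in> T01 M"
 by (auto simp: T10_def T01_def J_zero)

lemma T_closed: "f \<in> Cinf M ==> X \<in> T10 M ==> Y \<in> T10 M ==> fmul f X + Y \<in> T10 M"
 "f \<in> Cinf M ==> X \<in> T01 M ==> Y \<in> T01 M ==> fmul f X + Y \<in> T01 M"
 unfolding T10_def T01_def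
 by (auto simp: J_lin simp del: cv.scale_minus_left) (auto simp: fun_eq_iff fun_app cmul_def fmul_def algebra_simps)

lemma T01_simps: "X \<in> T01 M ==> Y \<in> T01 M ==> X + Y \<in> T01 M" "f \<in> Cinf M ==> X \<in> T01 M ==> fmul f X \<in> T01 M"
 "X \<in> T01 M ==> - X \<in> T01 M"
proof -
 show "f \<in> Cinf M ==> X \<in> T01 M ==> fmul f X \<in> T01 M" for f using T_closed(2)[of f X 0] by simp
 show "X \<in> T01 M ==> Y \<in> T01 M ==> X + Y \<in> T01 M" using T_closed(2)[OF uC(1), of X Y] by (simp add: uC_fmul T_Der)
 show "X \<in> T01 M ==> - X \<in> T01 M"
  by (auto simp: T01_def J_neg)
qed

text \<open>For two fields in the eigenspace of \<open>- \<i>\<close> the integrability equation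
  becomes \<open>- L = L - 2 \<i> J L\<close> with \<open>L = lie Z W\<close>, which says that
  \<open>L\<close> lies in the same eigenspace.\<close>

lemma T01_lie: assumes "Z \<in> T01 M" "W \<in> T01 M" shows "lie Z W \<in> T01 M"
proof -
 have d: "Z \<in> Der" "W \<in> Der" and j: "Jop M Z = cmul (- \<i>) Z" "Jop M W = cmul (- \<i>) W"
  using assms by (auto simp: T01_def)
 let ?L = "lie Z W"
 have L: "?L \<in> Der" using d by auto
 have 1: "lie (Jop M Z) W = cmul (- \<i>) ?L" "lie Z (Jop M W) = cmul (- \<i>) ?L" "lie (Jop M Z) (Jop M W) = cmul (- \<i>) (cmul (- \<i>) ?L)"
  unfolding j by (simp_all only: lie_cmul_left lie_cmul_right Der_cmul d)
 have "cmul (- \<i>) (cmul (- \<i>) ?L) = ?L + Jop M (cmul (- \<i>) ?L + cmul (- \<i>) ?L)"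
  using J_int[OF d] unfolding 1 .
 also have "Jop M (cmul (- \<i>) ?L + cmul (- \<i>) ?L) = cmul (- \<i>) (Jop M ?L) + cmul (- \<i>) (Jop M ?L)"
  by (simp only: L J_add J_cmul Der_cmul)
 finally have *: "cmul (- \<i>) (cmul (- \<i>) ?L) = ?L + (cmul (- \<i>) (Jop M ?L) + cmul (- \<i>) (Jop M ?L))" .
 have "cmul (- \<i>) (cmul (- \<i>) ?L) f x = (?L + (cmul (- \<i>) (Jop M ?L) + cmul (- \<i>) (Jop M ?L))) f x" for f x unfolding * ..
 hence e: "- ?L f x = ?L f x - 2 * \<i> * Jop M ?L f x" for f x by (simp add: fun_app cmul_def)
 have "b = - \<i> * a" if "- a = a - 2 * \<i> * b" for a b :: complex using that by (simp add: complex_eq_iff)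
 hence "Jop M ?L f x = - \<i> * ?L f x" for f x using e[of f x] by blast
 thus ?thesis using L by (auto simp: T01_def fun_eq_iff cmul_def)
qed

sublocale vf: algebroid "Cinf M" fmul "derivations (Cinf M)" uC "%X. X" lie
proof unfold_locales
 show "lie v (w + u) = lie v w + lie v u" if "v \<in> Der" "w \<in> Der" "u \<in> Der" for v w u by (rule lie_add_right[OF that])
 show "lie v (fmul f w) = fmul (v f) w + fmul f (lie v w)" if "f \<in> Cinf M" "v \<in> Der" "w \<in> Der" for f v w
  by (rule lie_fmul_right[OF that(2,3,1)])
 show "lie v (lie w u) = lie (lie v w) u + lie w (lie v u)" if "v \<in> Der" "w \<in> Der" "u \<in> Der" for v w u
  by (rule lie_jacobi[OF that])
 show "lie v w = - lie w v" for v w by (rule lie_skew)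
qed (auto simp: uC uC_fmul)

sublocale vfs: split_module "Cinf M" fmul "derivations (Cinf M)" uC "pr10 M" "pr01 M"
 by unfold_locales (simp_all add: pr_of_T pr_T pr_sum pr_lin T_Der(1)[OF pr_T(1)] T_Der(2)[OF pr_T(2)])

lemma forms_Alt: "forms (Cinf M) k = vf.Alt k"
 by (simp add: forms_def)

lemma ext_d_eq: "ext_d (Cinf M) k = vf.\<d> k"
 by (rule ext) (simp add: ext_d_def)

lemma contract_ip: "contract X = ip X"
 by (simp add: contract_def ip_def fun_eq_iff)

lemma form_component_0: "form_component M 0 \<w> v = (if set v \<subseteq> Der then \<w> (map (pr01 M) v) else 0)"
proof -
 have "{S. S \<subseteq> {..<length v} \<and> card S = 0} = {{}}" using finite_subset[OF _ finite_lessThan] by (auto simp: card_eq_0_iff)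
 moreover have "map (%i. pr01 M (v ! i)) [0..<length v] = map (pr01 M) v" by (rule nth_equalityI) auto
 ultimately show ?thesis by (simp add: form_component_def component_def)
qed

lemma form_component_1: "\<a> \<in> vf.Alt 1 ==> Y \<in> Der ==> form_component M 1 \<a> [Y] = \<a> [pr10 M Y]"
 and form_component_Alt: "\<a> \<in> vf.Alt 1 ==> form_component M 1 \<a> \<in> vf.Alt 1"
proof -
 have "(S \<subseteq> {..<length [Y]} \<and> card S = 1) = (S = {0})" for S :: "nat set"
 proof
  assume S: "S \<subseteq> {..<length [Y]} \<and> card S = 1"
  then obtain x where "S = {x}" by (elim conjE card_1_singletonE)
  thus "S = {0}" using S by simp
 qed simp
 thus "Y \<in> Der ==> form_component M 1 \<a> [Y] = \<a> [pr10 M Y]" by (simp add: form_component_def component_def)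
 show "\<a> \<in> vf.Alt 1 ==> form_component M 1 \<a> \<in> vf.Alt 1" unfolding form_component_def by (rule vfs.comp_Alt)
qed

lemma pq_0: "\<w> \<in> pq_forms M 0 q \<longleftrightarrow> \<w> \<in> vf.Alt q \<and> (\<forall>v. set v \<subseteq> Der --> \<w> (map (pr01 M) v) = \<w> v)"
proof -
 have "form_component M 0 \<w> = \<w> \<longleftrightarrow> (\<forall>v. (if set v \<subseteq> Der then \<w> (map (pr01 M) v) else 0) = \<w> v)"
  by (simp add: fun_eq_iff form_component_0)
 moreover have "\<w> \<in> vf.Alt q ==> \<not> set v \<subseteq> Der ==> \<w> v = 0" for v by (rule vf.Alt_support) auto
 ultimately show ?thesis unfolding pq_forms_def forms_Alt by auto
qed

lemma pq_10: "\<a> \<in> pq_forms M 1 0 \<longleftrightarrow> \<a> \<in> vf.Alt 1 \<and> (\<forall>Z\<in>T01 M. \<a> [Z] = 0)"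
proof -
 have fc: "form_component M 1 \<a> [X] = \<a> [pr10 M X]" if "\<a> \<in> vf.Alt 1" "X \<in> Der" for X by (rule form_component_1[OF that])
 have pr: "\<a> [X] = \<a> [pr10 M X] + \<a> [pr01 M X]" if "X \<in> Der" "\<a> \<in> vf.Alt 1" for X
  using vf.Alt_1_add[OF that(2) T_Der(1)[OF pr_T(1)[OF that(1)]] T_Der(2)[OF pr_T(2)[OF that(1)]]] by (simp add: pr_sum)
 have "form_component M 1 \<a> = \<a> \<longleftrightarrow> (\<forall>Z\<in>T01 M. \<a> [Z] = 0)" if a: "\<a> \<in> vf.Alt 1"
 proof (intro iffI ballI)
  fix Z assume "form_component M 1 \<a> = \<a>" "Z \<in> T01 M"
  thus "\<a> [Z] = 0" using fc[OF a T_Der(2), of Z] by (simp only: pr_of_T(4) vf.Alt_1_zero[OF a])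
 next
  assume z: "\<forall>Z\<in>T01 M. \<a> [Z] = 0"
  show "form_component M 1 \<a> = \<a>"
   using z pr_T(2) by (intro vf.Alt_1_eqI[OF form_component_Alt[OF a] a]) (simp add: fc[OF a] pr[OF _ a])
 qed
 thus ?thesis unfolding pq_forms_def forms_Alt by auto
qed

lemma pq_01: "\<a> \<in> pq_forms M 0 1 \<longleftrightarrow> \<a> \<in> vf.Alt 1 \<and> (\<forall>X\<in>T10 M. \<a> [X] = 0)"
proof -
 have sum: "\<a> [X] = \<a> [pr10 M X] + \<a> [pr01 M X]" if "X \<in> Der" "\<a> \<in> vf.Alt 1" for X
  using vf.Alt_1_add[OF that(2) T_Der(1)[OF pr_T(1)[OF that(1)]] T_Der(2)[OF pr_T(2)[OF that(1)]]] by (simp add: pr_sum)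
 moreover have "(\<forall>v. set v \<subseteq> Der --> \<a> (map (pr01 M) v) = \<a> v) \<longleftrightarrow> (\<forall>X\<in>Der. \<a> [pr01 M X] = \<a> [X])" if a: "\<a> \<in> vf.Alt 1"
 proof (intro iffI allI impI)
  fix v assume *: "\<forall>X\<in>Der. \<a> [pr01 M X] = \<a> [X]" "set v \<subseteq> Der"
  show "\<a> (map (pr01 M) v) = \<a> v"
  proof (cases "length v = 1")
   case True
   then obtain X where "v = [X]" by (auto simp: length_Suc_conv One_nat_def)
   thus ?thesis using * by simp
  qed (use vf.Alt_support[OF a] in simp)
 next
  assume *: "\<forall>v. set v \<subseteq> Der --> \<a> (map (pr01 M) v) = \<a> v"
  show "\<forall>X\<in>Der. \<a> [pr01 M X] = \<a> [X]"
  proof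
   fix X assume "X \<in> Der"
   thus "\<a> [pr01 M X] = \<a> [X]" using *[rule_format, of "[X]"] by simp
  qed
 qed
 moreover have "(\<forall>X\<in>Der. \<a> [pr01 M X] = \<a> [X]) \<longleftrightarrow> (\<forall>X\<in>T10 M. \<a> [X] = 0)" if a: "\<a> \<in> vf.Alt 1"
 proof (intro iffI ballI)
  fix X assume "\<forall>X\<in>Der. \<a> [pr01 M X] = \<a> [X]" "X \<in> T10 M"
  thus "\<a> [X] = 0" using T_Der(1)[of X] by (simp add: pr_of_T vf.Alt_1_zero[OF a] flip: \<open>\<forall>X\<in>Der. \<a> [pr01 M X] = \<a> [X]\<close>[rule_format])
 next
  fix X assume "\<forall>X\<in>T10 M. \<a> [X] = 0" "X \<in> Der"
  thus "\<a> [pr01 M X] = \<a> [X]" using sum[of X] a pr_T(1)[of X] by simp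
 qed
 ultimately show ?thesis unfolding pq_0 by blast
qed

lemma pq_10_module: "0 \<in> pq_forms M 1 0" "\<a> \<in> pq_forms M 1 0 ==> \<beta> \<in> pq_forms M 1 0 ==> \<a> + \<beta> \<in> pq_forms M 1 0"
 "\<a> \<in> pq_forms M 1 0 ==> \<beta> \<in> pq_forms M 1 0 ==> \<a> - \<beta> \<in> pq_forms M 1 0" "\<a> \<in> pq_forms M 1 0 ==> - \<a> \<in> pq_forms M 1 0"
 "f \<in> Cinf M ==> \<a> \<in> pq_forms M 1 0 ==> fmul f \<a> \<in> pq_forms M 1 0"
 unfolding pq_10 by (auto intro: vf.Alt_add vf.Alt_diff vf.Alt_neg vf.Alt_fmul)

lemma Lv_1: "X \<in> Der ==> Y \<in> Der ==> vf.Lv X \<a> [Y] = X (\<a> [Y]) - \<a> [lie X Y]"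
 by (simp add: LD_def)

lemma pq_10_Lv: "Z \<in> T01 M ==> \<a> \<in> pq_forms M 1 0 ==> vf.Lv Z \<a> \<in> pq_forms M 1 0"
 unfolding pq_10 using T01_lie[of Z] by (auto intro!: vf.Lv_Alt T_Der simp: Lv_1 T_Der)

lemma ip_pq_10: "Z \<in> T01 M ==> \<a> \<in> pq_forms M 1 0 ==> ip Z \<a> = 0"
 unfolding pq_10 by (intro vf.ip_Alt_1_0) auto

text \<open>A (1,0)-form vanishes on a (0,1)-field, so Cartan's formula turns the contraction of its
  differential into a Lie derivative.\<close>

lemma gbracket_Lbar:
 assumes "v \<in> Lbar_sec M" "w \<in> Lbar_sec M"
 shows "gbracket (Cinf M) v w = (lie (fst v) (fst w), vf.Lv (fst v) (snd w) - vf.Lv (fst w) (snd v))"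
proof -
 have "ip Z (vf.\<d> 1 \<a>) = vf.Lv Z \<a>" if "Z \<in> T01 M" "\<a> \<in> pq_forms M 1 0" for Z \<a>
  using vf.\<d>_ip[of \<a> 1 Z] that(2) ip_pq_10[OF that] T_Der(2)[OF that(1)] by (simp add: pq_10)
 moreover have "fst v \<in> T01 M" "fst w \<in> T01 M" "snd v \<in> pq_forms M 1 0" "snd w \<in> pq_forms M 1 0" using assms by (auto simp: Lbar_sec_def)
 ultimately show ?thesis by (simp add: gbracket_def ext_d_eq contract_ip)
qed

lemma Lbar_D: "v \<in> Lbar_sec M ==> fst v \<in> T01 M" "v \<in> Lbar_sec M ==> snd v \<in> pq_forms M 1 0"
  "v \<in> Lbar_sec M ==> fst v \<in> Der" "v \<in> Lbar_sec M ==> snd v \<in> vf.Alt 1"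
 using T_Der by (auto simp: Lbar_sec_def pq_10)

lemma LbarI: "fst v \<in> T01 M ==> snd v \<in> pq_forms M 1 0 ==> v \<in> Lbar_sec M"
 by (cases v) (auto simp: Lbar_sec_def)

lemma fmodule_Lbar: "fmodule (Cinf M) gmul (Lbar_sec M) uC"
proof unfold_locales
 show "gmul uC v = v" if "v \<in> Lbar_sec M" for v
  using that Lbar_D(3)[OF that] Lbar_D(4)[OF that] by (cases v) (auto simp: gmul_def uC_fmul fmul_def uC(2))
qed (simp_all add: uC gmul_def Lbar_D LbarI T01_simps pq_10_module)

sublocale lb: fmodule "Cinf M" gmul "Lbar_sec M" uC by (rule fmodule_Lbar)

text \<open>With the bracket in terms of Lie derivatives the axioms are properties of
  \<open>Lv\<close> for vector fields: the Jacobi identity is \<open>Lv_Lv\<close>, and in the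
  Leibniz rule the extra term of \<open>Lv_sm\<close> vanishes by \<open>ip_pq_10\<close>.\<close>

sublocale lb: algebroid "Cinf M" gmul "Lbar_sec M" uC fst "gbracket (Cinf M)"
proof unfold_locales
 let ?V = "Lbar_sec M"
 note [simp] = gbracket_Lbar Lbar_D
 show g: "gbracket (Cinf M) v w \<in> ?V" if "v \<in> ?V" "w \<in> ?V" for v w
  using that by (intro LbarI) (simp_all add: T01_lie pq_10_module(3) pq_10_Lv)
 show "gbracket (Cinf M) v w = - gbracket (Cinf M) w v" if "v \<in> ?V" "w \<in> ?V" for v w
  using that by (simp add: lie_skew[of "fst v"])
 show "gbracket (Cinf M) v (w + u) = gbracket (Cinf M) v w + gbracket (Cinf M) v u" if "v \<in> ?V" "w \<in> ?V" "u \<in> ?V" for v w u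
  using that by (simp add: lb.V_add lie_add_right vf.Lv_add[where k = 1] vf.Lv_add_arg[where k = 1])
 show "gbracket (Cinf M) v (gmul f w) = gmul (fst v f) w + gmul f (gbracket (Cinf M) v w)" if "f \<in> Cinf M" "v \<in> ?V" "w \<in> ?V" for f v w
  using that by (simp add: gbracket_Lbar[OF _ lb.V_sm[unfolded gmul_def]] gmul_def lie_fmul_right vf.Lv_fmul[where k = 1 and \<eta> = 0] vf.Lv_sm[where k = 1] ip_pq_10)
 show "fst (gbracket (Cinf M) v w) = lie (fst v) (fst w)" for v w by (simp add: gbracket_def)
 show "gbracket (Cinf M) v (gbracket (Cinf M) w u) = gbracket (Cinf M) (gbracket (Cinf M) v w) u + gbracket (Cinf M) w (gbracket (Cinf M) v u)"
  if vwu: "v \<in> ?V" "w \<in> ?V" "u \<in> ?V" for v w u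
 proof -
  have L: "vf.Lv (lie X Y) \<a> = vf.Lv X (vf.Lv Y \<a>) - vf.Lv Y (vf.Lv X \<a>)" if "X \<in> Der" "Y \<in> Der" "\<a> \<in> vf.Alt 1" for X Y \<a>
   using vf.Lv_Lv[OF that(3,1,2)] by simp
  have d: "vf.Lv X (\<a> - \<beta>) = vf.Lv X \<a> - vf.Lv X \<beta>" if "X \<in> Der" "\<a> \<in> vf.Alt 1" "\<beta> \<in> vf.Alt 1" for X \<a> \<beta>
   by (rule vf.Lv_diff[OF that])
  have j: "lie (fst v) (lie (fst w) (fst u)) = lie (lie (fst v) (fst w)) (fst u) + lie (fst w) (lie (fst v) (fst u))"
   using vwu by (intro lie_jacobi) auto
  show ?thesis using vwu g[of v w] g[of v u] g[of w u]
   by (simp add: L d vf.Lv_Alt Der_lie j)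
 qed
qed (auto simp: Lbar_D gmul_def)

sublocale lbs: split_module "Cinf M" gmul "Lbar_sec M" uC "%(Z, \<a>). (0, \<a>)" "%(Z, \<a>). (Z, 0)"
 by unfold_locales (auto simp: gmul_def Lbar_sec_def pq_10_module zero_prod_def)

lemma L_alt_Alt: "L_alt M k = lb.Alt k"
 by (simp add: L_alt_def)

lemma dbar_poly_eq: "dbar_poly M k = lb.\<d> k"
 by (rule ext) (simp add: dbar_poly_def)

end

subsection \<open>Frames\<close>

locale frame_module = fmodule C sm V uC for C :: "'m fn set" and sm :: "'m fn => 'v::ab_group_add => 'v" and V uC +
 fixes n :: nat and e :: "nat => 'v list => 'm fn" and \<e> :: "nat => 'v"
 assumes e_Alt: "\<And>b. b < n ==> e b \<in> Alt 1" and \<e>_V: "\<And>b. b < n ==> \<e> b \<in> V"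
  and expand: "\<And>v. v \<in> V ==> (\<Sum>b<n. sm (e b [v]) (\<e> b)) = v"
begin

lemma Alt_sum_arg:
 assumes w: "\<w> \<in> Alt k" and v: "\<And>i. i \<in> F ==> v i \<in> V"
 shows "ip (sum v F) \<w> = (\<Sum>i\<in>F. ip (v i) \<w>)"
 by (rule sum_additive[where h = "%v. ip v \<w>" and S = V])
  (rule Alt_zero_arg[OF w] Alt_add_arg[OF w] V_0 V_add v; assumption)+

lemma ip_expand: "\<w> \<in> Alt k ==> v \<in> V ==> ip v \<w> = (\<Sum>b<n. fmul (e b [v]) (ip (\<e> b) \<w>))"
proof -
 assume w: "\<w> \<in> Alt k" and v: "v \<in> V"
 have c: "e b [v] \<in> C" if "b < n" for b using Alt_C[OF e_Alt[OF that]] .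
 have "ip (\<Sum>b<n. sm (e b [v]) (\<e> b)) \<w> = (\<Sum>b<n. ip (sm (e b [v]) (\<e> b)) \<w>)"
  by (rule Alt_sum_arg[OF w]) (simp add: V_sm c \<e>_V)
 also have "\<dots> = (\<Sum>b<n. fmul (e b [v]) (ip (\<e> b) \<w>))"
  by (rule sum.cong) (auto intro!: Alt_sm_arg[OF w] simp: c \<e>_V)
 finally show ?thesis unfolding expand[OF v] .
qed

text \<open>Expanding one argument after another reduces a property of values to lists of frame
  elements. It is used with \<open>K = {0}\<close> on all sections and with the constant functions
  on invariant ones.\<close>

lemma frame_values:
 assumes K: "0 \<in> K" "\<And>f g. f \<in> K ==> g \<in> K ==> f + g \<in> K" and W: "W \<subseteq> V" "\<And>v b f. v \<in> W ==> b < n ==> f \<in> K ==> e b [v] * f \<in> K"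
 shows "\<w> \<in> Alt k ==> (\<And>l. set l \<subseteq> \<e> ` {..<n} ==> \<w> l \<in> K) ==> set l \<subseteq> W ==> \<w> l \<in> K"
proof (induction l arbitrary: k \<w>)
 case (Cons v l)
 have v: "v \<in> W" and l: "set l \<subseteq> W" using Cons.prems(3) by auto
 have "ip (\<e> b) \<w> l \<in> K" if b: "b < n" for b
 proof (rule Cons.IH[OF Alt_ip[OF Cons.prems(1)] _ l])
  show "ip (\<e> b) \<w> l' \<in> K" if "set l' \<subseteq> \<e> ` {..<n}" for l' unfolding ip_apply using that b by (intro Cons.prems(2)) auto
 qed
 hence "e b [v] * ip (\<e> b) \<w> l \<in> K" if "b < n" for b using W(2)[OF v] that by blast
 hence "(\<Sum>b<m. e b [v] * ip (\<e> b) \<w> l) \<in> K" if "m \<le> n" for m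
  using that K by (induction m) auto
 moreover have "\<w> (v # l) = (\<Sum>b<n. e b [v] * ip (\<e> b) \<w> l)"
  using fun_cong[OF ip_expand[OF Cons.prems(1)], of v l] v W(1) by (auto simp: ip_apply sum_fun_apply)
 ultimately show "\<w> (v # l) \<in> K" by simp
qed simp

lemma frame_zero: "\<w> \<in> Alt k ==> (\<And>l. set l \<subseteq> \<e> ` {..<n} ==> \<w> l = 0) ==> \<w> = 0"
proof
 fix l assume *: "\<w> \<in> Alt k" "\<And>l. set l \<subseteq> \<e> ` {..<n} ==> \<w> l = 0"
 show "\<w> l = 0 l"
 proof (cases "set l \<subseteq> V")
  case True
  have "\<w> l \<in> {0}" by (rule frame_values[OF _ _ _ _ *(1) _ True]) (use *(2) in auto)
  thus ?thesis by simp
 qed (simp add: Alt_support[OF *(1)])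
qed

lemma ip_Alt_1: "\<a> \<in> Alt 1 ==> ip v \<a> = fn0 (\<a> [v])"
proof
 fix l assume "\<a> \<in> Alt 1"
 thus "ip v \<a> l = fn0 (\<a> [v]) l" using homogD[OF Alt_homog[of \<a> 1], of "v # l"] by (cases l) (auto simp: ip_apply fn0_def One_nat_def)
qed

text \<open>Euler's identity: summing the products of \<open>e b\<close> with the contraction by
  \<open>\<e> b\<close> multiplies a form by its degree. It exhibits every form as a combination of
  products without choosing ordered index sets.\<close>

lemma generation: "\<w> \<in> Alt (Suc k) ==> (\<Sum>b<n. wedge (e b) (ip (\<e> b) \<w>)) = cmul (of_nat (Suc k)) \<w>"
proof (induction k arbitrary: \<w> rule: less_induct)
 case (less k)
 note w = less.prems
 have i: "ip v \<w> \<in> Alt k" for v using Alt_ip[OF w] by simp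
 show "(\<Sum>b<n. wedge (e b) (ip (\<e> b) \<w>)) = cmul (of_nat (Suc k)) \<w>"
 proof (rule Alt_eqI)
  have "wedge (e b) (ip (\<e> b) \<w>) \<in> Alt (1 + k)" if "b < n" for b by (intro Alt_wedge e_Alt that i)
  thus "(\<Sum>b<n. wedge (e b) (ip (\<e> b) \<w>)) \<in> Alt (Suc k)" by (intro Alt_sum) (simp flip: plus_1_eq_Suc)
  show "cmul (of_nat (Suc k)) \<w> \<in> Alt (Suc k)" by (rule Alt_cmul[OF w])
  fix v assume v: "v \<in> V"
  have s: "(\<Sum>b<n. wedge (e b) (ip (\<e> b) (ip v \<w>))) = cmul (of_nat k) (ip v \<w>)"
  proof (cases k)
   case 0
   hence "ip (\<e> b) (ip v \<w>) = 0" for b using i[of v] by simp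
   thus ?thesis using 0 by simp
  next
   case (Suc k')
   show ?thesis using less.IH[of k' "ip v \<w>"] i[of v] unfolding Suc by blast
  qed
  have "ip v (wedge (e b) (ip (\<e> b) \<w>)) = fmul (e b [v]) (ip (\<e> b) \<w>) + wedge (e b) (ip (\<e> b) (ip v \<w>))" if b: "b < n" for b
  proof -
   have sk: "ip v (ip (\<e> b) \<w>) = - ip (\<e> b) (ip v \<w>)" by (rule Alt_skew[OF w])
   show ?thesis
    unfolding ip_wedge[OF Alt_homog[OF e_Alt[OF b]]] ip_Alt_1[OF e_Alt[OF b]] wedge_fn0 sk
    by (simp add: One_nat_def) (simp add: fmul_def fun_eq_iff fun_app)
  qed
  hence "ip v (\<Sum>b<n. wedge (e b) (ip (\<e> b) \<w>)) = ip v \<w> + cmul (of_nat k) (ip v \<w>)"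
   unfolding ip_sum by (simp add: sum.distrib s flip: ip_expand[OF w v])
  thus "ip v (\<Sum>b<n. wedge (e b) (ip (\<e> b) \<w>)) = ip v (cmul (of_nat (Suc k)) \<w>)"
   by (simp add: cv.scale_left_distrib)
 qed
qed

text \<open>Dividing \<open>generation\<close> by the degree, every form arises from functions by
  products with \<open>e b\<close> and linear combinations. In this way identities for
  \<open>br\<close>, whose values are prescribed on generators only, reach all forms.\<close>

lemma gen_induct [consumes 1, case_names zero fn wedge lin]:
 assumes w: "\<w> \<in> Alt k" and z: "\<And>k. P k 0" and fn: "\<And>f. f \<in> C ==> P 0 (fn0 f)"
  and wg: "\<And>k b \<w>. b < n ==> \<w> \<in> Alt k ==> P k \<w> ==> P (Suc k) (wedge (e b) \<w>)"
  and lin: "\<And>k c \<w> \<eta>. \<w> \<in> Alt k ==> \<eta> \<in> Alt k ==> P k \<w> ==> P k \<eta> ==> P k (cmul c \<w> + \<eta>)"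
 shows "P k \<w>"
 using w
proof (induction k arbitrary: \<w>)
 case (0 \<w>)
 have "\<w> = fn0 (\<w> [])" using 0 by (auto simp: Alt_0_iff fn0_def)
 moreover have "P 0 (fn0 (\<w> []))" by (rule fn) (use 0 in simp)
 ultimately show "P 0 \<w>" by simp
next
 case (Suc k)
 note w = Suc.prems
 have i: "ip v \<w> \<in> Alt k" for v using Alt_ip[OF w] by simp
 have a: "wedge (e b) (ip (\<e> b) \<w>) \<in> Alt (Suc k)" if "b < n" for b using Alt_wedge[OF e_Alt[OF that] i] by (simp flip: plus_1_eq_Suc)
 have p: "P (Suc k) (wedge (e b) (ip (\<e> b) \<w>))" if "b < n" for b by (intro wg that i Suc.IH)
 have "P (Suc k) (\<Sum>b<m. wedge (e b) (ip (\<e> b) \<w>)) \<and> (\<Sum>b<m. wedge (e b) (ip (\<e> b) \<w>)) \<in> Alt (Suc k)" if "m \<le> n" for m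
  using that
 proof (induction m)
  case 0
  have "0 \<in> Alt (Suc k)" by simp
  thus ?case using z unfolding lessThan_0 sum.empty by blast
 next
  case (Suc m)
  let ?s = "\<Sum>b<m. wedge (e b) (ip (\<e> b) \<w>)"
  have m: "m < n" using Suc by simp
  have s: "P (Suc k) ?s" "?s \<in> Alt (Suc k)" using Suc by auto
  have "P (Suc k) (cmul 1 (wedge (e m) (ip (\<e> m) \<w>)) + ?s)" by (rule lin[OF a[OF m] s(2) p[OF m] s(1)])
  moreover have "cmul 1 (wedge (e m) (ip (\<e> m) \<w>)) + ?s = (\<Sum>b<Suc m. wedge (e b) (ip (\<e> b) \<w>))" by (simp add: add.commute)
  moreover have "cmul 1 (wedge (e m) (ip (\<e> m) \<w>)) + ?s \<in> Alt (Suc k)" by (intro Alt_add Alt_cmul a m s)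
  ultimately show ?case by metis
 qed
 note s = this
 have "cmul (1 / of_nat (Suc k)) (\<Sum>b<n. wedge (e b) (ip (\<e> b) \<w>)) = \<w>"
  unfolding generation[OF w] by (simp del: of_nat_Suc)
 moreover have "P (Suc k) (cmul (1 / of_nat (Suc k)) (\<Sum>b<n. wedge (e b) (ip (\<e> b) \<w>)) + 0)"
  using s[of n] z by (intro lin) auto
 ultimately show "P (Suc k) \<w>" by simp
qed

end

text \<open>An argument in the style of Engel's theorem. A longest independent triangular list spans
  \<open>E\<close>: otherwise some vector outside its span has all its images inside, and extends
  the list. If there were none, every vector outside could be moved to another one outside, and
  \<open>k\<close> such moves would contradict \<open>nil\<close>.\<close>

lemma triangular_basis:
 fixes E :: "('a => 'm fn) set" and N :: "'b => ('a => 'm fn) => 'a => 'm fn"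
 assumes E: "cv.subspace E" and F: "finite F" "E \<subseteq> cv.span F"
  and N: "\<And>Z X. Z \<in> A ==> X \<in> E ==> N Z X \<in> E"
  and nil: "\<And>Zs X. length Zs = k ==> set Zs \<subseteq> A ==> X \<in> E ==> foldr N Zs X = 0"
 obtains xs where "set xs \<subseteq> E" "distinct xs" "cv.independent (set xs)" "cv.span (set xs) = E"
  "\<And>i Z. i < length xs ==> Z \<in> A ==> N Z (xs ! i) \<in> cv.span (set (take i xs))"
proof -
 let ?T = "%xs. \<forall>i<length xs. \<forall>Z\<in>A. N Z (xs ! i) \<in> cv.span (set (take i xs))"
 let ?P = "%xs. set xs \<subseteq> E \<and> distinct xs \<and> cv.independent (set xs) \<and> ?T xs"
 have b: "\<forall>xs. ?P xs --> length xs < Suc (card F)"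
 proof (intro allI impI)
  fix xs assume p: "?P xs"
  hence "set xs \<subseteq> cv.span F" using F(2) by blast
  hence "card (set xs) \<le> card F" using p cv.independent_span_bound[OF F(1), of "set xs"] by blast
  thus "length xs < Suc (card F)" using p distinct_card[of xs] by simp
 qed
 have "?P []" by (simp add: cv.independent_empty)
 from ex_has_greatest_nat[of ?P, OF this, of length, OF b]
 obtain xs where p: "?P xs" and max: "\<And>ys. ?P ys ==> length ys \<le> length xs" by blast
 have sub: "cv.span (set xs) \<subseteq> E" using p E by (intro cv.span_minimal) auto
 have "E \<subseteq> cv.span (set xs)"
 proof (rule ccontr)
  assume "\<not> E \<subseteq> cv.span (set xs)"
  then obtain X0 where X0: "X0 \<in> E" "X0 \<notin> cv.span (set xs)" by blast
  have "\<exists>Y. Y \<in> E \<and> Y \<notin> cv.span (set xs) \<and> (\<forall>Z\<in>A. N Z Y \<in> cv.span (set xs))"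
  proof (rule ccontr)
   assume no: "\<nexists>Y. Y \<in> E \<and> Y \<notin> cv.span (set xs) \<and> (\<forall>Z\<in>A. N Z Y \<in> cv.span (set xs))"
   have "\<exists>Zs. length Zs = m \<and> set Zs \<subseteq> A \<and> foldr N Zs X0 \<in> E \<and> foldr N Zs X0 \<notin> cv.span (set xs)" for m
   proof (induction m)
    case (Suc m)
    then obtain Zs where Zs: "length Zs = m" "set Zs \<subseteq> A" "foldr N Zs X0 \<in> E" "foldr N Zs X0 \<notin> cv.span (set xs)" by blast
    then obtain Z where "Z \<in> A" "N Z (foldr N Zs X0) \<notin> cv.span (set xs)" using no by blast
    thus ?case using Zs N by (intro exI[of _ "Z # Zs"]) auto
   qed (use X0 in simp)
   then obtain Zs where "length Zs = k" "set Zs \<subseteq> A" "foldr N Zs X0 \<notin> cv.span (set xs)" by blast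
   thus False using nil[of Zs X0] X0(1) cv.span_zero by metis
  qed
  then obtain Y where Y: "Y \<in> E" "Y \<notin> cv.span (set xs)" "\<And>Z. Z \<in> A ==> N Z Y \<in> cv.span (set xs)" by blast
  have "?T (xs @ [Y])" using p Y(3) by (simp add: nth_append less_Suc_eq)
  moreover have "Y \<notin> set xs" using Y(2) cv.span_base by blast
  moreover have "cv.independent (insert Y (set xs))" using p Y(2) by (intro cv.independent_insertI) auto
  ultimately have "?P (xs @ [Y])" using p Y(1) by simp
  from max[OF this] show False by simp
 qed
 with p sub show thesis by (intro that[of xs]) auto
qed


section \<open>Coordinates with respect to the invariant frame\<close>

context framed_manifold
begin

lemma K_eq: "constants M = range cC"
proof
 show "constants M \<subseteq> range cC"
 proof
  fix f assume "f \<in> constants M"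
  then obtain c where "f \<in> Cinf M" "\<And>x. x \<in> points M ==> f x = c" by (auto simp: constants_def)
  hence "f = cC c" using off_points[of f] by (auto simp: cC_def uC_def fun_eq_iff)
  thus "f \<in> range cC" by blast
 qed
 have "\<exists>d. \<forall>x\<in>points M. cC c x = d" for c by (rule exI[of _ c]) (simp add: cC_def uC_def)
 thus "range cC \<subseteq> constants M" by (auto simp: constants_def)
qed

lemma cC_add: "cC a + cC b = cC (a + b)" and cC_times: "cC a * cC b = cC (a * b)" and cC_neg: "- cC a = cC (- a)" and cC_0: "0 = cC 0"
 and cC_1: "uC = cC 1"
 by (auto simp: cC_def fun_eq_iff fun_app algebra_simps uC_def)

lemma K_0 [simp]: "0 \<in> constants M" and K_uC [simp]: "uC \<in> constants M" unfolding K_eq cC_0 cC_1 by blast+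

lemma K_add: "f \<in> constants M ==> g \<in> constants M ==> f + g \<in> constants M"
 and K_mult: "f \<in> constants M ==> g \<in> constants M ==> f * g \<in> constants M"
 and K_neg: "f \<in> constants M ==> - f \<in> constants M"
 unfolding K_eq by (auto simp: cC_add cC_times cC_neg)

lemma K_diff: "f \<in> constants M ==> g \<in> constants M ==> f - g \<in> constants M"
 using K_add[of f "- g"] K_neg[of g] by simp

lemma K_sum: "(\<And>i. i \<in> F ==> f i \<in> constants M) ==> sum f F \<in> constants M"
 by (rule sum_closed[OF K_0 K_add])

lemma K_sgn: "f \<in> constants M ==> (- 1) ^ i * f \<in> constants M"
 by (induction i) (auto intro: K_neg)

lemma Der_K: "X \<in> Der ==> f \<in> constants M ==> X f = 0"
proof -
 assume X: "X \<in> Der" and f: "f \<in> constants M"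
 have "X (uC * uC) = uC * X uC + uC * X uC" by (rule Der_mult[OF X uC(1) uC(1)])
 hence "X uC = 0" using X by (simp add: uC Der_C')
 hence "X (cC c) = 0" for c unfolding cC_def using Der_scale[OF X uC(1), of c] by (simp add: fun_eq_iff fun_app)
 thus ?thesis using f unfolding K_eq by auto
qed

text \<open>Freezing the coefficients at a point \<open>x\<close> gives an element of
  \<open>I\<close> that vanishes at \<open>x\<close>, hence is 0 by \<open>I_point\<close>;
  independence over the scalars does the rest.\<close>

lemma I_free:
 assumes S: "set S \<subseteq> I" "distinct S" "cv.independent (set S)"
  and f: "\<And>i. i < length S ==> f i \<in> Cinf M" "(\<Sum>i<length S. fmul (f i) (S ! i)) = 0" and i: "i < length S"
 shows "f i = 0"
proof
 fix x
 show "f i x = 0 x"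
 proof (cases "x \<in> points M")
  case True
  let ?Y = "\<Sum>i<length S. cmul (f i x) (S ! i)"
  have "?Y \<in> I" by (intro cv.subspace_sum[OF I_subspace] cv.subspace_scale[OF I_subspace]) (use S in auto)
  moreover have "?Y g x = 0" for g
  proof -
   have "?Y g x = (\<Sum>i<length S. fmul (f i) (S ! i)) g x" by (simp add: sum_fun_apply cmul_apply fmul_apply)
   thus ?thesis unfolding f(2) by (simp add: fun_app)
  qed
  ultimately have Y: "?Y = 0" using I_point True by blast
  have b: "bij_betw ((!) S) {..<length S} (set S)" by (rule bij_betw_nth[OF S(2)]) auto
  define u where "u v = f (the_inv_into {..<length S} ((!) S) v) x" for v
  have u: "u (S ! j) = f j x" if "j < length S" for j
   unfolding u_def using the_inv_into_f_f[OF bij_betw_imp_inj_on[OF b], of j] that by simp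
  have "(\<Sum>v\<in>set S. cmul (u v) v) = ?Y"
   unfolding sum.reindex_bij_betw[OF b, symmetric, of "%v. cmul (u v) v"] by (rule sum.cong) (simp_all add: u)
  hence "u (S ! i) = 0" using Y i cv.independentD[OF S(3), of "set S" u "S ! i"] by simp
  thus ?thesis using u[OF i] by (simp add: fun_app)
 qed (use off_points f(1)[OF i] in \<open>simp add: fun_app\<close>)
qed

lemma span_list: "Y \<in> cv.span (set S) ==> distinct S ==> \<exists>c. Y = (\<Sum>i<length S. cmul (c i) (S ! i))"
proof -
 assume Y: "Y \<in> cv.span (set S)" and d: "distinct S"
 obtain u where "Y = (\<Sum>v\<in>set S. cmul (u v) v)" using Y unfolding cv.span_finite[OF finite_set] by auto
 also have "\<dots> = (\<Sum>i<length S. cmul (u (S ! i)) (S ! i))"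
  by (rule sum.reindex_bij_betw[symmetric]) (rule bij_betw_nth[OF d], auto)
 finally show ?thesis by (rule exI[of _ "%i. u (S ! i)"])
qed

text \<open>The dual 1-forms of an independent list, where \<open>P\<close> will be
  \<open>pr10\<close> or \<open>pr01\<close>. Coefficients exist by \<open>I_frame\<close> and
  because \<open>P\<close> maps \<open>I\<close> into the span; they are unique by
  \<open>I_free\<close>, and uniqueness makes the chosen ones linear.\<close>

lemma coord_forms:
 assumes S: "set S \<subseteq> I" "distinct S" "cv.independent (set S)"
  and lin: "\<And>f X Y. f \<in> Cinf M ==> X \<in> Der ==> Y \<in> Der ==> P (fmul f X + Y) = fmul f (P X) + P Y"
  and P0: "P 0 = 0" and PI: "\<And>Y. Y \<in> I ==> P Y \<in> cv.span (set S)"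
 obtains \<phi> where "\<And>i. i < length S ==> \<phi> i \<in> vf.Alt 1"
  "\<And>Y. Y \<in> Der ==> P Y = (\<Sum>i<length S. fmul (\<phi> i [Y]) (S ! i))"
  "\<And>Y f i. Y \<in> Der ==> (\<And>i. i < length S ==> f i \<in> Cinf M) ==> P Y = (\<Sum>i<length S. fmul (f i) (S ! i)) ==> i < length S ==> \<phi> i [Y] = f i"
proof -
 let ?n = "length S"
 let ?Q = "%f Y. (\<forall>i<?n. f i \<in> Cinf M) \<and> P Y = (\<Sum>i<?n. fmul (f i) (S ! i))"
 have SD: "S ! i \<in> Der" if "i < ?n" for i using S(1) I_Der nth_mem[OF that] by blast
 have uniq: "f i = g i" if "?Q f Y" "?Q g Y" "i < ?n" for f g Y i
 proof -
  have "(\<Sum>i<?n. fmul (f i - g i) (S ! i)) = 0" using that by (simp add: sum_subtractf)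
  hence "f i - g i = 0" using that I_free[OF S, of "%i. f i - g i" i] by auto
  thus ?thesis by simp
 qed
 have Q_lin: "?Q (%i. h * f i + g i) (fmul h X + Y)" if "?Q f X" "?Q g Y" "h \<in> Cinf M" "X \<in> Der" "Y \<in> Der" for f g h X Y
  using that by (auto simp: lin fmul_sum sum.distrib)
 have ex: "\<exists>f. ?Q f Y" if Y: "Y \<in> Der" for Y
 proof -
  from I_frame obtain F where F0: "finite F \<and> F \<subseteq> I \<and> I = cv.span F \<and>
   (\<forall>Y\<in>Der. \<exists>f. (\<forall>i\<in>F. f i \<in> Cinf M) \<and> Y = (\<Sum>i\<in>F. fmul (f i) i))" ..
  hence "\<exists>f. (\<forall>i\<in>F. f i \<in> Cinf M) \<and> Y = (\<Sum>i\<in>F. fmul (f i) i)" using Y by simp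
  then obtain g where "(\<forall>i\<in>F. g i \<in> Cinf M) \<and> Y = (\<Sum>i\<in>F. fmul (g i) i)" ..
  with F0 have F: "finite F" "F \<subseteq> I" "\<And>j. j \<in> F ==> g j \<in> Cinf M" "Y = (\<Sum>j\<in>F. fmul (g j) j)" by (simp_all add: cv.span_superset)
  have "\<exists>f. ?Q f (\<Sum>j\<in>F'. fmul (g j) j)" if "F' \<subseteq> F" for F'
   using finite_subset[OF that F(1)] that
  proof (induction F' rule: finite_induct)
   case empty
   show ?case by (rule exI[of _ "%i. 0"]) (simp add: P0)
  next
   case (insert j F')
   then obtain f where f: "?Q f (\<Sum>j\<in>F'. fmul (g j) j)" by auto
   have j: "j \<in> I" "j \<in> Der" "g j \<in> Cinf M" using insert F I_Der by auto
   obtain c where c: "P j = (\<Sum>i<?n. cmul (c i) (S ! i))" using span_list[OF PI[OF j(1)] S(2)] by blast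
   have q: "?Q (%i. cC (c i)) j" using c SD by (simp add: cC_fmul)
   have d: "(\<Sum>j\<in>F'. fmul (g j) j) \<in> Der" by (intro Der_Sum Der_fmul) (use insert F I_Der in auto)
   show "\<exists>f. ?Q f (\<Sum>j\<in>insert j F'. fmul (g j) j)" unfolding sum.insert[OF insert.hyps]
    by (rule exI[of _ "%i. g j * cC (c i) + f i"]) (rule Q_lin[OF q f j(3,2) d])
  qed
  from this[of F] show ?thesis unfolding F(4) by blast
 qed
 define \<phi> where "\<phi> i l = (if length l = 1 \<and> set l \<subseteq> Der then (SOME f. ?Q f (hd l)) i else 0)" for i l
 have Q: "?Q (%i. \<phi> i [Y]) Y" if "Y \<in> Der" for Y
  using someI_ex[OF ex[OF that]] that by (simp add: \<phi>_def)
 show thesis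
 proof (rule that[of \<phi>])
  fix i assume i: "i < ?n"
  show "\<phi> i \<in> vf.Alt 1"
  proof (rule vf.Alt_1I)
   show "\<phi> i [fmul f u + w] = f * \<phi> i [u] + \<phi> i [w]" if "f \<in> Cinf M" "u \<in> Der" "w \<in> Der" for f u w
    using uniq[OF Q Q_lin[OF Q[OF that(2)] Q[OF that(3)] that] i] that by auto
  qed (use Q i in \<open>auto simp: \<phi>_def\<close>)
 next
  show "\<phi> i [Y] = f i" if "Y \<in> Der" "\<And>i. i < ?n ==> f i \<in> Cinf M" "P Y = (\<Sum>i<?n. fmul (f i) (S ! i))" "i < ?n" for Y f i
   using uniq[OF Q[OF that(1)], of f i] that by auto
 qed (use Q in blast)
qed

end

text \<open>\<open>xs\<close> and \<open>zs\<close> frame the (1,0)- and (0,1)-fields by elements of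
  \<open>I\<close>, with dual 1-forms \<open>xf\<close> and \<open>zf\<close>. By
  \<open>triangular\<close> the (1,0)-part of \<open>lie Z (xs ! j)\<close> has components only at
  indices below \<open>j\<close>.\<close>

locale nil_frame = framed_manifold M I for M :: "('m, 'z) complex_manifold_scheme" and I +
 fixes xs zs :: "'m vf list" and xf zf :: "nat => 'm form"
 assumes xs: "set xs \<subseteq> I \<inter> T10 M" and zs: "set zs \<subseteq> I \<inter> T01 M"
  and xf_Alt: "\<And>i. i < length xs ==> xf i \<in> vf.Alt 1" and zf_Alt: "\<And>i. i < length zs ==> zf i \<in> vf.Alt 1"
  and pr10_eq: "\<And>Y. Y \<in> Der ==> pr10 M Y = (\<Sum>i<length xs. fmul (xf i [Y]) (xs ! i))"
  and pr01_eq: "\<And>Y. Y \<in> Der ==> pr01 M Y = (\<Sum>i<length zs. fmul (zf i [Y]) (zs ! i))"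
  and xf_I: "\<And>i Y. i < length xs ==> Y \<in> I ==> xf i [Y] \<in> constants M"
  and zf_I: "\<And>i Y. i < length zs ==> Y \<in> I ==> zf i [Y] \<in> constants M"
  and xf_xs: "\<And>i j. i < length xs ==> j < length xs ==> xf i [xs ! j] = (if i = j then uC else 0)"
  and zf_zs: "\<And>i j. i < length zs ==> j < length zs ==> zf i [zs ! j] = (if i = j then uC else 0)"
  and xf_01: "\<And>i Z. i < length xs ==> Z \<in> T01 M ==> xf i [Z] = 0"
  and zf_10: "\<And>i X. i < length zs ==> X \<in> T10 M ==> zf i [X] = 0"
  and triangular: "\<And>i j Z. i < length xs ==> j \<le> i ==> Z \<in> I \<inter> T01 M ==> xf i [lie Z (xs ! j)] = 0"

context framed_manifold
begin

lemma nil_frame_exists: "\<exists>xs zs xf zf. nil_frame M I xs zs xf zf"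
proof -
 have T10_sub: "cv.subspace (T10 M)" and T01_sub: "cv.subspace (T01 M)"
 proof -
  have "cmul c X \<in> T10 M" if "X \<in> T10 M" for c X using T_closed(1)[of "cC c" X 0] that by (simp add: cC_fmul T_Der)
  moreover have "X + Y \<in> T10 M" if "X \<in> T10 M" "Y \<in> T10 M" for X Y using T_closed(1)[OF uC(1), of X Y] that by (simp add: uC_fmul T_Der)
  ultimately show "cv.subspace (T10 M)" by (intro cv.subspaceI) auto
  have "cmul c X \<in> T01 M" if "X \<in> T01 M" for c X using T01_simps(2)[of "cC c" X] that by (simp add: cC_fmul T_Der)
  thus "cv.subspace (T01 M)" by (intro cv.subspaceI) (auto intro: T01_simps)
 qed
 have sub: "cv.subspace (I \<inter> T10 M)" "cv.subspace (I \<inter> T01 M)" by (intro cv.subspace_inter I_subspace T10_sub T01_sub)+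
 obtain F where F: "finite F" "I = cv.span F" using I_frame by blast
 obtain k where k: "\<And>Xs Y. length Xs = k ==> set Xs \<subseteq> I ==> Y \<in> I ==> foldr lie Xs Y = 0" using I_nilpotent by blast
 let ?N = "%Z X. pr10 M (lie Z X)"
 have ID: "Y \<in> Der" if "Y \<in> I" for Y using that I_Der by blast
 have fI: "foldr lie Zs X \<in> I" if "set Zs \<subseteq> I" "X \<in> I" for Zs X using that by (induction Zs) (auto intro: I_lie)
 \<comment> \<open>Projecting after every bracket agrees with projecting once at the end, because
   brackets of (0,1)-fields have no (1,0)-part. So nilpotency of \<open>I\<close> passes to the
   operators \<open>pr10 M (lie Z X)\<close>.\<close>
 have N: "foldr ?N Zs X = pr10 M (foldr lie Zs X)" if "set Zs \<subseteq> I \<inter> T01 M" "X \<in> I \<inter> T10 M" for Zs X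
  using that
 proof (induction Zs)
  case (Cons Z Zs)
  let ?Y = "foldr lie Zs X"
  have Y: "?Y \<in> I" using fI Cons.prems by auto
  have Z: "Z \<in> T01 M" "Z \<in> Der" using Cons.prems T_Der by auto
  note D = ID[OF pr_I(1)[OF Y]] ID[OF pr_I(2)[OF Y]]
  have "lie Z (pr10 M ?Y + pr01 M ?Y) = lie Z (pr10 M ?Y) + lie Z (pr01 M ?Y)" by (rule lie_add_right[OF Z(2) D])
  hence "lie Z ?Y = fmul uC (lie Z (pr10 M ?Y)) + lie Z (pr01 M ?Y)" unfolding pr_sum using Z D by (simp add: uC_fmul Der_lie)
  hence "pr10 M (lie Z ?Y) = fmul uC (pr10 M (lie Z (pr10 M ?Y))) + pr10 M (lie Z (pr01 M ?Y))"
   using Z D by (simp add: pr_lin uC Der_lie)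
  also have "pr10 M (lie Z (pr01 M ?Y)) = 0" by (intro pr_of_T T01_lie Z pr_T ID Y)
  finally have "pr10 M (lie Z ?Y) = pr10 M (lie Z (pr10 M ?Y))"
   using Z D by (simp add: uC_fmul T_Der(1)[OF pr_T(1)] Der_lie)
  thus ?case using Cons by simp
 qed (simp add: pr_of_T)
 obtain xs where xs: "set xs \<subseteq> I \<inter> T10 M" "distinct xs" "cv.independent (set xs)" "cv.span (set xs) = I \<inter> T10 M"
  "\<And>i Z. i < length xs ==> Z \<in> I \<inter> T01 M ==> ?N Z (xs ! i) \<in> cv.span (set (take i xs))"
 proof (rule triangular_basis[OF sub(1) F(1), of "I \<inter> T01 M" ?N k])
  show "I \<inter> T10 M \<subseteq> cv.span F" using F by blast
  show "?N Z X \<in> I \<inter> T10 M" if "Z \<in> I \<inter> T01 M" "X \<in> I \<inter> T10 M" for Z X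
   using that I_lie[of Z X] pr_I(1) pr_T(1) ID by blast
  show "foldr ?N Zs X = 0" if "length Zs = k" "set Zs \<subseteq> I \<inter> T01 M" "X \<in> I \<inter> T10 M" for Zs X
   unfolding N[OF that(2,3)] using k[of Zs X] that pr_of_T(4)[OF T_0(2)] by auto
 qed blast
 \<comment> \<open>For the (0,1)-part a basis is enough: with an empty set of operators the
   triangularity condition is void.\<close>
 obtain zs where zs: "set zs \<subseteq> I \<inter> T01 M" "distinct zs" "cv.independent (set zs)" "cv.span (set zs) = I \<inter> T01 M"
 proof (rule triangular_basis[OF sub(2) F(1), of "{} :: 'm vf set" "%Z X. X" 1])
  show "I \<inter> T01 M \<subseteq> cv.span F" using F by blast
 qed (auto simp: One_nat_def)
 have xI: "set xs \<subseteq> I" and zI: "set zs \<subseteq> I" using xs zs by auto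
 have xD: "xs ! i \<in> I" "xs ! i \<in> T10 M" "xs ! i \<in> Der" if "i < length xs" for i using xs(1) nth_mem[OF that] ID by auto
 have zD: "zs ! i \<in> I" "zs ! i \<in> T01 M" "zs ! i \<in> Der" if "i < length zs" for i using zs(1) nth_mem[OF that] ID by auto
 obtain xf where xf: "\<And>i. i < length xs ==> xf i \<in> vf.Alt 1"
  "\<And>Y. Y \<in> Der ==> pr10 M Y = (\<Sum>i<length xs. fmul (xf i [Y]) (xs ! i))"
  "\<And>Y f i. Y \<in> Der ==> (\<And>i. i < length xs ==> f i \<in> Cinf M) ==> pr10 M Y = (\<Sum>i<length xs. fmul (f i) (xs ! i)) ==> i < length xs ==> xf i [Y] = f i"
  by (rule coord_forms[OF xI xs(2,3) pr_lin(1) pr_of_T(4)[OF T_0(2)]]) (use xs(4) pr_I(1) pr_T(1) ID in blast)+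
 obtain zf where zf: "\<And>i. i < length zs ==> zf i \<in> vf.Alt 1"
  "\<And>Y. Y \<in> Der ==> pr01 M Y = (\<Sum>i<length zs. fmul (zf i [Y]) (zs ! i))"
  "\<And>Y f i. Y \<in> Der ==> (\<And>i. i < length zs ==> f i \<in> Cinf M) ==> pr01 M Y = (\<Sum>i<length zs. fmul (f i) (zs ! i)) ==> i < length zs ==> zf i [Y] = f i"
  by (rule coord_forms[OF zI zs(2,3) pr_lin(2) pr_of_T(3)[OF T_0(1)]]) (use zs(4) pr_I(2) pr_T(2) ID in blast)+
 have one: "(\<Sum>i<length S. fmul (if i = j then uC else 0) (S ! i)) = S ! j" if "j < length S" "S ! j \<in> Der" for S j
 proof -
  have "(\<Sum>i<length S. fmul (if i = j then uC else 0) (S ! i)) = (\<Sum>i<length S. if i = j then S ! j else 0)"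
   by (rule sum.cong) (auto simp: uC_fmul that)
  thus ?thesis using that by simp
 qed
 have "nil_frame M I xs zs xf zf"
 proof (rule nil_frame.intro[OF framed_manifold_axioms], rule nil_frame_axioms.intro)
  show "xf i [Y] \<in> constants M" if "i < length xs" "Y \<in> I" for i Y
  proof -
   have "pr10 M Y \<in> cv.span (set xs)" using xs(4) pr_I(1) pr_T(1) ID that by blast
   then obtain c where "pr10 M Y = (\<Sum>i<length xs. cmul (c i) (xs ! i))" using span_list xs(2) by blast
   hence "xf i [Y] = cC (c i)" using that ID xD by (intro xf(3)) (auto simp: cC_fmul)
   thus ?thesis unfolding K_eq by blast
  qed
  show "zf i [Y] \<in> constants M" if "i < length zs" "Y \<in> I" for i Y
  proof -
   have "pr01 M Y \<in> cv.span (set zs)" using zs(4) pr_I(2) pr_T(2) ID that by blast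
   then obtain c where "pr01 M Y = (\<Sum>i<length zs. cmul (c i) (zs ! i))" using span_list zs(2) by blast
   hence "zf i [Y] = cC (c i)" using that ID zD by (intro zf(3)) (auto simp: cC_fmul)
   thus ?thesis unfolding K_eq by blast
  qed
  show "xf i [xs ! j] = (if i = j then uC else 0)" if "i < length xs" "j < length xs" for i j
   using that xD one[of j xs] by (intro xf(3)) (auto simp: pr_of_T uC)
  show "zf i [zs ! j] = (if i = j then uC else 0)" if "i < length zs" "j < length zs" for i j
   using that zD one[of j zs] by (intro zf(3)) (auto simp: pr_of_T uC)
  show "xf i [Z] = 0" if "i < length xs" "Z \<in> T01 M" for i Z
   using that T_Der pr_of_T by (intro xf(3)[of Z "%_. 0" i]) auto
  show "zf i [X] = 0" if "i < length zs" "X \<in> T10 M" for i X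
   using that T_Der pr_of_T by (intro zf(3)[of X "%_. 0" i]) auto
  show "xf i [lie Z (xs ! j)] = 0" if "i < length xs" "j \<le> i" "Z \<in> I \<inter> T01 M" for i j Z
  proof -
   have j: "j < length xs" using that by simp
   obtain c where c: "pr10 M (lie Z (xs ! j)) = (\<Sum>l<j. cmul (c l) (xs ! l))"
    using span_list[OF xs(5)[OF j \<open>Z \<in> I \<inter> T01 M\<close>] distinct_take[OF xs(2)]] j by (auto simp: min_def)
   also have "\<dots> = (\<Sum>l<length xs. fmul (if l < j then cC (c l) else 0) (xs ! l))"
    using j by (intro sum.mono_neutral_cong_left) (auto simp: cC_fmul xD)
   finally have "xf i [lie Z (xs ! j)] = (if i < j then cC (c i) else 0)"
    using that ID xD j by (intro xf(3)) (auto intro!: Der_lie)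
   thus ?thesis using that by simp
  qed
 qed (use xf zf xs zs in auto)
 thus ?thesis by blast
qed

end

section \<open>Invariant polyvector forms\<close>

lemma (in algebroid) koszul_1: "v \<in> V ==> w \<in> V ==> \<d> 1 \<w> [v, w] = a v (\<w> [w]) - a w (\<w> [v]) - \<w> [br v w]"
 by (simp add: koszul_def One_nat_def nths_Cons)

lemma sum_split_add: "(\<Sum>b<m + n. g b) = (\<Sum>b<m. g b) + (\<Sum>b<n. g (m + b :: nat))"
 by (induction n) (simp_all add: add.assoc)

lemma wedge_cong:
 assumes "\<And>l'. set l' \<subseteq> set l ==> \<w> l' = \<w>' l'" "\<And>l'. set l' \<subseteq> set l ==> \<eta> l' = \<eta>' l'"
 shows "wedge \<w> \<eta> l = wedge \<w>' \<eta>' l"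
 unfolding wedge_def by (intro sum.cong refl arg_cong2[of _ _ _ _ "(*)"] assms set_nths_subset)

context framed_manifold
begin

lemma L_sec_D: "w \<in> L_sec M ==> fst w \<in> T10 M \<and> fst w \<in> Der \<and> snd w \<in> vf.Alt 1 \<and> (\<forall>X\<in>T10 M. snd w [X] = 0)"
 using T_Der by (auto simp: L_sec_def pq_01)

lemma embed_L_apply: "v \<in> Lbar_sec M ==> embed_L M w [v] = snd v [fst w] + snd w [fst v]"
 by (simp add: embed_L_def One_nat_def)

lemma embed_L_Alt: "w \<in> L_sec M ==> embed_L M w \<in> lb.Alt 1"
proof (rule lb.Alt_1I)
 assume w: "w \<in> L_sec M"
 show "embed_L M w [gmul f v + v'] = f * embed_L M w [v] + embed_L M w [v']"
  if "f \<in> Cinf M" "v \<in> Lbar_sec M" "v' \<in> Lbar_sec M" for f v v'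
 proof -
  have "snd w [fmul f (fst v) + fst v'] = f * snd w [fst v] + snd w [fst v']"
   using L_sec_D[OF w] Lbar_D(3) that by (intro vf.Alt_1_lin) auto
  thus ?thesis using that by (simp add: embed_L_apply lb.V_add lb.V_sm) (simp add: gmul_def algebra_simps)
 qed
 show "embed_L M w [v] \<in> Cinf M" if "v \<in> Lbar_sec M" for v
  unfolding embed_L_apply[OF that] using L_sec_D[OF w] Lbar_D(4)[OF that] by (intro alg_plus' vf.Alt_C) auto
qed (auto simp: embed_L_def)

section \<open>Invariant forms and the double of \<open>I\<close>\<close>

abbreviation "V0 \<equiv> (T01 M \<inter> I) \<times> inv_pq_forms M I 1 0"

definition "Inv k = {\<w> \<in> lb.Alt k. \<forall>l. set l \<subseteq> V0 --> \<w> l \<in> constants M}"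

text \<open>This is the Drinfeld double of \<open>I\<close>; \<open>L\<close> and its conjugate are transversal isotropic subalgebras.\<close>
definition "\<DD> = {v. fst v \<in> I \<and> snd v \<in> vf.Alt 1 \<and> (\<forall>Y\<in>I. snd v [Y] \<in> constants M)}"

definition pairing :: "'m gsec => 'm gsec => 'm fn" where "pairing v w = snd v [fst w] + snd w [fst v]"

text \<open>The projection of the double onto its summand \<open>V0\<close>, along the invariant
  sections of \<open>L\<close>.\<close>

definition "PP v = (pr01 M (fst v), form_component M 1 (snd v))"

abbreviation "gb \<equiv> gbracket (Cinf M)"

lemma \<DD>_D: "v \<in> \<DD> ==> fst v \<in> I" "v \<in> \<DD> ==> fst v \<in> Der" "v \<in> \<DD> ==> snd v \<in> vf.Alt 1" "v \<in> \<DD> ==> Y \<in> I ==> snd v [Y] \<in> constants M"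
 using I_Der by (auto simp: \<DD>_def)

lemma I_D: "X \<in> I ==> X \<in> Der" using I_Der by blast

lemma V0_\<DD>: "v \<in> V0 ==> v \<in> \<DD>" and V0_V: "v \<in> V0 ==> v \<in> Lbar_sec M"
proof -
 assume v: "v \<in> V0"
 hence *: "fst v \<in> T01 M" "fst v \<in> I" "snd v \<in> inv_pq_forms M I 1 0" by auto
 hence "snd v \<in> pq_forms M 1 0" "\<And>Y. Y \<in> I ==> snd v [Y] \<in> constants M" by (auto simp: inv_pq_forms_def)
 with * show "v \<in> \<DD>" "v \<in> Lbar_sec M" by (auto simp: \<DD>_def pq_10 intro: LbarI)
qed

lemma inv_pq_10: "\<a> \<in> pq_forms M 1 0 ==> (\<And>Y. Y \<in> I ==> \<a> [Y] \<in> constants M) ==> \<a> \<in> inv_pq_forms M I 1 0"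
proof -
 assume a: "\<a> \<in> pq_forms M 1 0" "\<And>Y. Y \<in> I ==> \<a> [Y] \<in> constants M"
 have "\<a> v \<in> constants M" if "set v \<subseteq> I" for v
 proof (cases "length v = 1")
  case True
  then obtain Y where "v = [Y]" by (auto simp: length_Suc_conv One_nat_def)
  thus ?thesis using a that by simp
 next
  case False
  hence "\<a> v = 0" using a(1) homogD[of 1 \<a>] by (simp add: pq_10)
  thus ?thesis by simp
 qed
 thus ?thesis using a by (simp add: inv_pq_forms_def)
qed

lemma PP_V0: "v \<in> \<DD> ==> PP v \<in> V0"
proof -
 assume v: "v \<in> \<DD>"
 note d = \<DD>_D[OF v]
 have "form_component M 1 (snd v) \<in> pq_forms M 1 0" unfolding pq_10
  using d by (auto simp: form_component_Alt form_component_1 T_Der pr_of_T vf.Alt_1_zero)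
 hence "form_component M 1 (snd v) \<in> inv_pq_forms M I 1 0"
  by (rule inv_pq_10) (simp add: form_component_1 d I_D pr_I)
 thus ?thesis using d by (simp add: PP_def pr_I pr_T)
qed

text \<open>Both summands of the double are isotropic, so only the mixed terms of the pairing
  survive.\<close>

lemma pairing_split: "v \<in> \<DD> ==> w \<in> \<DD> ==> pairing v w = pairing v (PP w) + pairing w (PP v)"
proof -
 assume v: "v \<in> \<DD>" and w: "w \<in> \<DD>"
 have s: "\<a> [Y] = \<a> [pr10 M Y] + \<a> [pr01 M Y]" if "\<a> \<in> vf.Alt 1" "Y \<in> Der" for \<a> Y
  using vf.Alt_1_add[OF that(1) T_Der(1)[OF pr_T(1)[OF that(2)]] T_Der(2)[OF pr_T(2)[OF that(2)]]] by (simp add: pr_sum)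
 show ?thesis unfolding pairing_def PP_def fst_conv snd_conv
  using s[of "snd v" "fst w"] s[of "snd w" "fst v"] v w by (simp add: form_component_1 \<DD>_D)
qed

text \<open>On the double the derivatives in \<open>ext_d\<close> fall on constants and drop out.
  What remains is the bracket of the semidirect product of \<open>I\<close> with its dual.\<close>

lemma gb_snd: "v \<in> \<DD> ==> w \<in> \<DD> ==> Y \<in> I ==> snd (gb v w) [Y] = snd v [lie (fst w) Y] - snd w [lie (fst v) Y]"
 unfolding gbracket_def ext_d_eq contract_ip snd_conv form_app ip_apply
 by (simp add: vf.koszul_1 \<DD>_D I_D Der_K)

lemma gb_fst: "fst (gb v w) = lie (fst v) (fst w)"
 by (simp add: gbracket_def)

lemma gb_\<DD>: "v \<in> \<DD> ==> w \<in> \<DD> ==> gb v w \<in> \<DD>"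
proof -
 assume v: "v \<in> \<DD>" and w: "w \<in> \<DD>"
 have "ip X (vf.\<d> 1 \<a>) \<in> vf.Alt 1" if "\<a> \<in> vf.Alt 1" for X \<a>
  using vf.Alt_ip[OF vf.\<d>_Alt[OF that], of X] by (simp add: One_nat_def)
 hence "snd (gb v w) \<in> vf.Alt 1" unfolding gbracket_def ext_d_eq contract_ip snd_conv
  using v w by (intro vf.Alt_diff) (auto dest: \<DD>_D)
 thus ?thesis using v w gb_snd[OF v w] by (auto simp: \<DD>_def gb_fst I_lie K_diff)
qed

lemma gb_skew: "gb v w = - gb w v"
 by (simp add: gbracket_def lie_skew[of "fst v"])

lemma pairing_neg: "v \<in> \<DD> ==> w \<in> \<DD> ==> pairing (- v) w = - pairing v w"
 by (simp add: pairing_def vf.Alt_1_neg \<DD>_D)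

lemma pairing_commute: "pairing v w = pairing w v"
 by (simp add: pairing_def add.commute)

lemma pairing_gb_skew: "v \<in> \<DD> ==> w \<in> \<DD> ==> y \<in> \<DD> ==> pairing (gb v w) y = - pairing (gb w v) y"
 using gb_skew[of v w] pairing_neg[OF gb_\<DD>, of w v y] by simp

lemma pairing_inv: "v \<in> \<DD> ==> w \<in> \<DD> ==> y \<in> \<DD> ==> pairing (gb v w) y = - pairing w (gb v y)"
proof -
 assume vwy: "v \<in> \<DD>" "w \<in> \<DD>" "y \<in> \<DD>"
 have "snd v [lie (fst y) (fst w)] = - snd v [lie (fst w) (fst y)]"
  using vf.Alt_1_neg[OF \<DD>_D(3)[OF vwy(1)] Der_lie[OF \<DD>_D(2)[OF vwy(2)] \<DD>_D(2)[OF vwy(3)]]] lie_skew[of "fst y"] by simp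
 thus ?thesis using vwy by (simp add: pairing_def gb_snd gb_fst \<DD>_D)
qed

lemma pairing_jacobi:
 assumes v: "v \<in> \<DD>" and w: "w \<in> \<DD>" and x: "x \<in> \<DD>" and y: "y \<in> \<DD>"
 shows "pairing y (gb v (gb w x)) = pairing y (gb (gb v w) x) + pairing y (gb w (gb v x))"
proof -
 note D = \<DD>_D[OF v] \<DD>_D[OF w] \<DD>_D[OF x] \<DD>_D[OF y]
 have j: "\<a> [lie X (lie Y Z)] = \<a> [lie (lie X Y) Z] + \<a> [lie Y (lie X Z)]"
  if "\<a> \<in> vf.Alt 1" "X \<in> Der" "Y \<in> Der" "Z \<in> Der" for \<a> X Y Z
  unfolding lie_jacobi[OF that(2-)] by (rule vf.Alt_1_add) (use that in auto)
 have "snd y [lie (fst v) (lie (fst w) (fst x))] = snd y [lie (lie (fst v) (fst w)) (fst x)] + snd y [lie (fst w) (lie (fst v) (fst x))]"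
  "snd x [lie (fst v) (lie (fst w) (fst y))] = snd x [lie (lie (fst v) (fst w)) (fst y)] + snd x [lie (fst w) (lie (fst v) (fst y))]"
  "snd w [lie (fst v) (lie (fst x) (fst y))] = snd w [lie (lie (fst v) (fst x)) (fst y)] + snd w [lie (fst x) (lie (fst v) (fst y))]"
  "snd v [lie (fst w) (lie (fst x) (fst y))] = snd v [lie (lie (fst w) (fst x)) (fst y)] + snd v [lie (fst x) (lie (fst w) (fst y))]"
  by (rule j; simp add: D)+
 thus ?thesis using v w x y by (simp add: pairing_def gb_snd gb_fst gb_\<DD> \<DD>_D I_lie)
qed

text \<open>The cocycle condition of a Lie bialgebra, in the form in which \<open>compat_ee\<close>
  uses it. Invariance of the pairing turns each term with \<open>PP\<close> into a pairing of
  \<open>PP\<close> of one bracket with another bracket, the Jacobi identity does the same for the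
  first term, and isotropy makes everything cancel.\<close>

lemma double_compat:
 assumes X: "X \<in> \<DD>" and w: "w \<in> \<DD>" and v: "v \<in> \<DD>" and v': "v' \<in> \<DD>"
 shows "- pairing (gb X w) (gb v v') - (pairing w (gb (PP (gb X v)) v') + pairing w (gb v (PP (gb X v'))))
  + (pairing X (gb (PP (gb w v)) v') + pairing X (gb v (PP (gb w v')))) = 0"
proof -
 have P: "PP (gb a b) \<in> \<DD>" if "a \<in> \<DD>" "b \<in> \<DD>" for a b by (rule V0_\<DD>[OF PP_V0[OF gb_\<DD>[OF that]]])
 have m: "pairing a (gb b c) = - pairing (gb a c) b" if "a \<in> \<DD>" "b \<in> \<DD>" "c \<in> \<DD>" for a b c
 proof -
  have "pairing a (gb b c) = - pairing (gb b a) c" using pairing_inv[OF that(2,1,3)] by simp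
  also have "\<dots> = pairing (gb a b) c" using pairing_gb_skew[OF that(2,1,3)] by simp
  also have "\<dots> = - pairing (gb a c) b" using pairing_inv[OF that] pairing_commute[of b] by simp
  finally show ?thesis .
 qed
 have m': "pairing a (gb b c) = pairing (gb a b) c" if "a \<in> \<DD>" "b \<in> \<DD>" "c \<in> \<DD>" for a b c
  using m[OF that] pairing_inv[OF that(1,3,2)] pairing_commute[of c] by simp
 note s = pairing_split[OF gb_\<DD> gb_\<DD>]
 have j: "pairing (gb X w) (gb v v') = - (pairing w (gb (gb X v) v') + pairing w (gb v (gb X v')))"
  unfolding pairing_inv[OF X w gb_\<DD>[OF v v']] pairing_jacobi[OF X v v' w] ..
 show ?thesis
  unfolding j m[OF w P[OF X v] v'] m'[OF w v P[OF X v']] m[OF X P[OF w v] v'] m'[OF X v P[OF w v']]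
   m[OF w gb_\<DD>[OF X v] v'] m'[OF w v gb_\<DD>[OF X v']]
  unfolding s[OF w v' X v] s[OF w v X v'] by simp
qed

lemma V0_gb: "v \<in> V0 ==> w \<in> V0 ==> gb v w \<in> V0"
proof -
 assume v: "v \<in> V0" and w: "w \<in> V0"
 have g: "gb v w \<in> \<DD>" by (intro gb_\<DD> V0_\<DD> v w)
 have "gb v w \<in> Lbar_sec M" by (intro lb.br_V V0_V v w)
 hence "snd (gb v w) \<in> inv_pq_forms M I 1 0" by (intro inv_pq_10 Lbar_D \<DD>_D(4)[OF g])
 thus ?thesis using Lbar_D(1)[OF \<open>gb v w \<in> Lbar_sec M\<close>] \<DD>_D(1)[OF g] by (cases "gb v w") auto
qed

lemma Inv_Alt: "\<w> \<in> Inv k ==> \<w> \<in> lb.Alt k" and Inv_K: "\<w> \<in> Inv k ==> set l \<subseteq> V0 ==> \<w> l \<in> constants M"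
 by (auto simp: Inv_def)

text \<open>In Koszul's formula the derivative terms act on constants, and the bracket terms stay
  among invariant arguments by \<open>V0_gb\<close>.\<close>

lemma Inv_\<d>: "\<w> \<in> Inv k ==> lb.\<d> k \<w> \<in> Inv (Suc k)"
proof -
 assume w: "\<w> \<in> Inv k"
 have "lb.\<d> k \<w> l \<in> constants M" if l: "set l \<subseteq> V0" for l
 proof (cases "length l = Suc k")
  case True
  have "fst (l ! i) (\<w> (nths l (- {i}))) = 0" if "i \<le> k" for i
  proof (rule Der_K[where X = "fst (l ! i)"])
   have "l ! i \<in> V0" using l True that nth_mem[of i l] by auto
   thus "fst (l ! i) \<in> Der" using T_Der by auto
   show "\<w> (nths l (- {i})) \<in> constants M" by (rule Inv_K[OF w subset_trans[OF set_nths_subset l]])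
  qed
  moreover have "\<w> (gb (l ! i) (l ! j) # nths l (- {i, j})) \<in> constants M" if "j \<le> k" "i < j" for i j
  proof (rule Inv_K[OF w])
   have "l ! i \<in> V0" "l ! j \<in> V0" using l True that nth_mem[of i l] nth_mem[of j l] by auto
   hence "gb (l ! i) (l ! j) \<in> V0" by (rule V0_gb)
   thus "set (gb (l ! i) (l ! j) # nths l (- {i, j})) \<subseteq> V0" using set_nths_subset[of l "- {i, j}"] l by auto
  qed
  ultimately show ?thesis unfolding koszul_def
   by (auto intro!: K_add K_sum K_sgn)
 qed (simp add: koszul_def)
 thus ?thesis using lb.\<d>_Alt[OF Inv_Alt[OF w]] by (simp add: Inv_def)
qed

lemma Inv_add: "\<w> \<in> Inv k ==> \<eta> \<in> Inv k ==> \<w> + \<eta> \<in> Inv k"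
 and Inv_diff: "\<w> \<in> Inv k ==> \<eta> \<in> Inv k ==> \<w> - \<eta> \<in> Inv k"
 and Inv_0 [simp]: "0 \<in> Inv k"
 by (auto simp: Inv_def K_add K_diff intro: lb.Alt_add lb.Alt_diff)

lemma Inv_cmul: "\<w> \<in> Inv k ==> cmul c \<w> \<in> Inv k"
proof -
 assume w: "\<w> \<in> Inv k"
 have "fmul (cC c) \<w> = cmul c \<w>" unfolding cC_def by (rule lb.fmul_const[OF Inv_Alt[OF w]])
 hence "cmul c \<w> l = cC c * \<w> l" for l by (simp flip: \<open>fmul (cC c) \<w> = cmul c \<w>\<close>)
 moreover have "cC c \<in> constants M" unfolding K_eq by blast
 ultimately show ?thesis using w by (auto simp: Inv_def intro: K_mult lb.Alt_cmul)
qed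

lemma Inv_sum: "(\<And>i. i \<in> F ==> \<w> i \<in> Inv k) ==> sum \<w> F \<in> Inv k"
 by (rule sum_closed[OF Inv_0 Inv_add])

lemma Inv_wedge: "\<w> \<in> Inv k ==> \<eta> \<in> Inv m ==> wedge \<w> \<eta> \<in> Inv (k + m)"
proof -
 assume w: "\<w> \<in> Inv k" and e: "\<eta> \<in> Inv m"
 have "wedge \<w> \<eta> l \<in> constants M" if l: "set l \<subseteq> V0" for l
  unfolding wedge_def mult.assoc
  by (intro K_sum K_sgn K_mult Inv_K[OF w] Inv_K[OF e]) (use set_nths_subset[of l] l in blast)+
 thus ?thesis using lb.Alt_wedge[OF Inv_Alt[OF w] Inv_Alt[OF e]] by (simp add: Inv_def)
qed

text \<open>Here the bigrading is dissolved: from now on the total complex is the algebra of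
  alternating forms on \<open>Lbar_sec M\<close>, and \<open>total_inv\<close> does the same for the
  invariant part.\<close>

lemma total_polyvec: "total (polyvec_forms M) k = lb.Alt k"
proof
 show "total (polyvec_forms M) k \<subseteq> lb.Alt k"
  by (auto simp: total_def polyvec_forms_def L_alt_Alt intro!: lb.Alt_sum)
 show "lb.Alt k \<subseteq> total (polyvec_forms M) k"
 proof
  fix \<w> assume w: "\<w> \<in> lb.Alt k"
  have "\<forall>p\<le>k. lbs.cpt p \<w> \<in> polyvec_forms M p (k - p)"
   using w by (auto simp: polyvec_forms_def L_alt_Alt lbs.comp_Alt lbs.comp_idem)
  thus "\<w> \<in> total (polyvec_forms M) k" unfolding total_def
   using lbs.comp_sum[OF w] by (intro CollectI exI[of _ "%p. lbs.cpt p \<w>"]) simp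
 qed
qed

lemma total_inv: "total (inv_polyvec_forms M I) k = Inv k"
proof
 have "inv_polyvec_forms M I p q \<subseteq> Inv (p + q)" for p q :: nat
  by (auto simp: inv_polyvec_forms_def polyvec_forms_def L_alt_Alt Inv_def)
 have "\<w> \<in> Inv k" if "\<w> \<in> inv_polyvec_forms M I p (k - p)" "p \<le> k" for \<w> p
  using subsetD[OF \<open>\<And>p q. inv_polyvec_forms M I p q \<subseteq> Inv (p + q)\<close> that(1)] that(2) by simp
 thus "total (inv_polyvec_forms M I) k \<subseteq> Inv k" by (auto simp: total_def intro!: Inv_sum)
 show "Inv k \<subseteq> total (inv_polyvec_forms M I) k"
 proof
  fix \<w> assume w: "\<w> \<in> Inv k"
  note wA = Inv_Alt[OF w]
  have 0: "0 \<in> inv_pq_forms M I 1 0" "0 \<in> I" by (auto intro!: inv_pq_10 pq_10_module cv.subspace_0[OF I_subspace])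
  have "lbs.cpt p \<w> l \<in> constants M" if l: "set l \<subseteq> V0" for p l
  proof (cases "set l \<subseteq> Lbar_sec M")
   case True
   have "\<w> (map (%i. if i \<in> S then (%(Z, \<a>). (0, \<a>)) (l ! i) else (%(Z, \<a>). (Z, 0)) (l ! i)) [0..<length l]) \<in> constants M" for S
   proof (rule Inv_K[OF w], rule subsetI)
    fix v assume "v \<in> set (map (%i. if i \<in> S then (%(Z, \<a>). (0, \<a>)) (l ! i) else (%(Z, \<a>). (Z, 0)) (l ! i)) [0..<length l])"
    then obtain i where i: "i < length l" "v = (if i \<in> S then (%(Z, \<a>). (0, \<a>)) (l ! i) else (%(Z, \<a>). (Z, 0)) (l ! i))" by auto
    hence "l ! i \<in> V0" using l nth_mem by blast
    thus "v \<in> V0" using i(2) 0 by (auto split: prod.splits)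
   qed
   thus ?thesis unfolding component_def if_P[OF True] by (rule K_sum)
  qed (simp add: component_def)
  hence "\<forall>p\<le>k. lbs.cpt p \<w> \<in> inv_polyvec_forms M I p (k - p)"
   using wA by (auto simp: inv_polyvec_forms_def polyvec_forms_def L_alt_Alt lbs.comp_Alt lbs.comp_idem)
  thus "\<w> \<in> total (inv_polyvec_forms M I) k" unfolding total_def
   using lbs.comp_sum[OF wA] by (intro CollectI exI[of _ "%p. lbs.cpt p \<w>"]) simp
 qed
qed

end

section \<open>Dual frames of \<open>L\<close> and of its conjugate\<close>

context nil_frame
begin

abbreviation "n1 \<equiv> length xs"
abbreviation "n2 \<equiv> length zs"

text \<open>\<open>uu\<close> frames \<open>L\<close> and \<open>\<e>\<close> below is the dual
  frame of the conjugate. Indices below \<open>n1\<close> stand for (1,0)-vectors in the first and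
  for (1,0)-forms in the second, the others for (0,1)-forms and (0,1)-vectors.\<close>

definition "uu b = (if b < n1 then (xs ! b, 0) else (0, zf (b - n1)))"
definition "\<e> b = (if b < n1 then (0, xf b) else (zs ! (b - n1), 0))"
definition "ee b = embed_L M (uu b)"

lemma xs_D: "i < n1 ==> xs ! i \<in> I" "i < n1 ==> xs ! i \<in> T10 M" "i < n1 ==> xs ! i \<in> Der"
 using subsetD[OF xs nth_mem, of i] I_D[of "xs ! i"] by blast+

lemma zs_D: "i < n2 ==> zs ! i \<in> I" "i < n2 ==> zs ! i \<in> T01 M" "i < n2 ==> zs ! i \<in> Der"
 using subsetD[OF zs nth_mem, of i] I_D[of "zs ! i"] by blast+

lemma xf_pq: "i < n1 ==> xf i \<in> pq_forms M 1 0" using xf_Alt xf_01 by (simp add: pq_10)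
lemma zf_pq: "i < n2 ==> zf i \<in> pq_forms M 0 1" using zf_Alt zf_10 by (simp add: pq_01)

lemma zero_pq_01: "0 \<in> pq_forms M 0 1" by (simp add: pq_01)

lemma I_0: "0 \<in> I" by (rule cv.subspace_0[OF I_subspace])

lemma uu_L: "b < n1 + n2 ==> uu b \<in> L_sec M"
 by (auto simp: uu_def L_sec_def xs_D zf_pq zero_pq_01)

lemma \<e>_V0: "b < n1 + n2 ==> \<e> b \<in> V0"
 by (auto simp: \<e>_def zs_D xf_I I_0 intro!: inv_pq_10 xf_pq pq_10_module)

lemma uu_\<DD>: "b < n1 + n2 ==> uu b \<in> \<DD>"
 by (auto simp: uu_def \<DD>_def xs_D I_0 zf_Alt zf_I)

lemma ee_apply: "v \<in> Lbar_sec M ==> b < n1 + n2 ==> ee b [v] = (if b < n1 then snd v [xs ! b] else zf (b - n1) [fst v])"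
 by (simp add: ee_def embed_L_apply uu_def vf.Alt_1_zero Lbar_D)

lemma frame_Lbar: "frame_module (Cinf M) gmul (Lbar_sec M) uC (n1 + n2) ee \<e>"
proof unfold_locales
 show "ee b \<in> lb.Alt 1" if "b < n1 + n2" for b unfolding ee_def by (rule embed_L_Alt[OF uu_L[OF that]])
 show "\<e> b \<in> Lbar_sec M" if "b < n1 + n2" for b by (rule V0_V[OF \<e>_V0[OF that]])
 fix v assume v: "v \<in> Lbar_sec M"
 have "(\<Sum>i<n1. fmul (snd v [xs ! i]) (xf i)) = snd v"
 proof (rule vf.Alt_1_eqI)
  show "(\<Sum>i<n1. fmul (snd v [xs ! i]) (xf i)) \<in> vf.Alt 1"
   by (intro vf.Alt_sum vf.Alt_fmul xf_Alt vf.Alt_C[OF Lbar_D(4)[OF v]]) simp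
  show "snd v \<in> vf.Alt 1" by (rule Lbar_D(4)[OF v])
  fix Y assume Y: "Y \<in> Der"
  have "snd v [pr10 M Y] = (\<Sum>i<n1. snd v [fmul (xf i [Y]) (xs ! i)])" unfolding pr10_eq[OF Y]
   by (rule vf.Alt_1_sum[OF Lbar_D(4)[OF v]]) (auto intro!: vf.Alt_C xf_Alt xs_D)
  also have "\<dots> = (\<Sum>i<n1. xf i [Y] * snd v [xs ! i])"
   by (rule sum.cong[OF refl], rule vf.Alt_1_sm[OF Lbar_D(4)[OF v]]) (auto intro!: vf.Alt_C xf_Alt xs_D)
  finally have "snd v [pr10 M Y] = (\<Sum>i<n1. xf i [Y] * snd v [xs ! i])" .
  moreover have "snd v [pr01 M Y] = 0" using Lbar_D(2)[OF v] pr_T(2)[OF Y] by (simp add: pq_10)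
  moreover have "snd v [Y] = snd v [pr10 M Y] + snd v [pr01 M Y]"
   using vf.Alt_1_add[OF Lbar_D(4)[OF v] T_Der(1)[OF pr_T(1)[OF Y]] T_Der(2)[OF pr_T(2)[OF Y]]] by (simp add: pr_sum)
  ultimately show "(\<Sum>i<n1. fmul (snd v [xs ! i]) (xf i)) [Y] = snd v [Y]"
   by (simp add: sum_fun_apply mult.commute)
 qed
 moreover have "(\<Sum>i<n2. fmul (zf i [fst v]) (zs ! i)) = fst v"
  using pr01_eq[OF Lbar_D(3)[OF v]] pr_of_T(2)[OF Lbar_D(1)[OF v]] by simp
 ultimately show "(\<Sum>b<n1 + n2. gmul (ee b [v]) (\<e> b)) = v"
  unfolding sum_split_add by (intro prod_eqI) (simp_all add: fst_sum snd_sum gmul_def \<e>_def ee_apply[OF v])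
qed

sublocale fr: frame_module "Cinf M" gmul "Lbar_sec M" uC "n1 + n2" ee \<e> by (rule frame_Lbar)

abbreviation "Fr \<equiv> \<e> ` {..<n1 + n2}"

lemma Fr_V0: "Fr \<subseteq> V0" using \<e>_V0 by blast

lemma ee_K: "v \<in> V0 ==> b < n1 + n2 ==> ee b [v] \<in> constants M"
 using ee_apply[OF V0_V, of v b] V0_\<DD>[of v] by (auto simp: \<DD>_D xs_D zf_I)

lemma InvI: "\<w> \<in> lb.Alt k ==> (\<And>l. set l \<subseteq> Fr ==> \<w> l \<in> constants M) ==> \<w> \<in> Inv k"
proof -
 assume w: "\<w> \<in> lb.Alt k" "\<And>l. set l \<subseteq> Fr ==> \<w> l \<in> constants M"
 have "\<w> l \<in> constants M" if "set l \<subseteq> V0" for l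
  by (rule fr.frame_values[OF _ _ _ _ w that]) (use V0_V ee_K in \<open>auto intro: K_add K_mult\<close>)
 thus ?thesis using w by (simp add: Inv_def)
qed

lemma ee_Inv: "b < n1 + n2 ==> ee b \<in> Inv 1"
proof (rule InvI[OF fr.e_Alt])
 fix l assume b: "b < n1 + n2" and l: "set l \<subseteq> Fr"
 show "ee b l \<in> constants M"
 proof (cases "length l = 1")
  case True
  then obtain v where "l = [v]" by (auto simp: length_Suc_conv One_nat_def)
  thus ?thesis using ee_K[of v b] l Fr_V0 b by auto
 qed (use homogD[OF lb.Alt_homog[OF fr.e_Alt[OF b]], of l] in simp)
qed

lemma one_form_expand: "\<w> \<in> lb.Alt 1 ==> (\<Sum>b<n1 + n2. fmul (\<w> [\<e> b]) (ee b)) = \<w>"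
proof (rule lb.Alt_1_eqI)
 assume w: "\<w> \<in> lb.Alt 1"
 show "(\<Sum>b<n1 + n2. fmul (\<w> [\<e> b]) (ee b)) \<in> lb.Alt 1" "\<w> \<in> lb.Alt 1"
  by (intro lb.Alt_sum lb.Alt_fmul fr.e_Alt lb.Alt_C[OF w] w; simp)+
 show "(\<Sum>b<n1 + n2. fmul (\<w> [\<e> b]) (ee b)) [v] = \<w> [v]" if "v \<in> Lbar_sec M" for v
  using fun_cong[OF fr.ip_expand[OF w that], of "[]"] by (simp add: ip_apply sum_fun_apply mult.commute)
qed

end

section \<open>The Schouten bracket with a Poisson bivector field\<close>

lemma (in algebroid) koszul_0: "v \<in> V ==> \<d> 0 \<w> [v] = a v (\<w> [])"
 by (simp add: koszul_def nths_Cons)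

lemma embed_fn_fn0: "embed_fn f = fn0 f"
 by (simp add: embed_fn_def fn0_def)

locale poisson = nil_frame M I xs zs xf zf for M :: "('m, 'z) complex_manifold_scheme" and I xs zs xf zf +
 fixes br :: "'m polyform => 'm polyform => 'm polyform" and \<mu> :: "'m polyform"
 assumes sb: "schouten_bracket M br" and \<mu>_inv: "\<mu> \<in> inv_polyvec_forms M I 2 0" and hp: "holomorphic_poisson M br \<mu>"
begin

abbreviation "Alt \<equiv> lb.Alt"
abbreviation "\<d> \<equiv> lb.\<d>"
abbreviation "sg k \<equiv> (- 1 :: complex) ^ k"

lemmas sb_Alt = sb[unfolded schouten_bracket_def L_alt_Alt]

lemma br_Alt: "a \<in> Alt k ==> b \<in> Alt l ==> br a b \<in> Alt (k + l - 1)"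
 by (rule sb_Alt[THEN conjunct1, rule_format])

lemma br_00: "a \<in> Alt 0 ==> b \<in> Alt 0 ==> br a b = 0"
 by (rule sb_Alt[THEN conjunct2, THEN conjunct1, rule_format])

lemma br_lin: "a \<in> Alt k ==> b \<in> Alt l ==> b' \<in> Alt l ==> br a (cmul c b + b') = cmul c (br a b) + br a b'"
 by (rule sb_Alt[THEN conjunct2, THEN conjunct2, THEN conjunct1, rule_format])

lemma br_skew: "a \<in> Alt k ==> b \<in> Alt l ==> br a b = cmul (- sg ((k + 1) * (l + 1))) (br b a)"
 by (rule sb_Alt[THEN conjunct2, THEN conjunct2, THEN conjunct2, THEN conjunct1, rule_format])

lemma br_wedge: "a \<in> Alt k ==> b \<in> Alt l ==> c \<in> Alt m ==>
  br a (wedge b c) = wedge (br a b) c + cmul (sg ((k + 1) * l)) (wedge b (br a c))"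
 and br_jacobi: "a \<in> Alt k ==> b \<in> Alt l ==> c \<in> Alt m ==>
  br a (br b c) = br (br a b) c + cmul (sg ((k + 1) * (l + 1))) (br b (br a c))"
 using sb_Alt[THEN conjunct2, THEN conjunct2, THEN conjunct2, THEN conjunct2, THEN conjunct1, rule_format, of a k b l c m]
 by simp_all

lemma br_ee: "c < n1 + n2 ==> d < n1 + n2 ==> br (ee c) (ee d) = embed_L M (gb (uu c) (uu d))"
 unfolding ee_def
 by (rule sb_Alt[THEN conjunct2, THEN conjunct2, THEN conjunct2, THEN conjunct2, THEN conjunct2, THEN conjunct1, rule_format])
  (rule uu_L; assumption)+

lemma br_ee_fn: "c < n1 + n2 ==> f \<in> Cinf M ==> br (ee c) (fn0 f) = fn0 (fst (uu c) f)"
 unfolding ee_def embed_fn_fn0[symmetric]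
 by (rule sb_Alt[THEN conjunct2, THEN conjunct2, THEN conjunct2, THEN conjunct2, THEN conjunct2, THEN conjunct2, rule_format])
  (rule uu_L; assumption)+

lemma br_zero: "a \<in> Alt k ==> br a 0 = 0"
 using br_lin[of a k 0 0 0 1] by simp

lemma br_add: "a \<in> Alt k ==> b \<in> Alt l ==> b' \<in> Alt l ==> br a (b + b') = br a b + br a b'"
 using br_lin[of a k b l b' 1] by simp

lemma br_diff: "a \<in> Alt k ==> b \<in> Alt l ==> b' \<in> Alt l ==> br a (b - b') = br a b - br a b'"
 using br_lin[of a k b' l b "- 1"] by (simp add: add.commute)

lemma br_lin_left: "a \<in> Alt k ==> a' \<in> Alt k ==> x \<in> Alt l ==> br (cmul c a + a') x = cmul c (br a x) + br a' x"
proof -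
 assume *: "a \<in> Alt k" "a' \<in> Alt k" "x \<in> Alt l"
 have "cmul c a + a' \<in> Alt k" by (intro lb.Alt_add lb.Alt_cmul *)
 from br_skew[OF this *(3)] show ?thesis
  unfolding br_lin[OF *(3,1,2)] br_skew[OF *(1,3)] br_skew[OF *(2,3)]
  by (simp add: cv.scale_right_distrib mult.commute)
qed

lemma br_zero_left: "x \<in> Alt l ==> br 0 x = 0"
 using br_lin_left[of 0 0 0 x l 1] by simp

lemma br_sum_left:
 assumes a: "\<And>i. i \<in> F ==> a i \<in> Alt k" and x: "x \<in> Alt l"
 shows "br (\<Sum>i\<in>F. cmul (c i) (a i)) x = (\<Sum>i\<in>F. cmul (c i) (br (a i) x))"
proof -
 have add: "br (b + b') x = br b x + br b' x" if "b \<in> Alt k" "b' \<in> Alt k" for b b' using br_lin_left[OF that x, of 1] by simp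
 have "br (\<Sum>i\<in>F. cmul (c i) (a i)) x = (\<Sum>i\<in>F. br (cmul (c i) (a i)) x)"
  by (rule sum_additive[where h = "%a. br a x" and S = "Alt k", OF br_zero_left[OF x] add lb.Alt_zero lb.Alt_add]) (assumption | rule lb.Alt_cmul[OF a])+
 also have "\<dots> = (\<Sum>i\<in>F. cmul (c i) (br (a i) x))"
  using br_lin_left[OF a lb.Alt_zero x] br_zero_left[OF x] by (intro sum.cong) simp_all
 finally show ?thesis .
qed

lemma br_1: "p \<in> Alt 1 ==> x \<in> Alt l ==> br x p = - br p x"
 using br_skew[of x l p 1] by (simp add: cmul_def fun_Compl_def)

lemma br_1_Alt: "p \<in> Alt 1 ==> x \<in> Alt l ==> br p x \<in> Alt l"
 using br_Alt[of p 1 x l] by simp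

lemma br_1_wedge: "p \<in> Alt 1 ==> b \<in> Alt l ==> c \<in> Alt m ==> br p (wedge b c) = wedge (br p b) c + wedge b (br p c)"
 using br_wedge[of p 1 b l c m] by (simp add: power_mult)

lemma wedge_comm: "a \<in> Alt k ==> b \<in> Alt l ==> wedge a b = cmul (sg (k * l)) (wedge b a)"
 by (intro ext, subst wedge_commute[of k a l b]) (simp_all add: cmul_def fun_app sgn_fn_apply)

lemma cmul_neg1: "cmul (- 1) \<w> = - \<w>"
 by (simp add: cmul_def fun_Compl_def)

text \<open>The Leibniz rule in the left argument, carried over by \<open>br_skew\<close>; the
  degree of \<open>x\<close> enters only through its parity, and its signs cancel.\<close>

lemma br_wedge_11:
 assumes "p \<in> Alt 1" "q \<in> Alt 1" "x \<in> Alt l"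
 shows "br (wedge p q) x = wedge p (br q x) - wedge q (br p x)"
proof -
 have pq: "wedge p q \<in> Alt 2" using lb.Alt_wedge[OF assms(1,2)] by simp
 have "sg ((2 + 1) * (l + 1)) = - sg l" by (simp add: power_add power_mult)
 moreover have "sg l = 1 \<or> sg l = - 1" by (cases "even l") simp_all
 ultimately have s: "sg ((2 + 1) * (l + 1)) = - sg l" "sg ((l + 1) * 1) = - sg l" "sg (l * 1) = sg l" "sg l = 1 \<or> sg l = - 1"
  by (simp_all add: power_add)
 have w: "wedge (br p x) q = cmul (sg l) (wedge q (br p x))"
  using wedge_comm[OF br_1_Alt[OF assms(1,3)] assms(2)] unfolding s(3) .
 show ?thesis
  unfolding br_skew[OF pq assms(3)] br_wedge[OF assms(3,1,2)] br_1[OF assms(1,3)] br_1[OF assms(2,3)] s(1,2) wedge_lin w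
  using s(4) by (elim disjE) (simp_all add: cmul_neg1)
qed

lemma br_wedge_21:
 assumes "p \<in> Alt 2" "q \<in> Alt 1" "x \<in> Alt l"
 shows "br (wedge p q) x = wedge q (br p x) + wedge p (br q x)"
proof -
 have pq: "wedge p q \<in> Alt 3" using lb.Alt_wedge[OF assms(1,2)] by simp
 have b: "br p x \<in> Alt (Suc l)" using br_Alt[OF assms(1,3)] by simp
 show ?thesis
  unfolding br_skew[OF pq assms(3)] br_wedge[OF assms(3,1,2)] br_skew[OF assms(3,1)] br_1[OF assms(2,3)]
  using wedge_comm[OF b assms(2)]
  by (cases "even l") (simp_all add: minus_one_power_iff cmul_neg1)
qed

section \<open>Brackets with frame elements as Lie derivatives\<close>

lemma uu_Der: "c < n1 + n2 ==> fst (uu c) \<in> Der" using \<DD>_D(2)[OF uu_\<DD>] .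

text \<open>The coadjoint action of the frame element \<open>uu c\<close> of \<open>L\<close> on
  \<open>V0\<close>, realised inside the double.\<close>

abbreviation "\<t> c v \<equiv> PP (gb (uu c) v)"

lemma \<t>_V0: "c < n1 + n2 ==> v \<in> V0 ==> \<t> c v \<in> V0"
 by (rule PP_V0[OF gb_\<DD>[OF uu_\<DD> V0_\<DD>]])

lemma embed_pairing: "v \<in> V0 ==> embed_L M w [v] = pairing w v"
 by (simp add: embed_L_apply V0_V pairing_def add.commute)

lemma ee_pairing: "v \<in> V0 ==> ee c [v] = pairing (uu c) v"
 by (simp add: ee_def embed_pairing)

lemma pairing_K: "v \<in> \<DD> ==> w \<in> \<DD> ==> pairing v w \<in> constants M"
 unfolding pairing_def by (intro K_add \<DD>_D)

lemma pairing_uu_PP: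
 assumes "c < n1 + n2" "v \<in> \<DD>"
 shows "pairing (uu c) (PP v) = pairing (uu c) v"
proof -
 note D = uu_\<DD>[OF assms(1)]
 have L: "fst (uu c) \<in> T10 M" "snd (uu c) \<in> vf.Alt 1" "\<And>X. X \<in> T10 M ==> snd (uu c) [X] = 0"
  using L_sec_D[OF uu_L[OF assms(1)]] by auto
 have "pairing v (PP (uu c)) = form_component M 1 (snd (uu c)) [fst v] + snd v [pr01 M (fst (uu c))]"
  by (simp add: pairing_def PP_def add.commute)
 also have "\<dots> = 0" using L assms(2)
  by (simp add: form_component_1 \<DD>_D pr_of_T pr_T vf.Alt_1_zero)
 finally show ?thesis using pairing_split[OF D assms(2)] by simp
qed

text \<open>Both sides are derivations of the wedge product. They agree on functions by the axioms
  and on frame 1-forms by invariance of the pairing. The identity is confined to lists from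
  \<open>Fr\<close>, where pairings are constant and \<open>gb\<close> behaves like the bracket of a
  Lie algebra.\<close>

lemma br_LD:
 assumes c: "c < n1 + n2" and x: "x \<in> Alt k" and l: "set l \<subseteq> Fr"
 shows "br (ee c) x l = LD Fr (fst (uu c)) (\<t> c) x l"
proof -
 let ?L = "LD Fr (fst (uu c)) (\<t> c)"
 note D = uu_Der[OF c] and e = fr.e_Alt[OF c]
 have "\<forall>l. set l \<subseteq> Fr --> br (ee c) x l = ?L x l"
  using x
 proof (induction rule: fr.gen_induct)
  case (zero k)
  show "\<forall>l. set l \<subseteq> Fr --> br (ee c) 0 l = ?L 0 l" unfolding br_zero[OF e] using D by (simp add: LD_def)
 next
  case (fn f)
  have "fn0 (fst (uu c) f) l = ?L (fn0 f) l" if "set l \<subseteq> Fr" for l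
  proof (cases "l = []")
   case False
   hence "fn0 g l' = 0" if "length l' = length l" for g :: "'m fn" and l' :: "'m gsec list" using that by (auto simp: fn0_def)
   thus ?thesis using D by (simp add: LD_def)
  qed (simp add: LD_Nil fn0_def)
  thus ?case using br_ee_fn[OF c fn] by simp
 next
  case (wedge k b \<w>)
  note eb = fr.e_Alt[OF wedge(1)]
  have g: "gb (uu c) v \<in> \<DD>" if "v \<in> V0" for v by (intro gb_\<DD> uu_\<DD> c V0_\<DD>[OF that])
  have 1: "br (ee c) (ee b) l' = ?L (ee b) l'" if l': "set l' \<subseteq> Fr" for l'
  proof (cases "length l' = 1")
   case True
   then obtain v where v: "l' = [v]" by (auto simp: length_Suc_conv One_nat_def)
   hence v0: "v \<in> Fr" "v \<in> V0" using l' Fr_V0 by auto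
   have "br (ee c) (ee b) [v] = - pairing (uu b) (gb (uu c) v)"
    unfolding br_ee[OF c wedge(1)] embed_pairing[OF v0(2)] by (rule pairing_inv[OF uu_\<DD>[OF c] uu_\<DD>[OF wedge(1)] V0_\<DD>[OF v0(2)]])
   moreover have "?L (ee b) [v] = - pairing (uu b) (\<t> c v)"
    using v0 Der_K[OF D pairing_K[OF uu_\<DD>[OF wedge(1)] V0_\<DD>[OF v0(2)]]]
    by (simp add: LD_def ee_pairing \<t>_V0[OF c])
   ultimately show ?thesis unfolding v pairing_uu_PP[OF wedge(1) g[OF v0(2)]] by simp
  next
   case False
   thus ?thesis
    using homogD[OF lb.Alt_homog[OF br_1_Alt[OF e eb]] False] homogD[OF homog_LD[OF lb.Alt_homog[OF eb]] False, of "fst (uu c)"] D by simp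
  qed
  show ?case
  proof (intro allI impI)
   fix l assume l: "set l \<subseteq> Fr"
   have "wedge (br (ee c) (ee b)) \<w> l = wedge (?L (ee b)) \<w> l" by (rule wedge_cong) (use 1 l in auto)
   moreover have "wedge (ee b) (br (ee c) \<w>) l = wedge (ee b) (?L \<w>) l" by (rule wedge_cong) (use wedge(3) l in auto)
   ultimately show "br (ee c) (wedge (ee b) \<w>) l = ?L (wedge (ee b) \<w>) l"
    unfolding br_1_wedge[OF e eb wedge(2)] form_app
    using LD_wedge[OF D lb.Alt_homog[OF eb] lb.Alt_C[OF eb] lb.Alt_C[OF wedge(2)] l] by simp
  qed
 next
  case (lin k a \<w> \<eta>)
  show ?case
  proof (intro allI impI)
   fix l assume l: "set l \<subseteq> Fr"
   have "fst (uu c) (cmul a \<w> l + \<eta> l) = (%x. a * fst (uu c) (\<w> l) x) + fst (uu c) (\<eta> l)"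
    unfolding cmul_def using lb.Alt_C[OF lin(1)] lb.Alt_C[OF lin(2)] by (subst Der_add[OF D]) (auto simp: Der_scale[OF D] intro: alg_scale)
   hence "?L (cmul a \<w> + \<eta>) l = cmul a (?L \<w>) l + ?L \<eta> l"
    using l by (simp add: LD_def sum.distrib cmul_def) (simp add: fun_eq_iff fun_app sum_fun_apply sum_distrib_left algebra_simps)
   moreover have "br (ee c) \<w> l = ?L \<w> l" "br (ee c) \<eta> l = ?L \<eta> l" using lin(3,4) l by auto
   ultimately show "br (ee c) (cmul a \<w> + \<eta>) l = ?L (cmul a \<w> + \<eta>) l"
    unfolding br_lin[OF e lin(1,2)] form_app by (simp add: cmul_def)
  qed
 qed
 thus ?thesis using l by blast
qed

lemma br_Inv: "c < n1 + n2 ==> x \<in> Inv k ==> br (ee c) x \<in> Inv k"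
proof (rule InvI)
 assume c: "c < n1 + n2" and x: "x \<in> Inv k"
 show "br (ee c) x \<in> Alt k" by (rule br_1_Alt[OF fr.e_Alt[OF c] Inv_Alt[OF x]])
 fix l assume l: "set l \<subseteq> Fr"
 have "x l \<in> constants M" using l Fr_V0 by (intro Inv_K[OF x]) auto
 moreover have "x (l[i := \<t> c (l ! i)]) \<in> constants M" if "i < length l" for i
 proof (rule Inv_K[OF x])
  have "l ! i \<in> V0" by (rule subsetD[OF subset_trans[OF l Fr_V0] nth_mem[OF that]])
  hence "insert (\<t> c (l ! i)) (set l) \<subseteq> V0" unfolding insert_subset by (intro conjI \<t>_V0[OF c] subset_trans[OF l Fr_V0])
  thus "set (l[i := \<t> c (l ! i)]) \<subseteq> V0" by (rule order_trans[OF set_update_subset_insert])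
 qed
 ultimately show "br (ee c) x l \<in> constants M"
  unfolding br_LD[OF c Inv_Alt[OF x] l] using l Der_K[OF uu_Der[OF c]] by (auto simp: LD_def intro!: K_neg K_sum)
qed

text \<open>The (1,0)-part of the differential of \<open>f\<close>, as a section of the conjugate of
  \<open>L\<close>. Bracketing with the function \<open>f\<close> is contraction with it, up to sign
  (\<open>br_fn\<close>).\<close>

definition vv :: "'m fn => 'm gsec" where
 "vv f = (0, form_component M 1 (vf.df f))"

lemma df_apply: "f \<in> Cinf M ==> X \<in> Der ==> vf.df f [X] = X f"
 using fun_cong[OF vf.df_ip[of f X], of "[]"] by (simp add: ip_apply fn0_def)

lemma vv_apply: "f \<in> Cinf M ==> Y \<in> Der ==> snd (vv f) [Y] = pr10 M Y f"
 using T_Der(1)[OF pr_T(1)] by (simp add: vv_def form_component_1 vf.df_Alt df_apply)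

lemma vv_V: "f \<in> Cinf M ==> vv f \<in> Lbar_sec M"
proof (rule LbarI)
 assume f: "f \<in> Cinf M"
 have "snd (vv f) [Z] = 0" if "Z \<in> T01 M" for Z
  unfolding vv_apply[OF f T_Der(2)[OF that]] pr_of_T(4)[OF that] by (simp add: fun_app)
 moreover have "snd (vv f) \<in> vf.Alt 1" using f by (simp add: vv_def form_component_Alt vf.df_Alt)
 ultimately show "snd (vv f) \<in> pq_forms M 1 0" by (simp add: pq_10)
qed (simp add: vv_def)

lemma ee_vv: "f \<in> Cinf M ==> c < n1 + n2 ==> ee c [vv f] = fst (uu c) f"
 using vv_V[of f] L_sec_D[OF uu_L, of c] uu_Der[of c]
 by (simp add: ee_def embed_L_apply vv_apply pr_of_T) (simp add: vv_def vf.Alt_1_zero)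

text \<open>Both sides are antiderivations of the wedge product, so it suffices to compare them on
  functions and on frame 1-forms, where \<open>ee_vv\<close> applies.\<close>

lemma br_fn: "x \<in> Alt k ==> f \<in> Cinf M ==> br (fn0 f) x = - ip (vv f) x"
proof (induction rule: fr.gen_induct)
 case (zero k)
 show "br (fn0 f) 0 = - ip (vv f) 0" using br_zero[OF lb.fn0_Alt[OF zero(1)]] by simp
next
 case (fn g)
 thus ?case using br_00[OF lb.fn0_Alt lb.fn0_Alt] by simp
next
 case (wedge k b \<w>)
 note f = wedge(4) and e = fr.e_Alt[OF wedge(1)]
 have "br (fn0 f) (ee b) = - fn0 (fst (uu b) f)" using br_1[OF e lb.fn0_Alt[OF f]] br_ee_fn[OF wedge(1) f] by simp
 moreover have "br (fn0 f) \<w> = - ip (vv f) \<w>" by (rule wedge(3)[OF f])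
 moreover have "fmul (sgn_fn 1) X = - X" for X :: "'m polyform" by (simp add: One_nat_def) (simp add: fmul_def)
 ultimately show "br (fn0 f) (wedge (ee b) \<w>) = - ip (vv f) (wedge (ee b) \<w>)"
  unfolding br_wedge[OF lb.fn0_Alt[OF f] e wedge(2)] ip_wedge[OF lb.Alt_homog[OF e]] fr.ip_Alt_1[OF e] ee_vv[OF f wedge(1)]
  by (simp only: wedge_lin wedge_fn0) (simp add: cmul_neg1)
next
 case (lin k c \<w> \<eta>)
 show "br (fn0 f) (cmul c \<w> + \<eta>) = - ip (vv f) (cmul c \<w> + \<eta>)"
  unfolding br_lin[OF lb.fn0_Alt[OF lin(5)] lin(1,2)] lin(3)[OF lin(5)] lin(4)[OF lin(5)] by simp
qed

lemma Alt_frame_eqI: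
 assumes "\<w> \<in> Alt k" "\<eta> \<in> Alt k" "\<And>l. set l \<subseteq> Fr ==> length l = k ==> \<w> l = \<eta> l"
 shows "\<w> = \<eta>"
proof -
 have "(\<w> - \<eta>) l = 0" if "set l \<subseteq> Fr" for l
  using assms(3)[OF that] homogD[OF lb.Alt_homog[OF assms(1)], of l] homogD[OF lb.Alt_homog[OF assms(2)], of l]
  by (cases "length l = k") auto
 hence "\<w> - \<eta> = 0" by (rule fr.frame_zero[OF lb.Alt_diff[OF assms(1,2)]])
 thus ?thesis by simp
qed

section \<open>The Dolbeault operator as a derivation of the Schouten bracket\<close>

lemma \<d>_ee_Alt: "c < n1 + n2 ==> \<d> 1 (ee c) \<in> Alt 2"
 using lb.\<d>_Alt[OF fr.e_Alt, of c] by (simp add: Suc_1[symmetric] One_nat_def)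

text \<open>Evaluated at a frame element with field \<open>Z\<close>, and with
  \<open>X = xs ! c\<close>, both sides are the (1,0)-part of \<open>lie Z X\<close> applied to
  \<open>f\<close>. On the left it is what remains of the commutator after the Lie derivative has
  removed the (0,1)-part; on the right it comes from \<open>\<d> 1 (ee c)\<close>.\<close>

lemma compat_fn:
 assumes c: "c < n1" and f: "f \<in> Cinf M"
 shows "\<d> 0 (br (ee c) (fn0 f)) - br (ee c) (\<d> 0 (fn0 f)) = br (\<d> 1 (ee c)) (fn0 f)"
proof -
 have c': "c < n1 + n2" using c by simp
 note e = fr.e_Alt[OF c'] and fA = lb.fn0_Alt[OF f]
 let ?X = "xs ! c"
 have u: "uu c = (?X, 0)" and X: "?X \<in> Der" "?X \<in> T10 M" using c by (simp_all add: uu_def xs_D)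
 have dA: "\<d> 0 \<w> \<in> Alt 1" if "\<w> \<in> Alt 0" for \<w> using lb.\<d>_Alt[OF that] by (simp add: One_nat_def)
 have r: "br (\<d> 1 (ee c)) (fn0 f) = - ip (vv f) (\<d> 1 (ee c))"
  using br_skew[OF \<d>_ee_Alt[OF c'] fA] br_fn[OF \<d>_ee_Alt[OF c'] f] by simp
 show ?thesis
 proof (rule Alt_frame_eqI)
  show "\<d> 0 (br (ee c) (fn0 f)) - br (ee c) (\<d> 0 (fn0 f)) \<in> Alt 1"
   by (intro lb.Alt_diff dA br_1_Alt e fA)
  show "br (\<d> 1 (ee c)) (fn0 f) \<in> Alt 1" using br_Alt[OF \<d>_ee_Alt[OF c'] fA] by (simp add: One_nat_def)
  fix l assume l: "set l \<subseteq> Fr" "length l = 1"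
  then obtain v where v: "l = [v]" by (auto simp: length_Suc_conv One_nat_def)
  hence v0: "v \<in> Fr" "v \<in> V0" "v \<in> Lbar_sec M" using l Fr_V0 V0_V by auto
  let ?Z = "fst v"
  have Z: "?Z \<in> Der" by (rule Lbar_D(3)[OF v0(3)])
  have L: "lie ?Z ?X \<in> Der" using X Z by auto
  have d0: "\<d> 0 (fn0 g) [w] = fst w g" if "w \<in> Lbar_sec M" for w g
   unfolding lb.koszul_0[OF that] by (simp add: fn0_def)
  have 1: "\<d> 0 (br (ee c) (fn0 f)) [v] = ?Z (?X f)"
   unfolding br_ee_fn[OF c' f] d0[OF v0(3)] u by simp
  have 2: "br (ee c) (\<d> 0 (fn0 f)) [v] = ?X (?Z f) - pr01 M (lie ?X ?Z) f"
  proof -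
   have "\<t> c v \<in> Lbar_sec M" by (rule V0_V[OF \<t>_V0[OF c' v0(2)]])
   hence "\<d> 0 (fn0 f) [\<t> c v] = pr01 M (lie ?X ?Z) f"
    unfolding d0[OF \<open>\<t> c v \<in> Lbar_sec M\<close>] by (simp add: PP_def gb_fst u)
   moreover have "br (ee c) (\<d> 0 (fn0 f)) [v] = LD Fr (fst (uu c)) (\<t> c) (\<d> 0 (fn0 f)) [v]"
    by (rule br_LD[OF c' dA[OF fA]]) (use v0 in simp)
   moreover have "LD Fr X t \<w> [v] = X (\<w> [v]) - \<w> [t v]" for X :: "'m vf" and t \<w>
    using v0(1) by (simp add: LD_def)
   ultimately show ?thesis unfolding d0[OF v0(3)] u by (simp only: d0[OF v0(3)] fst_conv)
  qed
  have 3: "- ip (vv f) (\<d> 1 (ee c)) [v] = ?Z (?X f) + ee c [gb (vv f) v]"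
  proof -
   have "ip (vv f) (\<d> 1 (ee c)) [v] = fst (vv f) (ee c [v]) - ?Z (ee c [vv f]) - ee c [gb (vv f) v]"
    unfolding ip_apply by (rule lb.koszul_1[OF vv_V[OF f] v0(3)])
   moreover have "fst (vv f) (ee c [v]) = 0" by (simp add: vv_def zero_fun_def)
   ultimately show ?thesis using ee_vv[OF f c'] u by simp
  qed
  have 4: "ee c [gb (vv f) v] = - (?Z (?X f) - pr10 M (lie ?Z ?X) f)"
  proof -
   have 0: "vf.Lv 0 (snd v) [?X] = 0"
    unfolding Lv_1[OF Der_0 X(1)] using X by (simp add: vf.Alt_1_zero Lbar_D(4)[OF v0(3)]) (simp add: zero_fun_def)
   have "gb (vv f) v = (lie 0 ?Z, vf.Lv 0 (snd v) - vf.Lv ?Z (snd (vv f)))"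
    unfolding gbracket_Lbar[OF vv_V[OF f] v0(3)] by (simp add: vv_def)
   moreover have "ee c [gb (vv f) v] = snd (gb (vv f) v) [?X]"
    using ee_apply[OF lb.br_V[OF vv_V[OF f] v0(3)] c'] c by simp
   ultimately show ?thesis
    by (simp only: snd_conv form_app(2) 0 Lv_1[OF Z X(1)] vv_apply[OF f X(1)] vv_apply[OF f L] pr_of_T(1)[OF X(2)]) simp
  qed
  have "lie ?Z ?X f = pr10 M (lie ?Z ?X) f + pr01 M (lie ?Z ?X) f"
   using fun_cong[OF pr_sum[of "lie ?Z ?X"], of f] by (simp add: fun_app)
  hence s: "?Z (?X f) - ?X (?Z f) = pr10 M (lie ?Z ?X) f + pr01 M (lie ?Z ?X) f" by (simp only: lie_def)
  have "lie ?X ?Z = fmul (cC (- 1)) (lie ?Z ?X) + 0" using lie_skew[of ?X ?Z] by (simp add: cC_fmul[OF L])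
  hence "pr01 M (lie ?X ?Z) f = cC (- 1) * pr01 M (lie ?Z ?X) f"
   using pr_lin(2)[OF cC_C L Der_0, of "- 1"] by (simp add: pr_of_T(3)[OF T_0(1)]) (simp add: fmul_def)
  hence p: "pr01 M (lie ?X ?Z) f = - pr01 M (lie ?Z ?X) f"
   using Der_C'[OF T_Der(2)[OF pr_T(2)[OF L]], of f] by (simp add: cC_mult fun_Compl_def)
  show "(\<d> 0 (br (ee c) (fn0 f)) - br (ee c) (\<d> 0 (fn0 f))) l = br (\<d> 1 (ee c)) (fn0 f) l"
   unfolding r v form_app(2,3) 1 2 3 4 p using s by (simp add: algebra_simps)
 qed
qed

lemma \<d>_embed: "w \<in> \<DD> ==> v \<in> V0 ==> v' \<in> V0 ==> \<d> 1 (embed_L M w) [v, v'] = - pairing w (gb v v')"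
proof -
 assume w: "w \<in> \<DD>" and v: "v \<in> V0" and v': "v' \<in> V0"
 have "fst v \<in> Der" "fst v' \<in> Der" using V0_\<DD> v v' \<DD>_D by auto
 thus ?thesis
  using lb.koszul_1[OF V0_V[OF v] V0_V[OF v'], of "embed_L M w"] Der_K[OF _ pairing_K[OF w V0_\<DD>[OF v]]] Der_K[OF _ pairing_K[OF w V0_\<DD>[OF v']]]
  by (simp add: embed_pairing v v' V0_gb del: mem_Times_iff)
qed

text \<open>Pairings of elements of the double are constant, so evaluating at two frame elements
  leaves only brackets and pairings, and the identity is \<open>double_compat\<close>.\<close>

lemma compat_ee:
 assumes c: "c < n1 + n2" and d: "d < n1 + n2"
 shows "\<d> 1 (br (ee c) (ee d)) - br (ee c) (\<d> 1 (ee d)) = br (\<d> 1 (ee c)) (ee d)"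
 unfolding br_1[OF fr.e_Alt[OF d] \<d>_ee_Alt[OF c]]
proof (rule Alt_frame_eqI)
 note ec = fr.e_Alt[OF c] and ed = fr.e_Alt[OF d]
 have dA: "\<d> 1 \<w> \<in> Alt 2" if "\<w> \<in> Alt 1" for \<w> using lb.\<d>_Alt[OF that] by (simp add: Suc_1[symmetric] One_nat_def)
 show "\<d> 1 (br (ee c) (ee d)) - br (ee c) (\<d> 1 (ee d)) \<in> Alt 2" "- br (ee d) (\<d> 1 (ee c)) \<in> Alt 2"
  by (intro lb.Alt_diff lb.Alt_neg dA br_1_Alt ec ed)+
 fix l assume l: "set l \<subseteq> Fr" "length l = 2"
 then obtain v v' where v: "l = [v, v']" by (auto simp: length_Suc_conv numeral_2_eq_2)
 hence f: "v \<in> Fr" "v' \<in> Fr" using l by auto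
 hence v0: "v \<in> V0" "v' \<in> V0" using Fr_V0 by auto
 have b: "br (ee i) (\<d> 1 (ee j)) [v, v'] = pairing (uu j) (gb (\<t> i v) v') + pairing (uu j) (gb v (\<t> i v'))"
  if i: "i < n1 + n2" and j: "j < n1 + n2" for i j
 proof -
  have t: "\<t> i v \<in> V0" "\<t> i v' \<in> V0" by (rule \<t>_V0[OF i v0(1)], rule \<t>_V0[OF i v0(2)])
  have "pairing (uu j) (gb v v') \<in> constants M" by (intro pairing_K uu_\<DD> j gb_\<DD> V0_\<DD> v0)
  hence "fst (uu i) (\<d> 1 (ee j) [v, v']) = 0"
   unfolding ee_def \<d>_embed[OF uu_\<DD>[OF j] v0] by (intro Der_K uu_Der i K_neg)
  moreover have "{..<length [v, v']} = {0, 1}" by auto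
  ultimately have "br (ee i) (\<d> 1 (ee j)) [v, v'] = - (\<d> 1 (ee j) [\<t> i v, v'] + \<d> 1 (ee j) [v, \<t> i v'])"
   using br_LD[OF i dA[OF fr.e_Alt[OF j]], of "[v, v']"] f by (simp add: LD_def One_nat_def)
  thus ?thesis unfolding ee_def \<d>_embed[OF uu_\<DD>[OF j] t(1) v0(2)] \<d>_embed[OF uu_\<DD>[OF j] v0(1) t(2)] by simp
 qed
 have "\<d> 1 (br (ee c) (ee d)) [v, v'] = - pairing (gb (uu c) (uu d)) (gb v v')"
  unfolding br_ee[OF c d] by (rule \<d>_embed[OF gb_\<DD>[OF uu_\<DD>[OF c] uu_\<DD>[OF d]] v0])
 note D = this
 show "(\<d> 1 (br (ee c) (ee d)) - br (ee c) (\<d> 1 (ee d))) l = (- br (ee d) (\<d> 1 (ee c))) l"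
  unfolding v form_app(2,3) D b[OF c d] b[OF d c] eq_neg_iff_add_eq_0
  by (rule double_compat[OF uu_\<DD>[OF c] uu_\<DD>[OF d] V0_\<DD>[OF v0(1)] V0_\<DD>[OF v0(2)]])
qed

section \<open>The operator \<open>[\<mu>, _]\<close> and the total differential\<close>

abbreviation "TT \<equiv> br \<mu>"

lemma \<mu>_Alt: "\<mu> \<in> Alt 2" and \<mu>_Inv: "\<mu> \<in> Inv 2"
proof -
 show "\<mu> \<in> Alt 2" using \<mu>_inv by (simp add: inv_polyvec_forms_def polyvec_forms_def L_alt_Alt)
 thus "\<mu> \<in> Inv 2" using \<mu>_inv by (simp add: inv_polyvec_forms_def Inv_def)
qed

lemma \<mu>_pure: "ip (Z, 0) \<mu> = 0"
proof
 fix l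
 show "ip (Z, 0) \<mu> l = 0 l"
 proof (cases "length l = 1 \<and> set ((Z, 0) # l) \<subseteq> Lbar_sec M")
  case True
  then obtain v where v: "l = [v]" by (auto simp: length_Suc_conv One_nat_def)
  let ?P = "%(Z, \<a>). (0 :: 'm vf, \<a> :: 'm form)"
  have "S = {..<2}" if "S \<subseteq> {..<2 :: nat}" "card S = 2" for S by (rule card_subset_eq) (use that in auto)
  hence S: "{S. S \<subseteq> {..<2 :: nat} \<and> card S = 2} = {{..<2}}" by auto
  have "\<mu> [(Z, 0), v] = lbs.cpt 2 \<mu> [(Z, 0), v]" using \<mu>_inv by (simp add: inv_polyvec_forms_def polyvec_forms_def)
  also have "\<dots> = \<mu> [0, ?P v]"
   using True v S by (simp add: component_def numeral_2_eq_2 zero_prod_def)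
  also have "\<dots> = 0" using fun_cong[OF lb.Alt_zero_arg[OF \<mu>_Alt], of "[?P v]"] by (simp add: ip_apply)
  finally show ?thesis by (simp add: ip_apply v)
 next
  case False
  thus ?thesis using lb.Alt_support[OF \<mu>_Alt, of "(Z, 0) # l"] by (auto simp: ip_apply One_nat_def)
 qed
qed

text \<open>\<open>generation\<close> in degree 2 yields twice \<open>\<mu>\<close>, whence the
  factor \<open>1 / 2\<close>. Only indices below \<open>n1\<close> occur since \<open>\<mu>\<close>
  has no (0,1)-vector arguments, and the coefficients are scalars since \<open>\<mu>\<close> is
  invariant.\<close>

lemma \<mu>_expand: "\<exists>m. \<mu> = (\<Sum>p\<in>{..<n1} \<times> {..<n1}. cmul (m p) (wedge (ee (fst p)) (ee (snd p))))"
proof -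
 have K: "\<mu> [\<e> b, \<e> c] \<in> constants M" if "b < n1" "c < n1" for b c
  using \<e>_V0[of b] \<e>_V0[of c] that by (intro Inv_K[OF \<mu>_Inv]) auto
 have "\<exists>m. \<mu> [\<e> (fst p), \<e> (snd p)] = cC m" if "p \<in> {..<n1} \<times> {..<n1}" for p
  using K[of "fst p" "snd p"] that unfolding K_eq by auto
 then obtain m where m: "\<And>p. p \<in> {..<n1} \<times> {..<n1} ==> \<mu> [\<e> (fst p), \<e> (snd p)] = cC (m p)" by metis
 have i: "ip (\<e> b) \<mu> = 0" if "\<not> b < n1" for b using \<mu>_pure that by (simp add: \<e>_def)
 have iA: "ip v \<mu> \<in> Alt 1" for v using lb.Alt_ip[OF \<mu>_Alt, of v] by (simp add: One_nat_def)
 have z: "\<mu> [\<e> b, \<e> c] = 0" if "\<not> c < n1" for b c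
  using fun_cong[OF lb.Alt_skew[OF \<mu>_Alt, of "\<e> c" "\<e> b"], of "[]"] i[OF that] by (simp add: ip_apply)
 have 1: "ip (\<e> b) \<mu> = (\<Sum>c<n1. cmul (m (b, c)) (ee c))" if b: "b < n1" for b
 proof -
  have "ip (\<e> b) \<mu> = (\<Sum>c<n1 + n2. fmul (\<mu> [\<e> b, \<e> c]) (ee c))"
   using one_form_expand[OF iA[of "\<e> b"]] by (simp add: ip_apply)
  also have "\<dots> = (\<Sum>c<n1. fmul (\<mu> [\<e> b, \<e> c]) (ee c))" unfolding sum_split_add by (simp add: z)
  also have "\<dots> = (\<Sum>c<n1. cmul (m (b, c)) (ee c))"
  proof (rule sum.cong[OF refl])
   fix c assume c: "c \<in> {..<n1}"
   have e: "\<mu> [\<e> b, \<e> c] = (%x. m (b, c) * uC x)" using m[of "(b, c)"] b c by (simp add: cC_def)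
   show "fmul (\<mu> [\<e> b, \<e> c]) (ee c) = cmul (m (b, c)) (ee c)"
    unfolding e by (rule lb.fmul_const[OF fr.e_Alt]) (use c in simp)
  qed
  finally show ?thesis .
 qed
 have "cmul (of_nat (Suc 1)) \<mu> = (\<Sum>b<n1 + n2. wedge (ee b) (ip (\<e> b) \<mu>))"
  by (rule fr.generation[symmetric]) (use \<mu>_Alt in \<open>simp only: Suc_1\<close>)
 also have "\<dots> = (\<Sum>b<n1. wedge (ee b) (ip (\<e> b) \<mu>))" unfolding sum_split_add by (simp add: i)
 also have "\<dots> = (\<Sum>b<n1. \<Sum>c<n1. cmul (m (b, c)) (wedge (ee b) (ee c)))"
  by (rule sum.cong) (simp_all add: 1 wedge_sum_right)
 also have "\<dots> = (\<Sum>p\<in>{..<n1} \<times> {..<n1}. cmul (m p) (wedge (ee (fst p)) (ee (snd p))))"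
  by (simp add: sum.cartesian_product split_def)
 finally have "cmul (1 / 2) (cmul (of_nat (Suc 1)) \<mu>) = (\<Sum>p\<in>{..<n1} \<times> {..<n1}. cmul (m p / 2) (wedge (ee (fst p)) (ee (snd p))))"
  by (simp add: cv.scale_sum_right del: cv.scale_scale) simp
 moreover have "cmul (1 / 2) (cmul (of_nat (Suc 1)) \<mu>) = \<mu>" by simp
 ultimately show ?thesis by (intro exI[of _ "%p. m p / 2"]) simp
qed

definition "mm = (SOME m. \<mu> = (\<Sum>p\<in>{..<n1} \<times> {..<n1}. cmul (m p) (wedge (ee (fst p)) (ee (snd p)))))"

abbreviation "FF \<equiv> {..<n1} \<times> {..<n1}"

lemma \<mu>_eq: "\<mu> = (\<Sum>p\<in>FF. cmul (mm p) (wedge (ee (fst p)) (ee (snd p))))"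
 unfolding mm_def by (rule someI_ex[OF \<mu>_expand])

lemma FF_D: "p \<in> FF ==> fst p < n1" "p \<in> FF ==> snd p < n1" "p \<in> FF ==> ee (fst p) \<in> Alt 1" "p \<in> FF ==> ee (snd p) \<in> Alt 1"
 by (auto intro: fr.e_Alt)

text \<open>This reduces the bracket with \<open>\<mu>\<close> to brackets with frame vectors, which
  \<open>br_LD\<close> computes.\<close>

lemma TT_eq: "x \<in> Alt l ==> TT x = (\<Sum>p\<in>FF. cmul (mm p) (wedge (ee (fst p)) (br (ee (snd p)) x) - wedge (ee (snd p)) (br (ee (fst p)) x)))"
proof -
 assume x: "x \<in> Alt l"
 have "TT x = (\<Sum>p\<in>FF. cmul (mm p) (br (wedge (ee (fst p)) (ee (snd p))) x))"
  by (subst \<mu>_eq, rule br_sum_left[OF _ x, of _ _ 2]) (use lb.Alt_wedge[OF FF_D(3,4)] in simp)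
 also have "\<dots> = (\<Sum>p\<in>FF. cmul (mm p) (wedge (ee (fst p)) (br (ee (snd p)) x) - wedge (ee (snd p)) (br (ee (fst p)) x)))"
  by (rule sum.cong[OF refl]) (simp only: br_wedge_11[OF FF_D(3,4) x])
 finally show ?thesis .
qed

lemma TT_Alt: "x \<in> Alt k ==> TT x \<in> Alt (Suc k)"
 using br_Alt[OF \<mu>_Alt, of x k] by simp

lemma TT_Inv: "x \<in> Inv k ==> TT x \<in> Inv (Suc k)"
proof -
 assume x: "x \<in> Inv k"
 have "wedge (ee b) (br (ee c) x) \<in> Inv (1 + k)" if "b < n1" "c < n1" for b c
  using that by (intro Inv_wedge ee_Inv br_Inv x) auto
 thus ?thesis unfolding TT_eq[OF Inv_Alt[OF x]]
  by (intro Inv_sum Inv_cmul Inv_diff) (auto simp: One_nat_def)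
qed

text \<open>For \<open>\<mu>\<close> of degree 2 the sign in the graded Jacobi identity is negative,
  so the identity reads \<open>2 [\<mu>, [\<mu>, x]] = [[\<mu>, \<mu>], x]\<close>.\<close>

lemma TT_TT: "x \<in> Alt k ==> TT (TT x) = 0"
proof -
 assume x: "x \<in> Alt k"
 have "br \<mu> \<mu> = 0" using hp by (simp add: holomorphic_poisson_def)
 hence "TT (TT x) = br 0 x + cmul (sg ((2 + 1) * (2 + 1))) (TT (TT x))" using br_jacobi[OF \<mu>_Alt \<mu>_Alt x] by simp
 hence "TT (TT x) = - TT (TT x)" by (simp add: br_zero_left[OF x] cmul_neg1)
 thus ?thesis by (auto simp: fun_eq_iff fun_app)
qed

lemma \<d>_sum:
 assumes a: "\<And>i. i \<in> F ==> a i \<in> Alt k"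
 shows "\<d> k (\<Sum>i\<in>F. cmul (c i) (a i)) = (\<Sum>i\<in>F. cmul (c i) (\<d> k (a i)))"
proof -
 have "\<d> k (\<Sum>i\<in>F. cmul (c i) (a i)) = (\<Sum>i\<in>F. \<d> k (cmul (c i) (a i)))"
  by (rule sum_additive[where h = "\<d> k" and S = "Alt k", OF lb.\<d>_zero lb.\<d>_add lb.Alt_zero lb.Alt_add]) (assumption | rule lb.Alt_cmul[OF a])+
 thus ?thesis by (simp add: lb.\<d>_cmul[OF a])
qed

lemma \<d>_wedge_1: "p \<in> Alt 1 ==> y \<in> Alt m ==> \<d> (Suc m) (wedge p y) = wedge (\<d> 1 p) y - wedge p (\<d> m y)"
proof -
 assume "p \<in> Alt 1" "y \<in> Alt m"
 moreover have "fmul (sgn_fn 1) X = - X" for X :: "'m polyform" by (simp add: One_nat_def) (simp add: fmul_def)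
 ultimately show ?thesis unfolding plus_1_eq_Suc[symmetric] using lb.\<d>_wedge[of p 1 y m] by simp
qed

text \<open>If \<open>dbar\<close> is a derivation of the bracket on the pairs of
  \<open>ee c\<close> and \<open>x\<close>, the Leibniz rule extends this to \<open>\<mu>\<close>
  and \<open>x\<close>. The failure to anticommute is then the bracket of \<open>dbar \<mu>\<close>
  with \<open>x\<close>, and \<open>dbar \<mu> = 0\<close>.\<close>

lemma \<d>_TT_compat:
 assumes x: "x \<in> Alt l" and R: "\<And>c. c < n1 ==> \<d> l (br (ee c) x) - br (ee c) (\<d> l x) = br (\<d> 1 (ee c)) x"
 shows "\<d> (Suc l) (TT x) = - TT (\<d> l x)"
proof -
 let ?w = "%p. wedge (ee (fst p)) (br (ee (snd p)) x) - wedge (ee (snd p)) (br (ee (fst p)) x)"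
 let ?v = "%p. wedge (ee (fst p)) (br (ee (snd p)) (\<d> l x)) - wedge (ee (snd p)) (br (ee (fst p)) (\<d> l x))"
 \<comment> \<open>\<open>?u p\<close> is the differential of the term \<open>p\<close> of
   \<open>\<mu>\<close>. The sum weighted by \<open>mm\<close> vanishes, while single terms need
   not.\<close>
 let ?u = "%p. wedge (\<d> 1 (ee (fst p))) (ee (snd p)) - wedge (ee (fst p)) (\<d> 1 (ee (snd p)))"
 have c: "c < n1 + n2" if "c < n1" for c using that by simp
 have bA: "br (ee c) x \<in> Alt l" "br (ee c) (\<d> l x) \<in> Alt (Suc l)" if "c < n1" for c
  by (rule br_1_Alt[OF fr.e_Alt[OF c[OF that]] x], rule br_1_Alt[OF fr.e_Alt[OF c[OF that]] lb.\<d>_Alt[OF x]])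
 have wA: "wedge (ee b) (br (ee c) x) \<in> Alt (Suc l)" if "b < n1" "c < n1" for b c
  using lb.Alt_wedge[OF fr.e_Alt[OF c[OF that(1)]] bA(1)[OF that(2)]] by (simp add: One_nat_def)
 have 1: "\<d> (Suc l) (TT x) = (\<Sum>p\<in>FF. cmul (mm p) (\<d> (Suc l) (?w p)))"
  unfolding TT_eq[OF x] by (rule \<d>_sum) (auto intro!: lb.Alt_diff wA)
 have 2: "TT (\<d> l x) = (\<Sum>p\<in>FF. cmul (mm p) (?v p))" by (rule TT_eq[OF lb.\<d>_Alt[OF x]])
 have uA: "wedge (\<d> 1 (ee b)) (ee c) \<in> Alt 3" "wedge (ee c) (\<d> 1 (ee b)) \<in> Alt 3" if "b < n1" "c < n1" for b c
  using lb.Alt_wedge[OF \<d>_ee_Alt[OF c[OF that(1)]] fr.e_Alt[OF c[OF that(2)]]]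
   lb.Alt_wedge[OF fr.e_Alt[OF c[OF that(2)]] \<d>_ee_Alt[OF c[OF that(1)]]] by simp_all
 have "\<d> 2 \<mu> = 0" using hp by (simp add: holomorphic_poisson_def dbar_poly_eq)
 moreover have "\<d> 2 \<mu> = (\<Sum>p\<in>FF. cmul (mm p) (\<d> 2 (wedge (ee (fst p)) (ee (snd p)))))"
  by (subst \<mu>_eq, rule \<d>_sum) (use lb.Alt_wedge[OF FF_D(3,4)] in simp)
 moreover have "\<dots> = (\<Sum>p\<in>FF. cmul (mm p) (?u p))"
  by (rule sum.cong[OF refl]) (simp only: \<d>_wedge_1[OF FF_D(3,4), unfolded Suc_1[unfolded One_nat_def, folded One_nat_def]])
 ultimately have "(\<Sum>p\<in>FF. cmul (mm p) (?u p)) = 0" by simp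
 hence 3: "(\<Sum>p\<in>FF. cmul (mm p) (br (?u p) x)) = 0"
 proof -
  have "?u p \<in> Alt 3" if "p \<in> FF" for p by (rule lb.Alt_diff[OF uA(1)[OF FF_D(1,2)[OF that]] uA(2)[OF FF_D(2,1)[OF that]]])
  hence "br (\<Sum>p\<in>FF. cmul (mm p) (?u p)) x = (\<Sum>p\<in>FF. cmul (mm p) (br (?u p) x))" by (rule br_sum_left[OF _ x])
  thus ?thesis unfolding \<open>(\<Sum>p\<in>FF. cmul (mm p) (?u p)) = 0\<close> br_zero_left[OF x] by simp
 qed
 have "\<d> (Suc l) (?w p) + ?v p = br (?u p) x" if p: "p \<in> FF" for p
 proof -
  note b = FF_D(1)[OF p] and c' = FF_D(2)[OF p] and eb = FF_D(3)[OF p] and ec = FF_D(4)[OF p]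
  have d: "\<d> (Suc l) (?w p) = wedge (\<d> 1 (ee (fst p))) (br (ee (snd p)) x) - wedge (ee (fst p)) (\<d> l (br (ee (snd p)) x)) -
    (wedge (\<d> 1 (ee (snd p))) (br (ee (fst p)) x) - wedge (ee (snd p)) (\<d> l (br (ee (fst p)) x)))"
   unfolding lb.\<d>_diff[OF wA[OF b c'] wA[OF c' b]] \<d>_wedge_1[OF eb bA(1)[OF c']] \<d>_wedge_1[OF ec bA(1)[OF b]] ..
  have comm: "wedge (ee (fst p)) (\<d> 1 (ee (snd p))) = wedge (\<d> 1 (ee (snd p))) (ee (fst p))"
   using wedge_comm[OF eb \<d>_ee_Alt[OF c[OF c']]] by simp
  have r: "br (?u p) x = wedge (ee (snd p)) (br (\<d> 1 (ee (fst p))) x) + wedge (\<d> 1 (ee (fst p))) (br (ee (snd p)) x)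
    - (wedge (ee (fst p)) (br (\<d> 1 (ee (snd p))) x) + wedge (\<d> 1 (ee (snd p))) (br (ee (fst p)) x))"
  proof -
   have "br (?u p) x = br (wedge (\<d> 1 (ee (fst p))) (ee (snd p))) x - br (wedge (ee (fst p)) (\<d> 1 (ee (snd p)))) x"
    using br_lin_left[OF uA(2)[OF c' b] uA(1)[OF b c'] x, of "- 1"] by (simp add: cmul_neg1)
   thus ?thesis unfolding comm br_wedge_21[OF \<d>_ee_Alt[OF c[OF b]] ec x] br_wedge_21[OF \<d>_ee_Alt[OF c[OF c']] eb x] .
  qed
  show ?thesis unfolding d r R[OF b, symmetric] R[OF c', symmetric] wedge_lin by simp
 qed
 hence "(\<Sum>p\<in>FF. cmul (mm p) (\<d> (Suc l) (?w p) + ?v p)) = 0"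
  using 3 by (simp cong: sum.cong)
 hence "(\<Sum>p\<in>FF. cmul (mm p) (\<d> (Suc l) (?w p))) + (\<Sum>p\<in>FF. cmul (mm p) (?v p)) = 0"
  by (simp only: cv.scale_right_distrib sum.distrib)
 thus ?thesis unfolding 1 2 by (simp only: add_eq_0_iff2)
qed

text \<open>\<open>compat_fn\<close> and \<open>compat_ee\<close> settle functions and frame
  1-forms; the rest follows along products, where both operators obey the graded Leibniz
  rule.\<close>

lemma \<d>_TT: "x \<in> Alt k ==> \<d> (Suc k) (TT x) = - TT (\<d> k x)"
proof (induction rule: fr.gen_induct)
 case (zero k)
 show "\<d> (Suc k) (TT 0) = - TT (\<d> k 0)" by (simp add: br_zero[OF \<mu>_Alt])
next
 case (fn f)
 show ?case by (rule \<d>_TT_compat[OF lb.fn0_Alt[OF fn] compat_fn[OF _ fn]])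
next
 case (wedge k b \<w>)
 note e = fr.e_Alt[OF wedge(1)] and w = wedge(2)
 note d = \<d>_ee_Alt[OF wedge(1)]
 have TTe: "TT (ee b) \<in> Alt 2" using TT_Alt[OF e] by (simp add: Suc_1[symmetric] One_nat_def)
 have Tw: "TT (wedge p y) = wedge (TT p) y - wedge p (TT y)" if "p \<in> Alt 1" "y \<in> Alt m" for p y m
  using br_wedge[OF \<mu>_Alt that] by (simp add: cmul_neg1)
 have Tw2: "TT (wedge p y) = wedge (TT p) y + wedge p (TT y)" if "p \<in> Alt 2" "y \<in> Alt m" for p y m
  using br_wedge[OF \<mu>_Alt that] by simp
 have dw2: "\<d> (Suc (Suc m)) (wedge p y) = wedge (\<d> 2 p) y + wedge p (\<d> m y)" if "p \<in> Alt 2" "y \<in> Alt m" for p y m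
 proof -
  have "fmul (sgn_fn 2) X = X" for X :: "'m polyform" by (simp add: numeral_2_eq_2) (simp add: fmul_def)
  thus ?thesis using lb.\<d>_wedge[OF that] by simp
 qed
 have E: "\<d> 2 (TT (ee b)) = - TT (\<d> 1 (ee b))"
  using \<d>_TT_compat[OF e compat_ee[OF _ wedge(1)]] by (simp add: Suc_1[symmetric] One_nat_def)
 have A1: "wedge (TT (ee b)) \<w> \<in> Alt (Suc (Suc k))" "wedge (\<d> 1 (ee b)) \<w> \<in> Alt (Suc (Suc k))"
  using lb.Alt_wedge[OF TTe w] lb.Alt_wedge[OF d w] by simp_all
 have A2: "wedge (ee b) (TT \<w>) \<in> Alt (Suc (Suc k))" "wedge (ee b) (\<d> k \<w>) \<in> Alt (Suc (Suc k))"
  using lb.Alt_wedge[OF e TT_Alt[OF w]] lb.Alt_wedge[OF e lb.\<d>_Alt[OF w]] by (simp_all add: One_nat_def)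
 have IH: "\<d> (Suc k) (TT \<w>) = - TT (\<d> k \<w>)" by (rule wedge(3))
 show "\<d> (Suc (Suc k)) (TT (wedge (ee b) \<w>)) = - TT (\<d> (Suc k) (wedge (ee b) \<w>))"
  unfolding Tw[OF e w] \<d>_wedge_1[OF e w] br_diff[OF \<mu>_Alt A1(2) A2(2)] lb.\<d>_diff[OF A1(1) A2(1)]
   dw2[OF TTe w] \<d>_wedge_1[OF e TT_Alt[OF w]] Tw2[OF d w] Tw[OF e lb.\<d>_Alt[OF w]] E IH wedge_lin by simp
next
 case (lin k c \<w> \<eta>)
 have "\<d> (Suc k) (TT (cmul c \<w> + \<eta>)) = cmul c (\<d> (Suc k) (TT \<w>)) + \<d> (Suc k) (TT \<eta>)"
  unfolding br_lin[OF \<mu>_Alt lin(1,2)] lb.\<d>_add[OF lb.Alt_cmul[OF TT_Alt[OF lin(1)]] TT_Alt[OF lin(2)]] lb.\<d>_cmul[OF TT_Alt[OF lin(1)]] ..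
 moreover have "TT (\<d> k (cmul c \<w> + \<eta>)) = cmul c (TT (\<d> k \<w>)) + TT (\<d> k \<eta>)"
  unfolding lb.\<d>_add[OF lb.Alt_cmul[OF lin(1)] lin(2)] lb.\<d>_cmul[OF lin(1)] br_lin[OF \<mu>_Alt lb.\<d>_Alt[OF lin(1)] lb.\<d>_Alt[OF lin(2)]] ..
 moreover have "\<d> (Suc k) (TT \<w>) = - TT (\<d> k \<w>)" by (rule lin(3))
 moreover have "\<d> (Suc k) (TT \<eta>) = - TT (\<d> k \<eta>)" by (rule lin(4))
 ultimately show "\<d> (Suc k) (TT (cmul c \<w> + \<eta>)) = - TT (\<d> k (cmul c \<w> + \<eta>))" by simp
qed

abbreviation "DD \<equiv> total_d M br \<mu>"

lemma DD_eq: "DD k x = \<d> k x + TT x"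
 by (simp add: total_d_def dbar_poly_eq)

lemma DD_Alt: "x \<in> Alt k ==> DD k x \<in> Alt (Suc k)"
 unfolding DD_eq by (intro lb.Alt_add lb.\<d>_Alt TT_Alt)

lemma DD_Inv: "x \<in> Inv k ==> DD k x \<in> Inv (Suc k)"
 unfolding DD_eq by (intro Inv_add Inv_\<d> TT_Inv)

lemma DD_lin: "x \<in> Alt k ==> y \<in> Alt k ==> DD k (x + y) = DD k x + DD k y"
 "x \<in> Alt k ==> y \<in> Alt k ==> DD k (x - y) = DD k x - DD k y"
 "x \<in> Alt k ==> DD k (cmul c x) = cmul c (DD k x)" "DD k 0 = 0"
 unfolding DD_eq using br_lin[OF \<mu>_Alt, of x k 0 c]
 by (simp_all add: lb.\<d>_add lb.\<d>_diff lb.\<d>_cmul br_add[OF \<mu>_Alt] br_diff[OF \<mu>_Alt] br_zero[OF \<mu>_Alt] cv.scale_right_distrib)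

lemma DD_DD: "x \<in> Alt k ==> DD (Suc k) (DD k x) = 0"
proof -
 assume x: "x \<in> Alt k"
 show ?thesis
  unfolding DD_eq lb.\<d>_add[OF lb.\<d>_Alt[OF x] TT_Alt[OF x]] br_add[OF \<mu>_Alt lb.\<d>_Alt[OF x] TT_Alt[OF x]]
   lb.\<d>_\<d>[OF x] TT_TT[OF x] \<d>_TT[OF x] by simp
qed

end

section \<open>Comparison of cohomologies\<close>

lemma coset_eq_iff:
 assumes "cv.subspace B"
 shows "coset B x = coset B y \<longleftrightarrow> x - y \<in> B"
proof
 assume "coset B x = coset B y"
 moreover have "x \<in> coset B x" using cv.subspace_0[OF assms] by (force simp: coset_def)
 ultimately obtain b where "x = y + b" "b \<in> B" by (auto simp: coset_def)
 thus "x - y \<in> B" by simp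
next
 assume d: "x - y \<in> B"
 have "x + b \<in> coset B y" "y + b \<in> coset B x" if "b \<in> B" for b
  using cv.subspace_add[OF assms d that] cv.subspace_diff[OF assms that d]
  by (force simp: coset_def intro: exI[of _ "x - y + b"] exI[of _ "b - (x - y)"])+
 thus "coset B x = coset B y" by (auto simp: coset_def)
qed

lemma induced_coset: "cv.subspace B' ==> 0 \<in> B ==> B \<subseteq> B' ==> induced B' (coset B x) = coset B' x"
proof
 assume s: "cv.subspace B'" "0 \<in> B" "B \<subseteq> B'"
 show "induced B' (coset B x) \<subseteq> coset B' x"
 proof
  fix z assume "z \<in> induced B' (coset B x)"
  then obtain b b' where "z = (x + b) + b'" "b \<in> B" "b' \<in> B'" by (auto simp: induced_def coset_def)
  hence "z = x + (b + b')" "b + b' \<in> B'" using s cv.subspace_add by (auto simp: add.assoc)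
  thus "z \<in> coset B' x" by (auto simp: coset_def)
 qed
 have "x \<in> coset B x" using s(2) by (force simp: coset_def)
 thus "coset B' x \<subseteq> induced B' (coset B x)" unfolding induced_def coset_def[of B'] by blast
qed

text \<open>The induced map is well defined and linear in any case, so being an isomorphism means
  injectivity and surjectivity on classes. The hypothesis on Dolbeault cohomology is read in this
  form, and the conclusion is proved in it.\<close>

lemma quot_iso_induced:
 assumes Z: "cv.subspace Z" "Z \<subseteq> Z'" and B: "cv.subspace B" "B \<subseteq> B'" and B': "cv.subspace B'"
 shows "quot_iso Z B Z' B' (induced B') \<longleftrightarrow> (\<forall>x\<in>Z. x \<in> B' --> x \<in> B) \<and> (\<forall>u\<in>Z'. \<exists>x\<in>Z. u - x \<in> B')"
proof -
 note ic = induced_coset[OF B' cv.subspace_0[OF B(1)] B(2)]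
 have lin: "induced B' (coset B (cmul c x + y)) = {cmul c u + w | u w. u \<in> induced B' (coset B x) \<and> w \<in> induced B' (coset B y)}" for c x y
  unfolding ic
 proof (intro Set.set_eqI iffI)
  fix z assume "z \<in> coset B' (cmul c x + y)"
  then obtain b where "z = cmul c (x + 0) + (y + b)" "b \<in> B'" by (auto simp: coset_def add.assoc)
  thus "z \<in> {cmul c u + w | u w. u \<in> coset B' x \<and> w \<in> coset B' y}"
   using cv.subspace_0[OF B'] unfolding coset_def by blast
 next
  fix z assume "z \<in> {cmul c u + w | u w. u \<in> coset B' x \<and> w \<in> coset B' y}"
  then obtain b b' where z: "z = cmul c (x + b) + (y + b')" "b \<in> B'" "b' \<in> B'" by (auto simp: coset_def)
  have "z = (cmul c x + y) + (cmul c b + b')" unfolding z cv.scale_right_distrib by (simp only: ac_simps)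
  moreover have "cmul c b + b' \<in> B'" by (intro cv.subspace_add[OF B'] cv.subspace_scale[OF B'] z)
  ultimately show "z \<in> coset B' (cmul c x + y)" unfolding coset_def by blast
 qed
 have "inj_on (induced B') (quot Z B) \<longleftrightarrow> (\<forall>x\<in>Z. x \<in> B' --> x \<in> B)"
 proof
  assume inj: "inj_on (induced B') (quot Z B)"
  show "\<forall>x\<in>Z. x \<in> B' --> x \<in> B"
  proof (intro ballI impI)
   fix x assume x: "x \<in> Z" "x \<in> B'"
   have "induced B' (coset B x) = induced B' (coset B 0)" unfolding ic coset_eq_iff[OF B'] using x by simp
   hence "coset B x = coset B 0" using inj x cv.subspace_0[OF Z(1)] unfolding inj_on_def quot_def by blast
   thus "x \<in> B" unfolding coset_eq_iff[OF B(1)] by simp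
  qed
 next
  assume h: "\<forall>x\<in>Z. x \<in> B' --> x \<in> B"
  show "inj_on (induced B') (quot Z B)"
  proof (rule inj_onI)
   fix c d assume "c \<in> quot Z B" "d \<in> quot Z B" and e: "induced B' c = induced B' d"
   then obtain x y where xy: "c = coset B x" "d = coset B y" "x \<in> Z" "y \<in> Z" by (auto simp: quot_def)
   have "x - y \<in> B'" using e unfolding xy ic coset_eq_iff[OF B'] .
   thus "c = d" unfolding xy coset_eq_iff[OF B(1)] using h cv.subspace_diff[OF Z(1) xy(3,4)] by simp
  qed
 qed
 moreover have "induced B' ` quot Z B = quot Z' B' \<longleftrightarrow> (\<forall>u\<in>Z'. \<exists>x\<in>Z. u - x \<in> B')"
 proof -
  have "induced B' ` quot Z B = coset B' ` Z" unfolding quot_def image_image ic ..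
  moreover have "coset B' ` Z = coset B' ` Z' \<longleftrightarrow> (\<forall>u\<in>Z'. \<exists>x\<in>Z. coset B' u = coset B' x)" using Z(2) by blast
  ultimately show ?thesis unfolding quot_def coset_eq_iff[OF B'] by simp
 qed
 ultimately show ?thesis unfolding quot_iso_def bij_betw_def using lin by simp
qed

lemma (in algebroid) \<d>_clin: "\<w> \<in> Alt k ==> \<eta> \<in> Alt k ==> \<d> k (cmul c \<w> + \<eta>) = cmul c (\<d> k \<w>) + \<d> k \<eta>"
 by (simp add: \<d>_add Alt_cmul \<d>_cmul)

lemma kernel_subspace:
 assumes "cv.subspace S" "\<And>c x y. x \<in> S ==> y \<in> S ==> d (cmul c x + y) = cmul c (d x) + d y"
 shows "cv.subspace {x \<in> S. d x = 0}" "cv.subspace (d ` S)"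
proof -
 have z: "d 0 = 0" using assms(2)[of 0 0 1] cv.subspace_0[OF assms(1)] by simp
 have a: "d (x + y) = d x + d y" if "x \<in> S" "y \<in> S" for x y using assms(2)[OF that, of 1] by simp
 have c: "d (cmul c x) = cmul c (d x)" if "x \<in> S" for c x using assms(2)[OF that cv.subspace_0[OF assms(1)], of c] z by simp
 show "cv.subspace {x \<in> S. d x = 0}"
  by (rule cv.subspaceI) (use assms(1) z a c in \<open>auto simp: cv.subspace_0 cv.subspace_add cv.subspace_scale\<close>)
 show "cv.subspace (d ` S)"
 proof (rule cv.subspaceI)
  show "0 \<in> d ` S" by (rule image_eqI[of _ _ 0]) (simp_all add: z cv.subspace_0[OF assms(1)])
 next
  fix x y assume "x \<in> d ` S" "y \<in> d ` S"
  then obtain a' b' where ab: "x = d a'" "y = d b'" "a' \<in> S" "b' \<in> S" by blast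
  show "x + y \<in> d ` S" by (rule image_eqI[of _ _ "a' + b'"]) (simp_all add: ab a cv.subspace_add[OF assms(1)])
 next
  fix k x assume "x \<in> d ` S"
  then obtain a' where ab: "x = d a'" "a' \<in> S" by blast
  show "cmul k x \<in> d ` S" by (rule image_eqI[of _ _ "cmul k a'"]) (simp_all add: ab c cv.subspace_scale[OF assms(1)])
 qed
qed

section \<open>Forms of type \<open>(0, q)\<close> and the relative Dolbeault statement\<close>

context framed_manifold
begin

definition \<zeta> :: "'m vf => 'm gsec" where "\<zeta> Z = (Z, 0)"

lemma \<zeta>_sel [simp]: "fst (\<zeta> Z) = Z" "snd (\<zeta> Z) = 0"
 by (simp_all add: \<zeta>_def)

text \<open>Restriction to the arguments \<open>(Z, 0)\<close>. Its right inverse \<open>Ez\<close>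
  on (0,q)-forms ignores the covector parts. Through them the Dolbeault operator on (0,q)-forms
  inherits its properties from the differential of the algebroid.\<close>

definition Rz :: "'m polyform => 'm form" where
 "Rz \<w> = (%v. if set v \<subseteq> Der then \<w> (map (%X. \<zeta> (pr01 M X)) v) else 0)"

definition Ez :: "'m form => 'm polyform" where
 "Ez \<eta> = (%l. if set l \<subseteq> Lbar_sec M then \<eta> (map fst l) else 0)"

lemma \<zeta>_V: "Z \<in> T01 M ==> \<zeta> Z \<in> Lbar_sec M"
 by (rule LbarI) (simp_all add: pq_10_module)

lemma gb_\<zeta>: "Z \<in> T01 M ==> W \<in> T01 M ==> gb (\<zeta> Z) (\<zeta> W) = \<zeta> (lie Z W)"
 unfolding gbracket_Lbar[OF \<zeta>_V \<zeta>_V] by (simp add: T_Der) (simp add: \<zeta>_def)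

lemma Rz_apply: "set Zs \<subseteq> T01 M ==> Rz \<w> Zs = \<w> (map \<zeta> Zs)"
proof -
 assume Z: "set Zs \<subseteq> T01 M"
 hence m: "map (%X. \<zeta> (pr01 M X)) Zs = map \<zeta> Zs" by (intro map_cong refl) (auto simp: pr_of_T)
 have "set Zs \<subseteq> Der" using Z T_Der by blast
 thus ?thesis unfolding Rz_def m by (simp only: if_True)
qed

lemma Rz_pq: "\<w> \<in> lb.Alt q ==> Rz \<w> \<in> pq_forms M 0 q"
proof -
 assume w: "\<w> \<in> lb.Alt q"
 let ?p = "%X. \<zeta> (pr01 M X)"
 have pV: "?p X \<in> Lbar_sec M" if "X \<in> Der" for X using that by (intro \<zeta>_V pr_T)
 have "Rz \<w> \<in> vf.Alt q"
 proof (rule vf.AltI)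
  fix l assume "\<not> (length l = q \<and> set l \<subseteq> Der)"
  thus "Rz \<w> l = 0" using homogD[OF lb.Alt_homog[OF w], of "map ?p l"] by (auto simp: Rz_def)
 next
  fix l :: "'m vf list" and i f u w' assume *: "length l = q" "set l \<subseteq> Der" "i < q" "f \<in> Cinf M" "u \<in> Der" "w' \<in> Der"
  have V: "set (map ?p l) \<subseteq> Lbar_sec M" using *(2) pV by auto
  have s: "set (l[i := x]) \<subseteq> Der" if "x \<in> Der" for x using that *(2) by (meson insert_subset order_trans set_update_subset_insert)
  have "?p (fmul f u + w') = gmul f (?p u) + ?p w'" using * by (simp add: pr_lin gmul_def \<zeta>_def)
  thus "Rz \<w> (l[i := fmul f u + w']) = f * Rz \<w> (l[i := u]) + Rz \<w> (l[i := w'])"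
   using lb.Alt_upd[OF w _ V, of i f "?p u" "?p w'"] * s[of u] s[of w'] s[OF Der_plus[OF Der_fmul[OF *(5,4)] *(6)]] pV
   by (simp add: Rz_def map_update)
 next
  fix l :: "'m vf list" and i j assume *: "length l = q" "set l \<subseteq> Der" "i < q" "j < q" "i \<noteq> j" "l ! i = l ! j"
  thus "Rz \<w> l = 0" using lb.Alt_same[OF w, of "map ?p l" i j] pV by (auto simp: Rz_def image_subset_iff)
 qed (simp add: Rz_def lb.Alt_C[OF w])
 moreover have "Rz \<w> (map (pr01 M) v) = Rz \<w> v" if v: "set v \<subseteq> Der" for v
 proof -
  have "set (map (pr01 M) v) \<subseteq> T01 M" using v pr_T(2) by auto
  thus ?thesis unfolding Rz_apply[OF \<open>set (map (pr01 M) v) \<subseteq> T01 M\<close>] using v by (simp add: Rz_def o_def)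
 qed
 ultimately show ?thesis by (simp add: pq_0)
qed

text \<open>The sections \<open>\<zeta> Z\<close> are closed under the bracket by
  \<open>gb_\<zeta>\<close> and act on functions as \<open>Z\<close> does, so the two Koszul sums
  agree term by term.\<close>

lemma Rz_\<d>: assumes w: "\<w> \<in> lb.Alt q" and Z: "set Zs \<subseteq> T01 M"
 shows "vf.\<d> q (Rz \<w>) Zs = lb.\<d> q \<w> (map \<zeta> Zs)"
proof (cases "length Zs = Suc q")
 case True
 have V: "set (map \<zeta> Zs) \<subseteq> Lbar_sec M" and D: "set Zs \<subseteq> Der" using Z \<zeta>_V T_Der by auto
 have n: "Rz \<w> (nths Zs A) = \<w> (nths (map \<zeta> Zs) A)" for A
  using Rz_apply[of "nths Zs A"] set_nths_subset[of Zs A] Z by (simp add: nths_map)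
 have b: "Rz \<w> (lie (Zs ! i) (Zs ! j) # nths Zs A) = \<w> (gb (map \<zeta> Zs ! i) (map \<zeta> Zs ! j) # nths (map \<zeta> Zs) A)"
  if "i < length Zs" "j < length Zs" for i j A
 proof -
  have ij: "Zs ! i \<in> T01 M" "Zs ! j \<in> T01 M" using that Z nth_mem by auto
  hence "set (lie (Zs ! i) (Zs ! j) # nths Zs A) \<subseteq> T01 M" using T01_lie set_nths_subset[of Zs A] Z by auto
  thus ?thesis using that by (simp add: Rz_apply gb_\<zeta>[OF ij] nths_map)
 qed
 have "(\<Sum>i\<le>q. (- 1) ^ i * (Zs ! i) (Rz \<w> (nths Zs (- {i})))) = (\<Sum>i\<le>q. (- 1) ^ i * fst (map \<zeta> Zs ! i) (\<w> (nths (map \<zeta> Zs) (- {i}))))"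
  by (rule sum.cong) (use True in \<open>simp_all add: n\<close>)
 moreover have "(\<Sum>j\<le>q. \<Sum>i<j. (- 1) ^ (i + j) * Rz \<w> (lie (Zs ! i) (Zs ! j) # nths Zs (- {i, j}))) =
   (\<Sum>j\<le>q. \<Sum>i<j. (- 1) ^ (i + j) * \<w> (gb (map \<zeta> Zs ! i) (map \<zeta> Zs ! j) # nths (map \<zeta> Zs) (- {i, j})))"
  by (intro sum.cong refl arg_cong2[where f = "(*)"] b) (use True in auto)
 ultimately show ?thesis using True V D unfolding koszul_def by simp
qed (simp add: koszul_def)

lemma dbar_0: "dbar M 0 q \<eta> v = (if set v \<subseteq> Der then vf.\<d> q \<eta> (map (pr01 M) v) else 0)"
 by (simp add: dbar_def form_component_0 ext_d_eq)

lemma dbar_Rz: "\<w> \<in> lb.Alt q ==> dbar M 0 q (Rz \<w>) = Rz (lb.\<d> q \<w>)"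
proof
 fix v assume w: "\<w> \<in> lb.Alt q"
 have r: "Rz \<w> \<in> vf.Alt q" using Rz_pq[OF w] by (simp add: pq_0)
 show "dbar M 0 q (Rz \<w>) v = Rz (lb.\<d> q \<w>) v"
 proof (cases "set v \<subseteq> Der")
  case True
  hence "set (map (pr01 M) v) \<subseteq> T01 M" using pr_T(2) by auto
  hence "dbar M 0 q (Rz \<w>) v = lb.\<d> q \<w> (map \<zeta> (map (pr01 M) v))"
   unfolding dbar_0 if_P[OF True] by (rule Rz_\<d>[OF w])
  thus ?thesis unfolding Rz_def[of "lb.\<d> q \<w>"] if_P[OF True] by (simp add: o_def)
 next
  case False
  show ?thesis unfolding dbar_0 Rz_def[of "lb.\<d> q \<w>"] if_not_P[OF False] ..
 qed
qed

lemma Ez_Alt: "\<eta> \<in> pq_forms M 0 q ==> Ez \<eta> \<in> lb.Alt q"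
proof -
 assume "\<eta> \<in> pq_forms M 0 q"
 hence e: "\<eta> \<in> vf.Alt q" by (simp add: pq_0)
 show ?thesis
 proof (rule lb.AltI)
  fix l :: "'m gsec list" assume "\<not> (length l = q \<and> set l \<subseteq> Lbar_sec M)"
  thus "Ez \<eta> l = 0" using homogD[OF vf.Alt_homog[OF e], of "map fst l"] by (auto simp: Ez_def)
 next
  fix l :: "'m gsec list" and i f u w'
  assume *: "length l = q" "set l \<subseteq> Lbar_sec M" "i < q" "f \<in> Cinf M" "u \<in> Lbar_sec M" "w' \<in> Lbar_sec M"
  have s: "set (l[i := x]) \<subseteq> Lbar_sec M" if "x \<in> Lbar_sec M" for x using that *(2) by (meson insert_subset order_trans set_update_subset_insert)
  have d: "set (map fst l) \<subseteq> Der" using *(2) Lbar_D(3) by auto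
  have "fst (gmul f u + w') = fmul f (fst u) + fst w'" by (simp add: gmul_def)
  thus "Ez \<eta> (l[i := gmul f u + w']) = f * Ez \<eta> (l[i := u]) + Ez \<eta> (l[i := w'])"
   using vf.Alt_upd[OF e _ d, of i f "fst u" "fst w'"] * s[of u] s[of w'] s[of "gmul f u + w'"]
   by (simp add: Ez_def map_update Lbar_D lb.V_add lb.V_sm)
 next
  fix l :: "'m gsec list" and i j assume *: "length l = q" "set l \<subseteq> Lbar_sec M" "i < q" "j < q" "i \<noteq> j" "l ! i = l ! j"
  hence d: "set (map fst l) \<subseteq> Der" using Lbar_D(3) by auto
  show "Ez \<eta> l = 0" using vf.Alt_same[OF e _ d, of i j] * by (simp add: Ez_def)
 qed (simp add: Ez_def vf.Alt_C[OF e])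
qed

lemma Rz_Ez: "\<eta> \<in> pq_forms M 0 q ==> Rz (Ez \<eta>) = \<eta>"
proof
 fix v assume e: "\<eta> \<in> pq_forms M 0 q"
 show "Rz (Ez \<eta>) v = \<eta> v"
 proof (cases "set v \<subseteq> Der")
  case True
  hence "set (map (%X. \<zeta> (pr01 M X)) v) \<subseteq> Lbar_sec M" using \<zeta>_V pr_T(2) by auto
  thus ?thesis using True e by (simp add: Rz_def Ez_def o_def pq_0)
 next
  case False
  thus ?thesis using vf.Alt_support[of \<eta> q v] e by (simp add: Rz_def pq_0)
 qed
qed

lemma Rz_0 [simp]: "Rz 0 = 0"
 by (rule ext) (simp add: Rz_def)

lemma dbar_pq: "\<eta> \<in> pq_forms M 0 q ==> dbar M 0 q \<eta> \<in> pq_forms M 0 (Suc q)"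
 using dbar_Rz[OF Ez_Alt, of \<eta> q] Rz_pq[OF lb.\<d>_Alt[OF Ez_Alt], of \<eta> q] by (simp add: Rz_Ez)

lemma dbar_dbar: "\<eta> \<in> pq_forms M 0 q ==> dbar M 0 (Suc q) (dbar M 0 q \<eta>) = 0"
proof -
 assume e: "\<eta> \<in> pq_forms M 0 q"
 have "dbar M 0 (Suc q) (dbar M 0 q (Rz (Ez \<eta>))) = 0"
  unfolding dbar_Rz[OF Ez_Alt[OF e]] dbar_Rz[OF lb.\<d>_Alt[OF Ez_Alt[OF e]]] lb.\<d>_\<d>[OF Ez_Alt[OF e]] by simp
 thus ?thesis by (simp add: Rz_Ez[OF e])
qed

lemma pq_0_subspace: "cv.subspace (pq_forms M 0 q)"
 by (rule cv.subspaceI) (auto simp: pq_0 cmul_def intro: vf.Alt_add vf.Alt_cmul[unfolded cmul_def])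

lemma inv_pq_0_subspace: "cv.subspace (inv_pq_forms M I 0 q)"
proof (rule cv.subspaceI)
 fix c \<w> assume "\<w> \<in> inv_pq_forms M I 0 q"
 hence w: "\<w> \<in> pq_forms M 0 q" "\<And>v. set v \<subseteq> I ==> \<w> v \<in> constants M" by (auto simp: inv_pq_forms_def)
 have "\<w> \<in> vf.Alt q" using w(1) by (simp add: pq_0)
 hence "cmul c \<w> v = cC c * \<w> v" for v unfolding cC_mult[OF vf.Alt_C[OF \<open>\<w> \<in> vf.Alt q\<close>]] by (simp add: cmul_def)
 thus "cmul c \<w> \<in> inv_pq_forms M I 0 q"
  using w cv.subspace_scale[OF pq_0_subspace w(1)] K_mult[of "cC c"] by (auto simp: inv_pq_forms_def K_eq)
qed (auto simp: inv_pq_forms_def cv.subspace_0[OF pq_0_subspace] cv.subspace_add[OF pq_0_subspace] K_add)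

lemma dbar_lin: "x \<in> pq_forms M 0 q ==> y \<in> pq_forms M 0 q ==> dbar M 0 q (cmul c x + y) = cmul c (dbar M 0 q x) + dbar M 0 q y"
proof
 fix v assume "x \<in> pq_forms M 0 q" "y \<in> pq_forms M 0 q"
 hence xy: "x \<in> vf.Alt q" "y \<in> vf.Alt q" by (auto simp: pq_0)
 thus "dbar M 0 q (cmul c x + y) v = (cmul c (dbar M 0 q x) + dbar M 0 q y) v"
  by (simp add: dbar_0 vf.Alt_add vf.Alt_cmul vf.\<d>_clin) (simp add: cmul_def dbar_0 fun_eq_iff fun_app)
qed

lemma inv_sub: "inv_pq_forms M I p q \<subseteq> pq_forms M p q"
 by (auto simp: inv_pq_forms_def)

text \<open>This is all that is used of the hypothesis on Dolbeault cohomology.\<close>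
lemma dolbeault_relative:
 assumes H: "\<And>q. quot_iso
   (dbar_cocycles M (inv_pq_forms M I) 0 q) (dbar_coboundaries M (inv_pq_forms M I) 0 q)
   (dbar_cocycles M (pq_forms M) 0 q) (dbar_coboundaries M (pq_forms M) 0 q)
   (induced (dbar_coboundaries M (pq_forms M) 0 q))"
  and e: "\<eta> \<in> pq_forms M 0 q" "dbar M 0 q \<eta> \<in> inv_pq_forms M I 0 (Suc q)"
 shows "\<exists>\<beta>\<in>inv_pq_forms M I 0 q. \<eta> - \<beta> \<in> dbar_coboundaries M (pq_forms M) 0 q"
proof -
 let ?I = "inv_pq_forms M I" and ?A = "pq_forms M"
 have lin: "dbar M 0 r (cmul c x + y) = cmul c (dbar M 0 r x) + dbar M 0 r y" if "x \<in> ?I 0 r" "y \<in> ?I 0 r" for c x y r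
  using that inv_sub by (intro dbar_lin) auto
 have Z: "cv.subspace (dbar_cocycles M ?I 0 r)" for r
  unfolding dbar_cocycles_def by (rule kernel_subspace(1)[OF inv_pq_0_subspace lin])
 have "cv.subspace (dbar M 0 r ` ?I 0 r)" for r by (rule kernel_subspace(2)[OF inv_pq_0_subspace lin])
 hence B: "cv.subspace (dbar_coboundaries M ?I 0 r)" for r by (simp add: dbar_coboundaries_def)
 have "cv.subspace (dbar M 0 r ` ?A 0 r)" for r by (rule kernel_subspace(2)[OF pq_0_subspace dbar_lin])
 hence B': "cv.subspace (dbar_coboundaries M ?A 0 r)" for r by (simp add: dbar_coboundaries_def)
 have sub: "dbar_cocycles M ?I 0 r \<subseteq> dbar_cocycles M ?A 0 r" "dbar_coboundaries M ?I 0 r \<subseteq> dbar_coboundaries M ?A 0 r" for r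
  using inv_sub by (auto simp: dbar_cocycles_def dbar_coboundaries_def)
 note iff = quot_iso_induced[OF Z sub(1) B sub(2) B', THEN iffD1, OF H]
 \<comment> \<open>Injectivity in degree \<open>Suc q\<close> yields an invariant \<open>b\<close>
   with the same differential as \<open>\<eta>\<close>; surjectivity in degree \<open>q\<close> then
   represents the closed difference by an invariant form.\<close>
 have "dbar M 0 q \<eta> \<in> dbar_cocycles M ?I 0 (Suc q)" using e by (simp add: dbar_cocycles_def dbar_dbar)
 moreover have "dbar M 0 q \<eta> \<in> dbar_coboundaries M ?A 0 (Suc q)" using e by (simp add: dbar_coboundaries_def)
 ultimately have "dbar M 0 q \<eta> \<in> dbar_coboundaries M ?I 0 (Suc q)" using iff[of "Suc q"] by blast
 then obtain b where b: "b \<in> ?I 0 q" "dbar M 0 q \<eta> = dbar M 0 q b" by (auto simp: dbar_coboundaries_def)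
 have bA: "b \<in> ?A 0 q" using b inv_sub by blast
 have "dbar M 0 q (\<eta> - b) = 0" using dbar_lin[OF bA e(1), of "- 1"] b(2) by (simp add: add.commute)
 hence "\<eta> - b \<in> dbar_cocycles M ?A 0 q" using cv.subspace_diff[OF pq_0_subspace e(1) bA] by (simp add: dbar_cocycles_def)
 then obtain x where "x \<in> dbar_cocycles M ?I 0 q" "\<eta> - b - x \<in> dbar_coboundaries M ?A 0 q" using iff[of q] by blast
 thus ?thesis using cv.subspace_add[OF inv_pq_0_subspace b(1), of x]
  by (intro bexI[of _ "b + x"]) (auto simp: dbar_cocycles_def diff_diff_eq)
qed

end


lemma wedge_1_zero:
 assumes "homog 1 e" "\<And>v. v \<in> set L ==> e [v] = 0"
 shows "wedge e y L = 0"
proof -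
 have "e (nths L S) = 0" for S
 proof (cases "length (nths L S) = 1")
  case True
  then obtain v where "nths L S = [v]" by (auto simp: length_Suc_conv One_nat_def)
  thus ?thesis using assms(2)[of v] set_nths_subset[of L S] by simp
 qed (rule homogD[OF assms(1)])
 thus ?thesis by (simp add: wedge_def)
qed

section \<open>The weight filtration\<close>

context poisson
begin

definition \<xi> :: "nat => 'm gsec" where "\<xi> i = (0, xf i)"

text \<open>Frame covectors first, arbitrary (0,1)-fields last. Fixing \<open>ls\<close> leaves a
  (0,q)-form in \<open>Zs\<close>, the coefficient of a form at \<open>ls\<close>; this is what
  \<open>ips\<close> extracts.\<close>

abbreviation "LL ls Zs \<equiv> map \<xi> ls @ map \<zeta> Zs"

lemma \<xi>_sel [simp]: "fst (\<xi> i) = 0" "snd (\<xi> i) = xf i"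
 by (simp_all add: \<xi>_def)

lemma \<e>_\<xi>: "i < n1 ==> \<e> i = \<xi> i"
 by (simp add: \<e>_def \<xi>_def)

lemma \<xi>_V: "i < n1 ==> \<xi> i \<in> Lbar_sec M"
 by (rule LbarI) (simp_all add: xf_pq)

definition "ips ls u = (%l. u (map \<xi> ls @ l))"

lemma ips_Cons: "ips (s # ls) u = ips ls (ip (\<xi> s) u)" and ips_Nil: "ips [] u = u"
 by (simp_all add: ips_def ip_def)

lemma ips_Alt: "u \<in> Alt k ==> ips ls u \<in> Alt (k - length ls)"
proof (induction ls arbitrary: u k)
 case (Cons s ls)
 have "ips ls (ip (\<xi> s) u) \<in> Alt (k - 1 - length ls)" by (rule Cons.IH[OF lb.Alt_ip[OF Cons.prems]])
 thus ?case unfolding ips_Cons by (simp add: plus_1_eq_Suc)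
qed (simp add: ips_Nil)

text \<open>The expression is the differential of \<open>xf i\<close> evaluated at
  \<open>xs ! j\<close> and \<open>Z\<close>, because \<open>xf i\<close> vanishes on (0,1)-fields
  and is constant on \<open>xs ! j\<close>. Hence it is function-linear in \<open>Z\<close>, and
  \<open>triangular\<close> for the frame \<open>zs\<close> suffices.\<close>

lemma xf_lie: "Z \<in> T01 M ==> j \<le> i ==> i < n1 ==> xf i [lie Z (xs ! j)] = 0"
proof -
 assume Z: "Z \<in> T01 M" and ij: "j \<le> i" "i < n1"
 have X: "xs ! j \<in> Der" "xs ! j \<in> I" using xs_D ij by auto
 have d: "vf.\<d> 1 (xf i) [xs ! j, W] = xf i [lie W (xs ! j)]" if "W \<in> T01 M" for W
 proof -
  have W: "W \<in> Der" using T_Der that by blast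
  have "xf i [lie (xs ! j) W] = - xf i [lie W (xs ! j)]"
   using vf.Alt_1_neg[OF xf_Alt[OF ij(2)] Der_lie[OF W X(1)]] lie_skew[of "xs ! j" W] by simp
  thus ?thesis using vf.koszul_1[OF X(1) W, of "xf i"] Der_K[OF W xf_I[OF ij(2) X(2)]] X W xf_01[OF ij(2) that] by simp
 qed
 have dA: "ip (xs ! j) (vf.\<d> 1 (xf i)) \<in> vf.Alt 1" using vf.Alt_ip[OF vf.\<d>_Alt[OF xf_Alt[OF ij(2)]], of "xs ! j"] by (simp add: One_nat_def)
 have zD: "zs ! b \<in> Der" "zs ! b \<in> T01 M" "zs ! b \<in> I" "zf b [Z] \<in> Cinf M" if "b < n2" for b
  using zs_D[OF that] vf.Alt_C[OF zf_Alt[OF that]] by auto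
 have "ip (xs ! j) (vf.\<d> 1 (xf i)) [Z] = ip (xs ! j) (vf.\<d> 1 (xf i)) [\<Sum>b<n2. fmul (zf b [Z]) (zs ! b)]"
  using pr01_eq[OF T_Der(2)[OF Z]] pr_of_T(2)[OF Z] by simp
 also have "\<dots> = (\<Sum>b<n2. ip (xs ! j) (vf.\<d> 1 (xf i)) [fmul (zf b [Z]) (zs ! b)])"
  by (rule vf.Alt_1_sum[OF dA]) (use zD in auto)
 also have "\<dots> = 0"
 proof (rule sum.neutral, rule ballI)
  fix b assume "b \<in> {..<n2}"
  hence b: "b < n2" by simp
  show "ip (xs ! j) (vf.\<d> 1 (xf i)) [fmul (zf b [Z]) (zs ! b)] = 0"
   unfolding vf.Alt_1_sm[OF dA zD(4)[OF b] zD(1)[OF b]] unfolding ip_apply d[OF zD(2)[OF b]] using triangular[OF ij(2,1), of "zs ! b"] zD[OF b] by simp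
 qed
 finally show ?thesis unfolding ip_apply d[OF Z] .
qed

lemma gb_\<xi>: "s < n1 ==> v \<in> Lbar_sec M ==> b < n1 ==>
  fst (gb (\<xi> s) v) = 0 \<and> snd (gb (\<xi> s) v) [xs ! b] = xf s [lie (fst v) (xs ! b)]"
proof -
 assume s: "s < n1" and v: "v \<in> Lbar_sec M" and b: "b < n1"
 have z: "vf.Lv 0 \<a> [Y] = 0" if "\<a> \<in> vf.Alt 1" "Y \<in> Der" for \<a> Y
  using that by (simp add: Lv_1 vf.Alt_1_zero) (simp add: zero_fun_def)
 have "fst v (xf s [xs ! b]) = 0" using s b by (intro Der_K Lbar_D v) (simp add: xf_xs)
 thus ?thesis unfolding gbracket_Lbar[OF \<xi>_V[OF s] v] fst_conv snd_conv \<xi>_sel form_app(2)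
  z[OF Lbar_D(4)[OF v] xs_D(3)[OF b]] Lv_1[OF Lbar_D(3)[OF v] xs_D(3)[OF b]] using Lbar_D(3)[OF v] by simp
qed

text \<open>Lower indices are heavier. By triangularity the bracket with \<open>\<xi> s\<close>
  produces only indices above \<open>s\<close>, and the resulting argument lists have to be lighter,
  so that a form in the filtration vanishes on them.\<close>

definition wt :: "nat => nat => nat" where "wt B i = B + (n1 - i)"

abbreviation "weight B ls \<equiv> sum_list (map (wt B) ls)"

text \<open>The filtration by weight in the (1,0)-directions; \<open>B\<close> makes the number of such directions dominate their indices.\<close>
definition "Fil B w = {u. \<forall>ls Zs. set ls \<subseteq> {..<n1} --> set Zs \<subseteq> T01 M --> weight B ls < w --> u (LL ls Zs) = 0}"

lemma FilD: "u \<in> Fil B w ==> set ls \<subseteq> {..<n1} ==> set Zs \<subseteq> T01 M ==> weight B ls < w ==> u (LL ls Zs) = 0"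
 unfolding Fil_def by blast

lemma Fil_ip: "u \<in> Fil B w ==> s < n1 ==> ip (\<xi> s) u \<in> Fil B (w - wt B s)"
proof -
 assume u: "u \<in> Fil B w" and s: "s < n1"
 have "ip (\<xi> s) u (LL ls Zs) = 0" if "set ls \<subseteq> {..<n1}" "set Zs \<subseteq> T01 M" "weight B ls < w - wt B s" for ls Zs
  using FilD[OF u, of "s # ls" Zs] that s by (simp add: ip_apply)
 thus ?thesis unfolding Fil_def by blast
qed

text \<open>On lists of weight at most \<open>w\<close> the differential acts on the coefficient
  alone. Cartan's formula for \<open>\<xi> s\<close> leaves a Lie derivative, whose terms trade
  \<open>\<xi> s\<close> for a covector of higher index; the list becomes lighter than
  \<open>w\<close>, and \<open>u\<close> vanishes there.\<close>

lemma \<d>_leading: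
 assumes "u \<in> Alt k" "u \<in> Fil B w" "set ls \<subseteq> {..<n1}" "set Zs \<subseteq> T01 M" "weight B ls \<le> w"
 shows "\<d> k u (LL ls Zs) = sgn_fn (length ls) * \<d> (k - length ls) (ips ls u) (map \<zeta> Zs)"
 using assms
proof (induction ls arbitrary: u k w)
 case (Cons s ls)
 note u = Cons.prems(1)
 have s: "s < n1" and ls: "set ls \<subseteq> {..<n1}" and w: "weight B ls \<le> w - wt B s" "wt B s + weight B ls \<le> w" using Cons.prems by auto
 let ?L = "LL ls Zs"
 have LV: "set ?L \<subseteq> Lbar_sec M" using ls Cons.prems(4) \<xi>_V \<zeta>_V by auto
 have "u (?L[i := gb (\<xi> s) (?L ! i)]) = 0" if i: "i < length ?L" for i
 proof -
  let ?v = "?L ! i" let ?g = "gb (\<xi> s) ?v"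
  have v: "?v \<in> Lbar_sec M" using LV nth_mem[OF i] by blast
  have g: "?g \<in> Lbar_sec M" by (rule lb.br_V[OF \<xi>_V[OF s] v])
  have e: "ee b [?g] = 0" if "b < n1 + n2" "\<not> b < n1" for b
   using ee_apply[OF g that(1)] gb_\<xi>[OF s v s] that by (simp add: vf.Alt_1_zero zf_Alt)
  \<comment> \<open>Only a covector of index \<open>b\<close> above \<open>s\<close>, substituted
    for one of the fields, has a possibly nonzero coefficient, and then \<open>u\<close> vanishes by
    weight. All other coefficients of \<open>?g\<close> are 0, by \<open>xf_lie\<close> for a field
    and because two covectors have bracket 0.\<close>
  have "ee b [?g] * u (\<e> b # take i ?L @ drop (Suc i) ?L) = 0" if b: "b < n1 + n2" for b
  proof (cases "b < n1 \<and> s < b \<and> length ls \<le> i")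
   case True
   let ?Z' = "take (i - length ls) Zs @ drop (Suc (i - length ls)) Zs"
   have "take i ?L @ drop (Suc i) ?L = LL ls ?Z'"
    using True by (simp add: take_map drop_map Suc_diff_le)
   moreover have "u (LL (b # ls) ?Z') = 0"
   proof (rule FilD[OF Cons.prems(2)])
    show "set (b # ls) \<subseteq> {..<n1}" using True ls by simp
    show "set ?Z' \<subseteq> T01 M" using Cons.prems(4) set_take_subset set_drop_subset by fastforce
    have "b < n1" "s < b" using True by auto
    hence "wt B b < wt B s" by (simp add: wt_def)
    thus "weight B (b # ls) < w" using w(2) by simp
   qed
   ultimately show ?thesis using True \<e>_\<xi>[of b] by simp
  next
   case False
   have "ee b [?g] = 0"
   proof (cases "b < n1")
    case True
    have "xf s [lie (fst ?v) (xs ! b)] = 0"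
    proof (cases "length ls \<le> i")
     case True
     hence "b \<le> s" using False \<open>b < n1\<close> by auto
     have "fst ?v \<in> T01 M" by (rule Lbar_D(1)[OF v])
     thus ?thesis by (rule xf_lie[OF _ \<open>b \<le> s\<close> s])
    next
     case False
     hence "fst ?v = 0" by (simp add: nth_append)
     thus ?thesis using xs_D[OF \<open>b < n1\<close>] by (simp add: vf.Alt_1_zero xf_Alt s)
    qed
    thus ?thesis using ee_apply[OF g b] gb_\<xi>[OF s v \<open>b < n1\<close>] True by simp
   qed (rule e[OF b])
   thus ?thesis by simp
  qed
  note t = this
  have "u (?L[i := ?g]) = sgn_fn i * ip ?g u (take i ?L @ drop (Suc i) ?L)"
  proof -
   have "length (take i ?L) = i" using i by simp
   thus ?thesis unfolding upd_conv_take_nth_drop[OF i] lb.Alt_move[OF u, of "take i ?L"] ip_apply by (simp only:)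
  qed
  also have "ip ?g u (take i ?L @ drop (Suc i) ?L) = (\<Sum>b<n1 + n2. ee b [?g] * u (\<e> b # take i ?L @ drop (Suc i) ?L))"
   unfolding fr.ip_expand[OF u g] by (simp only: sum_fun_apply form_app ip_apply)
  also have "\<dots> = 0" by (intro sum.neutral ballI t) simp
  finally show ?thesis by (simp only: mult_zero_right)
 qed
 hence "(\<Sum>i<length ?L. u (?L[i := gb (\<xi> s) (?L ! i)])) = 0" by (intro sum.neutral ballI) (simp only: lessThan_iff)
 hence "lb.Lv (\<xi> s) u ?L = 0" unfolding LD_def if_P[OF LV] by (simp only: \<xi>_sel zero_fun_apply diff_self)
 moreover have "\<d> (k - 1) (ip (\<xi> s) u) ?L = sgn_fn (length ls) * \<d> (k - 1 - length ls) (ips ls (ip (\<xi> s) u)) (map \<zeta> Zs)"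
  by (rule Cons.IH[OF lb.Alt_ip[OF u] Fil_ip[OF Cons.prems(2) s] ls Cons.prems(4) w(1)])
 moreover have "\<d> k u (LL (s # ls) Zs) = ip (\<xi> s) (\<d> k u) ?L" by (simp add: ip_apply)
 ultimately show "\<d> k u (LL (s # ls) Zs) = sgn_fn (length (s # ls)) * \<d> (k - length (s # ls)) (ips (s # ls) u) (map \<zeta> Zs)"
  unfolding ips_Cons lb.\<d>_ip[OF u \<xi>_V[OF s]] by (simp add: plus_1_eq_Suc)
qed (simp add: ips_Nil)

text \<open>For lists of pure arguments this counts the covectors, the zero section being counted as
  a field. So \<open>Nf c u\<close> says that the polyvector degree of \<open>u\<close> is at least
  \<open>c\<close>.\<close>

definition "nz L = length (filter (%v. v \<notin> \<zeta> ` T01 M) L)"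

definition "Nf c u \<longleftrightarrow> (\<forall>L. set L \<subseteq> Fr --> nz L < c --> u L = 0)"

abbreviation "pure \<equiv> \<zeta> ` T01 M \<union> {0} \<times> pq_forms M 1 0"

lemma nz_Cons: "nz (v # L) = (if v \<in> \<zeta> ` T01 M then nz L else Suc (nz L))"
 by (simp add: nz_def)

lemma pure_V: "v \<in> pure ==> v \<in> Lbar_sec M"
 by (auto intro: \<zeta>_V LbarI)

lemma ee_pure: "v \<in> \<zeta> ` T01 M ==> b < n1 ==> ee b [v] = 0"
 "v \<in> {0} \<times> pq_forms M 1 0 ==> b < n1 + n2 ==> \<not> b < n1 ==> ee b [v] = 0"
 using ee_apply[OF pure_V, of v b] by (auto simp: vf.Alt_1_zero zf_Alt)

lemma \<e>_\<zeta>: "b < n1 + n2 ==> \<not> b < n1 ==> \<e> b \<in> \<zeta> ` T01 M"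
 by (rule image_eqI[of _ _ "zs ! (b - n1)"]) (simp_all add: \<e>_def \<zeta>_def zs_D)

lemma Fr_pure: "v \<in> Fr ==> v \<in> pure"
proof -
 assume "v \<in> Fr"
 then obtain b where "b < n1 + n2" "v = \<e> b" by auto
 thus ?thesis using \<e>_\<zeta>[of b] xf_pq[of b] by (cases "b < n1") (auto simp: \<e>_\<xi> \<xi>_def)
qed

lemma Nf_ip: "Nf c u ==> b < n1 + n2 ==> Nf (if b < n1 then c - 1 else c) (ip (\<e> b) u)"
 unfolding Nf_def
proof (intro allI impI)
 fix L assume u: "\<forall>L. set L \<subseteq> Fr --> nz L < c --> u L = 0" and b: "b < n1 + n2" and L: "set L \<subseteq> Fr" "nz L < (if b < n1 then c - 1 else c)"
 have "nz (\<e> b # L) < c" using L(2) \<e>_\<zeta>[OF b] by (auto simp: nz_Cons split: if_splits)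
 thus "ip (\<e> b) u L = 0" unfolding ip_apply using u L(1) b by auto
qed

text \<open>A pure argument expands into frame elements of its own type (\<open>ee_pure\<close>), so
  the count of covectors is unchanged by the expansion wherever the coefficient is nonzero.\<close>

lemma Nf_pure: "u \<in> Alt k ==> Nf c u ==> set L \<subseteq> pure ==> nz L < c ==> u L = 0"
proof (induction L arbitrary: u k c)
 case Nil
 thus ?case by (simp add: Nf_def)
next
 case (Cons v L)
 have v: "v \<in> pure" and L: "set L \<subseteq> pure" using Cons.prems by auto
 have "ee b [v] * ip (\<e> b) u L = 0" if b: "b < n1 + n2" for b
 proof (cases "v \<in> \<zeta> ` T01 M \<longleftrightarrow> \<not> b < n1")
  case True
  have "ip (\<e> b) u L = 0"
   by (rule Cons.IH[OF lb.Alt_ip[OF Cons.prems(1)] Nf_ip[OF Cons.prems(2) b] L])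
    (use Cons.prems(4) True in \<open>auto simp: nz_Cons split: if_splits\<close>)
  thus ?thesis by simp
 next
  case False
  hence "ee b [v] = 0" using v ee_pure[of v b] b by blast
  thus ?thesis by simp
 qed
 moreover have "u (v # L) = (\<Sum>b<n1 + n2. ee b [v] * ip (\<e> b) u L)"
  using fun_cong[OF fr.ip_expand[OF Cons.prems(1) pure_V[OF v]], of L] by (simp add: ip_apply sum_fun_apply)
 ultimately show "u (v # L) = 0" by simp
qed

lemma Fr_decomp:
 assumes "set L \<subseteq> Fr"
 obtains ls Zs where "set ls \<subseteq> {..<n1}" "set Zs \<subseteq> T01 M" "mset L = mset (LL ls Zs)" "length ls = nz L"
proof -
 have "\<exists>ls Zs. set ls \<subseteq> {..<n1} \<and> set Zs \<subseteq> T01 M \<and> mset L = mset (LL ls Zs) \<and> length ls = nz L"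
  using assms
 proof (induction L)
  case Nil
  show ?case by (intro exI[of _ "[]"]) (simp add: nz_def)
 next
  case (Cons v L)
  then obtain ls Zs where *: "set ls \<subseteq> {..<n1}" "set Zs \<subseteq> T01 M" "mset L = mset (LL ls Zs)" "length ls = nz L" by (auto simp del: mset_append mset_map)
  obtain b where b: "b < n1 + n2" "v = \<e> b" using Cons.prems by auto
  show ?case
  proof (cases "v \<in> \<zeta> ` T01 M")
   case True
   then obtain Z where "Z \<in> T01 M" "v = \<zeta> Z" by blast
   thus ?thesis using * True by (intro exI[of _ ls] exI[of _ "Z # Zs"]) (simp add: nz_Cons)
  next
   case False
   hence "b < n1" using \<e>_\<zeta> b by blast
   thus ?thesis using * False b \<e>_\<xi>[of b] by (intro exI[of _ "b # ls"] exI[of _ Zs]) (simp add: nz_Cons)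
  qed
 qed
 thus thesis using that by blast
qed

lemma Fil_Nf: "u \<in> Alt k ==> u \<in> Fil B w ==> (\<And>ls. set ls \<subseteq> {..<n1} ==> length ls < c ==> weight B ls < w) ==> Nf c u"
 unfolding Nf_def
proof (intro allI impI)
 fix L assume u: "u \<in> Alt k" "u \<in> Fil B w" and w: "\<And>ls. set ls \<subseteq> {..<n1} ==> length ls < c ==> weight B ls < w"
  and L: "set L \<subseteq> Fr" "nz L < c"
 obtain ls Zs where *: "set ls \<subseteq> {..<n1}" "set Zs \<subseteq> T01 M" "mset L = mset (LL ls Zs)" "length ls = nz L" by (rule Fr_decomp[OF L(1)])
 have "u (LL ls Zs) = 0" using FilD[OF u(2) *(1,2) w[OF *(1)]] *(4) L(2) by simp
 thus "u L = 0" using lb.Alt_perm[OF u(1) *(3)] by auto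
qed

text \<open>For a vector \<open>xs ! b\<close> the substitution \<open>\<t> b\<close> sends fields
  to fields and pure covectors to pure covectors, so the count of covectors cannot grow.\<close>

lemma br_Nf:
 assumes b: "b < n1" and u: "u \<in> Alt k" and N: "Nf c u"
 shows "Nf c (br (ee b) u)"
 unfolding Nf_def
proof (intro allI impI)
 fix L assume L: "set L \<subseteq> Fr" "nz L < c"
 have b': "b < n1 + n2" using b by simp
 have Lp: "set L \<subseteq> pure" using L(1) Fr_pure by blast
 have "u (L[i := \<t> b (L ! i)]) = 0" if i: "i < length L" for i
 proof (rule Nf_pure[OF u N])
  let ?v = "L ! i"
  have v0: "?v \<in> V0" "?v \<in> pure" using L(1) Lp Fr_V0 nth_mem[OF i] by blast+
  have t0: "\<t> b ?v \<in> Lbar_sec M" by (rule V0_V[OF \<t>_V0[OF b' v0(1)]])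
  have X: "xs ! b \<in> Der" by (rule xs_D[OF b])
  have z: "\<t> b ?v \<in> \<zeta> ` T01 M" if "?v \<in> \<zeta> ` T01 M"
  proof -
   have "snd (gb (uu b) ?v) = 0" using that b by (auto simp: gbracket_def uu_def ext_d_eq contract_ip)
   hence "snd (\<t> b ?v) = 0" by (simp add: PP_def form_component_def component_lin)
   thus ?thesis using Lbar_D(1)[OF t0] by (intro image_eqI[of _ _ "fst (\<t> b ?v)"]) (simp_all add: prod_eq_iff)
  qed
  have "\<t> b ?v \<in> pure"
  proof (cases "?v \<in> \<zeta> ` T01 M")
   case False
   hence "fst ?v = 0" using v0(2) by auto
   hence "fst (\<t> b ?v) = 0" using X by (simp add: PP_def gb_fst uu_def b pr_of_T)
   thus ?thesis using Lbar_D(2)[OF t0] by (simp add: mem_Times_iff)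
  qed (use z in blast)
  thus "set (L[i := \<t> b ?v]) \<subseteq> pure" using Lp by (meson insert_subset order_trans set_update_subset_insert)
  have "nz (L[i := \<t> b ?v]) \<le> nz L"
   using i z unfolding upd_conv_take_nth_drop[OF i] by (subst (3) id_take_nth_drop[OF i]) (auto simp: nz_def)
  thus "nz (L[i := \<t> b ?v]) < c" using L(2) by simp
 qed
 moreover have "u L = 0" using N L by (simp add: Nf_def)
 ultimately show "br (ee b) u L = 0" unfolding br_LD[OF b' u L(1)] using uu_Der[OF b'] by (simp add: LD_def)
qed

lemma wedge_Nf: "b < n1 ==> Nf c y ==> Nf (Suc c) (wedge (ee b) y)"
proof -
 assume b: "b < n1" and N: "Nf c y"
 have e: "ee b \<in> Alt 1" by (rule fr.e_Alt) (use b in simp)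
 have "wedge (ee b) y L = 0" if "set L \<subseteq> Fr" "nz L < Suc c" "Nf c y" for L c y
  using that
 proof (induction L arbitrary: c y)
  case Nil
  thus ?case using homogD[OF lb.Alt_homog[OF e], of "[]"] by (simp add: wedge_Nil)
 next
  case (Cons v L)
  obtain b' where b': "b' < n1 + n2" "v = \<e> b'" and L: "set L \<subseteq> Fr" using Cons.prems by auto
  have vz: "v \<in> \<zeta> ` T01 M" if "\<not> b' < n1" using \<e>_\<zeta> b' that by blast
  have 1: "ee b [v] * y L = 0"
  proof (cases "v \<in> \<zeta> ` T01 M")
   case False
   hence "nz L < c" using Cons.prems(2) by (simp add: nz_Cons)
   thus ?thesis using Cons.prems(3) L by (simp add: Nf_def)
  qed (simp add: ee_pure b)
  have 2: "wedge (ee b) (ip v y) L = 0"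
  proof (cases "v \<in> \<zeta> ` T01 M")
   case True
   have "Nf c (ip v y)" unfolding Nf_def
    using Cons.prems(1,3) True by (auto simp: Nf_def ip_apply nz_Cons)
   thus ?thesis using Cons.IH[OF L, of c] Cons.prems(2) True by (simp add: nz_Cons)
  next
   case False
   then obtain c' where c: "c = Suc c'" using Cons.prems(2) by (cases c) (auto simp: nz_Cons)
   have "b' < n1" using vz False by blast
   hence "Nf c' (ip v y)" using Nf_ip[OF Cons.prems(3) b'(1)] c b'(2) by simp
   thus ?thesis using Cons.IH[OF L, of c'] Cons.prems(2) False c by (simp add: nz_Cons)
  qed
  show ?case unfolding wedge_Cons[OF lb.Alt_homog[OF e]] fr.ip_Alt_1[OF e] wedge_fn0 form_app 1 2 by simp
 qed
 thus ?thesis using N unfolding Nf_def by blast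
qed

text \<open>Every term of \<open>TT_eq\<close> is a frame vector wedged with a bracket by a frame
  vector: the product raises the polyvector degree by one, and the bracket preserves the
  bound.\<close>

lemma TT_Nf: "u \<in> Alt k ==> Nf c u ==> Nf (Suc c) (TT u)"
proof -
 assume u: "u \<in> Alt k" and N: "Nf c u"
 have "Nf (Suc c) (wedge (ee b) (br (ee b') u))" if "b < n1" "b' < n1" for b b' by (rule wedge_Nf[OF that(1) br_Nf[OF that(2) u N]])
 hence "wedge (ee b) (br (ee b') u) L = 0" if "b < n1" "b' < n1" "set L \<subseteq> Fr" "nz L < Suc c" for b b' L
  using that unfolding Nf_def by blast
 note z = this
 have "TT u L = 0" if L: "set L \<subseteq> Fr" "nz L < Suc c" for L
  unfolding TT_eq[OF u]
 proof (subst sum_fun_apply, rule sum.neutral, rule ballI)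
  fix p assume p: "p \<in> FF"
  show "cmul (mm p) (wedge (ee (fst p)) (br (ee (snd p)) u) - wedge (ee (snd p)) (br (ee (fst p)) u)) L = 0"
   using z[OF FF_D(1,2)[OF p] L] z[OF FF_D(2,1)[OF p] L] by (simp add: cmul_def) (simp add: fun_eq_iff fun_app)
 qed
 thus ?thesis unfolding Nf_def by blast
qed

text \<open>The bound on \<open>B\<close> makes any list with fewer covectors lighter, whatever its
  indices: \<open>m * (B + n1) < Suc m * B\<close> for \<open>m \<le> k\<close>. So \<open>u\<close>
  has polyvector degree at least \<open>length ls\<close>, and \<open>TT u\<close> has one more than
  the list \<open>ls\<close> can see.\<close>

lemma TT_leading:
 assumes u: "u \<in> Alt k" and F: "u \<in> Fil B w" and ls: "set ls \<subseteq> {..<n1}" and Z: "set Zs \<subseteq> T01 M" and w: "weight B ls \<le> w" and B: "Suc k * n1 < B"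
 shows "TT u (LL ls Zs) = 0"
proof (cases "length ls \<le> Suc k")
 case True
 have low: "length l * B \<le> weight B l" for l by (induction l) (auto simp: wt_def)
 have up: "weight B l \<le> length l * (B + n1)" for l by (induction l) (auto simp: wt_def)
 have "Nf (length ls) u"
 proof (rule Fil_Nf[OF u F])
  fix l :: "nat list" assume "length l < length ls"
  then obtain m where m: "length ls = Suc m" "length l \<le> m" by (cases "length ls") auto
  have "weight B l \<le> m * (B + n1)" using order_trans[OF up[of l] mult_le_mono1[OF m(2)]] .
  also have "\<dots> < Suc m * B"
  proof -
   have "m * n1 \<le> Suc k * n1" using True m(1) by (intro mult_le_mono1) simp
   thus ?thesis using B by (simp add: distrib_left)
  qed
  also have "\<dots> \<le> w" using low[of ls] w m(1) by simp
  finally show "weight B l < w" .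
 qed
 hence N: "Nf (Suc (length ls)) (TT u)" by (rule TT_Nf[OF u])
 show ?thesis
 proof (rule Nf_pure[OF TT_Alt[OF u] N])
  show "set (LL ls Zs) \<subseteq> pure" using ls Z xf_pq by (auto simp: \<xi>_def)
  have "nz (map \<zeta> Zs) = 0" using Z by (auto simp: nz_def filter_empty_conv)
  thus "nz (LL ls Zs) < Suc (length ls)" by (simp add: nz_def le_less_trans[OF length_filter_le])
 qed
next
 case False
 thus ?thesis by (intro homogD[OF lb.Alt_homog[OF TT_Alt[OF u]]]) simp
qed

end

lemma (in framed_manifold) Ez_\<zeta>: "set Zs \<subseteq> T01 M ==> Ez \<eta> (map \<zeta> Zs) = \<eta> Zs"
proof -
 assume "set Zs \<subseteq> T01 M"
 hence "set (map \<zeta> Zs) \<subseteq> Lbar_sec M" using \<zeta>_V by auto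
 thus ?thesis by (simp add: Ez_def o_def)
qed

context poisson
begin

text \<open>For a sorted list \<open>ls\<close> with indices below \<open>n1\<close>, the form whose
  leading coefficient at \<open>ls\<close> is \<open>\<eta>\<close>. It turns a (0,q)-form found by
  the Dolbeault hypothesis back into a polyvector form, and an invariant one into an invariant
  one.\<close>

definition "XW ls \<eta> = foldr (%s b. wedge (ee s) b) ls (Ez \<eta>)"

lemma XW_Alt: "\<eta> \<in> pq_forms M 0 q ==> set ls \<subseteq> {..<n1} ==> XW ls \<eta> \<in> Alt (length ls + q)"
proof (induction ls)
 case (Cons s ls)
 have "wedge (ee s) (XW ls \<eta>) \<in> Alt (1 + (length ls + q))"
  by (rule lb.Alt_wedge[OF fr.e_Alt Cons.IH]) (use Cons.prems in auto)
 thus ?case by (simp add: XW_def plus_1_eq_Suc)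
qed (simp add: XW_def Ez_Alt)

lemma XW_Inv: "\<eta> \<in> inv_pq_forms M I 0 q ==> set ls \<subseteq> {..<n1} ==> XW ls \<eta> \<in> Inv (length ls + q)"
proof (induction ls)
 case Nil
 hence e: "\<eta> \<in> pq_forms M 0 q" "\<And>v. set v \<subseteq> I ==> \<eta> v \<in> constants M" by (auto simp: inv_pq_forms_def)
 have "Ez \<eta> l \<in> constants M" if "set l \<subseteq> V0" for l
 proof -
  have "set (map fst l) \<subseteq> I" using that by auto
  thus ?thesis using e(2) by (simp add: Ez_def)
 qed
 thus ?case using Ez_Alt[OF e(1)] by (simp add: XW_def Inv_def)
next
 case (Cons s ls)
 have "wedge (ee s) (XW ls \<eta>) \<in> Inv (1 + (length ls + q))"
  by (rule Inv_wedge[OF ee_Inv Cons.IH]) (use Cons.prems in auto)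
 thus ?case by (simp add: XW_def plus_1_eq_Suc)
qed

lemma ee_\<xi>: "s < n1 ==> t < n1 ==> ee s [\<xi> t] = (if s = t then uC else 0)"
 using ee_apply[OF \<xi>_V, of t s] by (simp add: xf_xs)

lemma ee_LL: "s < n1 ==> set ls \<subseteq> {..<n1} ==> set Zs \<subseteq> T01 M ==> s \<notin> set ls ==> v \<in> set (LL ls Zs) ==> ee s [v] = 0"
 using ee_\<xi>[of s] ee_pure(1)[of v s] by auto

lemma XW_zero:
 assumes "set ls \<subseteq> {..<n1}" "s \<in> set ls" "s \<notin> set ls'" "set ls' \<subseteq> {..<n1}" "set Zs \<subseteq> T01 M"
 shows "set L \<subseteq> set (LL ls' Zs) ==> XW ls \<eta> L = 0"
 using assms(1,2)
proof (induction ls arbitrary: L)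
 case (Cons t ls)
 have t: "t < n1" "t < n1 + n2" using Cons.prems by auto
 have X: "XW (t # ls) \<eta> = wedge (ee t) (XW ls \<eta>)" by (simp add: XW_def)
 show "XW (t # ls) \<eta> L = 0"
 proof (cases "t = s")
  case True
  show ?thesis unfolding X
  proof (rule wedge_1_zero[OF lb.Alt_homog[OF fr.e_Alt[OF t(2)]]])
   fix v assume "v \<in> set L"
   hence "v \<in> set (LL ls' Zs)" using Cons.prems(1) by blast
   thus "ee t [v] = 0" using ee_LL[OF t(1) assms(4,5)] True assms(3) by blast
  qed
 next
  case False
  hence s: "s \<in> set ls" "set ls \<subseteq> {..<n1}" using Cons.prems by auto
  have "XW ls \<eta> (nths L S) = 0" for S
   by (rule Cons.IH[OF subset_trans[OF set_nths_subset Cons.prems(1)] s(2,1)])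
  thus ?thesis unfolding X wedge_def by simp
 qed
qed simp

lemma XW_value: "\<eta> \<in> pq_forms M 0 q ==> set ls \<subseteq> {..<n1} ==> set Zs \<subseteq> T01 M ==> distinct ls ==> XW ls \<eta> (LL ls Zs) = \<eta> Zs"
proof (induction ls)
 case Nil
 thus ?case by (simp add: XW_def Ez_\<zeta>)
next
 case (Cons s ls)
 have s: "s < n1" "s < n1 + n2" "set ls \<subseteq> {..<n1}" using Cons.prems by auto
 have IH: "XW ls \<eta> (LL ls Zs) = \<eta> Zs" using Cons by simp
 have e: "ee s \<in> Alt 1" by (rule fr.e_Alt[OF s(2)])
 have z: "wedge (ee s) (ip (\<xi> s) (XW ls \<eta>)) (LL ls Zs) = 0"
 proof (rule wedge_1_zero[OF lb.Alt_homog[OF e]])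
  fix v assume "v \<in> set (LL ls Zs)"
  thus "ee s [v] = 0" using ee_LL[OF s(1,3) Cons.prems(3)] Cons.prems(4) by simp
 qed
 have "XW (s # ls) \<eta> (LL (s # ls) Zs) = wedge (ee s) (XW ls \<eta>) (\<xi> s # LL ls Zs)" by (simp add: XW_def)
 also have "\<dots> = ee s [\<xi> s] * XW ls \<eta> (LL ls Zs)"
  unfolding wedge_Cons[OF lb.Alt_homog[OF e]] fr.ip_Alt_1[OF e] wedge_fn0 form_app z by simp
 also have "\<dots> = \<eta> Zs" unfolding IH ee_\<xi>[OF s(1,1)] if_P[OF refl] by (rule uC(2)[OF vf.Alt_C[of _ q]]) (use Cons.prems(1) in \<open>simp add: pq_0\<close>)
 finally show "XW (s # ls) \<eta> (LL (s # ls) Zs) = \<eta> Zs" .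
qed

lemma weight_mset: "mset ls = mset ls' ==> weight B ls = weight B ls'"
 by (metis mset_map sum_mset_sum_list)

lemma wt_pos: "i < n1 ==> 0 < wt B i"
 by (simp add: wt_def)

lemma weight_set: "distinct ls ==> weight B ls = sum (wt B) (set ls)"
 by (simp add: sum.distinct_set_conv_list)

text \<open>Weights are positive, so a proper subset of indices is strictly lighter.\<close>

lemma sorted_subset_eq:
 assumes "sorted_wrt (<) ls" "sorted_wrt (<) ls'" "set ls \<subseteq> set ls'" "set ls' \<subseteq> {..<n1}" "weight B ls' \<le> weight B ls"
 shows "ls = ls'"
proof -
 have d: "distinct ls" "distinct ls'" using assms(1,2) by (auto simp: strict_sorted_iff)
 have "set ls = set ls'"
 proof (rule ccontr)
  assume "set ls \<noteq> set ls'"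
  then obtain b where b: "b \<in> set ls' - set ls" using assms(3) by blast
  have "sum (wt B) (set ls) < sum (wt B) (set ls')"
   by (rule sum_strict_mono2[OF _ assms(3) b]) (use b assms(4) wt_pos in auto)
  thus False using assms(5) d by (simp add: weight_set)
 qed
 thus ?thesis using assms(1,2) by (intro strict_sorted_equal) simp_all
qed

text \<open>By \<open>XW_zero\<close> the form can be nonzero only on lists that contain every index
  of \<open>ls\<close>, and such lists weigh at least as much as \<open>ls\<close>.\<close>

lemma XW_Fil:
 assumes "set ls \<subseteq> {..<n1}" "sorted_wrt (<) ls" "\<eta> \<in> pq_forms M 0 q"
 shows "XW ls \<eta> \<in> Fil B (weight B ls)"
 unfolding Fil_def
proof (intro CollectI allI impI)
 fix ls' Zs assume *: "set ls' \<subseteq> {..<n1}" "set Zs \<subseteq> T01 M" "weight B ls' < weight B ls"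
 have "\<not> set ls \<subseteq> set ls'"
 proof
  assume "set ls \<subseteq> set ls'"
  hence "sum (wt B) (set ls) \<le> sum (wt B) (set ls')" by (intro sum_mono2) auto
  also have "\<dots> \<le> weight B ls'" by (induction ls') (auto simp: sum.insert_if)
  finally show False using *(3) assms(2) weight_set[of ls B] by (simp add: strict_sorted_iff)
 qed
 then obtain s where "s \<in> set ls" "s \<notin> set ls'" by blast
 thus "XW ls \<eta> (LL ls' Zs) = 0" using XW_zero[OF assms(1) _ _ *(1,2) subset_refl] by blast
qed

lemma Fil_sub: "cv.subspace (Fil B w)"
 by (rule cv.subspaceI) (auto simp: Fil_def cmul_def fun_eq_iff fun_app)

lemma \<d>_Fil:
 assumes u: "u \<in> Alt k" "u \<in> Fil B w"
 shows "\<d> k u \<in> Fil B w"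
 unfolding Fil_def
proof (intro CollectI allI impI)
 fix ls Zs assume *: "set ls \<subseteq> {..<n1}" "set Zs \<subseteq> T01 M" "weight B ls < w"
 have i: "ips ls u \<in> Alt (k - length ls)" by (rule ips_Alt[OF u(1)])
 have "Rz (ips ls u) = 0"
 proof
  fix v
  show "Rz (ips ls u) v = 0 v"
  proof (cases "set v \<subseteq> Der")
   case True
   hence "set (map (pr01 M) v) \<subseteq> T01 M" using pr_T(2) by auto
   from FilD[OF u(2) *(1) this *(3)] show ?thesis using True by (simp add: Rz_def ips_def o_def)
  qed (simp add: Rz_def)
 qed
 hence "\<d> (k - length ls) (ips ls u) (map \<zeta> Zs) = 0" using Rz_\<d>[OF i *(2)] by simp
 thus "\<d> k u (LL ls Zs) = 0" using \<d>_leading[OF u *(1,2), of] *(3) by simp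
qed

lemma TT_Fil: "u \<in> Alt k ==> u \<in> Fil B w ==> Suc k * n1 < B ==> TT u \<in> Fil B (Suc w)"
 unfolding Fil_def[of B "Suc w"] using TT_leading[of u k B w] by (auto simp del: map_append)

definition "Bd k = (if k = 0 then {0} else DD (k - 1) ` Alt (k - 1))"

lemma Alt_subspace: "cv.subspace (Alt k)" and Inv_subspace: "cv.subspace (Inv k)"
 by (rule cv.subspaceI; simp add: lb.Alt_add lb.Alt_cmul Inv_add Inv_cmul)+

lemma DD_clin: "x \<in> Alt k ==> y \<in> Alt k ==> DD k (cmul c x + y) = cmul c (DD k x) + DD k y"
 by (simp add: DD_lin lb.Alt_cmul)

lemma Bd_subspace: "cv.subspace (Bd k)"
proof -
 have "cv.subspace (DD j ` Alt j)" for j by (rule kernel_subspace(2)[OF Alt_subspace DD_clin])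
 thus ?thesis by (simp add: Bd_def)
qed

lemma Bd_D: "y \<in> Bd k ==> y \<in> Alt k" "y \<in> Bd k ==> DD k y = 0"
proof -
 assume y: "y \<in> Bd k"
 have "y \<in> Alt k \<and> DD k y = 0"
 proof (cases k)
  case (Suc j)
  then obtain v where "v \<in> Alt j" "y = DD j v" using y by (auto simp: Bd_def)
  thus ?thesis using DD_Alt[of v j] DD_DD[of v j] Suc by simp
 qed (use y in \<open>simp add: Bd_def DD_lin\<close>)
 thus "y \<in> Alt k" "DD k y = 0" by auto
qed

end

section \<open>Induction on the weight\<close>

locale poisson_iso = poisson M I xs zs xf zf br \<mu> for M :: "('m, 'z) complex_manifold_scheme" and I xs zs xf zf br \<mu> +
 assumes iso: "\<And>q. quot_iso
   (dbar_cocycles M (inv_pq_forms M I) 0 q) (dbar_coboundaries M (inv_pq_forms M I) 0 q)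
   (dbar_cocycles M (pq_forms M) 0 q) (dbar_coboundaries M (pq_forms M) 0 q)
   (induced (dbar_coboundaries M (pq_forms M) 0 q))"
begin

text \<open>At a list of weight \<open>w\<close> the differential \<open>DD k u\<close> is, up to
  sign, \<open>dbar\<close> of the coefficient of \<open>u\<close>, since the Poisson part vanishes
  there by \<open>TT_leading\<close>. So the coefficient has an invariant Dolbeault differential,
  and \<open>dolbeault_relative\<close> applies.\<close>

lemma leading_step:
 assumes u: "u \<in> Alt k" "u \<in> Fil B w" and D: "DD k u \<in> Inv (Suc k)" and B: "Suc k * n1 < B"
  and ls: "set ls \<subseteq> {..<n1}" "weight B ls = w"
 shows "\<exists>\<beta>\<in>inv_pq_forms M I 0 (k - length ls). \<exists>\<eta>\<in>pq_forms M 0 (k - length ls - 1).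
  Rz (ips ls u) = \<beta> + (if k - length ls = 0 then 0 else dbar M 0 (k - length ls - 1) \<eta>)"
proof -
 let ?q = "k - length ls" and ?i = "ips ls u"
 have i: "?i \<in> Alt ?q" by (rule ips_Alt[OF u(1)])
 have lead: "\<d> ?q ?i (map \<zeta> Zs) = sgn_fn (length ls) * DD k u (LL ls Zs)" if Z: "set Zs \<subseteq> T01 M" for Zs
 proof -
  have "DD k u (LL ls Zs) = \<d> k u (LL ls Zs)"
   unfolding DD_eq form_app using TT_leading[OF u ls(1) Z _ B] ls(2) by simp
  also have "\<dots> = sgn_fn (length ls) * \<d> ?q ?i (map \<zeta> Zs)" by (rule \<d>_leading[OF u ls(1) Z]) (simp add: ls(2))
  finally show ?thesis by simp
 qed
 have r: "Rz ?i \<in> pq_forms M 0 ?q" by (rule Rz_pq[OF i])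
 have "dbar M 0 ?q (Rz ?i) \<in> inv_pq_forms M I 0 (Suc ?q)"
  unfolding inv_pq_forms_def
 proof (intro CollectI conjI allI impI)
  show "dbar M 0 ?q (Rz ?i) \<in> pq_forms M 0 (Suc ?q)" by (rule dbar_pq[OF r])
  fix v assume v: "set v \<subseteq> I"
  have vD: "set v \<subseteq> Der" and Z: "set (map (pr01 M) v) \<subseteq> T01 M \<inter> I" using v I_D pr_T(2) pr_I(2) by auto
  have "DD k u (LL ls (map (pr01 M) v)) \<in> constants M"
  proof (rule Inv_K[OF D])
   have "\<xi> s \<in> V0" if "s < n1" for s using \<e>_V0[of s] \<e>_\<xi>[OF that] that by simp
   moreover have "\<zeta> Z \<in> V0" if "Z \<in> T01 M \<inter> I" for Z
    using that by (auto simp: mem_Times_iff intro!: inv_pq_10 pq_10_module)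
   ultimately show "set (LL ls (map (pr01 M) v)) \<subseteq> V0"
    unfolding set_append set_map[of \<xi>] set_map[of \<zeta>] using ls(1) Z by (intro Un_least image_subsetI) blast+
  qed
  hence "sgn_fn (length ls) * DD k u (LL ls (map (pr01 M) v)) \<in> constants M" unfolding sgn_fn_def by (rule K_sgn)
  thus "dbar M 0 ?q (Rz ?i) v \<in> constants M"
   unfolding dbar_Rz[OF i] Rz_def[of "\<d> ?q ?i"] if_P[OF vD] using lead[of "map (pr01 M) v"] Z by (simp add: o_def)
 qed
 from dolbeault_relative[OF iso r this]
 obtain \<beta> where b: "\<beta> \<in> inv_pq_forms M I 0 ?q" "Rz ?i - \<beta> \<in> dbar_coboundaries M (pq_forms M) 0 ?q" by blast
 show ?thesis
 proof (cases "?q = 0")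
  case True
  hence "Rz ?i = \<beta> + 0" using b(2) by (simp add: dbar_coboundaries_def)
  thus ?thesis using b(1) True cv.subspace_0[OF pq_0_subspace] by (intro bexI[OF _ b(1)] bexI[of _ 0]) auto
 next
  case False
  then obtain \<eta> where "\<eta> \<in> pq_forms M 0 (?q - 1)" "Rz ?i - \<beta> = dbar M 0 (?q - 1) \<eta>" using b(2) by (auto simp: dbar_coboundaries_def)
  thus ?thesis using False by (intro bexI[OF _ b(1)] bexI[of _ \<eta>]) (auto simp: algebra_simps)
 qed
qed

text \<open>All coefficients of weight \<open>w\<close> are removed at once: \<open>x\<close>
  collects the invariant parts and \<open>v\<close> the Dolbeault primitives. Subtracting the total
  differential of \<open>v\<close> is harmless, as its Poisson part lies in higher weight.\<close>

lemma step:
 assumes u: "u \<in> Alt k" "u \<in> Fil B w" and D: "DD k u \<in> Inv (Suc k)" and B: "Suc k * n1 < B"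
 shows "\<exists>x\<in>Inv k. \<exists>y\<in>Bd k. u - y - x \<in> Fil B (Suc w)"
proof -
 \<comment> \<open>One sorted list for each set of indices; values at other lists follow by
   alternation.\<close>
 define LS where "LS = {ls. sorted_wrt (<) ls \<and> set ls \<subseteq> {..<n1} \<and> length ls \<le> k \<and> weight B ls = w}"
 have fin: "finite LS"
  by (rule finite_subset[OF _ finite_lists_length_le[of "{..<n1}" k]]) (auto simp: LS_def)
 have LS: "set ls \<subseteq> {..<n1}" "weight B ls = w" "sorted_wrt (<) ls" "length ls \<le> k" "distinct ls" if "ls \<in> LS" for ls
  using that by (auto simp: LS_def strict_sorted_iff)
 have "\<forall>ls\<in>LS. \<exists>\<beta> \<eta>. \<beta> \<in> inv_pq_forms M I 0 (k - length ls) \<and> \<eta> \<in> pq_forms M 0 (k - length ls - 1) \<and>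
  Rz (ips ls u) = \<beta> + (if k - length ls = 0 then 0 else dbar M 0 (k - length ls - 1) \<eta>)"
  using leading_step[OF u D B LS(1,2)] by blast
 then obtain \<beta> \<eta> where be: "\<And>ls. ls \<in> LS ==> \<beta> ls \<in> inv_pq_forms M I 0 (k - length ls)"
  "\<And>ls. ls \<in> LS ==> \<eta> ls \<in> pq_forms M 0 (k - length ls - 1)"
  "\<And>ls. ls \<in> LS ==> Rz (ips ls u) = \<beta> ls + (if k - length ls = 0 then 0 else dbar M 0 (k - length ls - 1) (\<eta> ls))"
  by metis
 \<comment> \<open>At a list of length \<open>k\<close> the coefficient has degree 0 and there is no
   primitive to subtract.\<close>
 define LS1 where "LS1 = {ls \<in> LS. length ls < k}"
 define x where "x = (\<Sum>ls\<in>LS. XW ls (\<beta> ls))"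
 \<comment> \<open>The sign cancels the one that \<open>\<d>_leading\<close> produces when the
   differential passes the covectors of \<open>ls\<close>.\<close>
 define v where "v = (\<Sum>ls\<in>LS1. cmul (sg (length ls)) (XW ls (\<eta> ls)))"
 define y where "y = (if k = 0 then 0 else DD (k - 1) v)"
 have fin1: "finite LS1" using fin by (simp add: LS1_def)
 have bpq: "\<beta> ls \<in> pq_forms M 0 (k - length ls)" if "ls \<in> LS" for ls using be(1)[OF that] inv_sub by blast
 have xI: "x \<in> Inv k" unfolding x_def
 proof (rule Inv_sum)
  fix ls assume l: "ls \<in> LS"
  show "XW ls (\<beta> ls) \<in> Inv k" using XW_Inv[OF be(1)[OF l] LS(1)[OF l]] LS(4)[OF l] by simp
 qed
 have vA: "v \<in> Alt (k - 1)" unfolding v_def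
 proof (intro lb.Alt_sum lb.Alt_cmul)
  fix ls assume "ls \<in> LS1"
  hence l: "ls \<in> LS" "length ls < k" by (auto simp: LS1_def)
  show "XW ls (\<eta> ls) \<in> Alt (k - 1)" using XW_Alt[OF be(2)[OF l(1)] LS(1)[OF l(1)]] l(2) by simp
 qed
 have xF: "x \<in> Fil B w" unfolding x_def
 proof (rule cv.subspace_sum[OF Fil_sub])
  fix ls assume l: "ls \<in> LS"
  show "XW ls (\<beta> ls) \<in> Fil B w" using XW_Fil[OF LS(1)[OF l] LS(3)[OF l] bpq[OF l], of B] LS(2)[OF l] by simp
 qed
 have vF: "v \<in> Fil B w" unfolding v_def
 proof (intro cv.subspace_sum[OF Fil_sub] cv.subspace_scale[OF Fil_sub])
  fix ls assume "ls \<in> LS1"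
  hence l: "ls \<in> LS" by (simp add: LS1_def)
  show "XW ls (\<eta> ls) \<in> Fil B w" using XW_Fil[OF LS(1)[OF l] LS(3)[OF l] be(2)[OF l], of B] LS(2)[OF l] by simp
 qed
 have B1: "Suc (k - 1) * n1 < B" using B by (rule le_less_trans[rotated]) (intro mult_le_mono1, simp)
 have yBd: "y \<in> Bd k" using vA by (simp add: y_def Bd_def)
 have yT: "k \<noteq> 0 ==> TT v \<in> Fil B (Suc w)" by (rule TT_Fil[OF vA vF B1])
 have yF: "y \<in> Fil B w"
 proof (cases "k = 0")
  case False
  have "TT v \<in> Fil B w" using yT[OF False] by (auto simp: Fil_def simp del: map_append)
  thus ?thesis using False cv.subspace_add[OF Fil_sub \<d>_Fil[OF vA vF]] by (simp add: y_def DD_eq)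
 qed (simp add: y_def cv.subspace_0[OF Fil_sub])
 have zA: "u - y - x \<in> Alt k" by (intro lb.Alt_diff u Bd_D[OF yBd] Inv_Alt[OF xI])
 have zF: "u - y - x \<in> Fil B w" by (intro cv.subspace_diff[OF Fil_sub] u yF xF)
 \<comment> \<open>Of two different sorted lists of the same weight neither contains the other, so
   the forms built on them do not disturb each other's leading coefficients.\<close>
 have other: "XW ls \<rho> (LL ls' Zs) = 0" if "ls \<in> LS" "ls' \<in> LS" "ls \<noteq> ls'" "set Zs \<subseteq> T01 M" for ls ls' Zs \<rho>
 proof -
  have "\<not> set ls \<subseteq> set ls'" using sorted_subset_eq[OF LS(3)[OF that(1)] LS(3)[OF that(2)] _ LS(1)[OF that(2)], of B] LS(2) that by auto
  then obtain s where "s \<in> set ls" "s \<notin> set ls'" by blast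
  thus ?thesis using XW_zero[OF LS(1)[OF that(1)] _ _ LS(1)[OF that(2)] that(4) subset_refl] by blast
 qed
 have main: "(u - y - x) (LL ls Zs) = 0" if l: "ls \<in> LS" and Z: "set Zs \<subseteq> T01 M" for ls Zs
 proof -
  let ?q = "k - length ls"
  have 1: "u (LL ls Zs) = Rz (ips ls u) Zs" using Rz_apply[OF Z] by (simp add: ips_def)
  have "x (LL ls Zs) = (\<Sum>ls'\<in>LS. if ls' = ls then \<beta> ls Zs else 0)" unfolding x_def sum_fun_apply[of _ _ "LL ls Zs"]
  proof (rule sum.cong[OF refl])
   fix ls' assume "ls' \<in> LS"
   thus "XW ls' (\<beta> ls') (LL ls Zs) = (if ls' = ls then \<beta> ls Zs else 0)"
    using other[OF _ l _ Z] XW_value[OF bpq[OF l] LS(1)[OF l] Z LS(5)[OF l]] by auto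
  qed
  hence 2: "x (LL ls Zs) = \<beta> ls Zs" using fin l by simp
  have 3: "y (LL ls Zs) = (if ?q = 0 then 0 else dbar M 0 (?q - 1) (\<eta> ls)) Zs"
  proof (cases "k = 0")
   case True
   thus ?thesis by (simp add: y_def)
  next
   case False
   have vl: "v (LL ls Zs') = (if length ls < k then cmul (sg (length ls)) (\<eta> ls) Zs' else 0)" if Z': "set Zs' \<subseteq> T01 M" for Zs'
   proof -
    have "v (LL ls Zs') = (\<Sum>ls'\<in>LS1. if ls' = ls then cmul (sg (length ls)) (\<eta> ls) Zs' else 0)"
     unfolding v_def sum_fun_apply[of _ _ "LL ls Zs'"]
    proof (rule sum.cong[OF refl])
     fix ls' assume "ls' \<in> LS1"
     hence l': "ls' \<in> LS" by (simp add: LS1_def)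
     show "cmul (sg (length ls')) (XW ls' (\<eta> ls')) (LL ls Zs') = (if ls' = ls then cmul (sg (length ls)) (\<eta> ls) Zs' else 0)"
      using other[OF l' l _ Z', of "\<eta> ls'"] XW_value[OF be(2)[OF l] LS(1)[OF l] Z' LS(5)[OF l]]
      by (cases "ls' = ls") (simp_all add: cmul_def, simp add: fun_eq_iff fun_app)
    qed
    thus ?thesis using fin1 l by (simp add: LS1_def)
   qed
   have i: "ips ls v \<in> Alt (k - 1 - length ls)" by (rule ips_Alt[OF vA])
   have R: "Rz (ips ls v) = (if length ls < k then cmul (sg (length ls)) (\<eta> ls) else 0)"
   proof
    fix w
    show "Rz (ips ls v) w = (if length ls < k then cmul (sg (length ls)) (\<eta> ls) else 0) w"
    proof (cases "set w \<subseteq> Der")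
     case True
     have p: "set (map (pr01 M) w) \<subseteq> T01 M" using True pr_T(2) by auto
     have "Rz (ips ls v) w = v (LL ls (map (pr01 M) w))" using True by (simp add: Rz_def ips_def o_def)
     also have "\<dots> = (if length ls < k then cmul (sg (length ls)) (\<eta> ls) w else 0)"
      unfolding vl[OF p] using be(2)[OF l] True by (simp add: cmul_def pq_0)
     finally show ?thesis by simp
    next
     case False
     have "\<eta> ls w = 0" using vf.Alt_support[of "\<eta> ls" _ w] be(2)[OF l] False by (auto simp: pq_0)
     thus ?thesis using False by (simp add: Rz_def cmul_def) (simp add: fun_eq_iff fun_app)
    qed
   qed
   \<comment> \<open>The Poisson part of the total differential of \<open>v\<close> has filtration
     level \<open>Suc w\<close> and is invisible at a list of weight \<open>w\<close>.\<close>
   have "y (LL ls Zs) = \<d> (k - 1) v (LL ls Zs)"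
    using False FilD[OF yT[OF False] LS(1)[OF l] Z] LS(2)[OF l] by (simp add: y_def DD_eq)
   also have "\<dots> = sgn_fn (length ls) * \<d> (k - 1 - length ls) (ips ls v) (map \<zeta> Zs)"
    by (rule \<d>_leading[OF vA vF LS(1)[OF l] Z]) (simp add: LS(2)[OF l])
   also have "\<dots> = sgn_fn (length ls) * vf.\<d> (k - 1 - length ls) (Rz (ips ls v)) Zs" unfolding Rz_\<d>[OF i Z] ..
   also have "\<dots> = (if ?q = 0 then 0 else dbar M 0 (?q - 1) (\<eta> ls)) Zs"
   proof (cases "length ls < k")
    case True
    have q: "k - 1 - length ls = k - length ls - 1" by simp
    have e: "\<eta> ls \<in> vf.Alt (k - 1 - length ls)" "\<eta> ls \<in> vf.Alt (k - length ls - 1)"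
     using be(2)[OF l] unfolding q by (simp_all add: pq_0)
    have m: "map (pr01 M) Zs = Zs" using Z by (intro map_idI) (auto simp: pr_of_T)
    have "set Zs \<subseteq> Der" using Z T_Der by blast
    hence "dbar M 0 (?q - 1) (\<eta> ls) Zs = vf.\<d> (k - 1 - length ls) (\<eta> ls) Zs"
     unfolding q using dbar_0[of "?q - 1" "\<eta> ls" Zs] m by simp
    moreover have "sgn_fn (length ls) * cmul (sg (length ls)) F Zs = F Zs" for F :: "'m form"
     by (simp add: cmul_def fun_eq_iff fun_app sgn_fn_apply power_mult_distrib[symmetric] flip: mult.assoc)
    ultimately show ?thesis unfolding R if_P[OF True] vf.\<d>_cmul[OF e(1)] using True by simp
   next
    case False
    thus ?thesis unfolding R by simp
   qed
   finally show ?thesis .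
  qed
  show ?thesis unfolding form_app(2) 1 2 3 be(3)[OF l] form_app(1) by simp
 qed
 have "u - y - x \<in> Fil B (Suc w)" unfolding Fil_def
 proof (intro CollectI allI impI)
  fix ls Zs assume *: "set ls \<subseteq> {..<n1}" "set Zs \<subseteq> T01 M" "weight B ls < Suc w"
  show "(u - y - x) (LL ls Zs) = 0"
  proof (cases "weight B ls < w \<or> \<not> distinct ls \<or> k < length ls")
   case True
   then consider "weight B ls < w" | "\<not> distinct ls" | "k < length ls" by blast
   thus ?thesis
   proof cases
    case 1
    thus ?thesis by (rule FilD[OF zF *(1,2)])
   next
    case 2
    hence "\<not> distinct (LL ls Zs)" by (simp add: distinct_map)
    thus ?thesis by (rule lb.Alt_not_distinct[OF zA])
   next
    case 3
    thus ?thesis by (intro homogD[OF lb.Alt_homog[OF zA]]) simp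
   qed
  next
   case False
   have m: "mset (sort ls) = mset ls" by simp
   have "sort ls \<in> LS" using False * weight_mset[OF m, of B] by (simp add: LS_def strict_sorted_iff)
   hence "(u - y - x) (LL (sort ls) Zs) = 0" by (rule main[OF _ *(2)])
   moreover have "mset (LL ls Zs) = mset (LL (sort ls) Zs)" by simp
   ultimately show ?thesis using lb.Alt_perm[OF zA, of "LL ls Zs" "LL (sort ls) Zs"] by auto
  qed
 qed
 thus ?thesis using xI yBd by blast
qed

text \<open>Equivalently, the quotient complex of all forms by the invariant ones is acyclic. The
  hypothesis on \<open>u\<close> survives each \<open>step\<close>: the subtracted coboundary is
  closed, and the subtracted invariant form has an invariant differential. In fixed degree the
  weights are bounded.\<close>

lemma acyclic:
 assumes u: "u \<in> Alt k" and D: "DD k u \<in> Inv (Suc k)"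
 shows "\<exists>x\<in>Inv k. u - x \<in> Bd k"
proof -
 define B where "B = Suc (Suc k * n1)"
 \<comment> \<open>Above the weight of every list of at most \<open>k\<close> indices, so that a
   form of degree \<open>k\<close> at this filtration level is 0.\<close>
 define W where "W = Suc (k * (B + n1))"
 have B: "Suc k * n1 < B" by (simp add: B_def)
 have "\<exists>x\<in>Inv k. u - x \<in> Bd k" if "u \<in> Alt k" "u \<in> Fil B w" "DD k u \<in> Inv (Suc k)" "W - w = n" for u w n
  using that
 proof (induction n arbitrary: u w)
  case 0
  have "Nf (Suc k) u"
  proof (rule Fil_Nf[OF 0(1,2)])
   fix ls :: "nat list" assume "length ls < Suc k"
   hence l: "length ls \<le> k" by simp
   have "weight B ls \<le> length ls * (B + n1)" by (induction ls) (auto simp: wt_def)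
   also have "\<dots> \<le> k * (B + n1)" using l by (rule mult_le_mono1)
   finally show "weight B ls < w" using 0(4) by (simp add: W_def)
  qed
  moreover have "nz L \<le> length L" for L by (simp add: nz_def)
  ultimately have "u L = 0" if "set L \<subseteq> Fr" for L
   using that homogD[OF lb.Alt_homog[OF 0(1)], of L] unfolding Nf_def by (metis le_imp_less_Suc)
  hence "u = 0" by (rule fr.frame_zero[OF 0(1)])
  show "\<exists>x\<in>Inv k. u - x \<in> Bd k"
   unfolding \<open>u = 0\<close> by (rule bexI[of _ 0]) (simp_all add: cv.subspace_0[OF Bd_subspace])
 next
  case (Suc n)
  obtain x y where xy: "x \<in> Inv k" "y \<in> Bd k" "u - y - x \<in> Fil B (Suc w)" using step[OF Suc.prems(1-3) B] by blast
  have A: "y \<in> Alt k" "DD k y = 0" "x \<in> Alt k" "u - y \<in> Alt k" using Bd_D[OF xy(2)] Inv_Alt[OF xy(1)] Suc.prems(1) by (auto intro: lb.Alt_diff)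
  have "DD k (u - y - x) = DD k u - DD k x" unfolding DD_lin(2)[OF A(4,3)] DD_lin(2)[OF Suc.prems(1) A(1)] A(2) by simp
  hence DI: "DD k (u - y - x) \<in> Inv (Suc k)" using Inv_diff[OF Suc.prems(3) DD_Inv[OF xy(1)]] by simp
  have "\<exists>x'\<in>Inv k. u - y - x - x' \<in> Bd k"
  proof (rule Suc.IH[of "u - y - x" "Suc w"])
   show "u - y - x \<in> Alt k" by (rule lb.Alt_diff[OF A(4,3)])
   show "u - y - x \<in> Fil B (Suc w)" by (rule xy(3))
   show "DD k (u - y - x) \<in> Inv (Suc k)" by (rule DI)
   show "W - Suc w = n" using Suc.prems(4) by simp
  qed
  then obtain x' where x': "x' \<in> Inv k" "u - y - x - x' \<in> Bd k" by blast
  have e: "u - (x + x') = (u - y - x - x') + y" by (simp add: algebra_simps)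
  have "u - (x + x') \<in> Bd k" unfolding e by (rule cv.subspace_add[OF Bd_subspace x'(2) xy(2)])
  thus "\<exists>x\<in>Inv k. u - x \<in> Bd k" using Inv_add[OF xy(1) x'(1)] by blast
 qed
 moreover have "u \<in> Fil B 0" by (simp add: Fil_def)
 ultimately show ?thesis using u D by blast
qed

text \<open>Surjectivity is \<open>acyclic\<close> for a cocycle. For injectivity it is applied one
  degree lower, to a primitive of an invariant form: its differential is invariant, so the primitive
  may be replaced by an invariant one.\<close>

theorem total_iso: "quot_iso
  (total_cocycles M br \<mu> (inv_polyvec_forms M I) k) (total_coboundaries M br \<mu> (inv_polyvec_forms M I) k)
  (total_cocycles M br \<mu> (polyvec_forms M) k) (total_coboundaries M br \<mu> (polyvec_forms M) k)
  (induced (total_coboundaries M br \<mu> (polyvec_forms M) k))"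
proof -
 let ?B = "if k = 0 then {0} else DD (k - 1) ` Inv (k - 1)"
 have Ilin: "DD j (cmul c x + y) = cmul c (DD j x) + DD j y" if "x \<in> Inv j" "y \<in> Inv j" for c x y j
  by (rule DD_clin) (use that Inv_Alt in auto)
 have eqs: "total_cocycles M br \<mu> (inv_polyvec_forms M I) k = {\<w> \<in> Inv k. DD k \<w> = 0}"
  "total_coboundaries M br \<mu> (inv_polyvec_forms M I) k = ?B"
  "total_cocycles M br \<mu> (polyvec_forms M) k = {\<w> \<in> Alt k. DD k \<w> = 0}"
  "total_coboundaries M br \<mu> (polyvec_forms M) k = Bd k"
  by (simp_all add: total_cocycles_def total_coboundaries_def total_inv total_polyvec Bd_def)
 have "cv.subspace (DD j ` Inv j)" for j by (rule kernel_subspace(2)[OF Inv_subspace Ilin])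
 hence BI: "cv.subspace ?B" by simp
 have sub: "{\<w> \<in> Inv k. DD k \<w> = 0} \<subseteq> {\<w> \<in> Alt k. DD k \<w> = 0}" "?B \<subseteq> Bd k"
  using Inv_Alt by (auto simp: Bd_def)
 have ZI: "cv.subspace {\<w> \<in> Inv k. DD k \<w> = 0}" by (rule kernel_subspace(1)[OF Inv_subspace Ilin])
 have "(\<forall>x\<in>{\<w> \<in> Inv k. DD k \<w> = 0}. x \<in> Bd k --> x \<in> ?B) \<and> (\<forall>u\<in>{\<w> \<in> Alt k. DD k \<w> = 0}. \<exists>x\<in>{\<w> \<in> Inv k. DD k \<w> = 0}. u - x \<in> Bd k)"
 proof (intro conjI ballI impI)
  fix x assume x: "x \<in> {\<w> \<in> Inv k. DD k \<w> = 0}" "x \<in> Bd k"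
  show "x \<in> ?B"
  proof (cases k)
   case 0
   thus ?thesis using x(2) by (simp add: Bd_def)
  next
   case (Suc j)
   then obtain v where v: "v \<in> Alt j" "x = DD j v" using x(2) by (auto simp: Bd_def)
   then obtain x' where x': "x' \<in> Inv j" "v - x' \<in> Bd j" using acyclic[of v j] x(1) Suc by auto
   have "DD j v - DD j x' = 0" using Bd_D(2)[OF x'(2)] DD_lin(2)[OF v(1) Inv_Alt[OF x'(1)]] by simp
   thus ?thesis using v(2) x'(1) Suc by auto
  qed
 next
  fix u assume "u \<in> {\<w> \<in> Alt k. DD k \<w> = 0}"
  hence u: "u \<in> Alt k" "DD k u = 0" by auto
  obtain x where x: "x \<in> Inv k" "u - x \<in> Bd k" using acyclic[OF u(1)] u(2) by auto
  have "DD k x = 0" using Bd_D(2)[OF x(2)] DD_lin(2)[OF u(1) Inv_Alt[OF x(1)]] u(2) by simp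
  thus "\<exists>x\<in>{\<w> \<in> Inv k. DD k \<w> = 0}. u - x \<in> Bd k" using x by blast
 qed
 thus ?thesis unfolding eqs using quot_iso_induced[OF ZI sub(1) BI sub(2) Bd_subspace] by (simp only:)
qed

end

section \<open>The theorem\<close>

theorem corollary5p2:
  fixes G :: "('g::{t2_space, second_countable_topology}, 'r) monoid_scheme"
    and A :: "('g, 'e::euclidean_space) chart set"
    and n :: nat
    and J :: "'g vf \<Rightarrow> 'g vf"
    and \<Gamma> :: "'g set"
    and M :: "'g set complex_manifold"
    and I :: "'g set vf set"
    and br :: "'g set polyform \<Rightarrow> 'g set polyform \<Rightarrow> 'g set polyform"
    and \<mu> :: "'g set polyform"
  assumes "lie_group G A"
    and "simply_connected (UNIV :: 'g set)"
    and "DIM('e) = 2 * n"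
    and "nilpotent_group G"
    and "left_invariant_complex_structure G A J"
    and "lattice_in G \<Gamma>"
    and M: "M = nilmanifold G A \<Gamma> J"
    and I: "I = induced_fields G A \<Gamma>"
    and "\<forall>p q. quot_iso
           (dbar_cocycles M (inv_pq_forms M I) p q) (dbar_coboundaries M (inv_pq_forms M I) p q)
           (dbar_cocycles M (pq_forms M) p q) (dbar_coboundaries M (pq_forms M) p q)
           (induced (dbar_coboundaries M (pq_forms M) p q))"
    and "schouten_bracket M br"
    and "\<mu> \<in> inv_polyvec_forms M I 2 0"
    and "holomorphic_poisson M br \<mu>"
  shows "(\<forall>k. quot_iso
           (total_cocycles M br \<mu> (inv_polyvec_forms M I) k)
           (total_coboundaries M br \<mu> (inv_polyvec_forms M I) k)
           (total_cocycles M br \<mu> (polyvec_forms M) k)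
           (total_coboundaries M br \<mu> (polyvec_forms M) k)
           (induced (total_coboundaries M br \<mu> (polyvec_forms M) k))) \<and>
         (\<forall>k. \<exists>\<Phi>. quot_iso
           (total_cocycles M br \<mu> (inv_polyvec_forms M I) k)
           (total_coboundaries M br \<mu> (inv_polyvec_forms M I) k)
           (total_cocycles M br \<mu> (polyvec_forms M) k)
           (total_coboundaries M br \<mu> (polyvec_forms M) k) \<Phi>)"
proof -
  interpret nilmfd G A \<Gamma> J
    by (intro nilmfd.intro lie_grp.intro nilmfd_axioms.intro) (use assms in \<open>auto simp: lattice_in_def\<close>)
  have "framed_manifold M I" unfolding M I by (rule framed)
  then obtain xs zs xf zf where "nil_frame M I xs zs xf zf" using framed_manifold.nil_frame_exists by blast
  then have "poisson_iso M I xs zs xf zf br \<mu>"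
    using assms by (intro poisson_iso.intro poisson.intro poisson_axioms.intro poisson_iso_axioms.intro) blast+
  \<comment> \<open>The induced map itself serves as \<open>\<Phi>\<close> in the second
    conclusion.\<close>
  from poisson_iso.total_iso[OF this] show ?thesis by blast
qed

end
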